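(* Let $m\ge1$, let $P(z)\in\mathbb{K}[z]$ be a polynomial of degree $d\geq 2$, let $k_1,\dots,k_m$ be integers with $k_i\geq 2$ for all $i$, and let $Y=\{y_1^{k_1}\cdots y_m^{k_m}=P(z)\}\subset\mathbb{K}^{m+1}$. Then the group $\mathrm{Aut}(Y)$ is not solvable if and only if there are five pairwise distinct indices $i_1,i_2,i_3,i_4,i_5\in\{1,\dots,m\}$ such that $k_{i_1}=k_{i_2}=k_{i_3}=k_{i_4}=k_{i_5}$.
   Context: $\mathbb{K}$ is an algebraically closed field of characteristic zero. $\mathrm{Aut}(Y)$ is the group of automorphisms of the affine variety $Y$. *)

theory Defs
  imports
    "HOL-Computational_Algebra.Polynomial"
    "HOL-Algebra.Bij"
    "HOL-Algebra.Solvable_Groups"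
begin

text \<open>
  A point of affine \<open>n\<close>-space is a family of coordinates indexed by \<open>{1..n}\<close>. Points are
  extensional (they take the value \<open>undefined\<close> outside \<open>{1..n}\<close>), so that two points
  are equal iff their coordinates agree.
\<close>

definition affine_space :: "nat \<Rightarrow> (nat \<Rightarrow> 'a) set"
  where "affine_space n = ({1..n} \<rightarrow>\<^sub>E UNIV)"

inductive_set polynomial_functions :: "nat \<Rightarrow> ((nat \<Rightarrow> 'a::comm_ring_1) \<Rightarrow> 'a) set"
  for n :: nat where
  const: "(\<lambda>x. c) \<in> polynomial_functions n"
| coord: "i \<in> {1..n} \<Longrightarrow> (\<lambda>x. x i) \<in> polynomial_functions n"
| add: "f \<in> polynomial_functions n \<Longrightarrow> g \<in> polynomial_functions n
    \<Longrightarrow> (\<lambda>x. f x + g x) \<in> polynomial_functions n"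
| mult: "f \<in> polynomial_functions n \<Longrightarrow> g \<in> polynomial_functions n
    \<Longrightarrow> (\<lambda>x. f x * g x) \<in> polynomial_functions n"

definition affine_morphism ::
    "nat \<Rightarrow> (nat \<Rightarrow> 'a::comm_ring_1) set \<Rightarrow> nat \<Rightarrow> (nat \<Rightarrow> 'a) set
      \<Rightarrow> ((nat \<Rightarrow> 'a) \<Rightarrow> (nat \<Rightarrow> 'a)) \<Rightarrow> bool"
  where "affine_morphism n X n' X' f \<longleftrightarrow>
    f \<in> X \<rightarrow> X' \<and>
    (\<forall>j\<in>{1..n'}. \<exists>p\<in>polynomial_functions n. \<forall>x\<in>X. f x j = p x)"

text \<open>
  Automorphisms of a closed subset \<open>X\<close> of affine \<open>n\<close>-space: bijections of \<open>X\<close> such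
  that both the map and its inverse are morphisms, with composition as multiplication.
  \<^const>\<open>Bij\<close> contains only maps that are \<open>undefined\<close> outside \<open>X\<close>, so each
  automorphism is represented exactly once.
\<close>

definition variety_auts ::
    "nat \<Rightarrow> (nat \<Rightarrow> 'a::comm_ring_1) set \<Rightarrow> ((nat \<Rightarrow> 'a) \<Rightarrow> (nat \<Rightarrow> 'a)) set"
  where "variety_auts n X =
    {f \<in> Bij X. affine_morphism n X n X f \<and> affine_morphism n X n X (inv_into X f)}"

definition Aut_variety ::
    "nat \<Rightarrow> (nat \<Rightarrow> 'a::comm_ring_1) set \<Rightarrow> ((nat \<Rightarrow> 'a) \<Rightarrow> (nat \<Rightarrow> 'a)) monoid"
  where "Aut_variety n X = BijGroup X \<lparr>carrier := variety_auts n X\<rparr>"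

text \<open>
  The hypersurface \<open>y\<^sub>1 ^ k\<^sub>1 * \<dots> * y\<^sub>m ^ k\<^sub>m = P(z)\<close> in affine
  \<open>(m+1)\<close>-space, with coordinates \<open>y\<^sub>i = x i\<close> for \<open>1 \<le> i \<le> m\<close> and \<open>z = x (m + 1)\<close>.
\<close>

definition suspension :: "nat \<Rightarrow> (nat \<Rightarrow> nat) \<Rightarrow> 'a::comm_ring_1 poly \<Rightarrow> (nat \<Rightarrow> 'a) set"
  where "suspension m k P =
    {x \<in> affine_space (m + 1). (\<Prod>i\<in>{1..m}. x i ^ k i) = poly P (x (m + 1))}"

lemma polynomial_functions_subst:
  assumes "p \<in> polynomial_functions n'"
    and "\<forall>j\<in>{1..n'}. \<exists>q\<in>polynomial_functions n. \<forall>x\<in>X. f x j = q x"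
  shows "\<exists>q\<in>polynomial_functions n. \<forall>x\<in>X. p (f x) = q x"
  using assms(1)
proof induction
  case (const c)
  show ?case by (rule bexI[of _ "\<lambda>x. c"]) (auto intro: polynomial_functions.const)
next
  case (coord i)
  then show ?case using assms(2) by auto
next
  case (add p1 p2)
  then obtain q1 q2 where
    "q1 \<in> polynomial_functions n" "\<forall>x\<in>X. p1 (f x) = q1 x"
    "q2 \<in> polynomial_functions n" "\<forall>x\<in>X. p2 (f x) = q2 x" by blast
  then show ?case
    by (intro bexI[of _ "\<lambda>x. q1 x + q2 x"]) (auto intro: polynomial_functions.add)
next
  case (mult p1 p2)
  then obtain q1 q2 where
    "q1 \<in> polynomial_functions n" "\<forall>x\<in>X. p1 (f x) = q1 x"
    "q2 \<in> polynomial_functions n" "\<forall>x\<in>X. p2 (f x) = q2 x" by blast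
  then show ?case
    by (intro bexI[of _ "\<lambda>x. q1 x * q2 x"]) (auto intro: polynomial_functions.mult)
qed

lemma affine_morphism_comp:
  assumes "affine_morphism n X n' X' f" "affine_morphism n' X' n'' X'' g"
    and "\<And>x. x \<in> X \<Longrightarrow> h x = g (f x)"
  shows "affine_morphism n X n'' X'' h"
  unfolding affine_morphism_def
proof (intro conjI ballI)
  show "h \<in> X \<rightarrow> X''"
    using assms unfolding affine_morphism_def by auto
next
  fix j assume "j \<in> {1..n''}"
  then obtain p where p: "p \<in> polynomial_functions n'" "\<forall>x\<in>X'. g x j = p x"
    using assms(2) unfolding affine_morphism_def by blast
  obtain q where q: "q \<in> polynomial_functions n" "\<forall>x\<in>X. p (f x) = q x"
    using polynomial_functions_subst[OF p(1)] assms(1)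
    unfolding affine_morphism_def by blast
  have "\<forall>x\<in>X. h x j = q x"
    using p(2) q(2) assms(1,3) unfolding affine_morphism_def by (metis funcset_mem)
  with q(1) show "\<exists>p\<in>polynomial_functions n. \<forall>x\<in>X. h x j = p x" by blast
qed

lemma affine_morphism_id:
  assumes "\<And>x. x \<in> X \<Longrightarrow> h x = x"
  shows "affine_morphism n X n X h"
  unfolding affine_morphism_def
proof (intro conjI ballI)
  show "h \<in> X \<rightarrow> X" using assms by auto
  fix j assume "j \<in> {1..n}"
  then show "\<exists>p\<in>polynomial_functions n. \<forall>x\<in>X. h x j = p x"
    using assms by (intro bexI[of _ "\<lambda>x. x j"]) (auto intro: polynomial_functions.coord)
qed

lemma affine_morphism_cong:
  assumes "affine_morphism n X n' X' f" "\<And>x. x \<in> X \<Longrightarrow> h x = f x"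
  shows "affine_morphism n X n' X' h"
  using affine_morphism_comp[OF affine_morphism_id[of X "\<lambda>x. x" n] assms(1), of h] assms(2)
  by simp

lemma subgroup_variety_auts: "subgroup (variety_auts n X) (BijGroup X)"
proof (rule subgroup.intro)
  show "variety_auts n X \<subseteq> carrier (BijGroup X)"
    by (auto simp: variety_auts_def BijGroup_def)
next
  fix f g assume f: "f \<in> variety_auts n X" and g: "g \<in> variety_auts n X"
  have B: "f \<in> Bij X" "g \<in> Bij X" using f g by (auto simp: variety_auts_def)
  then have bb: "bij_betw f X X" "bij_betw g X X" by (auto simp: Bij_def)
  have "affine_morphism n X n X (compose X f g)"
    using f g affine_morphism_comp[of n X n X g n X f]
    by (auto simp: variety_auts_def compose_def)
  moreover have "inv_into X (compose X f g) x = inv_into X g (inv_into X f x)"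
    if "x \<in> X" for x
  proof -
    have "inj_on (compose X f g) X"
      using compose_Bij[OF B] by (auto simp: Bij_def bij_betw_def)
    moreover have "inv_into X f x \<in> X" "inv_into X g (inv_into X f x) \<in> X"
      using that bb Bij_inv_into_mem[OF B(1)] Bij_inv_into_mem[OF B(2)] by auto
    moreover have "compose X f g (inv_into X g (inv_into X f x)) = x"
      using calculation(2,3) that bb by (simp add: compose_def bij_betw_inv_into_right)
    ultimately show ?thesis by (metis inv_into_f_f)
  qed
  then have "affine_morphism n X n X (inv_into X (compose X f g))"
    using f g affine_morphism_comp[of n X n X "inv_into X f" n X "inv_into X g"]
    by (auto simp: variety_auts_def)
  ultimately show "f \<otimes>\<^bsub>BijGroup X\<^esub> g \<in> variety_auts n X"
    using B compose_Bij[OF B] by (auto simp: BijGroup_def variety_auts_def)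
next
  have "inv_into X (\<lambda>x\<in>X. x) x = x" if "x \<in> X" for x
    using that inv_into_f_f[of "\<lambda>x\<in>X. x" X x] by (simp add: inj_on_def)
  then show "\<one>\<^bsub>BijGroup X\<^esub> \<in> variety_auts n X"
    by (auto simp: BijGroup_def variety_auts_def id_Bij intro!: affine_morphism_id)
next
  fix f assume f: "f \<in> variety_auts n X"
  have B: "f \<in> Bij X" using f by (auto simp: variety_auts_def)
  let ?g = "restrict (inv_into X f) X"
  have gB: "?g \<in> Bij X" by (rule restrict_inv_into_Bij[OF B])
  have "inv_into X ?g x = f x" if "x \<in> X" for x
  proof -
    have "f x \<in> X" using that Bij_imp_funcset[OF B] by auto
    moreover have "?g (f x) = x"
      using that B calculation by (auto simp: Bij_def bij_betw_def)
    ultimately show ?thesis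
      using gB inv_into_f_f[of ?g X "f x"] by (auto simp: Bij_def bij_betw_def)
  qed
  then have "affine_morphism n X n X (inv_into X ?g)"
    using f affine_morphism_cong[of n X n X f] by (auto simp: variety_auts_def)
  moreover have "affine_morphism n X n X ?g"
    using f affine_morphism_cong[of n X n X "inv_into X f" ?g] by (auto simp: variety_auts_def)
  ultimately show "inv\<^bsub>BijGroup X\<^esub> f \<in> variety_auts n X"
    using gB by (simp add: inv_BijGroup[OF B] variety_auts_def)
qed

theorem group_Aut_variety: "group (Aut_variety n X)"
  unfolding Aut_variety_def
  by (rule subgroup.subgroup_is_group[OF subgroup_variety_auts group_BijGroup])

end

theory Submission
  imports Defs "HOL-Algebra.Sym_Groups" "HOL-Computational_Algebra.Computational_Algebra"
begin

text \<open>
  Write \<open>y\<^sub>1, \<dots>, y\<^sub>m, z\<close> for the coordinates and \<open>Y\<close> for the hypersurface. If five exponents agree,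
  then permuting the corresponding coordinates embeds the symmetric group on five letters into the
  automorphism group (\<open>Aut_not_solvable\<close>). For the converse the automorphism group is taken
  apart by an action of a torus.

  Let \<open>m \<ge> 2\<close> and let \<open>D\<close> be the boundary, where some \<open>y\<^sub>i\<close> vanishes. Since all \<open>k\<^sub>i\<close> are at least two,
  \<open>Y\<close> is singular exactly along the part of \<open>D\<close> that lies over the multiple roots of \<open>P\<close>, and this part
  is preserved by every automorphism (\<open>Sing_preserved\<close>). A nonconstant polynomial curve
  in \<open>Y\<close> that avoids the singular locus is contained in \<open>D\<close>, and the regular points of \<open>D\<close> lie on such
  curves; so automorphisms preserve \<open>D\<close> (\<open>D_preserved\<close>) and permute its components, which are
  the affine spaces \<open>y\<^sub>j = 0\<close>, \<open>z = a\<close> with \<open>P(a) = 0\<close>. Off the boundary, the functions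
  \<open>y\<^sub>i \<circ> \<phi>\<close> have no zeros. Hence along each orbit of a one-parameter group of
  diagonal automorphisms such a function is a single power of the parameter, and the exponent can be
  read off on the boundary (\<open>flow_equivariant_coordinate\<close>). The result is that every automorphism
  normalises the torus \<open>\<Prod> \<lambda>\<^sub>i\<^bsup>\<kappa>\<^sub>i\<^esup> = 1\<close>, where \<open>\<kappa>\<^sub>i = k\<^sub>i / g\<close> with
  the greatest common divisor \<open>g\<close> of the \<open>k\<^sub>i\<close>, and that it acts on this torus by a permutation of
  the factors that respects the exponents (\<open>has_type_exists\<close>).

  If all classes of equal exponents have at most four elements, then these permutations lie in a product
  of copies of \<open>S\<^sub>4\<close>, whose third derived subgroup is trivial. What remains is the group of those
  automorphisms that commute with the torus (\<open>derives_into_torus_centraliser\<close>). The functions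
  invariant under the torus are the polynomials in \<open>z\<close> and \<open>w = \<Prod> y\<^sub>i\<^bsup>\<kappa>\<^sub>i\<^esup>\<close>
  (\<open>torus_invariant_function\<close>), so this group acts on the curve \<open>w\<^bsup>g\<^esup> = P(z)\<close> by polynomial
  maps. The kernel of the action is abelian, because its elements move points within torus orbits
  (\<open>curve_kernel_derives_into_one\<close>).

  It remains to see that a group of polynomial automorphisms of the curve \<open>w\<^bsup>g\<^esup> = P(z)\<close> is solvable.
  Give \<open>z\<close> the weight \<open>g\<close> and \<open>w\<close> the weight \<open>d = degree P\<close>; these are the pole orders on the branches
  at infinity. If the group contains the rotations \<open>w \<mapsto> \<zeta> w\<close> with \<open>\<zeta>\<^bsup>g\<^esup> = 1\<close>, then
  automorphisms do not raise the weights: otherwise a suitable composition would raise a maximal pole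
  order further (\<open>pole_le_g\<close>, \<open>degree_bounds\<close>). Hence for \<open>g \<noteq> d\<close> the group consists of
  triangular maps. For \<open>g = d\<close> it consists of affine maps whose linear parts permute the asymptotic
  directions \<open>w\<^bsup>g\<^esup> = c z\<^bsup>g\<^esup>\<close>, which makes them diagonal or antidiagonal in suitable coordinates. Both
  kinds of groups are solvable (\<open>curve_derives_into_kernel\<close>). For \<open>m = 1\<close> the torus is
  trivial and the argument starts with the curve.
\<close>

section \<open>Solvability of groups of bijections\<close>

text \<open>
  The derived series of a subgroup may be computed in the ambient group.
\<close>

lemma (in group) solvable_carrier_update:
  assumes H: "subgroup H G" and n: "(derived G ^^ n) H = {\<one>}"
  shows "solvable (G\<lparr>carrier := H\<rparr>)"
proof -
  let ?H = "G\<lparr>carrier := H\<rparr>"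
  interpret H: group ?H by (rule subgroup.subgroup_is_group[OF H is_group])
  have sub: "(derived G ^^ j) H \<subseteq> H" for j
    by (induction j) (auto dest: derived_incl[OF _ H])
  have "(derived ?H ^^ j) H = (derived G ^^ j) H" for j
    by (induction j) (simp_all add: derived_consistent[OF sub H])
  then have "(derived ?H ^^ n) (carrier ?H) = {\<one>\<^bsub>?H\<^esub>}"
    using n by simp
  then show ?thesis
    using H.solvable_iff_trivial_derived_seq by blast
qed

text \<open>
  Modulo \<open>K\<close>, the set \<open>H\<close> is solvable. Chaining such steps reduces solvability to the construction of
  a descending chain of subgroups; the subgroups need not be members of the derived series.
\<close>

definition derives_into :: "('a, 'b) monoid_scheme \<Rightarrow> 'a set \<Rightarrow> 'a set \<Rightarrow> bool"
  where "derives_into G H K \<longleftrightarrow> (\<exists>n. (derived G ^^ n) H \<subseteq> K)"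

lemma (in group) derives_into_trans:
  assumes "derives_into G H K" "derives_into G K L"
  shows "derives_into G H L"
proof -
  obtain n n' where n: "(derived G ^^ n) H \<subseteq> K" and n': "(derived G ^^ n') K \<subseteq> L"
    using assms by (auto simp: derives_into_def)
  have "(derived G ^^ (n' + n)) H \<subseteq> (derived G ^^ n') K"
    using mono_exp_of_derived[OF n, of n'] by (simp add: funpow_add)
  then show ?thesis using n' unfolding derives_into_def by blast
qed

lemma derives_into_refl: "H \<subseteq> K \<Longrightarrow> derives_into G H K"
  unfolding derives_into_def by (rule exI[of _ 0]) simp

lemma (in group) derives_into_step:
  assumes "subgroup K G"
    and "\<And>a b. a \<in> H \<Longrightarrow> b \<in> H \<Longrightarrow> a \<otimes> b \<otimes> inv a \<otimes> inv b \<in> K"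
  shows "derives_into G H K"
proof -
  have "derived G H \<subseteq> K"
    unfolding derived_def using assms by (intro generate_subgroup_incl) auto
  then show ?thesis
    unfolding derives_into_def by (intro exI[of _ 1]) simp
qed

lemma (in group) solvable_if_derives_into_one:
  assumes H: "subgroup H G" and "derives_into G H {\<one>}"
  shows "solvable (G\<lparr>carrier := H\<rparr>)"
proof -
  obtain n where n: "(derived G ^^ n) H \<subseteq> {\<one>}"
    using assms(2) by (auto simp: derives_into_def)
  moreover have "\<one> \<in> (derived G ^^ n) H"
    using exp_of_derived_is_subgroup[OF H] by (rule subgroup.one_closed)
  ultimately show ?thesis
    using solvable_carrier_update[OF H, of n] by blast
qed

lemma BijGroup_sel:
  "carrier (BijGroup X) = Bij X" "\<one>\<^bsub>BijGroup X\<^esub> = (\<lambda>x\<in>X. x)"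
  "f \<in> Bij X \<Longrightarrow> g \<in> Bij X \<Longrightarrow> f \<otimes>\<^bsub>BijGroup X\<^esub> g = compose X f g"
  by (simp_all add: BijGroup_def)

lemma Bij_apply_mem: "f \<in> Bij X \<Longrightarrow> x \<in> X \<Longrightarrow> f x \<in> X"
  using Bij_imp_funcset by blast

lemma Bij_inj: "f \<in> Bij X \<Longrightarrow> x \<in> X \<Longrightarrow> y \<in> X \<Longrightarrow> f x = f y \<Longrightarrow> x = y"
  by (auto simp: Bij_def bij_betw_def inj_on_def)

lemma Bij_eqI:
  assumes "f \<in> Bij X" "g \<in> Bij X" "\<And>x. x \<in> X \<Longrightarrow> f x = g x"
  shows "f = g"
  using assms by (intro extensionalityI[of _ X]) (auto simp: Bij_def)

lemma BijGroup_inv: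
  assumes "f \<in> Bij X"
  shows "inv\<^bsub>BijGroup X\<^esub> f \<in> Bij X"
    and "x \<in> X \<Longrightarrow> (inv\<^bsub>BijGroup X\<^esub> f) (f x) = x"
    and "x \<in> X \<Longrightarrow> f ((inv\<^bsub>BijGroup X\<^esub> f) x) = x"
  using assms restrict_inv_into_Bij[OF assms] Bij_apply_mem[OF assms, of x]
  by (auto simp: inv_BijGroup Bij_def bij_betw_def f_inv_into_f)

text \<open>
  The group operations of \<open>BijGroup\<close> involve restrictions and inverses. Here and in the next lemma
  they are replaced by pointwise equations on \<open>X\<close>.
\<close>

lemma subgroup_BijGroup_restrict:
  assumes H: "subgroup H (BijGroup X)"
    and one: "\<And>f. f \<in> H \<Longrightarrow> (\<And>x. x \<in> X \<Longrightarrow> f x = x) \<Longrightarrow> Q f"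
    and comp: "\<And>f g h. f \<in> H \<Longrightarrow> g \<in> H \<Longrightarrow> h \<in> H \<Longrightarrow> Q f \<Longrightarrow> Q g \<Longrightarrow>
      (\<And>x. x \<in> X \<Longrightarrow> h x = f (g x)) \<Longrightarrow> Q h"
    and inv: "\<And>f h. f \<in> H \<Longrightarrow> h \<in> H \<Longrightarrow> Q f \<Longrightarrow> (\<And>x. x \<in> X \<Longrightarrow> h (f x) = x) \<Longrightarrow>
      (\<And>x. x \<in> X \<Longrightarrow> f (h x) = x) \<Longrightarrow> Q h"
  shows "subgroup {f \<in> H. Q f} (BijGroup X)"
proof -
  interpret G: group "BijGroup X" by (rule group_BijGroup)
  have HB: "f \<in> Bij X" if "f \<in> H" for f
    using subgroup.subset[OF H] that by (auto simp: BijGroup_sel)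
  show ?thesis
  proof (rule subgroup.intro)
    show "{f \<in> H. Q f} \<subseteq> carrier (BijGroup X)"
      using subgroup.subset[OF H] by blast
  next
    fix f g assume "f \<in> {f \<in> H. Q f}" and "g \<in> {f \<in> H. Q f}"
    then have fg: "f \<in> H" "g \<in> H" "Q f" "Q g" by auto
    have "f \<otimes>\<^bsub>BijGroup X\<^esub> g \<in> H"
      using fg subgroup.m_closed[OF H] by blast
    moreover have "(f \<otimes>\<^bsub>BijGroup X\<^esub> g) x = f (g x)" if "x \<in> X" for x
      using that fg HB by (simp add: BijGroup_sel compose_def)
    ultimately show "f \<otimes>\<^bsub>BijGroup X\<^esub> g \<in> {f \<in> H. Q f}"
      using comp[OF fg(1,2)] fg by blast
  next
    show "\<one>\<^bsub>BijGroup X\<^esub> \<in> {f \<in> H. Q f}"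
      using one subgroup.one_closed[OF H] by (simp add: BijGroup_sel)
  next
    fix f assume "f \<in> {f \<in> H. Q f}"
    then have f: "f \<in> H" "Q f" by auto
    have i: "inv\<^bsub>BijGroup X\<^esub> f \<in> H" using f subgroup.m_inv_closed[OF H] by blast
    then show "inv\<^bsub>BijGroup X\<^esub> f \<in> {f \<in> H. Q f}"
      using inv[OF f(1) i f(2)] BijGroup_inv[OF HB[OF f(1)]] by blast
  qed
qed

text \<open>
  The commutator of \<open>f\<close> and \<open>g\<close> is the only map \<open>c\<close> with \<open>c \<circ> g \<circ> f = f \<circ> g\<close>, an equation without inverses.
\<close>

lemma derives_into_BijGroup:
  assumes H: "subgroup H (BijGroup X)" and K: "subgroup K (BijGroup X)"
    and comm: "\<And>f g c. f \<in> H \<Longrightarrow> g \<in> H \<Longrightarrow> c \<in> H \<Longrightarrow>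
      (\<And>x. x \<in> X \<Longrightarrow> c (g (f x)) = f (g x)) \<Longrightarrow> c \<in> K"
  shows "derives_into (BijGroup X) H K"
proof -
  interpret G: group "BijGroup X" by (rule group_BijGroup)
  have HB: "f \<in> Bij X" if "f \<in> H" for f
    using subgroup.subset[OF H] that by (auto simp: BijGroup_sel)
  show ?thesis
  proof (rule G.derives_into_step[OF K])
    fix a b assume a: "a \<in> H" and b: "b \<in> H"
    let ?i = "\<lambda>f. inv\<^bsub>BijGroup X\<^esub> f"
    let ?c = "a \<otimes>\<^bsub>BijGroup X\<^esub> b \<otimes>\<^bsub>BijGroup X\<^esub> ?i a \<otimes>\<^bsub>BijGroup X\<^esub> ?i b"
    have cl: "a \<otimes>\<^bsub>BijGroup X\<^esub> b \<in> H" "a \<otimes>\<^bsub>BijGroup X\<^esub> b \<otimes>\<^bsub>BijGroup X\<^esub> ?i a \<in> H" "?i a \<in> H" "?i b \<in> H" "?c \<in> H"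
      using a b by (auto intro!: subgroup.m_closed[OF H] subgroup.m_inv_closed[OF H])
    show "?c \<in> K"
    proof (rule comm[OF a b cl(5)])
      fix x assume x: "x \<in> X"
      have "b (a x) \<in> X" "a x \<in> X"
        using x HB[OF a] HB[OF b] Bij_apply_mem by metis+
      then show "?c (b (a x)) = a (b x)"
        using cl a b x
        by (simp add: BijGroup_sel HB compose_def BijGroup_inv)
    qed
  qed
qed

section \<open>Polynomial functions\<close>

text \<open>
  Substitution principle: along a family of points \<open>\<gamma>\<close> whose coordinates belong to a ring of
  functions, polynomial functions belong to this ring, too. The ring consists of polynomials in one
  variable when \<open>\<gamma>\<close> is a curve, and of polynomials in two variables when \<open>\<gamma>\<close> is a plane.
\<close>

lemma polynomial_functions_closure:
  assumes "f \<in> polynomial_functions n"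
    and "\<And>c. (\<lambda>p. c) \<in> R"
    and "\<And>i. i \<in> {1..n} \<Longrightarrow> (\<lambda>p. \<gamma> p i) \<in> R"
    and "\<And>g h. g \<in> R \<Longrightarrow> h \<in> R \<Longrightarrow> (\<lambda>p. g p + h p) \<in> R"
    and "\<And>g h. g \<in> R \<Longrightarrow> h \<in> R \<Longrightarrow> (\<lambda>p. g p * h p) \<in> R"
  shows "(\<lambda>p. f (\<gamma> p)) \<in> R"
  using assms(1) by induction (use assms(2-) in auto)

lemma polynomial_functions_cong:
  assumes "f \<in> polynomial_functions n" "\<And>i. i \<in> {1..n} \<Longrightarrow> x i = y i"
  shows "f x = f y"
  using assms by induction auto

lemma polynomial_functions_mono:
  assumes "f \<in> polynomial_functions n" "n \<le> n'"
  shows "f \<in> polynomial_functions n'"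
  using assms by induction (auto intro: polynomial_functions.intros)

lemma polynomial_functions_uminus:
  "f \<in> polynomial_functions n \<Longrightarrow> (\<lambda>x. - f x) \<in> polynomial_functions n"
  using polynomial_functions.mult[OF polynomial_functions.const[of "-1"], of f n] by simp

lemma polynomial_functions_diff:
  "f \<in> polynomial_functions n \<Longrightarrow> g \<in> polynomial_functions n \<Longrightarrow>
    (\<lambda>x. f x - g x) \<in> polynomial_functions n"
  using polynomial_functions.add[OF _ polynomial_functions_uminus, of f n g] by simp

lemma polynomial_functions_power:
  "f \<in> polynomial_functions n \<Longrightarrow> (\<lambda>x. f x ^ e) \<in> polynomial_functions n"
  by (induction e) (auto intro: polynomial_functions.intros)

lemma polynomial_functions_prod:
  "(\<And>i. i \<in> I \<Longrightarrow> f i \<in> polynomial_functions n) \<Longrightarrow>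
    (\<lambda>x. \<Prod>i\<in>I. f i x) \<in> polynomial_functions n"
  by (induction I rule: infinite_finite_induct) (auto intro: polynomial_functions.intros)

lemma polynomial_functions_poly:
  "f \<in> polynomial_functions n \<Longrightarrow> (\<lambda>x. poly p (f x)) \<in> polynomial_functions n"
  by (induction p) (auto intro: polynomial_functions.intros)

lemma polynomial_functions_compose:
  assumes "f \<in> polynomial_functions n'"
    and "\<And>i. i \<in> {1..n'} \<Longrightarrow> (\<lambda>x. \<gamma> x i) \<in> polynomial_functions n"
  shows "(\<lambda>x. f (\<gamma> x)) \<in> polynomial_functions n"
  by (rule polynomial_functions_closure[OF assms(1)])
     (auto intro: polynomial_functions.intros assms(2))

definition is_poly_fun :: "('a::comm_ring_1 \<Rightarrow> 'a) \<Rightarrow> bool"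
  where "is_poly_fun f \<longleftrightarrow> (\<exists>p. \<forall>s. f s = poly p s)"

lemma is_poly_fun_const: "is_poly_fun (\<lambda>s. c)"
  unfolding is_poly_fun_def by (rule exI[of _ "[:c:]"]) simp

lemma is_poly_fun_id: "is_poly_fun (\<lambda>s. s)"
  unfolding is_poly_fun_def by (rule exI[of _ "[:0,1:]"]) simp

lemma is_poly_fun_poly: "is_poly_fun (poly p)"
  unfolding is_poly_fun_def by blast

lemma is_poly_fun_add: "is_poly_fun f \<Longrightarrow> is_poly_fun g \<Longrightarrow> is_poly_fun (\<lambda>s. f s + g s)"
  unfolding is_poly_fun_def by (metis poly_add)

lemma is_poly_fun_diff: "is_poly_fun f \<Longrightarrow> is_poly_fun g \<Longrightarrow> is_poly_fun (\<lambda>s. f s - g s)"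
  unfolding is_poly_fun_def by (metis poly_diff)

lemma is_poly_fun_mult: "is_poly_fun f \<Longrightarrow> is_poly_fun g \<Longrightarrow> is_poly_fun (\<lambda>s. f s * g s)"
  unfolding is_poly_fun_def by (metis poly_mult)

lemma is_poly_fun_power: "is_poly_fun f \<Longrightarrow> is_poly_fun (\<lambda>s. f s ^ e)"
  unfolding is_poly_fun_def by (metis poly_power)

lemma is_poly_fun_compose: "is_poly_fun f \<Longrightarrow> is_poly_fun (\<lambda>s. poly p (f s))"
  unfolding is_poly_fun_def by (metis poly_pcompose)

lemma is_poly_fun_prod:
  "(\<And>i. i \<in> I \<Longrightarrow> is_poly_fun (f i)) \<Longrightarrow> is_poly_fun (\<lambda>s. \<Prod>i\<in>I. f i s)"
  by (induction I rule: infinite_finite_induct) (auto intro: is_poly_fun_const is_poly_fun_mult)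

lemmas is_poly_fun_intros =
  is_poly_fun_const is_poly_fun_id is_poly_fun_poly is_poly_fun_add is_poly_fun_diff
  is_poly_fun_mult is_poly_fun_power is_poly_fun_compose is_poly_fun_prod

lemma polynomial_functions_along_curve:
  assumes "f \<in> polynomial_functions n" "\<And>i. i \<in> {1..n} \<Longrightarrow> is_poly_fun (\<lambda>s. \<gamma> s i)"
  shows "is_poly_fun (\<lambda>s. f (\<gamma> s))"
  using polynomial_functions_closure[OF assms(1), of "Collect is_poly_fun" \<gamma>] assms(2)
  by (auto intro: is_poly_fun_intros)

lemma is_poly_funE:
  assumes "is_poly_fun f" obtains p where "f = poly p"
  using assms unfolding is_poly_fun_def by auto

lemma poly_fun_zero_cofinite:
  fixes f :: "'a::{idom, ring_char_0} \<Rightarrow> 'a"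
  assumes "is_poly_fun f" "finite A" "\<And>s. s \<notin> A \<Longrightarrow> f s = 0"
  shows "f s = 0"
proof -
  obtain p where p: "f = poly p" by (rule is_poly_funE[OF assms(1)])
  have "p = 0"
  proof (rule ccontr)
    assume "p \<noteq> 0"
    then have "finite {s. poly p s = 0}" by (rule poly_roots_finite)
    moreover have "UNIV = A \<union> {s. poly p s = 0}" using assms(3) p by auto
    ultimately have "finite (UNIV :: 'a set)" using assms(2) by (metis finite_Un)
    then show False using infinite_UNIV_char_0 by blast
  qed
  then show ?thesis using p by simp
qed

lemma polynomial_functions_line_cong:
  fixes f :: "(nat \<Rightarrow> 'a::comm_ring_1) \<Rightarrow> 'a"
  assumes "f \<in> polynomial_functions n"
  shows "is_poly_fun (\<lambda>s. f (\<lambda>i. x i + s * v i))"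
  by (rule polynomial_functions_along_curve[OF assms])
     (intro is_poly_fun_add is_poly_fun_mult is_poly_fun_const is_poly_fun_id)

lemma nonvanishing_poly_fun_const:
  fixes f :: "'a::alg_closed_field \<Rightarrow> 'a"
  assumes "is_poly_fun f" "\<And>s. f s \<noteq> 0"
  shows "f s = f s'"
proof -
  obtain p where p: "f = poly p" by (rule is_poly_funE[OF assms(1)])
  have "degree p = 0" using assms(2) p alg_closed_imp_poly_has_root[of p] by auto
  then show ?thesis using p by (auto elim!: degree_eq_zeroE)
qed

section \<open>Roots of polynomials over an algebraically closed field\<close>

lemma sum_order_eq_degree:
  fixes p :: "'a::alg_closed_field poly"
  assumes "p \<noteq> 0"
  shows "(\<Sum>x | poly p x = 0. Polynomial.order x p) = degree p"
proof -
  obtain A where A: "size A = degree p" "p = smult (lead_coeff p) (\<Prod>x\<in>#A. [:-x, 1:])"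
    using alg_closed_imp_factorization[OF assms] by blast
  have nz: "(\<Prod>x\<in>#B. [:-x, 1:]) \<noteq> 0" for B :: "'a multiset"
    by (auto simp: prod_mset_zero_iff)
  have "proots (\<Prod>x\<in>#A. [:-x, 1:]) = A"
    by (induction A) (use nz in \<open>auto simp: proots_mult simp del: mult_pCons_left\<close>)
  then have "proots p = A"
    using A(2) assms by (metis leading_coeff_neq_0 proots_smult smult_0_left)
  then have "degree p = size (proots p)" using A(1) by simp
  also have "\<dots> = (\<Sum>x | poly p x = 0. Polynomial.order x p)"
    using assms by (simp add: size_multiset_overloaded_eq)
  finally show ?thesis by simp
qed

lemma degree_diff_const:
  fixes p :: "'a::comm_ring_1 poly"
  assumes "degree p \<noteq> 0"
  shows "degree (p - [:c:]) = degree p"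
  using degree_add_eq_left[of "[:-c:]" p] assms by (simp add: diff_conv_add_uminus del: add_uminus_conv_diff)

lemma card_roots_if_separable:
  fixes p :: "'a::alg_closed_field poly"
  assumes "p \<noteq> 0" "\<And>x. poly p x = 0 \<Longrightarrow> poly (pderiv p) x \<noteq> 0"
  shows "card {x. poly p x = 0} = degree p"
proof -
  have "Polynomial.order x p = 1" if "poly p x = 0" for x
  proof -
    have "Polynomial.order x p \<noteq> 0" using assms(1) that by (simp add: order_root)
    moreover have "\<not> [:-x, 1:] ^ 2 dvd p"
    proof
      assume "[:-x, 1:] ^ 2 dvd p"
      then obtain q where q: "p = [:-x, 1:] ^ 2 * q" by (elim dvdE)
      have "poly (pderiv p) x = 0"
        unfolding q power2_eq_square pderiv_mult poly_add poly_mult by simp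
      then show False using assms(2) that by blast
    qed
    then have "\<not> 2 \<le> Polynomial.order x p" using assms(1) by (simp add: order_divides)
    ultimately show ?thesis by simp
  qed
  then have "(\<Sum>x | poly p x = 0. Polynomial.order x p) = (\<Sum>x | poly p x = 0. 1)"
    by (intro sum.cong) auto
  then show ?thesis using sum_order_eq_degree[OF assms(1)] by simp
qed

lemma finite_critical_values:
  fixes p :: "'a::field_char_0 poly"
  assumes "degree p \<noteq> 0"
  shows "finite (poly p ` {x. poly (pderiv p) x = 0})"
  using assms by (intro finite_imageI poly_roots_finite) (simp add: pderiv_eq_0_iff)

lemma card_fibre_noncritical:
  fixes p :: "'a::{alg_closed_field, field_char_0} poly"
  assumes "degree p \<noteq> 0" "c \<notin> poly p ` {x. poly (pderiv p) x = 0}"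
  shows "card {x. poly p x = c} = degree p"
proof -
  have "{x. poly p x = c} = {x. poly (p - [:c:]) x = 0}" by auto
  moreover have "degree (p - [:c:]) = degree p"
    by (rule degree_diff_const[OF assms(1)])
  moreover have "p - [:c:] \<noteq> 0" using assms(1) by auto
  moreover have "poly (pderiv (p - [:c:])) x \<noteq> 0" if "poly (p - [:c:]) x = 0" for x
    using that assms(2) by (auto simp: pderiv_diff pderiv_pCons)
  ultimately show ?thesis by (metis card_roots_if_separable)
qed

lemma card_nth_roots:
  fixes c :: "'a::{alg_closed_field, field_char_0}"
  assumes "g > 0" "c \<noteq> 0"
  shows "card {x. x ^ g = c} = g"
proof -
  have "poly (pderiv (monom 1 g)) x \<noteq> 0" if "x ^ g = c" for x :: 'a
    using that assms by (auto simp: pderiv_monom poly_monom)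
  then have "c \<notin> poly (monom 1 g) ` {x. poly (pderiv (monom 1 g)) x = 0}"
    by (auto simp: poly_monom)
  then show ?thesis
    using card_fibre_noncritical[of "monom 1 g" c] assms by (simp add: poly_monom degree_monom_eq)
qed

lemma finite_nth_roots:
  fixes c :: "'a::{alg_closed_field, field_char_0}"
  assumes "g > 0" "c \<noteq> 0"
  shows "finite {x. x ^ g = c}"
  using card_nth_roots[OF assms] assms(1) by (metis card.infinite less_irrefl)

lemma exists_nontrivial_root_of_unity:
  assumes "g \<ge> 2"
  shows "\<exists>\<zeta>::'a::{alg_closed_field, field_char_0}. \<zeta> ^ g = 1 \<and> \<zeta> \<noteq> 1"
proof (rule ccontr)
  assume "\<not> ?thesis"
  then have "{x::'a. x ^ g = 1} \<subseteq> {1}" by auto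
  then have "card {x::'a. x ^ g = 1} \<le> 1" using card_mono[of "{1::'a}"] by auto
  then show False using card_nth_roots[of g "1::'a"] assms by simp
qed

text \<open>Orthogonality of the characters of the group of \<open>g\<close>-th roots of unity.\<close>

lemma sum_roots_of_unity_power:
  fixes g n :: nat
  assumes "0 < n" "n < g"
  shows "(\<Sum>\<zeta> | \<zeta> ^ g = (1::'a::{alg_closed_field, field_char_0}). \<zeta> ^ n) = 0"
proof -
  let ?M = "{\<zeta>::'a. \<zeta> ^ g = 1}"
  obtain \<eta> :: 'a where \<eta>: "\<eta> ^ g = 1" "\<eta> ^ n \<noteq> 1"
  proof -
    have "card {x::'a. x ^ n = 1} < card ?M"
      using assms by (simp add: card_nth_roots)
    then have "\<not> ?M \<subseteq> {x. x ^ n = 1}"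
      using card_mono[OF finite_nth_roots[of n "1::'a"], of ?M] assms by auto
    then show ?thesis using that by blast
  qed
  have \<eta>0: "\<eta> \<noteq> 0" using \<eta>(1) assms by (auto simp: zero_power)
  have "bij_betw (\<lambda>\<zeta>. \<eta> * \<zeta>) ?M ?M"
    by (rule bij_betw_byWitness[of _ "\<lambda>\<zeta>. \<zeta> / \<eta>"])
       (use \<eta> \<eta>0 in \<open>auto simp: power_mult_distrib power_divide\<close>)
  then have "(\<Sum>\<zeta>\<in>?M. \<zeta> ^ n) = (\<Sum>\<zeta>\<in>?M. (\<eta> * \<zeta>) ^ n)"
    by (rule sum.reindex_bij_betw[symmetric])
  also have "\<dots> = \<eta> ^ n * (\<Sum>\<zeta>\<in>?M. \<zeta> ^ n)"
    by (simp add: power_mult_distrib sum_distrib_left)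
  finally have "(1 - \<eta> ^ n) * (\<Sum>\<zeta>\<in>?M. \<zeta> ^ n) = 0"
    by (simp add: algebra_simps)
  then show ?thesis using \<eta>(2) by simp
qed

text \<open>
  A non-constant polynomial cannot have only multiple zeros over two different values: each zero
  of \<open>h - c\<close> of multiplicity \<open>\<mu> \<ge> 2\<close> is a zero of the derivative of multiplicity
  \<open>\<mu> - 1 \<ge> \<mu> / 2\<close>, and the derivative has only \<open>degree h - 1\<close> zeros.
\<close>

lemma const_if_two_totally_ramified_values:
  fixes h :: "'a::{alg_closed_field, field_char_0} poly"
  assumes "a \<noteq> b"
    and "\<And>s. poly h s = a \<Longrightarrow> poly (pderiv h) s = 0"
    and "\<And>s. poly h s = b \<Longrightarrow> poly (pderiv h) s = 0"
  shows "degree h = 0"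
proof (rule ccontr)
  assume N: "degree h \<noteq> 0"
  define R where "R c = {s. poly (h - [:c:]) s = 0}" for c
  have R: "s \<in> R c \<longleftrightarrow> poly h s = c" for s c by (simp add: R_def)
  have h': "pderiv h \<noteq> 0" using N by (simp add: pderiv_eq_0_iff)
  have ram: "degree h \<le> 2 * (\<Sum>s\<in>R c. Polynomial.order s (pderiv h))"
    if c: "\<And>s. poly h s = c \<Longrightarrow> poly (pderiv h) s = 0" for c
  proof -
    have nz: "h - [:c:] \<noteq> 0" using N by auto
    have d: "degree (h - [:c:]) = degree h" by (rule degree_diff_const[OF N])
    have "Polynomial.order s (h - [:c:]) \<le> 2 * Polynomial.order s (pderiv h)" if "s \<in> R c" for s
    proof -
      have "Polynomial.order s (h - [:c:]) = Suc (Polynomial.order s (pderiv h))"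
        using order_pderiv[OF nz, of s] that by (simp add: R_def pderiv_diff pderiv_pCons)
      moreover have "Polynomial.order s (pderiv h) \<noteq> 0"
        using c that h' by (simp add: R order_root)
      ultimately show ?thesis by simp
    qed
    then have "(\<Sum>s\<in>R c. Polynomial.order s (h - [:c:])) \<le> (\<Sum>s\<in>R c. 2 * Polynomial.order s (pderiv h))"
      by (rule sum_mono)
    then show ?thesis
      using sum_order_eq_degree[OF nz] d by (simp only: R_def sum_distrib_left)
  qed
  have fin: "finite (R c)" for c
    unfolding R_def using N by (intro poly_roots_finite) auto
  have disj: "R a \<inter> R b = {}" using assms(1) by (auto simp: R)
  have sub: "R a \<union> R b \<subseteq> {s. poly (pderiv h) s = 0}" using assms(2,3) by (auto simp: R)
  have "degree h \<le> 2 * (\<Sum>s\<in>R a. Polynomial.order s (pderiv h))"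
    by (rule ram) (rule assms(2))
  moreover have "degree h \<le> 2 * (\<Sum>s\<in>R b. Polynomial.order s (pderiv h))"
    by (rule ram) (rule assms(3))
  ultimately have "degree h \<le> (\<Sum>s\<in>R a. Polynomial.order s (pderiv h)) + (\<Sum>s\<in>R b. Polynomial.order s (pderiv h))"
    by linarith
  also have "\<dots> = (\<Sum>s\<in>R a \<union> R b. Polynomial.order s (pderiv h))"
    by (rule sum.union_disjoint[OF fin fin disj, symmetric])
  also have "\<dots> \<le> (\<Sum>s | poly (pderiv h) s = 0. Polynomial.order s (pderiv h))"
    by (rule sum_mono2[OF poly_roots_finite[OF h'] sub]) simp
  also have "\<dots> = degree (pderiv h)" by (rule sum_order_eq_degree[OF h'])
  also have "\<dots> = degree h - 1" by (rule degree_pderiv)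
  finally show False using N by simp
qed

text \<open>
  The number of zeros, counted with multiplicity, is the degree.
\<close>

lemma poly_only_root_0:
  fixes p :: "'a::alg_closed_field poly"
  assumes "\<And>s. s \<noteq> 0 \<Longrightarrow> poly p s \<noteq> 0"
  shows "\<exists>c. c \<noteq> 0 \<and> p = monom c (degree p)"
proof -
  have p: "p \<noteq> 0" using assms[of 1] by auto
  have "Polynomial.order 0 p = degree p"
  proof (cases "poly p 0 = 0")
    case True
    then have "{x. poly p x = 0} = {0}" using assms by auto
    then show ?thesis using sum_order_eq_degree[OF p] by simp
  next
    case False
    then have "poly p x \<noteq> 0" for x using assms[of x] by (cases "x = 0") simp_all
    then show ?thesis using sum_order_eq_degree[OF p] by (simp add: order_0I)
  qed
  then have "monom 1 (degree p) dvd p"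
    using p by (simp add: monom_1_dvd_iff)
  then obtain q where q: "p = monom 1 (degree p) * q" by (elim dvdE)
  have "q \<noteq> 0"
  proof
    assume "q = 0"
    then show False using q p by (metis mult_zero_right)
  qed
  have "degree (monom 1 (degree p) * q) = degree p + degree q"
    using \<open>q \<noteq> 0\<close> by (subst degree_mult_eq) (auto simp: degree_monom_eq monom_eq_0_iff)
  then have "degree q = 0" using arg_cong[OF q, of degree] by linarith
  then obtain c where c: "q = [:c:]" by (rule degree_eq_zeroE)
  have "monom 1 (degree p) * q = monom c (degree p)"
    by (simp add: c mult.commute smult_monom)
  then have "p = monom c (degree p)" using q by (rule trans[rotated])
  moreover have "c \<noteq> 0" using c \<open>q \<noteq> 0\<close> by auto
  ultimately show ?thesis by blast
qed

section \<open>The ideal of the hypersurface\<close>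

locale suspension_variety =
  fixes P :: "'a::{alg_closed_field, field_char_0} poly" and m :: nat and k :: "nat \<Rightarrow> nat"
  assumes m_pos: "m \<ge> 1" and deg_P: "degree P \<ge> 2"
    and k_ge_2: "\<And>i. i \<in> {1..m} \<Longrightarrow> k i \<ge> 2"
begin

abbreviation "PF \<equiv> polynomial_functions (Suc m) :: ((nat \<Rightarrow> 'a) \<Rightarrow> 'a) set"

definition Y :: "(nat \<Rightarrow> 'a) set" where "Y = suspension m k P"

definition F :: "(nat \<Rightarrow> 'a) \<Rightarrow> 'a"
  where "F x = (\<Prod>i\<in>{1..m}. x i ^ k i) - poly P (x (Suc m))"

text \<open>
  Points are extensional, so coordinates given by a formula have to be restricted.
\<close>

definition pt :: "(nat \<Rightarrow> 'a) \<Rightarrow> nat \<Rightarrow> 'a" where "pt x = restrict x {1..Suc m}"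

lemma pt_apply [simp]: "i \<in> {1..Suc m} \<Longrightarrow> pt x i = x i"
  by (simp add: pt_def)

lemma F_pt [simp]: "F (pt x) = F x"
  unfolding F_def by (simp add: prod.cong[of "{1..m}" "{1..m}" "\<lambda>i. pt x i ^ k i" "\<lambda>i. x i ^ k i"])

lemma mem_Y: "x \<in> Y \<longleftrightarrow> x \<in> extensional {1..Suc m} \<and> F x = 0"
  by (auto simp: Y_def suspension_def affine_space_def F_def PiE_def)

lemma pt_mem_Y: "pt x \<in> Y \<longleftrightarrow> F x = 0"
  by (simp add: mem_Y) (simp add: pt_def)

lemma PF_pt: "f \<in> PF \<Longrightarrow> f (pt x) = f x"
  by (rule polynomial_functions_cong) auto

lemma Y_eqI:
  assumes "x \<in> Y" "y \<in> Y" "\<And>i. i \<in> {1..m} \<Longrightarrow> x i = y i" "x (Suc m) = y (Suc m)"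
  shows "x = y"
proof (rule extensionalityI)
  show "x \<in> extensional {1..Suc m}" "y \<in> extensional {1..Suc m}"
    using assms by (auto simp: mem_Y)
  show "x i = y i" if "i \<in> {1..Suc m}" for i
    using that assms by (cases "i = Suc m") auto
qed

lemma P_nz [simp]: "P \<noteq> 0" and deg_P_nz: "degree P \<noteq> 0"
  using deg_P by auto

lemma coord_PF: "i \<in> {1..m} \<Longrightarrow> (\<lambda>x. x i) \<in> PF" "(\<lambda>x. x (Suc m)) \<in> PF"
  by (rule polynomial_functions.coord; simp)+

lemma F_PF: "F \<in> PF"
  unfolding F_def
  by (intro polynomial_functions_diff polynomial_functions_prod polynomial_functions_power
      polynomial_functions_poly coord_PF)

text \<open>
  Division with remainder by \<open>F\<close> with respect to the last coordinate; the coefficients of the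
  remainder are polynomials in the other coordinates.
\<close>

definition divisible_with_remainder :: "((nat \<Rightarrow> 'a) \<Rightarrow> 'a) \<Rightarrow> bool"
  where "divisible_with_remainder Q \<longleftrightarrow> (\<exists>H\<in>PF. \<exists>r. (\<forall>j. r j \<in> polynomial_functions m) \<and>
    (\<forall>x. Q x = F x * H x + (\<Sum>j<degree P. r j x * x (Suc m) ^ j)))"

lemma divisible_with_remainderI:
  assumes "H \<in> PF" "\<And>j. r j \<in> polynomial_functions m"
    "\<And>x. Q x = F x * H x + (\<Sum>j<degree P. r j x * x (Suc m) ^ j)"
  shows "divisible_with_remainder Q"
  using assms unfolding divisible_with_remainder_def by blast

lemma divisible_with_remainderE:
  assumes "divisible_with_remainder Q"
  obtains H r where "H \<in> PF" "\<And>j. r j \<in> polynomial_functions m"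
    "\<And>x. Q x = F x * H x + (\<Sum>j<degree P. r j x * x (Suc m) ^ j)"
  using assms unfolding divisible_with_remainder_def by blast

lemma divisible_with_remainder_add:
  assumes "divisible_with_remainder Q" "divisible_with_remainder Q'"
  shows "divisible_with_remainder (\<lambda>x. Q x + Q' x)"
proof -
  obtain H r where 1: "H \<in> PF" "\<And>j. r j \<in> polynomial_functions m"
    "\<And>x. Q x = F x * H x + (\<Sum>j<degree P. r j x * x (Suc m) ^ j)"
    using assms(1) by (rule divisible_with_remainderE) blast
  obtain H' r' where 2: "H' \<in> PF" "\<And>j. r' j \<in> polynomial_functions m"
    "\<And>x. Q' x = F x * H' x + (\<Sum>j<degree P. r' j x * x (Suc m) ^ j)"
    using assms(2) by (rule divisible_with_remainderE) blast
  show ?thesis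
    by (rule divisible_with_remainderI[of "\<lambda>x. H x + H' x" "\<lambda>j x. r j x + r' j x"])
       (use 1 2 in \<open>auto intro!: polynomial_functions.add simp: algebra_simps sum.distrib\<close>)
qed

lemma divisible_with_remainder_mult_left:
  assumes "c \<in> polynomial_functions m" "divisible_with_remainder Q"
  shows "divisible_with_remainder (\<lambda>x. c x * Q x)"
proof -
  obtain H r where 1: "H \<in> PF" "\<And>j. r j \<in> polynomial_functions m"
    "\<And>x. Q x = F x * H x + (\<Sum>j<degree P. r j x * x (Suc m) ^ j)"
    using assms(2) by (rule divisible_with_remainderE) blast
  have "c \<in> PF" using polynomial_functions_mono[OF assms(1)] by simp
  then show ?thesis
    by (intro divisible_with_remainderI[of "\<lambda>x. c x * H x" "\<lambda>j x. c x * r j x"])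
       (use 1 assms(1) in \<open>auto intro!: polynomial_functions.mult simp: algebra_simps sum_distrib_left\<close>)
qed

text \<open>
  \<open>F\<close> is, up to sign and a constant, monic in the last coordinate, so the top power of that
  coordinate can be rewritten modulo \<open>F\<close>.
\<close>

lemma divisible_with_remainder_mult_last:
  assumes "divisible_with_remainder Q"
  shows "divisible_with_remainder (\<lambda>x. x (Suc m) * Q x)"
proof -
  obtain H r where 1: "H \<in> PF" "\<And>j. r j \<in> polynomial_functions m"
    "\<And>x. Q x = F x * H x + (\<Sum>j<degree P. r j x * x (Suc m) ^ j)"
    using assms by (rule divisible_with_remainderE) blast
  obtain e where e: "degree P = Suc e" using deg_P by (cases "degree P") auto
  define l where "l = coeff P (Suc e)"
  have l: "l \<noteq> 0" unfolding l_def e[symmetric] by simp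
  define M where "M x = (\<Prod>i\<in>{1..m}. x i ^ k i)" for x :: "nat \<Rightarrow> 'a"
  have M: "M \<in> polynomial_functions m"
    unfolding M_def by (intro polynomial_functions_prod polynomial_functions_power)
      (auto intro: polynomial_functions.coord)
  have re: "r e \<in> PF" by (rule polynomial_functions_mono[OF 1(2)]) simp
  define r' where "r' j = (\<lambda>x. (if j = 0 then 0 else r (j - 1) x)
      + (r e x * inverse l) * ((if j = 0 then M x else 0) - coeff P j))" for j
  have r': "r' j \<in> polynomial_functions m" for j
    unfolding r'_def using 1(2) M
    by (cases "j = 0") (auto intro!: polynomial_functions.add polynomial_functions.mult
        polynomial_functions_diff polynomial_functions_uminus intro: polynomial_functions.const)
  define H' where "H' x = x (Suc m) * H x - r e x * inverse l" for x
  have H': "H' \<in> PF"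
    unfolding H'_def using 1(1) re coord_PF(2)
    by (auto intro!: polynomial_functions.mult polynomial_functions_diff polynomial_functions.const)
  show ?thesis
  proof (rule divisible_with_remainderI[OF H' r'])
    fix x :: "nat \<Rightarrow> 'a"
    define z where "z = x (Suc m)"
    have P: "poly P z = (\<Sum>j\<le>e. coeff P j * z ^ j) + l * z ^ Suc e"
      unfolding poly_altdef e l_def by simp
    have F: "F x = M x - poly P z" by (simp add: F_def M_def z_def)
    have "(\<Sum>j\<le>e. r' j x * z ^ j) = (\<Sum>j\<le>e. (if j = 0 then 0 else r (j - 1) x * z ^ j))
        + (r e x * inverse l) * (\<Sum>j\<le>e. ((if j = 0 then M x else 0) * z ^ j - coeff P j * z ^ j))"
      unfolding sum_distrib_left sum.distrib[symmetric]
      by (rule sum.cong) (auto simp: r'_def algebra_simps)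
    also have "(\<Sum>j\<le>e. ((if j = 0 then M x else 0) * z ^ j - coeff P j * z ^ j)) = M x - (poly P z - l * z ^ Suc e)"
      by (simp add: sum_subtractf P if_distribR sum.atMost_shift)
    also have "(\<Sum>j\<le>e. (if j = 0 then 0 else r (j - 1) x * z ^ j)) = (\<Sum>j<e. r j x * z ^ Suc j)"
      by (simp add: sum.atMost_shift)
    finally have "F x * H' x + (\<Sum>j\<le>e. r' j x * z ^ j)
        = F x * (z * H x) + (\<Sum>j<e. r j x * z ^ Suc j) + r e x * z ^ Suc e"
      using l by (simp add: H'_def F z_def[symmetric] algebra_simps)
    also have "\<dots> = z * (F x * H x + (\<Sum>j\<le>e. r j x * z ^ j))"
      by (simp add: algebra_simps sum_distrib_left lessThan_Suc_atMost[symmetric])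
    finally show "x (Suc m) * Q x = F x * H' x + (\<Sum>j<degree P. r' j x * x (Suc m) ^ j)"
      using 1(3)[of x] by (simp add: e lessThan_Suc_atMost z_def)
  qed
qed

lemma PF_divisible_with_remainder:
  assumes "Q \<in> PF"
  shows "divisible_with_remainder Q"
proof -
  have one: "divisible_with_remainder (\<lambda>x. 1)"
  proof (rule divisible_with_remainderI[of "\<lambda>x. 0" "\<lambda>j x. if j = 0 then 1 else 0"])
    show "(\<lambda>x. if j = 0 then 1 else 0) \<in> polynomial_functions m" for j :: nat
      by (rule polynomial_functions.const)
    show "1 = F x * 0 + (\<Sum>j<degree P. (if j = 0 then 1 else 0) * x (Suc m) ^ j)" for x
    proof -
      have "(\<Sum>j<degree P. (if j = 0 then 1 else 0) * x (Suc m) ^ j) = (\<Sum>j<degree P. if j = 0 then 1 else 0)"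
        by (rule sum.cong) auto
      then show ?thesis using deg_P_nz by simp
    qed
  qed (rule polynomial_functions.const)
  have "divisible_with_remainder (\<lambda>x. Q x * R x)" if "divisible_with_remainder R" for R
    using assms that
  proof (induction arbitrary: R)
    case (const c)
    then show ?case
      using divisible_with_remainder_mult_left[OF polynomial_functions.const] by blast
  next
    case (coord i)
    then show ?case
      using divisible_with_remainder_mult_left[OF polynomial_functions.coord[of i m]]
        divisible_with_remainder_mult_last by (cases "i = Suc m") auto
  next
    case (add f g)
    show ?case
      using divisible_with_remainder_add[OF add.IH(1)[OF add.prems] add.IH(2)[OF add.prems]]
      by (simp add: distrib_right)
  next
    case (mult f g)
    show ?case using mult.IH(1)[OF mult.IH(2)[OF mult.prems]] by (simp add: mult.assoc)
  qed
  from this[OF one] show ?thesis by simp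
qed

text \<open>
  Over a generic \<open>y\<close> the equation has \<open>degree P\<close> distinct solutions, so a remainder
  of smaller degree that vanishes on them is zero; a polynomial that vanishes for generic \<open>y\<close>
  vanishes identically, as one sees on the lines in direction \<open>(1, \<dots>, 1)\<close>, which meet the
  exceptional set in finitely many points.
\<close>

lemma vanishing_ideal:
  assumes "Q \<in> PF" and zero: "\<And>x. x \<in> Y \<Longrightarrow> (\<And>i. i \<in> {1..m} \<Longrightarrow> x i \<noteq> 0) \<Longrightarrow> Q x = 0"
  shows "\<exists>H\<in>PF. \<forall>x. Q x = F x * H x"
proof -
  obtain H r where H: "H \<in> PF" and r: "\<And>j. r j \<in> polynomial_functions m"
    and Q: "\<And>x. Q x = F x * H x + (\<Sum>j<degree P. r j x * x (Suc m) ^ j)"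
    using PF_divisible_with_remainder[OF assms(1)] by (rule divisible_with_remainderE) blast
  define CV where "CV = poly P ` {x. poly (pderiv P) x = 0}"
  have CV: "finite CV" unfolding CV_def by (rule finite_critical_values[OF deg_P_nz])
  define M where "M y = (\<Prod>i\<in>{1..m}. y i ^ k i)" for y :: "nat \<Rightarrow> 'a"
  \<comment> \<open>Away from the critical values of \<open>P\<close> and from the coordinate hyperplanes the remainder has
    more zeros in the last coordinate than its degree allows.\<close>
  have generic: "r j y = 0" if j: "j < degree P" and M: "M y \<notin> CV" and nz: "\<And>i. i \<in> {1..m} \<Longrightarrow> y i \<noteq> 0"
    for j y
  proof -
    define q where "q = (\<Sum>j<degree P. monom (r j y) j)"
    have cq: "coeff q j = (if j < degree P then r j y else 0)" for j
      by (simp add: q_def coeff_sum)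
    have deg: "degree q < degree P"
      using deg_P_nz cq by (intro degree_lessI) auto
    have "poly q z = 0" if z: "poly P z = M y" for z
    proof -
      define x where "x = pt (y(Suc m := z))"
      have xi: "x i = y i" if "i \<in> {1..m}" for i
        using that by (simp add: x_def)
      have "(\<Prod>i\<in>{1..m}. (y(Suc m := z)) i ^ k i) = M y"
        unfolding M_def by (rule prod.cong) auto
      then have "F (y(Suc m := z)) = 0"
        using z by (simp add: F_def)
      then have "x \<in> Y" by (simp add: x_def pt_mem_Y)
      then have "Q x = 0" using zero nz xi by metis
      moreover have "F x = 0" using \<open>x \<in> Y\<close> by (simp add: mem_Y)
      moreover have "r j x = r j y" for j
        by (rule polynomial_functions_cong[OF r]) (rule xi)
      moreover have "x (Suc m) = z" by (simp add: x_def)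
      ultimately show ?thesis using Q[of x] by (simp add: q_def poly_sum poly_monom)
    qed
    moreover have "card {z. poly P z = M y} = degree P"
      using card_fibre_noncritical[OF deg_P_nz] M by (simp add: CV_def)
    ultimately have "q = 0"
      using deg by (intro poly_eqI_degree[of "{z. poly P z = M y}"]) auto
    then have "coeff q j = 0" by simp
    then show ?thesis using cq j by simp
  qed
  \<comment> \<open>The exceptional points on the line through \<open>y\<close> in direction \<open>(1, \<dots>, 1)\<close> are the zeros of
    \<open>q - c\<close> for critical values \<open>c\<close> and the points on coordinate hyperplanes.\<close>
  have "r j y = 0" if j: "j < degree P" for j y
  proof -
    define q where "q = (\<Prod>i\<in>{1..m}. [:y i, 1:] ^ k i)"
    have q: "poly q s = M (\<lambda>i. y i + s * 1)" for s
      by (simp add: q_def M_def poly_prod poly_power add.commute)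
    have "degree q = (\<Sum>i\<in>{1..m}. k i)"
      unfolding q_def by (subst degree_prod_eq_sum_degree) (auto simp: degree_power_eq)
    moreover have "k 1 \<le> (\<Sum>i\<in>{1..m}. k i)"
      using m_pos by (intro member_le_sum) auto
    moreover have "2 \<le> k 1" using k_ge_2[of 1] m_pos by simp
    ultimately have "degree q \<noteq> 0" by linarith
    then have "finite {s. poly q s = c}" for c
    proof -
      have "q \<noteq> [:c:]" using \<open>degree q \<noteq> 0\<close> by auto
      then show ?thesis using poly_roots_finite[of "q - [:c:]"] by simp
    qed
    then have "finite (\<Union>c\<in>CV. {s. poly q s = c})" using CV by blast
    moreover have "finite ((\<lambda>i. - y i) ` {1..m})" by simp
    ultimately have fin: "finite ((\<Union>c\<in>CV. {s. poly q s = c}) \<union> (\<lambda>i. - y i) ` {1..m})" (is "finite ?B")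
      by blast
    have "r j (\<lambda>i. y i + 0 * 1) = 0"
    proof (rule poly_fun_zero_cofinite[OF polynomial_functions_line_cong[OF r] fin])
      fix s assume s: "s \<notin> ?B"
      show "r j (\<lambda>i. y i + s * 1) = 0"
      proof (rule generic[OF j])
        show "M (\<lambda>i. y i + s * 1) \<notin> CV" using s q by auto
        show "y i + s * 1 \<noteq> 0" if "i \<in> {1..m}" for i
          using s that by (auto simp: add_eq_0_iff)
      qed
    qed
    then show ?thesis by simp
  qed
  then have "Q x = F x * H x" for x using Q[of x] by simp
  then show ?thesis using H by blast
qed

end

lemma is_poly_fun_split_const:
  assumes "is_poly_fun f"
  shows "\<exists>w. is_poly_fun w \<and> (\<forall>s. f s = f 0 + s * w s)"
proof -
  obtain p where p: "f = poly p" by (rule is_poly_funE[OF assms])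
  obtain c q where q: "p = pCons c q" by (cases p)
  show ?thesis
    by (rule exI[of _ "poly q"]) (simp add: p q is_poly_fun_poly)
qed

text \<open>
  A double zero of \<open>f h\<close> at a point where \<open>h\<close> does not vanish is a double zero of \<open>f\<close>.
\<close>

lemma is_poly_fun_cancel_square:
  fixes f h B :: "'a::{idom, ring_char_0} \<Rightarrow> 'a"
  assumes "is_poly_fun f" "is_poly_fun h" "is_poly_fun B"
    and eq: "\<And>s. f s * h s = s ^ 2 * B s" and "h 0 \<noteq> 0"
  shows "\<exists>C. f = poly ([:0, 0, 1:] * C)"
proof -
  obtain p q b where p: "f = poly p" "h = poly q" "B = poly b"
    using assms(1-3) by (auto elim!: is_poly_funE)
  have "poly (p * q) s = poly ([:0, 0, 1:] * b) s" for s
    using eq[of s] by (simp add: p power2_eq_square algebra_simps)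
  then have pq: "p * q = [:0, 0, 1:] * b" by (metis poly_eq_poly_eq_iff ext)
  obtain c0 p1 where 1: "p = pCons c0 p1" by (cases p)
  obtain c1 p2 where 2: "p1 = pCons c1 p2" by (cases p1)
  obtain d0 q1 where 3: "q = pCons d0 q1" by (cases q)
  have d0: "d0 \<noteq> 0" using assms(5) by (simp add: p 3)
  have "coeff (p * q) 0 = 0" using pq by simp
  then have c0: "c0 = 0" using d0 by (simp add: 1 3)
  have "coeff (p * q) (Suc 0) = 0" using pq by simp
  then have "c1 = 0" using d0 by (simp add: 1 2 3 c0)
  then have "p = [:0, 0, 1:] * p2" using 1 2 c0 by simp
  then show ?thesis using p by blast
qed

section \<open>Automorphisms preserve the singular locus\<close>

context suspension_variety
begin

definition G :: "((nat \<Rightarrow> 'a) \<Rightarrow> (nat \<Rightarrow> 'a)) set" where "G = variety_auts (Suc m) Y"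

lemma G_subgroup: "subgroup G (BijGroup Y)"
  unfolding G_def by (rule subgroup_variety_auts)

lemma G_Bij: "\<phi> \<in> G \<Longrightarrow> \<phi> \<in> Bij Y"
  by (simp add: G_def variety_auts_def)

lemma G_mem: "\<phi> \<in> G \<Longrightarrow> x \<in> Y \<Longrightarrow> \<phi> x \<in> Y"
  by (rule Bij_apply_mem[OF G_Bij])

lemma G_coordinate:
  assumes "\<phi> \<in> G" "i \<in> {1..Suc m}"
  shows "\<exists>f\<in>PF. \<forall>x\<in>Y. \<phi> x i = f x"
  using assms by (auto simp: G_def variety_auts_def affine_morphism_def)

lemma G_lift:
  assumes "\<phi> \<in> G"
  shows "\<exists>\<Phi>. \<forall>i\<in>{1..Suc m}. (\<lambda>x. \<Phi> x i) \<in> PF \<and> (\<forall>x\<in>Y. \<phi> x i = \<Phi> x i)"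
proof -
  have "\<forall>i. \<exists>f. i \<in> {1..Suc m} \<longrightarrow> f \<in> PF \<and> (\<forall>x\<in>Y. \<phi> x i = f x)"
    using G_coordinate[OF assms] by blast
  then obtain f where "\<forall>i. i \<in> {1..Suc m} \<longrightarrow> f i \<in> PF \<and> (\<forall>x\<in>Y. \<phi> x i = f i x)"
    by (rule choice[THEN exE])
  then show ?thesis by (intro exI[of _ "\<lambda>x i. f i x"]) auto
qed

lemma G_inverse:
  assumes "\<phi> \<in> G"
  shows "\<exists>\<psi>\<in>G. (\<forall>x\<in>Y. \<psi> (\<phi> x) = x) \<and> (\<forall>x\<in>Y. \<phi> (\<psi> x) = x)"
proof (rule bexI[of _ "inv\<^bsub>BijGroup Y\<^esub> \<phi>"])
  show "inv\<^bsub>BijGroup Y\<^esub> \<phi> \<in> G" by (rule subgroup.m_inv_closed[OF G_subgroup assms])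
qed (simp add: BijGroup_inv[OF G_Bij[OF assms]])

text \<open>
  The boundary, and the singular locus: since all exponents are at least two, the partial derivatives
  of \<open>F\<close> vanish simultaneously on \<open>Y\<close> precisely where some \<open>y\<^sub>i\<close> and \<open>P'(z)\<close> vanish.
\<close>

definition D :: "(nat \<Rightarrow> 'a) set" where "D = {x \<in> Y. \<exists>i\<in>{1..m}. x i = 0}"

definition Sing :: "(nat \<Rightarrow> 'a) set"
  where "Sing = {x \<in> D. poly (pderiv P) (x (Suc m)) = 0}"

lemma F_cong: "(\<And>i. i \<in> {1..Suc m} \<Longrightarrow> x i = y i) \<Longrightarrow> F x = F y"
  by (rule polynomial_functions_cong[OF F_PF])

lemma Y_F: "x \<in> Y \<Longrightarrow> F x = 0"
  by (simp add: mem_Y)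

lemma prod_eq_0_if: "i \<in> {1..m} \<Longrightarrow> x i = 0 \<Longrightarrow> (\<Prod>i\<in>{1..m}. x i ^ k i) = (0::'a)"
  using k_ge_2[of i] by (intro prod_zero bexI[of _ i]) simp_all

lemma D_root: "x \<in> D \<Longrightarrow> poly P (x (Suc m)) = 0"
proof -
  assume "x \<in> D"
  then obtain i where i: "i \<in> {1..m}" "x i = 0" and "F x = 0" by (auto simp: D_def Y_F)
  then show ?thesis using prod_eq_0_if[of i x, OF i] by (simp only: F_def) simp
qed

lemma PF_along: "f \<in> PF \<Longrightarrow> (\<And>i. i \<in> {1..Suc m} \<Longrightarrow> is_poly_fun (\<lambda>s. \<gamma> s i)) \<Longrightarrow> is_poly_fun (\<lambda>s. f (\<gamma> s))"
  by (rule polynomial_functions_along_curve)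

lemma vanishing_ideal_Y:
  assumes "Q \<in> PF" "\<And>x. x \<in> Y \<Longrightarrow> Q x = 0"
  shows "\<exists>H\<in>PF. \<forall>x. Q x = F x * H x"
  using vanishing_ideal[OF assms(1)] assms(2) by blast

lemma is_poly_fun_single_coord: "is_poly_fun (\<lambda>s. (x(j := c + s)) i)"
  by (cases "i = j") (auto intro: is_poly_fun_intros)

text \<open>
  Let \<open>\<Phi>\<close>, \<open>\<Psi>\<close> lift \<open>\<phi>\<close> and its inverse to polynomial maps of the affine space. Both
  \<open>F \<circ> \<Phi>\<close> and \<open>F \<circ> \<Psi>\<close> are multiples \<open>F \<cdot> H\<close>, \<open>F \<cdot> H'\<close> of \<open>F\<close>. Moving away from a
  point \<open>p\<close> of the singular locus along the last coordinate and comparing lowest order terms in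
  \<open>F \<circ> \<Psi> \<circ> \<Phi>\<close> gives \<open>H(p) H'(\<phi>(p)) = 1\<close>. So near \<open>\<phi>(p)\<close> the function \<open>F\<close> is, up to a unit,
  \<open>F \<circ> \<Psi>\<close>, which vanishes to second order because \<open>F\<close> does so at \<open>p\<close>.
\<close>

lemma Sing_preserved:
  assumes \<phi>: "\<phi> \<in> G" and p: "p \<in> Sing"
  shows "\<phi> p \<in> Sing"
proof -
  obtain \<psi> where \<psi>: "\<psi> \<in> G" and \<psi>\<phi>: "\<And>x. x \<in> Y \<Longrightarrow> \<psi> (\<phi> x) = x" using G_inverse[OF \<phi>] by blast
  obtain \<Phi> where \<Phi>: "\<And>i. i \<in> {1..Suc m} \<Longrightarrow> (\<lambda>x. \<Phi> x i) \<in> PF"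
      "\<And>i x. i \<in> {1..Suc m} \<Longrightarrow> x \<in> Y \<Longrightarrow> \<phi> x i = \<Phi> x i" using G_lift[OF \<phi>] by blast
  obtain \<Psi> where \<Psi>: "\<And>i. i \<in> {1..Suc m} \<Longrightarrow> (\<lambda>x. \<Psi> x i) \<in> PF"
      "\<And>i x. i \<in> {1..Suc m} \<Longrightarrow> x \<in> Y \<Longrightarrow> \<psi> x i = \<Psi> x i" using G_lift[OF \<psi>] by blast
  have "F (\<Phi> x) = 0" if "x \<in> Y" for x
    using F_cong[of "\<Phi> x" "\<phi> x"] \<Phi>(2) that Y_F G_mem[OF \<phi>] by simp
  then obtain H where H: "H \<in> PF" "\<And>x. F (\<Phi> x) = F x * H x"
    using vanishing_ideal_Y[OF polynomial_functions_compose[where \<gamma> = \<Phi>, OF F_PF \<Phi>(1)]] by blast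
  have "F (\<Psi> x) = 0" if "x \<in> Y" for x
    using F_cong[of "\<Psi> x" "\<psi> x"] \<Psi>(2) that Y_F G_mem[OF \<psi>] by simp
  then obtain H' where H': "H' \<in> PF" "\<And>x. F (\<Psi> x) = F x * H' x"
    using vanishing_ideal_Y[OF polynomial_functions_compose[where \<gamma> = \<Psi>, OF F_PF \<Psi>(1)]] by blast
  have "\<forall>i. \<exists>V. i \<in> {1..Suc m} \<longrightarrow> V \<in> PF \<and> (\<forall>x. \<Psi> (\<Phi> x) i = x i + F x * V x)"
  proof (intro allI, goal_cases)
    case (1 i)
    show ?case
    proof (cases "i \<in> {1..Suc m}")
      case i: True
      have "\<Psi> (\<Phi> x) i - x i = 0" if "x \<in> Y" for x
      proof -
        have "\<Psi> (\<Phi> x) i = \<Psi> (\<phi> x) i"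
          by (rule polynomial_functions_cong[OF \<Psi>(1)[OF i]]) (use \<Phi>(2) that in simp)
        also have "\<dots> = x i" using \<Psi>(2)[OF i G_mem[OF \<phi> that]] \<psi>\<phi>[OF that] by simp
        finally show ?thesis by simp
      qed
      moreover have "(\<lambda>x. \<Psi> (\<Phi> x) i - x i) \<in> PF"
        using polynomial_functions_compose[where \<gamma> = \<Phi>, OF \<Psi>(1)[OF i] \<Phi>(1)] i
        by (intro polynomial_functions_diff) (auto intro: polynomial_functions.coord)
      ultimately obtain V where "V \<in> PF" "\<And>x. \<Psi> (\<Phi> x) i - x i = F x * V x"
        using vanishing_ideal_Y[of "\<lambda>x. \<Psi> (\<Phi> x) i - x i"] by blast
      then show ?thesis by (metis add.commute diff_add_cancel)
    qed auto
  qed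
  then obtain V where "\<forall>i. i \<in> {1..Suc m} \<longrightarrow> V i \<in> PF \<and> (\<forall>x. \<Psi> (\<Phi> x) i = x i + F x * V i x)"
    by (rule choice[THEN exE])
  then have V: "\<And>i. i \<in> {1..Suc m} \<Longrightarrow> V i \<in> PF"
      "\<And>i x. i \<in> {1..Suc m} \<Longrightarrow> \<Psi> (\<Phi> x) i = x i + F x * V i x"
    by blast+
  define a where "a = p (Suc m)"
  have pY: "p \<in> Y" and a: "poly P a = 0" "poly (pderiv P) a = 0"
    using p D_root by (auto simp: Sing_def D_def a_def)
  obtain j where j: "j \<in> {1..m}" "p j = 0" using p by (auto simp: Sing_def D_def)
  define e where "e = Polynomial.order a P"
  obtain Q where Q: "P = [:-a, 1:] ^ e * Q" "\<not> [:-a, 1:] dvd Q"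
    using order_decomp[OF P_nz, of a] by (auto simp: e_def)
  have Qa: "poly Q a \<noteq> 0" using Q(2) by (simp add: poly_eq_0_iff_dvd)
  have e: "e \<ge> 2"
    using order_pderiv[OF P_nz a(1)] a(2) deg_P_nz order_root[of "pderiv P" a]
    by (auto simp: e_def pderiv_eq_0_iff)
  have Pz: "poly P (a + t) = t ^ e * poly Q (a + t)" for t
    by (subst Q(1)) (simp add: poly_power)
  define q where "q = \<phi> p"
  have qY: "q \<in> Y" unfolding q_def by (rule G_mem[OF \<phi> pY])
  have \<Phi>p: "\<Phi> p i = q i" if "i \<in> {1..Suc m}" for i using \<Phi>(2)[OF that pY] by (simp add: q_def)
  have \<Psi>q: "\<Psi> q i = p i" if "i \<in> {1..Suc m}" for i
    using \<Psi>(2)[OF that qY] \<psi>\<phi>[OF pY] by (simp add: q_def)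

  \<comment> \<open>\<open>A\<close>, \<open>B\<close> and \<open>C\<close> are what remains of \<open>\<Prod> y\<^sub>i\<^bsup>k\<^sub>i\<^esup>\<close>, of \<open>P(z)\<close> and of \<open>F H H'\<close> after division
    by \<open>s\<^bsup>e\<^esup>\<close>, where \<open>e\<close> is the multiplicity of the root \<open>a\<close>.\<close>
  have unit: "H' q \<noteq> 0"
  proof -
    define x where "x s = p(Suc m := a + s)" for s
    have xp: "is_poly_fun (\<lambda>s. x s i)" for i
      unfolding x_def by (rule is_poly_fun_single_coord)
    have Fx: "F (x s) = - (s ^ e * poly Q (a + s))" for s
      using prod_eq_0_if[of j "x s"] j by (simp add: F_def x_def Pz)
    let ?V = "\<lambda>i s. V i (x s)"
    have Vp: "is_poly_fun (?V i)" if "i \<in> {1..Suc m}" for i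
      by (rule PF_along[where \<gamma> = x, OF V(1)[OF that] xp])
    define A where "A s = (\<Prod>i\<in>{1..m} - {j}. (x s i + F (x s) * ?V i s) ^ k i) *
      (s ^ (k j * e - e) * (- poly Q (a + s) * ?V j s) ^ k j)" for s
    define B where "B s = (1 - s ^ (e - 1) * poly Q (a + s) * ?V (Suc m) s) ^ e *
      poly Q (a + s + F (x s) * ?V (Suc m) s)" for s
    define C where "C s = poly Q (a + s) * H (x s) * H' (\<Phi> (x s))" for s
    have ke: "k j * e = e + (k j * e - e)" "k j * e - e > 0"
      using k_ge_2[OF j(1)] e by (cases "k j"; simp)+
    have eq: "s ^ e * (A s - B s) = - (s ^ e * C s)" for s
    proof -
      have "(\<Prod>i\<in>{1..m}. (x s i + F (x s) * ?V i s) ^ k i) =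
          (\<Prod>i\<in>{1..m} - {j}. (x s i + F (x s) * ?V i s) ^ k i) * (F (x s) * ?V j s) ^ k j"
        using j by (subst prod.remove[of _ j]) (auto simp: x_def mult.commute)
      also have "(F (x s) * ?V j s) ^ k j = s ^ e * s ^ (k j * e - e) * (- poly Q (a + s) * ?V j s) ^ k j"
      proof -
        have "F (x s) * ?V j s = s ^ e * (- poly Q (a + s) * ?V j s)" by (simp add: Fx)
        then have "(F (x s) * ?V j s) ^ k j = s ^ (k j * e) * (- poly Q (a + s) * ?V j s) ^ k j"
          by (simp only: power_mult_distrib[of "s ^ e"] power_mult[symmetric] mult.commute[of e])
        moreover have "s ^ (k j * e) = s ^ e * s ^ (k j * e - e)" using ke(1) by (metis power_add)
        ultimately show ?thesis by simp
      qed
      finally have "(\<Prod>i\<in>{1..m}. (x s i + F (x s) * ?V i s) ^ k i) = s ^ e * A s"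
        by (simp add: A_def mult_ac)
      moreover have "poly P (a + s + F (x s) * ?V (Suc m) s) = s ^ e * B s"
      proof -
        have "s + F (x s) * ?V (Suc m) s = s * (1 - s ^ (e - 1) * poly Q (a + s) * ?V (Suc m) s)"
          using e by (cases e) (simp_all add: Fx algebra_simps)
        then show ?thesis
          using Pz[of "s + F (x s) * ?V (Suc m) s"] by (simp add: B_def power_mult_distrib add.assoc)
      qed
      ultimately have "F (\<lambda>i. x s i + F (x s) * ?V i s) = s ^ e * (A s - B s)"
        by (simp add: F_def[of "\<lambda>i. x s i + F (x s) * ?V i s"] x_def[of s, THEN fun_cong, of "Suc m"] right_diff_distrib)
      moreover have "F (\<lambda>i. x s i + F (x s) * ?V i s) = F (\<Psi> (\<Phi> (x s)))"
        by (rule F_cong) (simp add: V(2))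
      moreover have "F (\<Psi> (\<Phi> (x s))) = - (s ^ e * C s)"
        by (simp add: H'(2) H(2) Fx C_def)
      ultimately show ?thesis by simp
    qed
    have "is_poly_fun (\<lambda>s. A s - B s + C s)"
    proof -
      have Fp: "is_poly_fun (\<lambda>s. F (x s))" by (rule PF_along[where \<gamma> = x, OF F_PF xp])
      have as: "is_poly_fun (\<lambda>s. a + s)" by (intro is_poly_fun_add is_poly_fun_const is_poly_fun_id)
      have m: "is_poly_fun (\<lambda>s. - g s)" if "is_poly_fun g" for g :: "'a \<Rightarrow> 'a"
        using is_poly_fun_mult[OF is_poly_fun_const[of "-1"] that] by simp
      have Ap: "is_poly_fun A" unfolding A_def
        using j by (intro is_poly_fun_mult is_poly_fun_prod is_poly_fun_power is_poly_fun_add xp Fp Vp m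
            is_poly_fun_compose as is_poly_fun_id) auto
      have Bp: "is_poly_fun B" unfolding B_def
        by (intro is_poly_fun_mult is_poly_fun_power is_poly_fun_add is_poly_fun_diff xp Fp Vp m
            is_poly_fun_compose as is_poly_fun_id is_poly_fun_const) auto
      have "is_poly_fun (\<lambda>s. H' (\<Phi> (x s)))"
        by (rule PF_along[where \<gamma> = "\<lambda>s. \<Phi> (x s)", OF H'(1)])
           (rule PF_along[where \<gamma> = x, OF \<Phi>(1) xp])
      then have Cp: "is_poly_fun C" unfolding C_def
        by (intro is_poly_fun_mult is_poly_fun_compose as PF_along[where \<gamma> = x, OF H(1) xp])
      show ?thesis by (intro is_poly_fun_add is_poly_fun_diff Ap Bp Cp)
    qed
    moreover have "A s - B s + C s = 0" if "s \<notin> {0}" for s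
      using eq[of s] that by (simp add: minus_mult_right del: mult_minus_right)
    ultimately have "A 0 - B 0 + C 0 = 0"
      using poly_fun_zero_cofinite[of "\<lambda>s. A s - B s + C s" "{0}" 0] by blast
    moreover have "A 0 = 0" using ke(2) by (simp add: A_def zero_power)
    moreover have "B 0 = poly Q a" using e by (simp add: B_def Fx zero_power)
    ultimately have "C 0 \<noteq> 0" using Qa by simp
    then have "H' (\<Phi> (x 0)) \<noteq> 0" by (auto simp: C_def)
    moreover have "x 0 = p" by (simp add: x_def a_def)
    moreover have "H' (\<Phi> p) = H' q" by (rule polynomial_functions_cong[OF H'(1) \<Phi>p])
    ultimately show ?thesis by simp
  qed

  have sq: "t ^ n = t ^ 2 * t ^ (n - 2)" if "n \<ge> 2" for t :: 'a and n
    using that by (metis le_add_diff_inverse power_add)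
  \<comment> \<open>\<open>F \<circ> \<Psi>\<close> vanishes to second order at \<open>q\<close>, because \<open>\<Psi>(q) = p\<close>, \<open>k\<^sub>j \<ge> 2\<close> and \<open>e \<ge> 2\<close>;
    since \<open>H'(q) \<noteq> 0\<close>, this carries over to \<open>F\<close> itself.\<close>
  have second_order: "\<exists>C. (\<lambda>s. F (q(i := q i + s))) = poly ([:0, 0, 1:] * C)" for i
  proof -
    define y where "y s = q(i := q i + s)" for s
    have yp: "is_poly_fun (\<lambda>s. y s l)" for l
      unfolding y_def by (rule is_poly_fun_single_coord)
    have "\<forall>l. \<exists>w. l \<in> {1..Suc m} \<longrightarrow> is_poly_fun w \<and> (\<forall>s. \<Psi> (y s) l = p l + s * w s)"
    proof (intro allI, goal_cases)
      case (1 l)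
      show ?case
      proof (cases "l \<in> {1..Suc m}")
        case l: True
        show ?thesis
          using is_poly_fun_split_const[OF PF_along[where \<gamma> = y, OF \<Psi>(1)[OF l] yp]] \<Psi>q[OF l] by (auto simp: y_def)
      qed auto
    qed
    then obtain w where "\<forall>l. l \<in> {1..Suc m} \<longrightarrow> is_poly_fun (w l) \<and> (\<forall>s. \<Psi> (y s) l = p l + s * w l s)"
      by (rule choice[THEN exE])
    then have w: "\<And>l. l \<in> {1..Suc m} \<Longrightarrow> is_poly_fun (w l)"
        "\<And>l s. l \<in> {1..Suc m} \<Longrightarrow> \<Psi> (y s) l = p l + s * w l s"
      by blast+
    define B where "B s = (\<Prod>l\<in>{1..m} - {j}. (\<Psi> (y s) l) ^ k l) * (s ^ (k j - 2) * w j s ^ k j)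
      - s ^ (e - 2) * w (Suc m) s ^ e * poly Q (\<Psi> (y s) (Suc m))" for s
    have \<Psi>y: "is_poly_fun (\<lambda>s. \<Psi> (y s) l)" if "l \<in> {1..Suc m}" for l
      by (rule PF_along[where \<gamma> = y, OF \<Psi>(1)[OF that] yp])
    have "is_poly_fun B" unfolding B_def
      using j(1) by (intro is_poly_fun_mult is_poly_fun_power is_poly_fun_diff is_poly_fun_prod
          is_poly_fun_compose w(1) \<Psi>y is_poly_fun_id) auto
    moreover have "F (y s) * H' (y s) = s ^ 2 * B s" for s
    proof -
      have "(\<Prod>l\<in>{1..m}. (\<Psi> (y s) l) ^ k l) = (\<Prod>l\<in>{1..m} - {j}. (\<Psi> (y s) l) ^ k l) * (s * w j s) ^ k j"
        using j by (subst prod.remove[of _ j]) (auto simp: w(2) mult.commute)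
      also have "(s * w j s) ^ k j = s ^ 2 * (s ^ (k j - 2) * w j s ^ k j)"
        using sq[OF k_ge_2[OF j(1)], of s] by (simp only: power_mult_distrib mult.assoc)
      finally have 1: "(\<Prod>l\<in>{1..m}. (\<Psi> (y s) l) ^ k l) =
        s ^ 2 * ((\<Prod>l\<in>{1..m} - {j}. (\<Psi> (y s) l) ^ k l) * (s ^ (k j - 2) * w j s ^ k j))"
        by (simp add: mult_ac)
      have "\<Psi> (y s) (Suc m) = a + s * w (Suc m) s" by (simp add: w(2) a_def)
      then have "poly P (\<Psi> (y s) (Suc m)) = (s * w (Suc m) s) ^ e * poly Q (\<Psi> (y s) (Suc m))"
        using Pz by metis
      also have "(s * w (Suc m) s) ^ e = s ^ 2 * (s ^ (e - 2) * w (Suc m) s ^ e)"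
        using sq[OF e, of s] by (simp only: power_mult_distrib mult.assoc)
      finally have "F (\<Psi> (y s)) = s ^ 2 * B s"
        using 1 by (simp add: F_def B_def algebra_simps)
      then show ?thesis by (simp add: H'(2))
    qed
    moreover have "H' (y 0) \<noteq> 0" using unit by (simp add: y_def)
    ultimately show ?thesis
      using is_poly_fun_cancel_square[OF PF_along[where \<gamma> = y, OF F_PF yp] PF_along[where \<gamma> = y, OF H'(1) yp], of B] by (simp add: y_def)
  qed

  have double: "poly (pderiv f) 0 = 0" if "\<And>s. poly f s + c = F (q(i := q i + s))" for f c i
  proof -
    obtain C where C: "(\<lambda>s. F (q(i := q i + s))) = poly ([:0, 0, 1:] * C)" using second_order by blast
    have "poly (f + [:c:]) s = poly ([:0, 0, 1:] * C) s" for s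
      using that[of s] fun_cong[OF C, of s] by simp
    then have "f + [:c:] = [:0, 0, 1:] * C" by (metis poly_eq_poly_eq_iff ext)
    then have "pderiv (f + [:c:]) = pderiv ([:0, 0, 1:] * C)" by simp
    then show ?thesis by (simp add: pderiv_add pderiv_mult pderiv_pCons)
  qed
  \<comment> \<open>The partial derivatives of \<open>F\<close> with respect to \<open>z\<close> and to \<open>y\<^sub>1\<close> vanish at \<open>q\<close>.\<close>
  have "poly (pderiv P) (q (Suc m)) = 0"
  proof -
    let ?f = "- (P \<circ>\<^sub>p [:q (Suc m), 1:])"
    have "poly ?f s + (\<Prod>i\<in>{1..m}. q i ^ k i) = F (q(Suc m := q (Suc m) + s))" for s
      by (simp add: F_def poly_pcompose)
    from double[OF this] show ?thesis
      by (simp add: pderiv_minus pderiv_pcompose pderiv_pCons poly_pcompose)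
  qed
  moreover have "q \<in> D"
  proof (rule ccontr)
    assume "q \<notin> D"
    then have nz: "q i \<noteq> 0" if "i \<in> {1..m}" for i using that qY by (auto simp: D_def)
    have one: "1 \<in> {1..m}" using m_pos by simp
    define c where "c = (\<Prod>i\<in>{1..m} - {1}. q i ^ k i)"
    have c: "c \<noteq> 0" unfolding c_def using nz by auto
    let ?f = "smult c ([:q 1, 1:] ^ k 1)"
    have "poly ?f s + - poly P (q (Suc m)) = F (q(1 := q 1 + s))" for s
    proof -
      have "(\<Prod>i\<in>{1..m}. (q(1 := q 1 + s)) i ^ k i) = (q 1 + s) ^ k 1 * (\<Prod>i\<in>{1..m} - {1}. (q(1 := q 1 + s)) i ^ k i)"
        using one by (subst prod.remove[of _ 1]) auto
      also have "(\<Prod>i\<in>{1..m} - {1}. (q(1 := q 1 + s)) i ^ k i) = c"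
        unfolding c_def by (rule prod.cong) auto
      finally show ?thesis using m_pos by (simp add: F_def poly_power mult.commute)
    qed
    from double[OF this] have "c * (of_nat (k 1) * q 1 ^ (k 1 - 1)) = 0"
      by (simp add: pderiv_smult pderiv_power poly_power pderiv_pCons)
    then show False using c nz[OF one] k_ge_2[OF one] by auto
  qed
  ultimately show ?thesis by (simp add: Sing_def q_def)
qed

end

section \<open>Automorphisms permute the components of the boundary\<close>

context suspension_variety
begin

text \<open>
  A nonconstant polynomial curve in \<open>Y\<close> that avoids the singular locus lies over a single root of \<open>P\<close>.
  If its last coordinate \<open>h\<close> were not constant, it would take every value, hence \<open>P\<close> would have simple roots
  only; but over each of these roots \<open>h\<close> is ramified, because all \<open>k\<^sub>i\<close> are at least two.
\<close>

lemma regular_line_in_D: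
  assumes poly: "\<And>i. i \<in> {1..Suc m} \<Longrightarrow> is_poly_fun (\<lambda>s. \<gamma> s i)"
    and Y: "\<And>s. \<gamma> s \<in> Y" and reg: "\<And>s. \<gamma> s \<notin> Sing" and nonconst: "\<gamma> s0 \<noteq> \<gamma> s1"
  shows "\<gamma> s \<in> D"
proof -
  obtain h where h: "\<And>s. \<gamma> s (Suc m) = poly h s"
    using poly[of "Suc m"] by (auto simp: is_poly_fun_def)
  have "\<forall>i. \<exists>c. i \<in> {1..m} \<longrightarrow> (\<forall>s. \<gamma> s i = poly c s)"
    using poly by (auto simp: is_poly_fun_def)
  then obtain c where "\<forall>i. i \<in> {1..m} \<longrightarrow> (\<forall>s. \<gamma> s i = poly (c i) s)"
    by (rule choice[THEN exE])
  then have c: "\<And>i s. i \<in> {1..m} \<Longrightarrow> \<gamma> s i = poly (c i) s" by blast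
  have eq: "(\<Prod>i\<in>{1..m}. \<gamma> s i ^ k i) = poly P (poly h s)" for s
    using Y_F[OF Y[of s]] h by (simp add: F_def)
  have inD: "\<gamma> s \<in> D" if "poly P (poly h s) = 0" for s
  proof -
    have "(\<Prod>i\<in>{1..m}. \<gamma> s i ^ k i) = 0" using that eq by metis
    then obtain i where "i \<in> {1..m}" "\<gamma> s i ^ k i = 0" by auto
    then show ?thesis using Y[of s] by (auto simp: D_def)
  qed
  have "degree h = 0"
  proof (rule ccontr)
    assume dh: "degree h \<noteq> 0"
    have simple: "poly (pderiv P) a \<noteq> 0" if a: "poly P a = 0" for a
    proof
      assume a': "poly (pderiv P) a = 0"
      have "degree (h - [:a:]) \<noteq> 0" using dh by (simp add: degree_diff_const)
      then obtain s where "poly h s = a"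
        using alg_closed_imp_poly_has_root[of "h - [:a:]"] by auto
      then have "\<gamma> s \<in> Sing" using inD[of s] a a' h by (simp add: Sing_def)
      then show False using reg by blast
    qed
    then have "card {a. poly P a = 0} \<ge> 2"
      using card_roots_if_separable[OF P_nz] deg_P by simp
    then obtain a b where ab: "a \<noteq> b" "poly P a = 0" "poly P b = 0"
      by (metis (mono_tags, lifting) card_le_Suc0_iff_eq card.infinite mem_Collect_eq not_less_eq_eq
          numeral_2_eq_2 zero_le)
    \<comment> \<open>\<open>P \<circ> h\<close> is a product of powers with exponents at least two, so its zeros are multiple, while
      \<open>P\<close> has simple roots only.\<close>
    have ram: "poly (pderiv h) s = 0" if "poly h s = a" "poly P a = 0" for s a
    proof -
      have "(\<Prod>i\<in>{1..m}. \<gamma> s i ^ k i) = 0" using that eq by metis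
      then obtain i where i: "i \<in> {1..m}" "poly (c i) s = 0" using c by auto
      have "poly (\<Prod>i\<in>{1..m}. c i ^ k i) t = poly (P \<circ>\<^sub>p h) t" for t
      proof -
        have "poly (\<Prod>i\<in>{1..m}. c i ^ k i) t = (\<Prod>i\<in>{1..m}. \<gamma> t i ^ k i)"
          unfolding poly_prod poly_power by (rule prod.cong) (simp_all add: c)
        then show ?thesis using eq by (simp add: poly_pcompose)
      qed
      then have "P \<circ>\<^sub>p h = (\<Prod>i\<in>{1..m}. c i ^ k i)" by (metis poly_eq_poly_eq_iff ext)
      also have "\<dots> = c i ^ 2 * (c i ^ (k i - 2) * (\<Prod>i\<in>{1..m} - {i}. c i ^ k i))"
      proof -
        have "c i ^ k i = c i ^ 2 * c i ^ (k i - 2)"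
          using k_ge_2[OF i(1)] by (metis le_add_diff_inverse power_add)
        moreover have "(\<Prod>i\<in>{1..m}. c i ^ k i) = c i ^ k i * (\<Prod>i\<in>{1..m} - {i}. c i ^ k i)"
          using i by (intro prod.remove) auto
        ultimately show ?thesis by (simp only: mult.assoc)
      qed
      finally have "pderiv (P \<circ>\<^sub>p h) = pderiv (c i ^ 2 * (c i ^ (k i - 2) * (\<Prod>i\<in>{1..m} - {i}. c i ^ k i)))"
        by simp
      then have "poly (pderiv (P \<circ>\<^sub>p h)) s = 0"
        using i(2) by (simp add: pderiv_mult power2_eq_square)
      then show ?thesis
        using simple[OF that(2)] that(1) by (simp add: pderiv_pcompose poly_pcompose)
    qed
    show False
      using const_if_two_totally_ramified_values[OF ab(1), of h] ram ab dh by blast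
  qed
  then obtain a where a: "h = [:a:]" by (rule degree_eq_zeroE)
  have "poly P a = 0"
  proof (rule ccontr)
    assume nz: "poly P a \<noteq> 0"
    have "\<gamma> s i \<noteq> 0" if "i \<in> {1..m}" for i s
    proof
      assume "\<gamma> s i = 0"
      then have "poly P (poly h s) = 0" using prod_eq_0_if[of i "\<gamma> s", OF that] eq[of s] by metis
      then show False using nz a by simp
    qed
    then have "\<gamma> s0 i = \<gamma> s1 i" if "i \<in> {1..m}" for i
      using nonvanishing_poly_fun_const[of "\<lambda>s. \<gamma> s i" s0 s1] poly[of i] that by auto
    then have "\<gamma> s0 = \<gamma> s1"
      using Y_eqI[OF Y Y, of s0 s1] h a by simp
    then show False using nonconst by blast
  qed
  then show ?thesis using inD[of s] a by simp
qed

lemma Y_update: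
  assumes "x \<in> D" "i \<in> {1..m}" "x i = 0" "l \<in> {1..m}" "l \<noteq> i"
  shows "x(l := c) \<in> D"
proof -
  have "F (x(l := c)) = 0"
    using prod_eq_0_if[of i "x(l := c)"] assms D_root[OF assms(1)] by (simp add: F_def)
  moreover have "x(l := c) \<in> extensional {1..Suc m}"
    using assms by (auto simp: D_def mem_Y extensional_def)
  ultimately show ?thesis using assms by (auto simp: D_def mem_Y)
qed

lemma other_index:
  assumes "m \<ge> 2" shows "\<exists>l\<in>{1..m}. l \<noteq> (i::nat)"
  using assms by (cases "i = 1") (auto intro: bexI[of _ 1] bexI[of _ 2])

text \<open>
  For \<open>m \<ge> 2\<close> a regular point of the boundary lies on a line in the boundary along which \<open>z\<close> is
  constant; the image of this line is a curve in \<open>Y\<close> that avoids the singular locus.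
\<close>

lemma D_preserved:
  assumes m: "m \<ge> 2" and \<phi>: "\<phi> \<in> G" and x: "x \<in> D"
  shows "\<phi> x \<in> D"
proof (cases "x \<in> Sing")
  case True
  then show ?thesis using Sing_preserved[OF \<phi>] by (auto simp: Sing_def)
next
  case reg: False
  obtain \<psi> where \<psi>: "\<psi> \<in> G" "\<And>x. x \<in> Y \<Longrightarrow> \<psi> (\<phi> x) = x" using G_inverse[OF \<phi>] by blast
  obtain i where i: "i \<in> {1..m}" "x i = 0" using x by (auto simp: D_def)
  obtain l where l: "l \<in> {1..m}" "l \<noteq> i" using other_index[OF m] by blast
  define \<gamma> where "\<gamma> s = x(l := x l + s)" for s
  have \<gamma>D: "\<gamma> s \<in> D" for s unfolding \<gamma>_def by (rule Y_update[OF x i l])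
  then have \<gamma>Y: "\<gamma> s \<in> Y" for s by (auto simp: D_def)
  have \<gamma>p: "is_poly_fun (\<lambda>s. \<gamma> s i)" for i unfolding \<gamma>_def by (rule is_poly_fun_single_coord)
  have "\<phi> (\<gamma> 0) \<in> D"
  proof (rule regular_line_in_D[of "\<lambda>s. \<phi> (\<gamma> s)" 0 1])
    show "is_poly_fun (\<lambda>s. \<phi> (\<gamma> s) i)" if i: "i \<in> {1..Suc m}" for i
    proof -
      obtain f where f: "f \<in> PF" "\<And>x. x \<in> Y \<Longrightarrow> \<phi> x i = f x" using G_coordinate[OF \<phi> i] by blast
      show ?thesis using PF_along[where \<gamma> = \<gamma>, OF f(1) \<gamma>p] f(2)[OF \<gamma>Y] by simp
    qed
    show "\<phi> (\<gamma> s) \<in> Y" for s by (rule G_mem[OF \<phi> \<gamma>Y])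
    show "\<phi> (\<gamma> s) \<notin> Sing" for s
    proof
      assume "\<phi> (\<gamma> s) \<in> Sing"
      then have "\<gamma> s \<in> Sing" using Sing_preserved[OF \<psi>(1)] \<psi>(2)[OF \<gamma>Y] by metis
      then show False using reg x l by (auto simp: Sing_def \<gamma>_def)
    qed
    show "\<phi> (\<gamma> 0) \<noteq> \<phi> (\<gamma> 1)"
    proof
      assume "\<phi> (\<gamma> 0) = \<phi> (\<gamma> 1)"
      then have "\<gamma> 0 = \<gamma> 1" using \<psi>(2)[OF \<gamma>Y] by metis
      then have "\<gamma> 0 l = \<gamma> 1 l" by simp
      then show False by (simp add: \<gamma>_def)
    qed
  qed
  then show ?thesis by (simp add: \<gamma>_def)
qed

definition Delta :: "nat \<Rightarrow> 'a \<Rightarrow> (nat \<Rightarrow> 'a) set"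
  where "Delta j a = {x \<in> Y. x j = 0 \<and> x (Suc m) = a}"

definition segment :: "(nat \<Rightarrow> 'a) \<Rightarrow> (nat \<Rightarrow> 'a) \<Rightarrow> 'a \<Rightarrow> nat \<Rightarrow> 'a"
  where "segment x x' s = pt (\<lambda>i. x i + s * (x' i - x i))"

lemma segment_apply: "i \<in> {1..Suc m} \<Longrightarrow> segment x x' s i = x i + s * (x' i - x i)"
  by (simp add: segment_def)

lemma segment_poly:
  assumes "f \<in> PF" shows "is_poly_fun (\<lambda>s. f (segment x x' s))"
  using polynomial_functions_line_cong[OF assms, of x "\<lambda>i. x' i - x i"]
  by (simp add: segment_def PF_pt[OF assms])

lemma Y_ext: "x \<in> Y \<Longrightarrow> pt x = x"
  by (auto simp: mem_Y pt_def extensional_restrict)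

lemma Delta_I:
  assumes "j \<in> {1..m}" "poly P a = 0" "x j = 0" "x (Suc m) = a"
  shows "pt x \<in> Delta j a"
  using assms prod_eq_0_if[of j x] by (auto simp: Delta_def pt_mem_Y F_def)

lemma Delta_D: "j \<in> {1..m} \<Longrightarrow> x \<in> Delta j a \<Longrightarrow> x \<in> D"
  by (auto simp: Delta_def D_def)

lemma Delta_segment:
  assumes "j \<in> {1..m}" "poly P a = 0" "x \<in> Delta j a" "x' \<in> Delta j a"
  shows "segment x x' s \<in> Delta j a"
  unfolding segment_def by (rule Delta_I) (use assms in \<open>auto simp: Delta_def\<close>)

lemma segment_0 [simp]: "x \<in> Y \<Longrightarrow> segment x x' 0 = x"
  and segment_1 [simp]: "x' \<in> Y \<Longrightarrow> segment x x' 1 = x'"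
  by (simp_all add: segment_def Y_ext)

text \<open>The components of the boundary are affine spaces, hence irreducible.\<close>

lemma Delta_irreducible:
  assumes j: "j \<in> {1..m}" "poly P a = 0" and "finite I" "\<And>i. i \<in> I \<Longrightarrow> f i \<in> PF"
    "\<And>i. i \<in> I \<Longrightarrow> \<exists>x\<in>Delta j a. f i x \<noteq> 0"
  shows "\<exists>x\<in>Delta j a. \<forall>i\<in>I. f i x \<noteq> 0"
  using assms(3-)
proof (induction I)
  case empty
  show ?case using Delta_I[OF j, of "\<lambda>i. if i = Suc m then a else 0"] j by auto
next
  case (insert b I)
  then obtain x x' where x: "x \<in> Delta j a" "\<forall>i\<in>I. f i x \<noteq> 0" and x': "x' \<in> Delta j a" "f b x' \<noteq> 0"
    by (metis insert_iff)
  have xY: "x \<in> Y" "x' \<in> Y" using x x' by (auto simp: Delta_def)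
  obtain p where p: "(\<lambda>s. \<Prod>i\<in>I. f i (segment x x' s)) = poly p"
    using is_poly_fun_prod[of I "\<lambda>i s. f i (segment x x' s)"] segment_poly insert.prems(1)
    by (auto elim: is_poly_funE)
  obtain q where q: "(\<lambda>s. f b (segment x x' s)) = poly q"
    using segment_poly[of "f b" x x'] insert.prems(1) by (auto elim: is_poly_funE)
  have "poly p 0 \<noteq> 0" using fun_cong[OF p, of 0] x(2) insert.hyps(1) xY by auto
  moreover have "poly q 1 \<noteq> 0" using fun_cong[OF q, of 1] x'(2) xY by auto
  ultimately have "p * q \<noteq> 0" by auto
  then obtain s where s: "poly (p * q) s \<noteq> 0" by (metis poly_all_0_iff_0)
  have "\<forall>i\<in>insert b I. f i (segment x x' s) \<noteq> 0"
    using s fun_cong[OF p, of s, symmetric] fun_cong[OF q, of s, symmetric] insert.hyps(1) by auto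
  then show ?case using Delta_segment[OF j x(1) x'(1)] by blast
qed

text \<open>
  By irreducibility one of the coordinates \<open>y\<^sub>i\<close> vanishes on the whole image of a component, and the
  last coordinate, which takes only finitely many values on the boundary, is constant on it.
\<close>

lemma Delta_image_subset:
  assumes m: "m \<ge> 2" and \<phi>: "\<phi> \<in> G" and j: "j \<in> {1..m}" "poly P a = 0"
  shows "\<exists>j'\<in>{1..m}. \<exists>a'. poly P a' = 0 \<and> \<phi> ` Delta j a \<subseteq> Delta j' a'"
proof -
  obtain \<Phi> where \<Phi>: "\<And>i. i \<in> {1..Suc m} \<Longrightarrow> (\<lambda>x. \<Phi> x i) \<in> PF"
      "\<And>i x. i \<in> {1..Suc m} \<Longrightarrow> x \<in> Y \<Longrightarrow> \<phi> x i = \<Phi> x i" using G_lift[OF \<phi>] by blast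
  have D: "\<phi> x \<in> D" if "x \<in> Delta j a" for x
    using D_preserved[OF m \<phi>] Delta_D[OF j(1) that] by blast
  have Y: "x \<in> Y" if "x \<in> Delta j a" for x using that by (simp add: Delta_def)
  have "\<exists>j'\<in>{1..m}. \<forall>x\<in>Delta j a. \<Phi> x j' = 0"
  proof (rule ccontr)
    assume "\<not> ?thesis"
    then obtain x where "x \<in> Delta j a" "\<forall>i\<in>{1..m}. \<Phi> x i \<noteq> 0"
      using Delta_irreducible[OF j, of "{1..m}" "\<lambda>i x. \<Phi> x i"] \<Phi>(1) by auto
    then show False using D[of x] \<Phi>(2)[OF _ Y] by (auto simp: D_def)
  qed
  then obtain j' where j': "j' \<in> {1..m}" "\<And>x. x \<in> Delta j a \<Longrightarrow> \<phi> x j' = 0"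
    using \<Phi>(2)[OF _ Y] by auto
  have const: "\<phi> x (Suc m) = \<phi> x' (Suc m)" if x: "x \<in> Delta j a" "x' \<in> Delta j a" for x x'
  proof -
    obtain p where p: "(\<lambda>s. \<Phi> (segment x x' s) (Suc m)) = poly p"
      using segment_poly[OF \<Phi>(1), of "Suc m" x x'] by (auto elim: is_poly_funE)
    have "poly (P \<circ>\<^sub>p p) s = 0" for s
    proof -
      have s: "segment x x' s \<in> Delta j a" by (rule Delta_segment[OF j x])
      have "poly p s = \<phi> (segment x x' s) (Suc m)"
        using fun_cong[OF p, of s, symmetric] \<Phi>(2)[OF _ Y[OF s]] by simp
      then show ?thesis using D_root[OF D[OF s]] by (simp add: poly_pcompose)
    qed
    then have "P \<circ>\<^sub>p p = 0" by (metis poly_all_0_iff_0)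
    then have "degree p = 0" using pcompose_eq_0[of P p] P_nz by auto
    then obtain c where c: "p = [:c:]" by (rule degree_eq_zeroE)
    show ?thesis
      using fun_cong[OF p, of 0] fun_cong[OF p, of 1] c x[THEN Y] by (simp add: \<Phi>(2))
  qed
  obtain x0 where x0: "x0 \<in> Delta j a" using Delta_irreducible[OF j, of "{}"] by auto
  have "\<phi> ` Delta j a \<subseteq> Delta j' (\<phi> x0 (Suc m))"
    using j'(2) const[OF _ x0] D by (auto simp: Delta_def D_def)
  then show ?thesis using j'(1) D_root[OF D[OF x0]] by blast
qed

lemma Delta_subset_eq:
  assumes "j \<in> {1..m}" "poly P a = 0" "j' \<in> {1..m}" "Delta j a \<subseteq> Delta j' a'"
  shows "j = j' \<and> a = a'"
proof -
  let ?x = "\<lambda>i. if i = Suc m then a else if i = j then 0 else 1"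
  have "pt ?x \<in> Delta j' a'" using Delta_I[OF assms(1,2), of ?x] assms by auto
  then show ?thesis using assms(3) by (auto simp: Delta_def split: if_splits)
qed

lemma Delta_image:
  assumes m: "m \<ge> 2" and \<phi>: "\<phi> \<in> G" and j: "j \<in> {1..m}" "poly P a = 0"
  shows "\<exists>j'\<in>{1..m}. \<exists>a'. poly P a' = 0 \<and> \<phi> ` Delta j a = Delta j' a'"
proof -
  obtain \<psi> where \<psi>: "\<psi> \<in> G" "\<And>x. x \<in> Y \<Longrightarrow> \<psi> (\<phi> x) = x" "\<And>x. x \<in> Y \<Longrightarrow> \<phi> (\<psi> x) = x"
    using G_inverse[OF \<phi>] by blast
  obtain j' a' where 1: "j' \<in> {1..m}" "poly P a' = 0" "\<phi> ` Delta j a \<subseteq> Delta j' a'"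
    using Delta_image_subset[OF m \<phi> j] by blast
  obtain j'' a'' where 2: "j'' \<in> {1..m}" "poly P a'' = 0" "\<psi> ` Delta j' a' \<subseteq> Delta j'' a''"
    using Delta_image_subset[OF m \<psi>(1) 1(1,2)] by blast
  have DY: "Delta i b \<subseteq> Y" for i b by (auto simp: Delta_def)
  have "Delta j a \<subseteq> Delta j'' a''"
  proof
    fix x assume x: "x \<in> Delta j a"
    then have "\<psi> (\<phi> x) \<in> Delta j'' a''" using 1(3) 2(3) by blast
    moreover have "x \<in> Y" using x DY by blast
    ultimately show "x \<in> Delta j'' a''" using \<psi>(2)[of x] by simp
  qed
  then have "j = j'' \<and> a = a''" by (rule Delta_subset_eq[OF j 2(1)])
  then have 3: "\<psi> ` Delta j' a' \<subseteq> Delta j a" using 2(3) by simp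
  have "Delta j' a' \<subseteq> \<phi> ` Delta j a"
  proof
    fix x assume x: "x \<in> Delta j' a'"
    then have "\<psi> x \<in> Delta j a" "x = \<phi> (\<psi> x)" using 3 \<psi>(3)[of x] DY[of j' a'] by auto
    then show "x \<in> \<phi> ` Delta j a" by blast
  qed
  then show ?thesis using 1 by blast
qed

text \<open>
  All components over the same root \<open>a\<close> contain the point \<open>y = 0\<close>, \<open>z = a\<close>. Hence their images lie over
  a common root \<open>a'\<close>.
\<close>

lemma boundary_permutation:
  assumes m: "m \<ge> 2" and \<phi>: "\<phi> \<in> G" and a: "poly P a = 0"
  shows "\<exists>\<tau> a'. \<tau> permutes {1..m} \<and> poly P a' = 0 \<and> (\<forall>i\<in>{1..m}. \<phi> ` Delta (\<tau> i) a = Delta i a')"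
proof -
  have "\<forall>l. \<exists>j' a'. l \<in> {1..m} \<longrightarrow> j' \<in> {1..m} \<and> poly P a' = 0 \<and> \<phi> ` Delta l a = Delta j' a'"
    using Delta_image[OF m \<phi> _ a] by blast
  then obtain lam \<alpha> where lam: "\<And>l. l \<in> {1..m} \<Longrightarrow> lam l \<in> {1..m}"
      "\<And>l. l \<in> {1..m} \<Longrightarrow> poly P (\<alpha> l) = 0" "\<And>l. l \<in> {1..m} \<Longrightarrow> \<phi> ` Delta l a = Delta (lam l) (\<alpha> l)"
    by metis
  let ?o = "pt (\<lambda>i. if i = Suc m then a else 0)"
  have \<alpha>: "\<alpha> l = \<phi> ?o (Suc m)" if "l \<in> {1..m}" for l
  proof -
    have "?o \<in> Delta l a" using that by (intro Delta_I a) auto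
    then have "\<phi> ?o \<in> Delta (lam l) (\<alpha> l)" using lam(3)[OF that] by blast
    then show ?thesis by (simp add: Delta_def)
  qed
  have inj: "inj_on lam {1..m}"
  proof (rule inj_onI)
    fix l l' assume l: "l \<in> {1..m}" "l' \<in> {1..m}" "lam l = lam l'"
    then have eq: "\<phi> ` Delta l a = \<phi> ` Delta l' a" using lam(3) \<alpha> by simp
    have "inj_on \<phi> Y" using G_Bij[OF \<phi>] by (auto simp: Bij_def bij_betw_def)
    then have "Delta l a = Delta l' a"
      using eq by (subst (asm) inj_on_image_eq_iff[of _ Y]) (auto simp: Delta_def)
    then show "l = l'" using Delta_subset_eq[OF l(1) a l(2), of a] by simp
  qed
  define \<rho> where "\<rho> l = (if l \<in> {1..m} then lam l else l)" for l
  have "lam ` {1..m} = {1..m}"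
    by (rule endo_inj_surj[OF _ _ inj]) (use lam(1) in auto)
  then have "bij_betw lam {1..m} {1..m}" using inj by (simp add: bij_betw_def)
  then have "bij_betw \<rho> {1..m} {1..m}"
    by (rule bij_betw_cong[THEN iffD1, rotated]) (simp add: \<rho>_def)
  then have \<rho>: "\<rho> permutes {1..m}" by (rule bij_imp_permutes) (auto simp: \<rho>_def)
  have "\<phi> ` Delta (inv' \<rho> i) a = Delta i (\<phi> ?o (Suc m))" if i: "i \<in> {1..m}" for i
  proof -
    have l: "inv' \<rho> i \<in> {1..m}" using permutes_in_image[OF permutes_inv[OF \<rho>]] i by blast
    have "lam (inv' \<rho> i) = \<rho> (inv' \<rho> i)" unfolding \<rho>_def[of "inv' \<rho> i"] using l by simp
    then have "lam (inv' \<rho> i) = i" using permutes_inverses(1)[OF \<rho>] by simp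
    then show ?thesis using lam(3)[OF l] \<alpha>[OF l] by simp
  qed
  moreover have "poly P (\<phi> ?o (Suc m)) = 0" using lam(2)[of 1] \<alpha>[of 1] m_pos by simp
  ultimately show ?thesis using permutes_inv[OF \<rho>] by blast
qed

text \<open>
  On \<open>Delta j a\<close> the function \<open>y\<^sub>i \<circ> \<phi>\<close> vanishes exactly where \<open>y\<^sub>l\<close> does. So it has no zeros on lines on
  which \<open>y\<^sub>l\<close> is a nonzero constant, hence is constant there, and depends on \<open>y\<^sub>l\<close> only. As a polynomial
  in \<open>y\<^sub>l\<close> it has no zero other than \<open>0\<close>.
\<close>

lemma boundary_coordinate_monomial:
  assumes \<phi>: "\<phi> \<in> G" and idx: "j \<in> {1..m}" "l \<in> {1..m}" "j \<noteq> l" "i \<in> {1..m}" and a: "poly P a = 0"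
    and img: "\<phi> ` Delta j a = Delta j' a'" "\<phi> ` Delta l a = Delta i a'"
  shows "\<exists>c n. c \<noteq> 0 \<and> n \<ge> 1 \<and> (\<forall>x\<in>Delta j a. \<phi> x i = c * x l ^ n)"
proof -
  obtain f where f: "f \<in> PF" "\<And>x. x \<in> Y \<Longrightarrow> \<phi> x i = f x" using G_coordinate[OF \<phi>, of i] idx by auto
  have DY: "x \<in> Y" if "x \<in> Delta n b" for x n b using that by (simp add: Delta_def)
  have zero: "\<phi> x i = 0 \<longleftrightarrow> x l = 0" if x: "x \<in> Delta j a" for x
  proof
    assume "\<phi> x i = 0"
    moreover have "\<phi> x \<in> Delta j' a'" using img(1) x by blast
    ultimately have "\<phi> x \<in> Delta i a'" by (auto simp: Delta_def)
    then obtain x' where x': "x' \<in> Delta l a" "\<phi> x = \<phi> x'" using img(2) by (metis imageE)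
    then have "x = x'" using Bij_inj[OF G_Bij[OF \<phi>] DY[OF x] DY[OF x'(1)]] by blast
    then show "x l = 0" using x' by (simp add: Delta_def)
  next
    assume "x l = 0"
    then have "x \<in> Delta l a" using x by (auto simp: Delta_def)
    then have "\<phi> x \<in> Delta i a'" using img(2) by blast
    then show "\<phi> x i = 0" by (simp add: Delta_def)
  qed
  have const: "\<phi> x i = \<phi> x' i" if x: "x \<in> Delta j a" "x' \<in> Delta j a" "x l = x' l" for x x'
  proof (cases "x l = 0")
    case True
    then show ?thesis using zero[OF x(1)] zero[OF x(2)] x(3) by simp
  next
    case False
    have "f (segment x x' 0) = f (segment x x' 1)"
    proof (rule nonvanishing_poly_fun_const[OF segment_poly[OF f(1)]])
      fix s
      have s: "segment x x' s \<in> Delta j a" by (rule Delta_segment[OF idx(1) a x(1,2)])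
      have "segment x x' s l \<noteq> 0" using False x(3) idx by (simp add: segment_apply)
      then show "f (segment x x' s) \<noteq> 0" using zero[OF s] f(2)[OF DY[OF s]] by simp
    qed
    then show ?thesis using DY[OF x(1)] DY[OF x(2)] f(2) by simp
  qed
  define B where "B s = pt (\<lambda>r. if r = Suc m then a else if r = j then 0 else if r = l then s else 1)" for s
  have B: "B s \<in> Delta j a" "B s l = s" for s
    unfolding B_def by (rule Delta_I) (use idx a in auto)
  have Bp: "is_poly_fun (\<lambda>s. B s r)" if "r \<in> {1..Suc m}" for r
    using that by (cases "r = Suc m"; cases "r = j"; cases "r = l")
      (simp_all add: B_def is_poly_fun_const is_poly_fun_id)
  obtain p where p: "\<And>s. f (B s) = poly p s"
    using PF_along[where \<gamma> = B, OF f(1) Bp] by (auto simp: is_poly_fun_def)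
  have pz: "poly p s = 0 \<longleftrightarrow> s = 0" for s
    using zero[OF B(1)] B(2) f(2)[OF DY[OF B(1)]] p by metis
  then obtain c where c: "c \<noteq> 0" "p = monom c (degree p)"
    using poly_only_root_0[of p] by blast
  then have pc: "poly p s = c * s ^ degree p" for s by (metis poly_monom)
  have "degree p \<ge> 1"
    using pz[of 0] pc[of 0] c(1) by (cases "degree p") auto
  moreover have "\<phi> x i = c * x l ^ degree p" if x: "x \<in> Delta j a" for x
    using const[OF x B(1)[of "x l"]] B(2) f(2)[OF DY[OF B(1)]] p pc by simp
  ultimately show ?thesis using c(1) by blast
qed

text \<open>The exponent is one because the inverse automorphism is described by a monomial as well.\<close>

lemma boundary_coordinate_linear:
  assumes \<phi>: "\<phi> \<in> G" and idx: "j \<in> {1..m}" "l \<in> {1..m}" "j \<noteq> l" "i \<in> {1..m}" "j' \<in> {1..m}" "i \<noteq> j'"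
    and a: "poly P a = 0" "poly P a' = 0"
    and img: "\<phi> ` Delta j a = Delta j' a'" "\<phi> ` Delta l a = Delta i a'"
  shows "\<exists>c. c \<noteq> 0 \<and> (\<forall>x\<in>Delta j a. \<phi> x i = c * x l)"
proof -
  obtain \<psi> where \<psi>: "\<psi> \<in> G" "\<And>x. x \<in> Y \<Longrightarrow> \<psi> (\<phi> x) = x" "\<And>x. x \<in> Y \<Longrightarrow> \<phi> (\<psi> x) = x"
    using G_inverse[OF \<phi>] by blast
  have DY: "Delta n b \<subseteq> Y" for n b by (auto simp: Delta_def)
  have inv_img: "\<psi> ` Delta n a'' = Delta n' b" if "\<phi> ` Delta n' b = Delta n a''" for n n' a'' b
  proof -
    have "\<psi> ` \<phi> ` Delta n' b = Delta n' b"
      unfolding image_image using \<psi>(2) DY[of n' b] by (force simp: image_iff)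
    then show ?thesis using that by simp
  qed
  obtain c n where c: "c \<noteq> 0" "n \<ge> 1" "\<And>x. x \<in> Delta j a \<Longrightarrow> \<phi> x i = c * x l ^ n"
    using boundary_coordinate_monomial[OF \<phi> idx(1-4) a(1) img] by blast
  obtain c' n' where c': "\<And>x. x \<in> Delta j' a' \<Longrightarrow> \<psi> x l = c' * x i ^ n'"
    using boundary_coordinate_monomial[OF \<psi>(1) idx(5) idx(4) _ idx(2) a(2) inv_img[OF img(1)] inv_img[OF img(2)]]
      idx(6) by blast
  \<comment> \<open>Comparing the values at \<open>1\<close> and \<open>2\<close> gives \<open>2\<^bsup>n n'\<^esup> = 2\<close>, hence \<open>n n' = 1\<close> in characteristic zero.\<close>
  have eq: "c' * (c * s ^ n) ^ n' = s" for s
  proof -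
    define x where "x = pt (\<lambda>r. if r = Suc m then a else if r = j then 0 else if r = l then s else 1)"
    have x: "x \<in> Delta j a" "x l = s"
      unfolding x_def by (rule Delta_I) (use idx a in auto)
    have "\<phi> x \<in> Delta j' a'" using img(1) x(1) by blast
    moreover have "\<psi> (\<phi> x) = x" using \<psi>(2) DY x(1) by blast
    ultimately show ?thesis using c'[of "\<phi> x"] c(3)[OF x(1)] x(2) by simp
  qed
  have "c' * c ^ n' = 1" using eq[of 1] by simp
  moreover have "c' * c ^ n' * 2 ^ (n * n') = 2"
    using eq[of 2] by (simp add: power_mult_distrib power_mult mult.assoc)
  ultimately have "(2::'a) ^ (n * n') = 2" by simp
  then have "of_nat (2 ^ (n * n')) = (of_nat (2 ^ 1) :: 'a)" by simp
  then have "(2::nat) ^ (n * n') = 2 ^ 1" by (rule of_nat_eq_iff[THEN iffD1])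
  then have "n * n' = 1" by (subst (asm) power_inject_exp) auto
  then show ?thesis using c by auto
qed

end

section \<open>Curves of the form w^g = R(z)\<close>

text \<open>
  Polynomials in two variables \<open>z\<close> and \<open>w\<close> are written as polynomials in \<open>w\<close> over the polynomials in \<open>z\<close>.
\<close>

definition bev :: "'a::comm_ring_1 poly poly \<Rightarrow> 'a \<Rightarrow> 'a \<Rightarrow> 'a"
  where "bev B z w = poly (poly B [:w:]) z"

lemma bev_simps [simp]:
  "bev 0 z w = 0" "bev 1 z w = 1" "bev (A + B) z w = bev A z w + bev B z w"
  "bev (A - B) z w = bev A z w - bev B z w" "bev (A * B) z w = bev A z w * bev B z w"
  "bev [:p:] z w = poly p z" "bev (smult p B) z w = poly p z * bev B z w"
  "bev (monom p n) z w = poly p z * w ^ n" "bev (A ^ n) z w = bev A z w ^ n"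
  by (simp_all add: bev_def poly_monom poly_power)

lemma bev_pCons [simp]: "bev (pCons p B) z w = poly p z + w * bev B z w"
  by (simp add: bev_def)

lemma bev_sum: "bev (\<Sum>i\<in>I. f i) z w = (\<Sum>i\<in>I. bev (f i) z w)"
  by (induction I rule: infinite_finite_induct) simp_all

lemma bev_specialise: "bev B z w = poly (map_poly (\<lambda>p. poly p z) B) w"
  by (induction B) (simp_all add: map_poly_pCons)

lemma bev_altdef:
  assumes "degree B < g"
  shows "bev B z w = (\<Sum>j<g. poly (coeff B j) z * w ^ j)"
proof -
  have "B = (\<Sum>j<g. monom (coeff B j) j)"
  proof (rule poly_eqI)
    fix n show "coeff B n = coeff (\<Sum>j<g. monom (coeff B j) j) n"
      using assms by (simp add: coeff_sum coeff_eq_0)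
  qed
  then have "bev B z w = bev (\<Sum>j<g. monom (coeff B j) j) z w" by simp
  then show ?thesis by (simp add: bev_sum)
qed

definition is_bipoly_fun :: "('a::comm_ring_1 \<times> 'a \<Rightarrow> 'a) \<Rightarrow> bool"
  where "is_bipoly_fun f \<longleftrightarrow> (\<exists>B. \<forall>p. f p = bev B (fst p) (snd p))"

lemma is_bipoly_fun_const: "is_bipoly_fun (\<lambda>p. c)"
  unfolding is_bipoly_fun_def by (rule exI[of _ "[:[:c:]:]"]) simp

lemma is_bipoly_fun_fst: "is_bipoly_fun fst"
  unfolding is_bipoly_fun_def by (rule exI[of _ "[:[:0, 1:]:]"]) simp

lemma is_bipoly_fun_snd: "is_bipoly_fun snd"
  unfolding is_bipoly_fun_def by (rule exI[of _ "[:0, 1:]"]) simp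

lemma is_bipoly_fun_add: "is_bipoly_fun f \<Longrightarrow> is_bipoly_fun g \<Longrightarrow> is_bipoly_fun (\<lambda>p. f p + g p)"
  unfolding is_bipoly_fun_def by (metis bev_simps(3))

lemma is_bipoly_fun_diff: "is_bipoly_fun f \<Longrightarrow> is_bipoly_fun g \<Longrightarrow> is_bipoly_fun (\<lambda>p. f p - g p)"
  unfolding is_bipoly_fun_def by (metis bev_simps(4))

lemma is_bipoly_fun_mult: "is_bipoly_fun f \<Longrightarrow> is_bipoly_fun g \<Longrightarrow> is_bipoly_fun (\<lambda>p. f p * g p)"
  unfolding is_bipoly_fun_def by (metis bev_simps(5))

lemma is_bipoly_fun_prod:
  "(\<And>i. i \<in> I \<Longrightarrow> is_bipoly_fun (f i)) \<Longrightarrow> is_bipoly_fun (\<lambda>p. \<Prod>i\<in>I. f i p)"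
  by (induction I rule: infinite_finite_induct) (auto intro: is_bipoly_fun_const is_bipoly_fun_mult)

lemma polynomial_functions_bipoly:
  assumes "f \<in> polynomial_functions n" "\<And>i. i \<in> {1..n} \<Longrightarrow> is_bipoly_fun (\<lambda>p. \<gamma> p i)"
  shows "is_bipoly_fun (\<lambda>p. f (\<gamma> p))"
  using polynomial_functions_closure[OF assms(1), of "Collect is_bipoly_fun" \<gamma>] assms(2)
  by (auto intro: is_bipoly_fun_const is_bipoly_fun_add is_bipoly_fun_mult)

definition curve_eqn :: "nat \<Rightarrow> 'a::comm_ring_1 poly \<Rightarrow> 'a poly poly"
  where "curve_eqn g R = monom 1 g - [:R:]"

lemma bev_curve_eqn [simp]: "bev (curve_eqn g R) z w = w ^ g - poly R z"
  by (simp add: curve_eqn_def)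

lemma curve_division:
  fixes B :: "'a::idom poly poly"
  assumes "g \<ge> 1"
  shows "\<exists>q r. B = curve_eqn g R * q + r \<and> degree r < g"
proof -
  let ?D = "curve_eqn g R"
  have dm: "degree (monom (1::'a poly) g) = g" by (simp add: degree_monom_eq)
  have deg: "degree ?D = g"
    unfolding curve_eqn_def using degree_diff_const[of "monom (1::'a poly) g" R] dm assms by simp
  have "coeff ?D g = 1" using assms by (simp add: curve_eqn_def coeff_pCons split: nat.splits)
  then have lc: "lead_coeff ?D = 1" by (simp add: deg)
  then have nz: "?D \<noteq> 0" by auto
  obtain q r where qr: "pseudo_divmod B ?D = (q, r)" by fastforce
  show ?thesis
    using pseudo_divmod[OF nz qr] lc deg assms by (intro exI[of _ q] exI[of _ r]) auto
qed

text \<open>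
  The powers \<open>1, w, \<dots>, w\<^bsup>g-1\<^esup>\<close> are independent over the polynomials in \<open>z\<close>, even if the points
  with \<open>w = 0\<close> are left out.
\<close>

lemma curve_independent:
  fixes r :: "'a::{alg_closed_field, field_char_0} poly poly"
  assumes g: "g \<ge> 1" and R: "R \<noteq> 0" and r: "degree r < g"
    and zero: "\<And>z w. w ^ g = poly R z \<Longrightarrow> w \<noteq> 0 \<Longrightarrow> bev r z w = 0"
  shows "r = 0"
proof -
  have nz: "poly (coeff r j) z = 0" if z: "poly R z \<noteq> 0" for j z
  proof -
    let ?p = "map_poly (\<lambda>p. poly p z) r"
    have "card {w. w ^ g = poly R z} = g" using card_nth_roots[of g "poly R z"] g z by simp
    moreover have "poly ?p w = 0" if "w ^ g = poly R z" for w
    proof -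
      have "w \<noteq> 0" using that z g by (auto simp: zero_power)
      then show ?thesis using zero[OF that] by (simp add: bev_specialise)
    qed
    moreover have "degree ?p < g" using r by (metis le_less_trans map_poly_degree_leq)
    ultimately have "?p = 0"
      by (intro poly_eqI_degree[of "{w. w ^ g = poly R z}"]) auto
    then show ?thesis by (metis coeff_0 coeff_map_poly poly_0)
  qed
  have "poly (coeff r j) z = 0" for j z
    by (rule poly_fun_zero_cofinite[OF is_poly_fun_poly poly_roots_finite[OF R]]) (use nz in simp)
  then have "coeff r j = 0" for j
    by (simp add: poly_all_0_iff_0[symmetric])
  then show ?thesis by (intro poly_eqI) simp
qed

lemma curve_ideal:
  fixes B :: "'a::{alg_closed_field, field_char_0} poly poly"
  assumes g: "g \<ge> 1" and R: "R \<noteq> 0"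
    and zero: "\<And>z w. w ^ g = poly R z \<Longrightarrow> w \<noteq> 0 \<Longrightarrow> bev B z w = 0"
  shows "\<exists>q. B = curve_eqn g R * q"
proof -
  obtain q r where qr: "B = curve_eqn g R * q + r" "degree r < g" using curve_division[OF g] by blast
  have "r = 0"
  proof (rule curve_independent[OF g R qr(2)])
    fix z w assume "w ^ g = poly R z" "w \<noteq> 0"
    then show "bev r z w = 0" using zero[of w z] by (simp add: qr(1))
  qed
  then show ?thesis using qr by auto
qed

text \<open>
  Every component of the curve passes through each point \<open>(a, 0)\<close> with \<open>R(a) = 0\<close>, so a function that
  is nonzero there is not a zero divisor. Proof: in a relation \<open>B\<^sub>1 B\<^sub>2 = 0\<close> take \<open>B\<^sub>2\<close> of degree less
  than \<open>g\<close> in \<open>w\<close>. Setting \<open>z = a\<close> turns the equation into \<open>w^g = 0\<close>, for which \<open>B\<^sub>1(a, w)\<close> is a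
  unit; so \<open>B\<^sub>2(a, w) = 0\<close> and \<open>B\<^sub>2\<close> is divisible by \<open>z - a\<close>. Dividing and repeating shows that
  \<open>B\<^sub>2\<close> is divisible by all powers of \<open>z - a\<close>.
\<close>

lemma curve_no_zero_divisor:
  fixes B1 B2 :: "'a::{alg_closed_field, field_char_0} poly poly"
  assumes g: "g \<ge> 1" and R: "R \<noteq> 0" "poly R a = 0" and B1: "bev B1 a 0 \<noteq> 0"
    and zero: "\<And>z w. w ^ g = poly R z \<Longrightarrow> w \<noteq> 0 \<Longrightarrow> bev B1 z w * bev B2 z w = 0"
    and pt: "w ^ g = poly R z" "w \<noteq> 0"
  shows "bev B2 z w = 0"
proof -
  obtain q r where qr: "B2 = curve_eqn g R * q + r" "degree r < g" using curve_division[OF g] by blast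
  have eq: "bev B2 z w = bev r z w" if "w ^ g = poly R z" for z w
    using that by (simp add: qr(1))
  let ?l = "[:-a, 1:]"
  have "\<exists>r'. r = smult (?l ^ n) r'" for n
  proof (induction n)
    case 0
    show ?case by (rule exI[of _ r]) simp
  next
    case (Suc n)
    then obtain r' where r': "r = smult (?l ^ n) r'" by blast
    have "bev (B1 * r') z w = 0" if c: "w ^ g = poly R z" "w \<noteq> 0" for z w
    proof -
      have "z \<noteq> a" using c R(2) by auto
      moreover have "bev B1 z w * bev r z w = 0" using zero[OF c] eq[OF c(1)] by simp
      ultimately show ?thesis by (auto simp: r' poly_power)
    qed
    then obtain q' where q': "B1 * r' = curve_eqn g R * q'" using curve_ideal[OF g R(1)] by blast
    let ?e = "map_poly (\<lambda>p. poly p a)"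
    have "poly (?e B1 * ?e r') w = poly (monom 1 g * ?e q') w" for w
    proof -
      have "bev (B1 * r') a w = bev (curve_eqn g R * q') a w" using q' by simp
      then have "bev B1 a w * bev r' a w = w ^ g * bev q' a w" using R(2) by simp
      then show ?thesis by (simp add: bev_specialise[symmetric] poly_monom)
    qed
    then have pe: "?e B1 * ?e r' = monom 1 g * ?e q'" by (metis poly_eq_poly_eq_iff ext)
    have e0: "poly (?e B1) 0 \<noteq> 0" using B1 by (simp add: bev_specialise)
    have "?e r' = 0"
    proof (rule ccontr)
      assume nz: "?e r' \<noteq> 0"
      have prod: "?e B1 * ?e r' \<noteq> 0" using nz e0 by auto
      have "degree (?e r') \<le> degree r'" by (rule map_poly_degree_leq)
      also have "degree r' = degree r" by (simp add: r')
      finally have "degree (?e r') < g" using qr(2) by simp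
      moreover have "monom 1 g dvd ?e B1 * ?e r'" using pe by simp
      then have "g \<le> Polynomial.order 0 (?e B1 * ?e r')" using prod by (simp add: monom_1_dvd_iff)
      then have "g \<le> Polynomial.order 0 (?e r')" using order_mult[OF prod] order_0I[OF e0] by simp
      ultimately show False using order_degree[OF nz, of 0] by simp
    qed
    then have "?l dvd coeff r' j" for j
      by (metis coeff_0 coeff_map_poly poly_0 poly_eq_0_iff_dvd)
    then have "\<forall>j. \<exists>c. coeff r' j = ?l * c" by (metis dvdE)
    then obtain c where c: "\<And>j. coeff r' j = ?l * c j" by metis
    have cz: "c j = 0" if "degree r' < j" for j
    proof -
      have "?l * c j = 0" using c[of j] that by (metis coeff_eq_0)
      then show ?thesis by (simp only: mult_eq_0_iff) auto
    qed
    define r'' where "r'' = (\<Sum>j\<le>degree r'. monom (c j) j)"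
    have "coeff r'' j = c j" for j
      using cz[of j] by (cases "j \<le> degree r'") (auto simp: r''_def coeff_sum)
    then have "r' = smult ?l r''" using c by (intro poly_eqI) (simp only: coeff_smult)
    then have "r = smult (?l ^ Suc n) r''" using r' by (simp add: mult.commute)
    then show ?case by blast
  qed
  then have dvd: "?l ^ n dvd coeff r j" for n j
    by (metis coeff_smult dvd_triv_left)
  have "coeff r j = 0" for j
  proof (rule ccontr)
    assume nz: "coeff r j \<noteq> 0"
    then have "Suc (degree (coeff r j)) \<le> degree (coeff r j)"
      using dvd_imp_degree_le[OF dvd[of "Suc (degree (coeff r j))" j] nz] by (simp add: degree_power_eq del: power_Suc)
    then show False by simp
  qed
  then have "r = 0" by (intro poly_eqI) simp
  then show ?thesis using eq[OF pt(1)] by simp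
qed

section \<open>Laurent polynomials\<close>

lemma laurent_to_poly:
  fixes L :: "('a::field \<times> int) list"
  shows "\<exists>N p. (\<forall>t. t \<noteq> 0 \<longrightarrow> (\<Sum>(c, n)\<leftarrow>L. c * t powi n) * t ^ N = poly p t) \<and>
    (\<forall>e. coeff p e = (\<Sum>(c, n)\<leftarrow>L. if n + int N = int e then c else 0))"
proof -
  obtain N where N: "\<And>c n. (c, n) \<in> set L \<Longrightarrow> - n \<le> int N"
  proof -
    have "finite ((\<lambda>(c, n). nat (- n)) ` set L)" by simp
    then obtain N where "\<forall>x\<in>(\<lambda>(c, n). nat (- n)) ` set L. x \<le> N"
      using finite_nat_set_iff_bounded_le by blast
    then show ?thesis using that[of N] by fastforce
  qed
  define p where "p = (\<Sum>(c, n)\<leftarrow>L. monom c (nat (n + int N)))"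
  have "(\<Sum>(c, n)\<leftarrow>M. c * t powi n) * t ^ N = poly (\<Sum>(c, n)\<leftarrow>M. monom c (nat (n + int N))) t"
    if "t \<noteq> 0" "set M \<subseteq> set L" for t M
    using that(2)
  proof (induction M)
    case (Cons x M)
    obtain c n where x: "x = (c, n)" by fastforce
    have "n + int N \<ge> 0" using N[of c n] Cons.prems x by simp
    then have "t powi n * t ^ N = t ^ nat (n + int N)"
      using that(1) by (metis int_nat_eq power_int_add power_int_of_nat)
    then show ?case using Cons by (simp add: x poly_monom algebra_simps)
  qed simp
  moreover have "coeff (\<Sum>(c, n)\<leftarrow>M. monom c (nat (n + int N))) e
      = (\<Sum>(c, n)\<leftarrow>M. if n + int N = int e then c else 0)" if "set M \<subseteq> set L" for M e
    using that
  proof (induction M)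
    case (Cons x M)
    obtain c n where x: "x = (c, n)" by fastforce
    have "n + int N \<ge> 0" using N[of c n] Cons.prems x by simp
    then show ?case using Cons by (auto simp: x)
  qed simp
  ultimately show ?thesis unfolding p_def by blast
qed

lemma laurent_constant_term:
  fixes L :: "('a::field_char_0 \<times> int) list"
  assumes "\<And>t. t \<noteq> 0 \<Longrightarrow> (\<Sum>(c, n)\<leftarrow>L. c * t powi n) = b"
  shows "(\<Sum>(c, n)\<leftarrow>L. if n = 0 then c else 0) = b"
proof -
  obtain N p where p: "\<And>t. t \<noteq> 0 \<Longrightarrow> (\<Sum>(c, n)\<leftarrow>L. c * t powi n) * t ^ N = poly p t"
    "\<And>e. coeff p e = (\<Sum>(c, n)\<leftarrow>L. if n + int N = int e then c else 0)"
    using laurent_to_poly[of L] by blast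
  have "poly (p - monom b N) t = 0" for t
  proof (rule poly_fun_zero_cofinite[OF is_poly_fun_poly, of "{0}"])
    fix s :: 'a assume "s \<notin> {0}"
    then show "poly (p - monom b N) s = 0" using p(1)[of s] assms[of s] by (simp add: poly_monom)
  qed simp
  then have "p = monom b N" by (metis eq_iff_diff_eq_0 poly_all_0_iff_0)
  then have "coeff p N = b" by simp
  then show ?thesis using p(2)[of N] by simp
qed

lemma sum_list_nonzeroE:
  assumes "(\<Sum>(c, n)\<leftarrow>L. if Q n then c else 0) \<noteq> (0::'a::comm_monoid_add)"
  shows "\<exists>n\<in>snd ` set L. Q n"
  using assms by (induction L) (auto split: if_splits)

text \<open>
  A Laurent polynomial without zeros on the punctured line is a unit.
\<close>

lemma nonvanishing_laurent_monomial:
  fixes L :: "('a::{alg_closed_field, field_char_0} \<times> int) list"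
  assumes "\<And>t. t \<noteq> 0 \<Longrightarrow> (\<Sum>(c, n)\<leftarrow>L. c * t powi n) \<noteq> 0"
  shows "\<exists>c. \<exists>n\<in>snd ` set L. c \<noteq> 0 \<and> (\<forall>t. t \<noteq> 0 \<longrightarrow> (\<Sum>(c, n)\<leftarrow>L. c * t powi n) = c * t powi n)"
proof -
  obtain N p where p: "\<And>t. t \<noteq> 0 \<Longrightarrow> (\<Sum>(c, n)\<leftarrow>L. c * t powi n) * t ^ N = poly p t"
    "\<And>e. coeff p e = (\<Sum>(c, n)\<leftarrow>L. if n + int N = int e then c else 0)"
    using laurent_to_poly[of L] by blast
  have "poly p t \<noteq> 0" if "t \<noteq> 0" for t using p(1)[OF that] assms[OF that] that by (metis mult_eq_0_iff power_not_zero)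
  then obtain c where c: "c \<noteq> 0" "p = monom c (degree p)" using poly_only_root_0 by blast
  define e where "e = degree p"
  have "coeff p e \<noteq> 0" using c by (metis coeff_monom e_def)
  then obtain n where n: "n \<in> snd ` set L" "n + int N = int e"
    using sum_list_nonzeroE[of "\<lambda>n. n + int N = int e" L] p(2)[of e] by auto
  have "(\<Sum>(c, n)\<leftarrow>L. c * t powi n) = c * t powi n" if t: "t \<noteq> 0" for t
  proof -
    have "(\<Sum>(c, n)\<leftarrow>L. c * t powi n) * t ^ N = c * t ^ e" using p(1)[OF t] c(2) by (metis e_def poly_monom)
    also have "t ^ e = t powi n * t ^ N" using n(2) t by (metis power_int_add power_int_of_nat)
    finally show ?thesis using t by (simp add: mult.assoc[symmetric])
  qed
  then show ?thesis using n c(1) by blast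
qed

section \<open>One-parameter groups of diagonal automorphisms\<close>

lemma prod_power_int:
  "(t::'a::field) \<noteq> 0 \<Longrightarrow> (\<Prod>i\<in>I. t powi f i) = t powi (\<Sum>i\<in>I. f i)"
  by (induction I rule: infinite_finite_induct) (simp_all add: power_int_add)

lemma sum_list_mult_product:
  fixes f g :: "_ \<Rightarrow> 'a::comm_ring_1"
  shows "(\<Sum>x\<leftarrow>L. f x) * (\<Sum>y\<leftarrow>M. g y) = (\<Sum>(x, y)\<leftarrow>List.product L M. f x * g y)"
  by (induction L) (simp_all add: distrib_right sum_list_const_mult o_def)

context suspension_variety
begin

text \<open>
  The last coordinate is centred at \<open>a\<close>, because the one-parameter groups below scale \<open>z - a\<close>.
\<close>

definition mon :: "'a \<Rightarrow> (nat \<Rightarrow> nat) \<Rightarrow> (nat \<Rightarrow> 'a) \<Rightarrow> 'a"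
  where "mon a B x = (\<Prod>i\<in>{1..m}. x i ^ B i) * (x (Suc m) - a) ^ B (Suc m)"

lemma mon_mult: "mon a B x * mon a B' x = mon a (\<lambda>i. B i + B' i) x"
  by (simp add: mon_def power_add prod.distrib mult_ac)

lemma monomial_expansion:
  assumes "f \<in> PF"
  shows "\<exists>L. \<forall>x. f x = (\<Sum>(c, B)\<leftarrow>L. c * mon a B x)"
  using assms
proof induction
  case (const c)
  show ?case by (rule exI[of _ "[(c, \<lambda>_. 0)]"]) (simp add: mon_def)
next
  case (coord i)
  define e where "e r = (if r = i then 1 else 0 :: nat)" for r
  show ?case
  proof (cases "i = Suc m")
    case True
    then have "mon a e x = x (Suc m) - a" for x by (simp add: mon_def e_def)
    then show ?thesis using True
      by (intro exI[of _ "[(1, e), (a, \<lambda>_. 0)]"]) (simp add: mon_def)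
  next
    case False
    then have i: "i \<in> {1..m}" using coord by auto
    have "(\<Prod>r\<in>{1..m}. x r ^ e r) = (\<Prod>r\<in>{1..m}. if r = i then x r else 1)" for x :: "nat \<Rightarrow> 'a"
      by (rule prod.cong) (simp_all add: e_def)
    then have "mon a e x = x i" for x using i False by (simp add: mon_def e_def)
    then show ?thesis by (intro exI[of _ "[(1, e)]"]) simp
  qed
next
  case (add f g)
  then obtain L M where "\<forall>x. f x = (\<Sum>(c, B)\<leftarrow>L. c * mon a B x)" "\<forall>x. g x = (\<Sum>(c, B)\<leftarrow>M. c * mon a B x)"
    by blast
  then show ?case by (intro exI[of _ "L @ M"]) simp
next
  case (mult f g)
  then obtain L M where LM: "\<forall>x. f x = (\<Sum>(c, B)\<leftarrow>L. c * mon a B x)" "\<forall>x. g x = (\<Sum>(c, B)\<leftarrow>M. c * mon a B x)"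
    by blast
  let ?N = "map (\<lambda>((c, B), (c', B')). (c * c', \<lambda>i. B i + B' i)) (List.product L M)"
  have "f x * g x = (\<Sum>(c, B)\<leftarrow>?N. c * mon a B x)" for x
  proof -
    have "f x * g x = (\<Sum>(u, v)\<leftarrow>List.product L M. (case u of (c, B) \<Rightarrow> c * mon a B x) * (case v of (c, B) \<Rightarrow> c * mon a B x))"
      using LM by (simp add: sum_list_mult_product)
    also have "\<dots> = (\<Sum>(c, B)\<leftarrow>?N. c * mon a B x)"
      unfolding map_map by (rule arg_cong[where f = sum_list], rule map_cong)
        (auto simp: mon_mult[symmetric] mult_ac)
    finally show ?thesis .
  qed
  then show ?case by blast
qed

definition wt :: "(nat \<Rightarrow> int) \<Rightarrow> (nat \<Rightarrow> nat) \<Rightarrow> int"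
  where "wt v B = (\<Sum>i\<in>{1..Suc m}. v i * int (B i))"

text \<open>
  The one-parameter group with weights \<open>v\<close>, acting on \<open>y\<^sub>1, \<dots>, y\<^sub>m\<close> and \<open>z - a\<close>.
\<close>

definition flow :: "'a \<Rightarrow> (nat \<Rightarrow> int) \<Rightarrow> 'a \<Rightarrow> (nat \<Rightarrow> 'a) \<Rightarrow> nat \<Rightarrow> 'a"
  where "flow a v t x = pt (\<lambda>i. if i = Suc m then a + t powi v (Suc m) * (x (Suc m) - a) else t powi v i * x i)"

lemma flow_apply:
  "i \<in> {1..m} \<Longrightarrow> flow a v t x i = t powi v i * x i"
  "flow a v t x (Suc m) = a + t powi v (Suc m) * (x (Suc m) - a)"
  by (auto simp: flow_def)

lemma flow_1 [simp]: "x \<in> Y \<Longrightarrow> flow a v 1 x = x"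
proof -
  assume "x \<in> Y"
  moreover have "(\<lambda>i. if i = Suc m then a + 1 powi v (Suc m) * (x (Suc m) - a) else 1 powi v i * x i) = x"
    by auto
  ultimately show ?thesis by (simp only: flow_def Y_ext)
qed

lemma mon_flow:
  assumes "t \<noteq> 0"
  shows "mon a B (flow a v t x) = t powi wt v B * mon a B x"
proof -
  have "(\<Prod>i\<in>{1..m}. flow a v t x i ^ B i) = (\<Prod>i\<in>{1..m}. t powi (v i * int (B i)) * x i ^ B i)"
    by (rule prod.cong) (simp_all add: flow_apply power_mult_distrib power_int_mult)
  also have "\<dots> = t powi (\<Sum>i\<in>{1..m}. v i * int (B i)) * (\<Prod>i\<in>{1..m}. x i ^ B i)"
    by (simp add: prod.distrib prod_power_int[OF assms])
  finally show ?thesis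
    using assms by (simp add: mon_def flow_apply wt_def power_mult_distrib power_int_add power_int_mult)
qed

lemma expansion_flow:
  assumes L: "f (flow a v t x) = (\<Sum>(c, B)\<leftarrow>L. c * mon a B (flow a v t x))" and t: "t \<noteq> 0"
  shows "f (flow a v t x) = (\<Sum>(c, n)\<leftarrow>map (\<lambda>(c, B). (c * mon a B x, wt v B)) L. c * t powi n)"
proof -
  have "(\<lambda>(c, B). c * mon a B (flow a v t x)) = (\<lambda>(c, B). c * mon a B x * t powi wt v B)"
    using t by (auto simp: mon_flow mult_ac)
  then show ?thesis using L by (simp add: o_def case_prod_unfold)
qed

text \<open>
  A function without zeros on an orbit is a single power of the parameter there. The exponent belongs to a
  finite set that does not depend on the orbit.
\<close>

lemma flow_monomial:
  assumes L: "\<And>x. f x = (\<Sum>(c, B)\<leftarrow>L. c * mon a B x)" and x: "x \<in> Y"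
    and nz: "\<And>t. t \<noteq> 0 \<Longrightarrow> f (flow a v t x) \<noteq> 0"
  shows "\<exists>n \<in> (\<lambda>(c, B). wt v B) ` set L. \<forall>t. t \<noteq> 0 \<longrightarrow> f (flow a v t x) = t powi n * f x"
proof -
  let ?M = "map (\<lambda>(c, B). (c * mon a B x, wt v B)) L"
  have "(\<Sum>(c, n)\<leftarrow>?M. c * t powi n) \<noteq> 0" if "t \<noteq> 0" for t
    using nz[OF that] expansion_flow[of f a v _ x L, OF L that] by simp
  then have "\<exists>c. \<exists>n\<in>snd ` set ?M. c \<noteq> 0 \<and>
      (\<forall>t. t \<noteq> 0 \<longrightarrow> (\<Sum>(c, n)\<leftarrow>?M. c * t powi n) = c * t powi n)"
    by (rule nonvanishing_laurent_monomial)
  then obtain c n where n: "n \<in> snd ` set ?M"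
      "\<And>t. t \<noteq> 0 \<Longrightarrow> (\<Sum>(c, n)\<leftarrow>?M. c * t powi n) = c * t powi n"
    by blast
  have *: "f (flow a v t x) = c * t powi n" if "t \<noteq> 0" for t
    using expansion_flow[of f a v _ x L, OF L that] n(2)[OF that] by simp
  have "c = f x" using *[of 1] x by simp
  then have "\<forall>t. t \<noteq> 0 \<longrightarrow> f (flow a v t x) = t powi n * f x" using * by (simp add: mult.commute)
  moreover have "n \<in> (\<lambda>(c, B). wt v B) ` set L" using n(1) by (force simp: image_iff)
  ultimately show ?thesis by (rule bexI)
qed

text \<open>
  Terms of the wrong weight cancel along an orbit on which \<open>f\<close> is homogeneous. It is enough that the
  expansion is valid on this orbit, which allows the lemma to be applied for several weights in turn.
\<close>

lemma weight_component:
  assumes L: "\<And>t. t \<noteq> 0 \<Longrightarrow> f (flow a v t x) = (\<Sum>(c, B)\<leftarrow>L. c * mon a B (flow a v t x))"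
    and hom: "\<And>t. t \<noteq> 0 \<Longrightarrow> f (flow a v t x) = t powi n * f x"
  shows "f x = (\<Sum>(c, B)\<leftarrow>filter (\<lambda>(c, B). wt v B = n) L. c * mon a B x)"
proof -
  let ?M = "map (\<lambda>(c, B). (c * mon a B x, wt v B - n)) L"
  have "(\<Sum>(c, n)\<leftarrow>?M. c * t powi n) = f x" if t: "t \<noteq> 0" for t
  proof -
    have "t powi n * (\<Sum>(c, n)\<leftarrow>?M. c * t powi n) = (\<Sum>(c, n)\<leftarrow>map (\<lambda>(c, B). (c * mon a B x, wt v B)) L. c * t powi n)"
      using t by (induction L) (auto simp: algebra_simps power_int_diff)
    also have "\<dots> = t powi n * f x" using hom[OF t] expansion_flow[of f a v t x L, OF L[OF t] t] by metis
    finally show ?thesis using t by simp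
  qed
  then have "(\<Sum>(c, n)\<leftarrow>?M. if n = 0 then c else 0) = f x" by (rule laurent_constant_term)
  moreover have "(\<Sum>(c, n)\<leftarrow>?M. if n = 0 then c else 0) = (\<Sum>(c, B)\<leftarrow>filter (\<lambda>(c, B). wt v B = n) L. c * mon a B x)"
    by (induction L) auto
  ultimately show ?thesis by simp
qed

definition flow_ok :: "'a \<Rightarrow> (nat \<Rightarrow> int) \<Rightarrow> bool"
  where "flow_ok a v \<longleftrightarrow> (\<forall>x\<in>Y. \<forall>t. t \<noteq> 0 \<longrightarrow> flow a v t x \<in> Y)"

lemma flow_off_D: "flow_ok a v \<Longrightarrow> x \<in> Y - D \<Longrightarrow> t \<noteq> 0 \<Longrightarrow> flow a v t x \<in> Y - D"
  by (auto simp: flow_ok_def D_def flow_apply)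

lemma prod_flow:
  assumes "t \<noteq> 0"
  shows "(\<Prod>i\<in>{1..m}. flow a v t x i ^ e i) = t powi (\<Sum>i\<in>{1..m}. v i * int (e i)) * (\<Prod>i\<in>{1..m}. x i ^ e i)"
proof -
  have "(\<Prod>i\<in>{1..m}. flow a v t x i ^ e i) = (\<Prod>i\<in>{1..m}. t powi (v i * int (e i)) * x i ^ e i)"
    by (rule prod.cong) (simp_all add: flow_apply power_mult_distrib power_int_mult)
  then show ?thesis by (simp add: prod.distrib prod_power_int[OF assms])
qed

lemma flow_ok_horizontal:
  assumes "v (Suc m) = 0" "(\<Sum>i\<in>{1..m}. v i * int (k i)) = 0"
  shows "flow_ok a v"
  unfolding flow_ok_def
proof (intro ballI allI impI)
  fix x and t :: 'a assume x: "x \<in> Y" and t: "t \<noteq> 0"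
  have "F (flow a v t x) = 0"
    using Y_F[OF x] unfolding F_def prod_flow[OF t] flow_apply(2) assms by simp
  then show "flow a v t x \<in> Y" unfolding flow_def F_pt by (simp add: pt_mem_Y flow_def)
qed

text \<open>
  If \<open>a\<close> is the only root, then \<open>P\<close> is homogeneous in \<open>z - a\<close>, and the flow may move \<open>z\<close> as well.
\<close>

lemma flow_ok_single_root:
  assumes P: "P = smult c ([:-a, 1:] ^ degree P)" and v: "(\<Sum>i\<in>{1..m}. v i * int (k i)) = v (Suc m) * int (degree P)"
  shows "flow_ok a v"
  unfolding flow_ok_def
proof (intro ballI allI impI)
  fix x and t :: 'a assume x: "x \<in> Y" and t: "t \<noteq> 0"
  have Pz: "poly P z = c * (z - a) ^ degree P" for z
    by (subst P) (simp add: poly_power)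
  have "F (flow a v t x) = t powi (v (Suc m) * int (degree P)) * F x"
    unfolding F_def prod_flow[OF t] flow_apply(2) v Pz
    by (simp add: power_mult_distrib power_int_mult right_diff_distrib[of _ "prod _ _"])
  then have "F (flow a v t x) = 0" using Y_F[OF x] by simp
  then show "flow a v t x \<in> Y" unfolding flow_def F_pt by (simp add: pt_mem_Y flow_def)
qed

lemma G_off_D:
  assumes m: "m \<ge> 2" and \<phi>: "\<phi> \<in> G" and x: "x \<in> Y - D"
  shows "\<phi> x \<in> Y - D"
proof -
  obtain \<psi> where \<psi>: "\<psi> \<in> G" "\<And>x. x \<in> Y \<Longrightarrow> \<psi> (\<phi> x) = x" using G_inverse[OF \<phi>] by blast
  have "\<phi> x \<notin> D" using D_preserved[OF m \<psi>(1), of "\<phi> x"] \<psi>(2)[of x] x by auto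
  then show ?thesis using G_mem[OF \<phi>] x by blast
qed

text \<open>
  The coordinate \<open>f = y\<^sub>i \<circ> \<phi>\<close> has no zeros on an orbit of the flow off the boundary, so along this orbit
  it is a single power of \<open>t\<close>, with an exponent from a finite list. On the boundary component
  \<open>Delta j a\<close> the exponent is that of \<open>y\<^bsub>\<tau> i\<^esub>\<close>. Since the factors for the other exponents do not vanish
  on this component, they are not zero divisors, and the exponent is the same everywhere.
\<close>

lemma flow_equivariant_coordinate:
  assumes m: "m \<ge> 2" and \<phi>: "\<phi> \<in> G" and a: "poly P a = 0"
    and \<tau>: "\<tau> permutes {1..m}" "poly P a' = 0" "\<And>i. i \<in> {1..m} \<Longrightarrow> \<phi> ` Delta (\<tau> i) a = Delta i a'"
    and v: "flow_ok a v" and x: "x \<in> Y - D" and t: "t \<noteq> 0" and i: "i \<in> {1..m}"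
  shows "\<phi> (flow a v t x) i = t powi v (\<tau> i) * \<phi> x i"
proof -
  obtain j' where j': "j' \<in> {1..m}" "j' \<noteq> i" using other_index[OF m] by blast
  define j l where "j = \<tau> j'" and "l = \<tau> i"
  have jl: "j \<in> {1..m}" "l \<in> {1..m}" "j \<noteq> l"
    unfolding j_def l_def using permutes_in_image[OF \<tau>(1)] j' i permutes_inj[OF \<tau>(1)]
    by (auto dest: injD)
  obtain c where c: "c \<noteq> 0" "\<And>x. x \<in> Delta j a \<Longrightarrow> \<phi> x i = c * x l"
    using boundary_coordinate_linear[OF \<phi> jl i j'(1) j'(2)[symmetric] a \<tau>(2)] \<tau>(3)[OF j'(1)] \<tau>(3)[OF i]
    unfolding j_def l_def by blast
  obtain f where f: "f \<in> PF" "\<And>x. x \<in> Y \<Longrightarrow> \<phi> x i = f x" using G_coordinate[OF \<phi>, of i] i by auto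
  obtain L where L: "\<And>x. f x = (\<Sum>(c, B)\<leftarrow>L. c * mon a B x)" using monomial_expansion[OF f(1)] by blast
  define S where "S = {n \<in> (\<lambda>(c, B). wt v B) ` set L. t powi n \<noteq> t powi v l}"
  have S: "finite S" by (simp add: S_def)
  \<comment> \<open>The plane through \<open>x\<close> in the directions of \<open>z\<close> and \<open>y\<^sub>j\<close> meets \<open>Y\<close> in a curve
    \<open>w\<^bsup>k\<^sub>j\<^esup> = R(z)\<close>, which runs into the boundary component \<open>Delta j a\<close> at \<open>(a, 0)\<close>.\<close>
  define \<xi> where "\<xi> p = x(j := snd p, Suc m := fst p)" for p :: "'a \<times> 'a"
  have \<xi>b: "is_bipoly_fun (\<lambda>p. \<xi> p r)" for r
    by (cases "r = j"; cases "r = Suc m")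
       (simp_all add: \<xi>_def is_bipoly_fun_const is_bipoly_fun_fst is_bipoly_fun_snd)
  have \<xi>t: "is_bipoly_fun (\<lambda>p. flow a v t (\<xi> p) r)" if "r \<in> {1..Suc m}" for r
  proof (cases "r = Suc m")
    case True
    have "(\<lambda>p. flow a v t (\<xi> p) r) = (\<lambda>p. a + t powi v (Suc m) * (\<xi> p (Suc m) - a))"
      using True by (simp add: flow_apply)
    then show ?thesis
      by (simp only:) (intro is_bipoly_fun_add is_bipoly_fun_mult is_bipoly_fun_diff is_bipoly_fun_const \<xi>b)
  next
    case False
    have "(\<lambda>p. flow a v t (\<xi> p) r) = (\<lambda>p. t powi v r * \<xi> p r)"
      using False that by (simp add: flow_apply)
    then show ?thesis
      by (simp only:) (intro is_bipoly_fun_mult is_bipoly_fun_const \<xi>b)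
  qed
  have fb: "is_bipoly_fun (\<lambda>p. f (\<xi> p))" "is_bipoly_fun (\<lambda>p. f (flow a v t (\<xi> p)))"
    by (rule polynomial_functions_bipoly[where \<gamma> = \<xi>, OF f(1) \<xi>b])
       (rule polynomial_functions_bipoly[where \<gamma> = "\<lambda>p. flow a v t (\<xi> p)", OF f(1) \<xi>t])
  \<comment> \<open>\<open>B1\<close> collects the exponents that differ from the expected one, \<open>B2\<close> stands for the expected
    exponent; their product vanishes on the curve.\<close>
  obtain B1 where B1: "\<And>p. (\<Prod>n\<in>S. f (flow a v t (\<xi> p)) - t powi n * f (\<xi> p)) = bev B1 (fst p) (snd p)"
    using is_bipoly_fun_prod[of S "\<lambda>n p. f (flow a v t (\<xi> p)) - t powi n * f (\<xi> p)"]
      is_bipoly_fun_diff[OF fb(2) is_bipoly_fun_mult[OF is_bipoly_fun_const fb(1)]]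
    unfolding is_bipoly_fun_def by blast
  obtain B2 where B2: "\<And>p. f (flow a v t (\<xi> p)) - t powi v l * f (\<xi> p) = bev B2 (fst p) (snd p)"
    using is_bipoly_fun_diff[OF fb(2) is_bipoly_fun_mult[OF is_bipoly_fun_const fb(1)]]
    unfolding is_bipoly_fun_def by blast
  have xY: "x \<in> Y" and xnz: "\<And>r. r \<in> {1..m} \<Longrightarrow> x r \<noteq> 0" using x by (auto simp: D_def)
  define C where "C = (\<Prod>r\<in>{1..m} - {j}. x r ^ k r)"
  have C: "C \<noteq> 0" unfolding C_def using xnz by auto
  define R where "R = smult (inverse C) P"
  have \<xi>F: "F (\<xi> p) = snd p ^ k j * C - poly P (fst p)" for p
  proof -
    have "(\<Prod>r\<in>{1..m}. \<xi> p r ^ k r) = \<xi> p j ^ k j * (\<Prod>r\<in>{1..m} - {j}. \<xi> p r ^ k r)"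
      using jl(1) by (intro prod.remove) auto
    also have "(\<Prod>r\<in>{1..m} - {j}. \<xi> p r ^ k r) = C"
      unfolding C_def by (rule prod.cong) (auto simp: \<xi>_def)
    finally show ?thesis using jl(1) by (simp add: F_def \<xi>_def)
  qed
  have \<xi>Y: "\<xi> p \<in> Y \<longleftrightarrow> F (\<xi> p) = 0" for p
    using xY jl(1) by (auto simp: mem_Y \<xi>_def extensional_def)
  have curve: "F (\<xi> (z, w)) = 0 \<longleftrightarrow> w ^ k j = poly R z" for z w
    using C by (auto simp: \<xi>F R_def field_simps)
  have off: "\<xi> (z, w) \<in> Y - D" if "w ^ k j = poly R z" "w \<noteq> 0" for z w
    using that \<xi>Y curve xnz by (auto simp: D_def \<xi>_def)
  have "bev B2 (x (Suc m)) (x j) = 0"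
  proof (rule curve_no_zero_divisor[of "k j" R a B1])
    show "k j \<ge> 1" using k_ge_2[OF jl(1)] by simp
    show "R \<noteq> 0" "poly R a = 0" using C a by (simp_all add: R_def)
    show "bev B1 a 0 \<noteq> 0"
    proof -
      let ?x = "\<xi> (a, 0)"
      have "F ?x = 0" using a k_ge_2[OF jl(1)] by (simp add: \<xi>F)
      then have x0: "?x \<in> Y" by (simp add: \<xi>Y)
      then have x1: "?x \<in> Delta j a" using jl(1) by (simp add: Delta_def \<xi>_def)
      have xt: "flow a v t ?x \<in> Y" using v x0 t by (simp add: flow_ok_def)
      then have x2: "flow a v t ?x \<in> Delta j a"
        using jl(1) by (simp add: Delta_def flow_apply) (simp add: \<xi>_def)
      have xl: "?x l \<noteq> 0" using jl xnz[OF jl(2)] by (simp add: \<xi>_def)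
      have "f (flow a v t ?x) = t powi v l * (c * ?x l)"
        using c(2)[OF x2] f(2)[OF xt] jl(2) by (simp add: flow_apply)
      moreover have "f ?x = c * ?x l" using c(2)[OF x1] f(2)[OF x0] by simp
      ultimately have "f (flow a v t ?x) - t powi n * f ?x = (t powi v l - t powi n) * (c * ?x l)" for n
        by (simp add: algebra_simps)
      then have "(\<Prod>n\<in>S. f (flow a v t ?x) - t powi n * f ?x) \<noteq> 0"
        using S c(1) xl by (auto simp: S_def)
      then show ?thesis using B1[of "(a, 0)"] by simp
    qed
    show "x j ^ k j = poly R (x (Suc m))"
    proof -
      have "\<xi> (x (Suc m), x j) = x" by (auto simp: \<xi>_def)
      then show ?thesis using curve[of "x (Suc m)" "x j"] Y_F[OF xY] by simp
    qed
    show "x j \<noteq> 0" by (rule xnz[OF jl(1)])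
    fix z w assume zw: "w ^ k j = poly R z" "w \<noteq> 0"
    let ?x = "\<xi> (z, w)"
    have x1: "?x \<in> Y - D" by (rule off[OF zw])
    have "f (flow a v s ?x) \<noteq> 0" if "s \<noteq> 0" for s
    proof -
      have "\<phi> (flow a v s ?x) \<in> Y - D" by (rule G_off_D[OF m \<phi> flow_off_D[OF v x1 that]])
      then show ?thesis using f(2)[of "flow a v s ?x"] flow_off_D[OF v x1 that] i by (auto simp: D_def)
    qed
    then obtain n where n: "n \<in> (\<lambda>(c, B). wt v B) ` set L" "f (flow a v t ?x) = t powi n * f ?x"
      using flow_monomial[OF L, of ?x v] x1 t by blast
    show "bev B1 z w * bev B2 z w = 0"
    proof (cases "n \<in> S")
      case True
      then have "(\<Prod>n\<in>S. f (flow a v t ?x) - t powi n * f ?x) = 0"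
        using S n(2) by (intro prod_zero) auto
      then show ?thesis using B1[of "(z, w)"] by simp
    next
      case False
      then have "t powi n = t powi v l" using n(1) by (simp add: S_def)
      then show ?thesis using B2[of "(z, w)"] n(2) by simp
    qed
  qed
  moreover have "\<xi> (x (Suc m), x j) = x" by (auto simp: \<xi>_def)
  ultimately have "f (flow a v t x) = t powi v l * f x" using B2[of "(x (Suc m), x j)"] by simp
  then show ?thesis using f(2) xY v t by (simp add: l_def flow_ok_def)
qed

end

section \<open>Automorphisms permute the torus weights and preserve the exponents\<close>

lemma power_int_surj:
  fixes c :: "'a::alg_closed_field"
  assumes "n \<noteq> 0" "c \<noteq> 0"
  shows "\<exists>t. t \<noteq> 0 \<and> t powi n = c"
proof (cases "n > 0")
  case True
  obtain t where t: "t ^ nat n = c" using nth_root_exists[of "nat n" c] True by auto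
  then have "t \<noteq> 0" using assms True by (auto simp: zero_power)
  moreover have "t powi n = c" using t True by (simp add: power_int_def)
  ultimately show ?thesis by blast
next
  case False
  obtain t where t: "t ^ nat (- n) = inverse c" using nth_root_exists[of "nat (- n)"] False assms by auto
  then have "t \<noteq> 0" using assms False by (auto simp: zero_power)
  moreover have "t powi n = c" using t False assms by (simp add: power_int_def power_inverse)
  ultimately show ?thesis by blast
qed

lemma power_int_2_inj: "(2::'a::field_char_0) powi n = 2 powi n' \<Longrightarrow> n = n'"
proof -
  have *: "n = 0" if "(2::'a) powi n = 1" for n
  proof -
    have "of_nat (2 ^ nat \<bar>n\<bar>) = (of_nat 1 :: 'a)"
      using that by (cases "n \<ge> 0") (auto simp: power_int_def power_inverse[symmetric] field_simps)
    then have "(2::nat) ^ nat \<bar>n\<bar> = 1" by (rule of_nat_eq_iff[THEN iffD1])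
    then show ?thesis by simp
  qed
  assume "(2::'a) powi n = 2 powi n'"
  then have "(2::'a) powi (n - n') = 1" by (simp add: power_int_diff)
  then show ?thesis using *[of "n - n'"] by simp
qed

lemma single_root_poly:
  fixes P :: "'a::alg_closed_field poly"
  assumes "P \<noteq> 0" and "\<And>b. poly P b = 0 \<Longrightarrow> b = a"
  shows "\<exists>c. P = smult c ([:-a, 1:] ^ degree P)"
proof -
  have "Polynomial.order a P = degree P"
  proof (cases "poly P a = 0")
    case True
    then have "{x. poly P x = 0} = {a}" using assms(2) by blast
    then show ?thesis using sum_order_eq_degree[OF assms(1)] by simp
  next
    case False
    then have "poly P x \<noteq> 0" for x using assms(2)[of x] by metis
    then show ?thesis using sum_order_eq_degree[OF assms(1)] by (simp add: order_0I)
  qed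
  then have "[:-a, 1:] ^ degree P dvd P" by (metis order_1)
  then obtain q where q: "P = [:-a, 1:] ^ degree P * q" by (elim dvdE)
  have "q \<noteq> 0" using q assms(1) by (metis mult_zero_right)
  then have "degree ([:-a, 1:] ^ degree P * q) = degree P + degree q"
    by (subst degree_mult_eq) (auto simp: degree_power_eq)
  then have "degree q = 0" using arg_cong[OF q, of degree] by linarith
  then obtain c where "q = [:c:]" by (rule degree_eq_zeroE)
  then have "[:-a, 1:] ^ degree P * q = smult c ([:-a, 1:] ^ degree P)" by simp
  then have "P = smult c ([:-a, 1:] ^ degree P)" using q by (rule trans[rotated])
  then show ?thesis by blast
qed

lemma proportional_with_equal_sums:
  fixes k k' :: "'i \<Rightarrow> nat"
  assumes "finite I" "sum k' I = sum k I" "sum k I > 0"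
    and cross: "\<And>p q. p \<in> I \<Longrightarrow> q \<in> I \<Longrightarrow> k' p * k q = k' q * k p" and p: "p \<in> I"
  shows "k' p = k p"
proof -
  have "k' p * sum k I = (\<Sum>q\<in>I. k' q * k p)"
    unfolding sum_distrib_left by (rule sum.cong) (use cross p in auto)
  also have "\<dots> = k p * sum k I" by (simp add: sum_distrib_right[symmetric] sum_distrib_left[symmetric] assms(2) mult.commute)
  finally show ?thesis using assms(3) by simp
qed

context suspension_variety
begin

lemma off_D_nonempty: "\<exists>x. x \<in> Y - D"
proof -
  have "degree (P - [:1:]) \<noteq> 0" using deg_P_nz by (simp add: degree_diff_const)
  then obtain z where z: "poly P z = 1" using alg_closed_imp_poly_has_root[of "P - [:1:]"] by auto
  let ?x = "\<lambda>i. if i = Suc m then z else 1"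
  have "F ?x = 0" using z by (simp add: F_def)
  then have "pt ?x \<in> Y - D" by (auto simp: pt_mem_Y D_def)
  then show ?thesis by blast
qed

lemma off_D_prod: "x \<in> Y - D \<Longrightarrow> (\<Prod>i\<in>{1..m}. x i ^ k i) \<noteq> 0"
  by (auto simp: D_def)

lemma off_D_P: "x \<in> Y - D \<Longrightarrow> poly P (x (Suc m)) \<noteq> 0"
  using off_D_prod[of x] Y_F[of x] by (auto simp: F_def simp del: prod_zero_iff)

lemma Y_eq: "x \<in> Y \<Longrightarrow> poly P (x (Suc m)) = (\<Prod>i\<in>{1..m}. x i ^ k i)"
  using Y_F[of x] by (simp add: F_def)

text \<open>A root of \<open>P\<close> is fixed; it is the origin of the scalings of the last coordinate.\<close>

definition base_root :: 'a where "base_root = (SOME a. poly P a = 0)"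

lemma base_root: "poly P base_root = 0"
  unfolding base_root_def using alg_closed_imp_poly_has_root[of P] deg_P by (intro someI_ex[of "\<lambda>a. poly P a = 0"]) auto

definition permutes_boundary :: "((nat \<Rightarrow> 'a) \<Rightarrow> (nat \<Rightarrow> 'a)) \<Rightarrow> (nat \<Rightarrow> nat) \<Rightarrow> bool"
  where "permutes_boundary \<phi> \<tau> \<longleftrightarrow> \<tau> permutes {1..m} \<and>
    (\<forall>v x t i. flow_ok base_root v \<longrightarrow> x \<in> Y - D \<longrightarrow> t \<noteq> 0 \<longrightarrow> i \<in> {1..m} \<longrightarrow>
      \<phi> (flow base_root v t x) i = t powi v (\<tau> i) * \<phi> x i)"

lemma permutes_boundary_exists:
  assumes "m \<ge> 2" "\<phi> \<in> G"
  shows "\<exists>\<tau>. permutes_boundary \<phi> \<tau>"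
proof -
  obtain \<tau> a' where "\<tau> permutes {1..m}" "poly P a' = 0" "\<And>i. i \<in> {1..m} \<Longrightarrow> \<phi> ` Delta (\<tau> i) base_root = Delta i a'"
    using boundary_permutation[OF assms base_root] by blast
  then show ?thesis
    unfolding permutes_boundary_def using flow_equivariant_coordinate[OF assms base_root, of \<tau> a'] by blast
qed

text \<open>
  Off the boundary \<open>P \<circ> z \<circ> \<phi>\<close> has no zeros, so \<open>z \<circ> \<phi>\<close> does not take the value \<open>b\<close>.
\<close>

lemma last_coordinate_laurent:
  assumes m: "m \<ge> 2" and \<phi>: "\<phi> \<in> G" and v: "flow_ok a v" and x: "x \<in> Y - D" and b: "poly P b = 0"
  shows "\<exists>n. \<forall>t. t \<noteq> 0 \<longrightarrow> \<phi> (flow a v t x) (Suc m) - b = t powi n * (\<phi> x (Suc m) - b)"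
proof -
  obtain f where f: "f \<in> PF" "\<And>x. x \<in> Y \<Longrightarrow> \<phi> x (Suc m) = f x" using G_coordinate[OF \<phi>, of "Suc m"] by auto
  have "(\<lambda>x. f x - b) \<in> PF" using f(1) by (intro polynomial_functions_diff polynomial_functions.const)
  then obtain L where L: "\<And>x. f x - b = (\<Sum>(c, B)\<leftarrow>L. c * mon a B x)" using monomial_expansion by meson
  have xt: "flow a v t x \<in> Y - D" if "t \<noteq> 0" for t by (rule flow_off_D[OF v x that])
  have "f (flow a v t x) - b \<noteq> 0" if "t \<noteq> 0" for t
    using off_D_P[OF G_off_D[OF m \<phi> xt[OF that]]] f(2) xt[OF that] b by auto
  then obtain n where "\<And>t. t \<noteq> 0 \<Longrightarrow> f (flow a v t x) - b = t powi n * (f x - b)"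
    using flow_monomial[OF L, of x v] x by blast
  then show ?thesis using f(2) xt x by (intro exI[of _ n]) auto
qed

lemma P_along_flow:
  assumes m: "m \<ge> 2" and \<phi>: "\<phi> \<in> G" and \<tau>: "permutes_boundary \<phi> \<tau>" and v: "flow_ok base_root v"
    and x: "x \<in> Y - D" and t: "t \<noteq> 0"
  shows "poly P (\<phi> (flow base_root v t x) (Suc m)) =
    t powi (\<Sum>i\<in>{1..m}. v i * int (k (inv' \<tau> i))) * poly P (\<phi> x (Suc m))"
proof -
  have perm: "\<tau> permutes {1..m}" using \<tau> by (simp add: permutes_boundary_def)
  have xt: "flow base_root v t x \<in> Y" using flow_off_D[OF v x t] by blast
  have "poly P (\<phi> (flow base_root v t x) (Suc m)) = (\<Prod>i\<in>{1..m}. (t powi v (\<tau> i) * \<phi> x i) ^ k i)"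
    unfolding Y_eq[OF G_mem[OF \<phi> xt]]
    by (rule prod.cong) (use \<tau> v x t in \<open>auto simp: permutes_boundary_def\<close>)
  also have "\<dots> = (\<Prod>i\<in>{1..m}. t powi (v (\<tau> i) * int (k i))) * (\<Prod>i\<in>{1..m}. \<phi> x i ^ k i)"
    by (simp add: power_mult_distrib prod.distrib power_int_mult)
  also have "(\<Prod>i\<in>{1..m}. \<phi> x i ^ k i) = poly P (\<phi> x (Suc m))"
    using Y_eq[OF G_mem[OF \<phi>], of x] x by simp
  also have "(\<Prod>i\<in>{1..m}. t powi (v (\<tau> i) * int (k i))) = t powi (\<Sum>i\<in>{1..m}. v (\<tau> i) * int (k i))"
    by (rule prod_power_int[OF t])
  also have "(\<Sum>i\<in>{1..m}. v (\<tau> i) * int (k i)) = (\<Sum>i\<in>{1..m}. v i * int (k (inv' \<tau> i)))"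
    by (subst sum.permute[OF perm, of "\<lambda>i. v i * int (k (inv' \<tau> i))"]) (simp add: permutes_inverses[OF perm])
  finally show ?thesis .
qed

text \<open>
  The one-parameter group \<open>(y\<^sub>p, y\<^sub>q) \<mapsto> (t\<^bsup>e\<^sub>q\<^esup> y\<^sub>p, t\<^bsup>-e\<^sub>p\<^esup> y\<^sub>q)\<close> fixes \<open>y\<^sub>p\<^bsup>e\<^sub>p\<^esup> y\<^sub>q\<^bsup>e\<^sub>q\<^esup>\<close>.
\<close>

definition pair_weight :: "(nat \<Rightarrow> nat) \<Rightarrow> nat \<Rightarrow> nat \<Rightarrow> nat \<Rightarrow> int"
  where "pair_weight e p q i = (if i = p then int (e q) else 0) - (if i = q then int (e p) else 0)"

lemma sum_pair_weight:
  assumes "p \<in> {1..m}" "q \<in> {1..m}"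
  shows "(\<Sum>i\<in>{1..m}. pair_weight e p q i * int (f i)) = int (e q * f p) - int (e p * f q)"
proof -
  have delta: "(\<Sum>i\<in>{1..m}. (if i = r then c else 0) * int (f i)) = c * int (f r)" if "r \<in> {1..m}" for r c
  proof -
    have "(\<Sum>i\<in>{1..m}. (if i = r then c else 0) * int (f i)) = (\<Sum>i\<in>{1..m}. if i = r then c * int (f i) else 0)"
      by (rule sum.cong) auto
    then show ?thesis using that by simp
  qed
  show ?thesis
    unfolding pair_weight_def left_diff_distrib sum_subtractf delta[OF assms(1)] delta[OF assms(2)] by simp
qed

lemma pair_weight_last: "p \<in> {1..m} \<Longrightarrow> q \<in> {1..m} \<Longrightarrow> pair_weight e p q (Suc m) = 0"
  by (auto simp: pair_weight_def)

text \<open>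
  Along an orbit \<open>z \<circ> \<phi> - b\<close> is a multiple of a power of the parameter. If the exponent were
  nonzero, then \<open>z \<circ> \<phi>\<close> would take the value \<open>b'\<close>, which it omits.
\<close>

lemma last_coordinate_invariant_two_roots:
  assumes m: "m \<ge> 2" and \<phi>: "\<phi> \<in> G" and v: "flow_ok a v" and x: "x \<in> Y - D" and t: "t \<noteq> 0"
    and b: "poly P b = 0" "poly P b' = 0" "b \<noteq> b'"
  shows "\<phi> (flow a v t x) (Suc m) = \<phi> x (Suc m)"
proof -
  obtain n where n: "\<And>t. t \<noteq> 0 \<Longrightarrow> \<phi> (flow a v t x) (Suc m) - b = t powi n * (\<phi> x (Suc m) - b)"
    using last_coordinate_laurent[OF m \<phi> v x b(1)] by blast
  have h: "\<phi> x (Suc m) - b \<noteq> 0" using off_D_P[OF G_off_D[OF m \<phi> x]] b(1) by auto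
  have "n = 0"
  proof (rule ccontr)
    assume "n \<noteq> 0"
    then obtain s where s: "s \<noteq> 0" "s powi n = (b' - b) / (\<phi> x (Suc m) - b)"
      using power_int_surj[of n "(b' - b) / (\<phi> x (Suc m) - b)"] h b(3) by auto
    then have "\<phi> (flow a v s x) (Suc m) = b'" using n[OF s(1)] h by simp
    then show False using off_D_P[OF G_off_D[OF m \<phi> flow_off_D[OF v x s(1)]]] b(2) by simp
  qed
  then show ?thesis using n[OF t] by simp
qed

text \<open>
  If \<open>P\<close> has a single root \<open>a\<close>, there are additional flows that scale \<open>y\<^sub>i\<close> and \<open>z - a\<close> at the same time.
  They show that the functions \<open>y\<^sub>l \<circ> \<phi>\<close> depend on \<open>y\<close> only. So \<open>z \<circ> \<phi>\<close> cannot depend on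
  \<open>y\<close> only, that is, an expansion of \<open>z \<circ> \<phi> - a\<close> contains \<open>z - a\<close>, and hence
  it grows along the flow at least as fast as \<open>z - a\<close> does.
\<close>

lemma exponents_grow_single_root:
  assumes m: "m \<ge> 2" and \<phi>: "\<phi> \<in> G" and \<tau>: "permutes_boundary \<phi> \<tau>"
    and P: "P = smult c ([:-base_root, 1:] ^ degree P)" and i: "i \<in> {1..m}"
  shows "k i \<le> k (inv' \<tau> i)"
proof (rule ccontr)
  assume less: "\<not> k i \<le> k (inv' \<tau> i)"
  let ?a = base_root
  let ?d = "degree P"
  have perm: "\<tau> permutes {1..m}" using \<tau> by (simp add: permutes_boundary_def)
  have c: "c \<noteq> 0" using P P_nz by (metis smult_0_left)
  have Pz: "poly P z = c * (z - ?a) ^ ?d" for z by (subst P) (simp add: poly_power)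
  define v where "v i r = (if r = i then int ?d else if r = Suc m then int (k i) else 0)" for i r
  have vsum: "(\<Sum>r\<in>{1..m}. v i r * int (e r)) = int ?d * int (e i)" if "i \<in> {1..m}" for i e
  proof -
    have "(\<Sum>r\<in>{1..m}. v i r * int (e r)) = (\<Sum>r\<in>{1..m}. if r = i then int ?d * int (e r) else 0)"
      by (rule sum.cong) (auto simp: v_def)
    then show ?thesis using that by simp
  qed
  have ok: "flow_ok ?a (v i)" if "i \<in> {1..m}" for i
  proof (rule flow_ok_single_root[OF P])
    show "(\<Sum>r\<in>{1..m}. v i r * int (k r)) = v i (Suc m) * int ?d"
      using vsum[OF that] that by (simp add: v_def)
  qed
  have w: "wt (v i) B = int ?d * int (B i) + int (k i) * int (B (Suc m))" if "i \<in> {1..m}" for i B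
    using vsum[OF that, of B] that by (simp add: wt_def) (simp add: v_def)
  obtain \<omega> :: 'a where \<omega>: "\<omega> ^ ?d = 1" "\<omega> \<noteq> 1" using exists_nontrivial_root_of_unity[OF deg_P] by blast
  obtain x where x: "x \<in> Y - D" using off_D_nonempty by blast
  \<comment> \<open>Two points that differ in \<open>z\<close> only.\<close>
  define x' where "x' = x(Suc m := ?a + \<omega> * (x (Suc m) - ?a))"
  have "F x' = F x"
  proof -
    have "(\<Prod>i\<in>{1..m}. x' i ^ k i) = (\<Prod>i\<in>{1..m}. x i ^ k i)" by (rule prod.cong) (auto simp: x'_def)
    then show ?thesis using \<omega>(1) by (simp add: F_def Pz x'_def power_mult_distrib)
  qed
  moreover have "x' \<in> extensional {1..Suc m}" using x by (auto simp: x'_def mem_Y extensional_def)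
  ultimately have x': "x' \<in> Y - D" using x by (auto simp: mem_Y D_def x'_def)
  have neq: "x \<noteq> x'"
  proof
    assume "x = x'"
    then have "x (Suc m) = x' (Suc m)" by simp
    then have "(\<omega> - 1) * (x (Suc m) - ?a) = 0" by (simp add: x'_def algebra_simps)
    then have "x (Suc m) = ?a" using \<omega>(2) by simp
    then show False using off_D_P[OF x] base_root by simp
  qed
  \<comment> \<open>A function of weight less than \<open>k\<^sub>i\<close> for the flow \<open>v i\<close> does not involve \<open>z - a\<close>, which has
    weight \<open>k\<^sub>i\<close>; so it cannot separate \<open>x\<close> from \<open>x'\<close>.\<close>
  have same: "f x = f x'" if f: "f \<in> PF" and i: "i \<in> {1..m}" and n: "n < int (k i)"
    and hom: "\<And>x t. x \<in> Y - D \<Longrightarrow> t \<noteq> 0 \<Longrightarrow> f (flow ?a (v i) t x) = t powi n * f x" for f i n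
  proof -
    obtain L where L: "\<And>x. f x = (\<Sum>(c, B)\<leftarrow>L. c * mon ?a B x)" using monomial_expansion[OF f] by blast
    let ?L = "filter (\<lambda>(c, B). wt (v i) B = n) L"
    have "B (Suc m) = 0" if "(c, B) \<in> set ?L" for c B
    proof (rule ccontr)
      assume "B (Suc m) \<noteq> 0"
      then have "int (k i) * 1 \<le> int (k i) * int (B (Suc m))" by (intro mult_left_mono) auto
      moreover have "n = int ?d * int (B i) + int (k i) * int (B (Suc m))" using that w[OF i] by auto
      moreover have "0 \<le> int ?d * int (B i)" by simp
      ultimately show False using n by linarith
    qed
    moreover have "mon ?a B x = mon ?a B x'" if "B (Suc m) = 0" for B
      unfolding mon_def that by (auto simp: x'_def intro!: prod.cong)
    ultimately have "mon ?a B x = mon ?a B x'" if "(c, B) \<in> set ?L" for c B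
      using that by blast
    then have "(\<Sum>(c, B)\<leftarrow>?L. c * mon ?a B x) = (\<Sum>(c, B)\<leftarrow>?L. c * mon ?a B x')"
      by (intro arg_cong[where f = sum_list] map_cong) auto
    then show ?thesis
      using weight_component[of f ?a "v i" x L, OF L hom[OF x]] weight_component[of f ?a "v i" x' L, OF L hom[OF x']] by simp
  qed
  \<comment> \<open>\<open>y\<^sub>l \<circ> \<phi>\<close> has weight zero for the flow of an index other than \<open>\<tau> l\<close>.\<close>
  have y: "\<phi> x l = \<phi> x' l" if l: "l \<in> {1..m}" for l
  proof -
    obtain f where f: "f \<in> PF" "\<And>x. x \<in> Y \<Longrightarrow> \<phi> x l = f x" using G_coordinate[OF \<phi>, of l] l by auto
    obtain i where i: "i \<in> {1..m}" "i \<noteq> \<tau> l" using other_index[OF m] by blast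
    have "f x = f x'"
    proof (rule same[OF f(1) i(1)])
      show "0 < int (k i)" using k_ge_2[OF i(1)] by simp
      fix x t assume xt: "x \<in> Y - D" "t \<noteq> (0::'a)"
      have "\<tau> l \<noteq> Suc m" using permutes_in_image[OF perm, of l] l by auto
      then have "v i (\<tau> l) = 0" using i(2) by (simp add: v_def)
      then have "\<phi> (flow ?a (v i) t x) l = \<phi> x l"
        using \<tau> ok[OF i(1)] xt l unfolding permutes_boundary_def by (metis mult_1 power_int_0_right)
      then show "f (flow ?a (v i) t x) = t powi 0 * f x"
        using f(2) xt flow_off_D[OF ok[OF i(1)] xt] by simp
    qed
    then show ?thesis using f(2) x x' by simp
  qed
  have z: "\<phi> x (Suc m) = \<phi> x' (Suc m)"
  proof -
    obtain f where f: "f \<in> PF" "\<And>x. x \<in> Y \<Longrightarrow> \<phi> x (Suc m) = f x"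
      using G_coordinate[OF \<phi>, of "Suc m"] by auto
    have "f x - ?a = f x' - ?a"
    proof (rule same[of "\<lambda>x. f x - ?a", OF _ i])
      show "(\<lambda>x. f x - ?a) \<in> PF" using f(1) by (intro polynomial_functions_diff polynomial_functions.const)
      show "int (k (inv' \<tau> i)) < int (k i)" using less by simp
      fix x t assume xt: "x \<in> Y - D" "t \<noteq> (0::'a)"
      obtain n where n: "\<And>t. t \<noteq> 0 \<Longrightarrow> \<phi> (flow ?a (v i) t x) (Suc m) - ?a = t powi n * (\<phi> x (Suc m) - ?a)"
        using last_coordinate_laurent[OF m \<phi> ok[OF i] xt(1) base_root] by blast
      have h: "poly P (\<phi> x (Suc m)) \<noteq> 0" using off_D_P[OF G_off_D[OF m \<phi> xt(1)]] .
      have "2 powi (int ?d * int (k (inv' \<tau> i))) * poly P (\<phi> x (Suc m)) = poly P (\<phi> (flow ?a (v i) 2 x) (Suc m))"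
        using P_along_flow[OF m \<phi> \<tau> ok[OF i] xt(1), of 2] by (simp only: vsum[OF i]) simp
      also have "\<dots> = c * (2 powi n * (\<phi> x (Suc m) - ?a)) ^ ?d" using n[of 2] by (simp add: Pz)
      also have "\<dots> = 2 powi (n * int ?d) * poly P (\<phi> x (Suc m))"
        by (simp add: Pz power_mult_distrib power_int_mult)
      finally have "(2::'a) powi (int ?d * int (k (inv' \<tau> i))) = 2 powi (n * int ?d)" using h by simp
      then have "int ?d * int (k (inv' \<tau> i)) = n * int ?d" by (rule power_int_2_inj)
      then have "n = int (k (inv' \<tau> i))" using deg_P_nz by simp
      then show "f (flow ?a (v i) t x) - ?a = t powi int (k (inv' \<tau> i)) * (f x - ?a)"
        using n[OF xt(2)] f(2) xt flow_off_D[OF ok[OF i] xt] by simp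
    qed
    then show ?thesis using f(2) x x' by simp
  qed
  have "\<phi> x = \<phi> x'"
    by (rule Y_eqI[OF G_mem[OF \<phi>] G_mem[OF \<phi>] y z]) (use x x' in auto)
  then have "x = x'" using Bij_inj[OF G_Bij[OF \<phi>]] x x' by blast
  then show False using neq by blast
qed

text \<open>
  The sums of the exponents before and after the permutation agree. With a single root no exponent
  decreases. With several roots \<open>P \<circ> z \<circ> \<phi>\<close> is invariant under the flows of the pair
  weights, which makes the permuted exponents proportional to the original ones.
\<close>

lemma permutation_preserves_exponents:
  assumes m: "m \<ge> 2" and \<phi>: "\<phi> \<in> G" and \<tau>: "permutes_boundary \<phi> \<tau>" and i: "i \<in> {1..m}"
  shows "k (\<tau> i) = k i"
proof -
  have perm: "\<tau> permutes {1..m}" using \<tau> by (simp add: permutes_boundary_def)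
  let ?k' = "\<lambda>i. k (inv' \<tau> i)"
  have sum: "sum ?k' {1..m} = sum k {1..m}"
    using sum.permute[OF permutes_inv[OF perm], of k] by (simp add: o_def)
  have "?k' p = k p" if p: "p \<in> {1..m}" for p
  proof (cases "\<forall>b. poly P b = 0 \<longrightarrow> b = base_root")
    case True
    then obtain c where c: "P = smult c ([:-base_root, 1:] ^ degree P)" using single_root_poly[OF P_nz] by blast
    have le: "k q \<le> ?k' q" if "q \<in> {1..m}" for q
      by (rule exponents_grow_single_root[OF m \<phi> \<tau> c that])
    have "sum k {1..m} < sum ?k' {1..m}" if "k p < ?k' p"
      using that p le by (intro sum_strict_mono_ex1) auto
    then show ?thesis using sum le[OF p] by force
  next
    case False
    then obtain b where b: "poly P b = 0" "b \<noteq> base_root" by blast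
    obtain x where x: "x \<in> Y - D" using off_D_nonempty by blast
    show ?thesis
    proof (rule proportional_with_equal_sums[OF _ sum _ _ p])
      have "k 1 \<le> sum k {1..m}" using m_pos by (intro member_le_sum) auto
      then show "0 < sum k {1..m}" using k_ge_2[of 1] m_pos by simp
      fix p q assume pq: "p \<in> {1..m}" "q \<in> {1..m}"
      let ?v = "pair_weight k p q"
      have ok: "flow_ok base_root ?v"
        by (rule flow_ok_horizontal[of ?v, OF pair_weight_last[OF pq]])
           (unfold sum_pair_weight[OF pq], simp add: mult.commute)
      have h: "poly P (\<phi> x (Suc m)) \<noteq> 0" using off_D_P[OF G_off_D[OF m \<phi> x]] .
      have "2 powi (\<Sum>i\<in>{1..m}. ?v i * int (?k' i)) * poly P (\<phi> x (Suc m)) = poly P (\<phi> x (Suc m))"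
        using P_along_flow[OF m \<phi> \<tau> ok x, of 2]
          last_coordinate_invariant_two_roots[OF m \<phi> ok x _ base_root b(1) b(2)[symmetric], of 2] by simp
      then have "(2::'a) powi (\<Sum>i\<in>{1..m}. ?v i * int (?k' i)) = 2 powi 0" using h by simp
      then have "(\<Sum>i\<in>{1..m}. ?v i * int (?k' i)) = 0" by (rule power_int_2_inj)
      then have "int (k q * ?k' p) = int (k p * ?k' q)"
        by (simp only: sum_pair_weight[OF pq] right_minus_eq)
      then have "k q * ?k' p = k p * ?k' q" by (rule of_nat_eq_iff[THEN iffD1])
      then show "?k' p * k q = ?k' q * k p" by (simp add: mult.commute)
    qed simp
  qed
  from this[of "\<tau> i"] show ?thesis
    using permutes_in_image[OF perm, of i] i permutes_inverses[OF perm] by simp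
qed

text \<open>
  With a single root \<open>a\<close>, the function \<open>P(z \<circ> \<phi>) = c (z \<circ> \<phi> - a)\<^bsup>d\<^esup>\<close> is invariant
  because the permutation preserves the exponents; so the exponent of \<open>z \<circ> \<phi> - a\<close> is zero.
\<close>

lemma last_coordinate_invariant:
  assumes m: "m \<ge> 2" and \<phi>: "\<phi> \<in> G"
    and v: "v (Suc m) = 0" "(\<Sum>i\<in>{1..m}. v i * int (k i)) = 0" and x: "x \<in> Y - D" and t: "t \<noteq> 0"
  shows "\<phi> (flow base_root v t x) (Suc m) = \<phi> x (Suc m)"
proof (cases "\<forall>b. poly P b = 0 \<longrightarrow> b = base_root")
  case False
  then obtain b where b: "poly P b = 0" "b \<noteq> base_root" by blast
  show ?thesis
    by (rule last_coordinate_invariant_two_roots[OF m \<phi> flow_ok_horizontal[OF v] x t base_root b(1) b(2)[symmetric]])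
next
  case True
  then obtain c where c: "P = smult c ([:-base_root, 1:] ^ degree P)" using single_root_poly[OF P_nz] by blast
  have Pz: "poly P z = c * (z - base_root) ^ degree P" for z by (subst c) (simp add: poly_power)
  have ok: "flow_ok base_root v" by (rule flow_ok_horizontal[OF v])
  obtain \<tau> where \<tau>: "permutes_boundary \<phi> \<tau>" using permutes_boundary_exists[OF m \<phi>] by blast
  have perm: "\<tau> permutes {1..m}" using \<tau> by (simp add: permutes_boundary_def)
  obtain n where n: "\<And>t. t \<noteq> 0 \<Longrightarrow> \<phi> (flow base_root v t x) (Suc m) - base_root = t powi n * (\<phi> x (Suc m) - base_root)"
    using last_coordinate_laurent[OF m \<phi> ok x base_root] by blast
  have h: "poly P (\<phi> x (Suc m)) \<noteq> 0" using off_D_P[OF G_off_D[OF m \<phi> x]] .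
  have "k (inv' \<tau> i) = k i" if "i \<in> {1..m}" for i
    using permutation_preserves_exponents[OF m \<phi> \<tau>, of "inv' \<tau> i"]
      permutes_in_image[OF permutes_inv[OF perm], of i] that permutes_inverses[OF perm] by simp
  then have "(\<Sum>i\<in>{1..m}. v i * int (k (inv' \<tau> i))) = (\<Sum>i\<in>{1..m}. v i * int (k i))"
    by (intro sum.cong) simp_all
  then have "poly P (\<phi> (flow base_root v 2 x) (Suc m)) = poly P (\<phi> x (Suc m))"
    using P_along_flow[OF m \<phi> \<tau> ok x, of 2] v(2) by simp
  moreover have "poly P (\<phi> (flow base_root v 2 x) (Suc m)) = 2 powi (n * int (degree P)) * poly P (\<phi> x (Suc m))"
    using n[of 2] by (simp add: Pz power_mult_distrib power_int_mult)
  ultimately have "(2::'a) powi (n * int (degree P)) = 2 powi 0" using h by simp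
  then have "n * int (degree P) = 0" by (rule power_int_2_inj)
  then have "n = 0" using deg_P_nz by simp
  then show ?thesis using n[OF t] by simp
qed

end

section \<open>The torus and its invariant functions\<close>

lemma prod_power_int_distrib:
  "(\<Prod>i\<in>I. f i powi n) = (\<Prod>i\<in>I. f i :: 'a::field) powi n"
  by (induction I rule: infinite_finite_induct) (simp_all add: power_int_mult_distrib)

lemma bezout_Gcd:
  fixes k :: "'i \<Rightarrow> nat"
  assumes "finite I"
  shows "\<exists>b. (\<Sum>i\<in>I. b i * int (k i)) = int (Gcd (k ` I))"
  using assms
proof (induction I)
  case (insert j I)
  then obtain b where b: "(\<Sum>i\<in>I. b i * int (k i)) = int (Gcd (k ` I))" by blast
  obtain u v where uv: "u * int (k j) + v * int (Gcd (k ` I)) = int (gcd (k j) (Gcd (k ` I)))"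
    using bezout_int[of "int (k j)" "int (Gcd (k ` I))"] by auto
  have "(\<Sum>i\<in>I. (if i = j then u else v * b i) * int (k i)) = (\<Sum>i\<in>I. v * (b i * int (k i)))"
    using insert.hyps by (intro sum.cong) auto
  then have "(\<Sum>i\<in>insert j I. (if i = j then u else v * b i) * int (k i)) = int (Gcd (k ` insert j I))"
    using insert.hyps b uv by (simp add: sum_distrib_left[symmetric])
  then show ?case by (rule exI[of _ "\<lambda>i. if i = j then u else v * b i"])
qed simp

context suspension_variety
begin

definition g :: nat where "g = Gcd (k ` {1..m})"

definition \<kappa> :: "nat \<Rightarrow> nat" where "\<kappa> i = k i div g"

lemma g_pos: "g > 0"
proof -
  have "g dvd k 1" unfolding g_def using m_pos by (intro Gcd_dvd) auto
  then show ?thesis using k_ge_2[of 1] m_pos by (auto intro: Nat.gr0I)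
qed

lemma k_eq: "i \<in> {1..m} \<Longrightarrow> k i = g * \<kappa> i"
  unfolding \<kappa>_def g_def by (simp add: Gcd_dvd)

lemma \<kappa>_pos: "i \<in> {1..m} \<Longrightarrow> \<kappa> i > 0"
  using k_ge_2[of i] k_eq[of i] by (auto intro: Nat.gr0I)

lemma bezout_\<kappa>: "\<exists>b. (\<Sum>i\<in>{1..m}. b i * int (\<kappa> i)) = 1"
proof -
  obtain b where "(\<Sum>i\<in>{1..m}. b i * int (k i)) = int g"
    using bezout_Gcd[of "{1..m}" k] by (auto simp: g_def)
  moreover have "(\<Sum>i\<in>{1..m}. b i * int (k i)) = int g * (\<Sum>i\<in>{1..m}. b i * int (\<kappa> i))"
    unfolding sum_distrib_left by (rule sum.cong) (auto simp: k_eq)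
  ultimately show ?thesis using g_pos by auto
qed

lemma \<kappa>_single: "m < 2 \<Longrightarrow> \<kappa> 1 = 1"
proof -
  assume "m < 2"
  then have I: "{1..m} = {1}" using m_pos by auto
  have "k 1 > 0" using k_ge_2[of 1] m_pos by simp
  then show ?thesis unfolding \<kappa>_def g_def I by simp
qed

definition zc :: "(nat \<Rightarrow> 'a) \<Rightarrow> 'a" where "zc x = x (Suc m)"

text \<open>
  The function \<open>w\<close>, which satisfies \<open>w\<^bsup>g\<^esup> = P(z)\<close> on \<open>Y\<close>.
\<close>

definition wc :: "(nat \<Rightarrow> 'a) \<Rightarrow> 'a" where "wc x = (\<Prod>i\<in>{1..m}. x i ^ \<kappa> i)"

lemma prod_k: "(\<Prod>i\<in>{1..m}. x i ^ k i) = (\<Prod>i\<in>{1..m}. x i ^ \<kappa> i) ^ g" for x :: "nat \<Rightarrow> 'a"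
  unfolding prod_power_distrib by (rule prod.cong) (simp_all add: k_eq power_mult mult.commute flip: power_mult)

lemma wc_power: "x \<in> Y \<Longrightarrow> wc x ^ g = poly P (zc x)"
  using Y_eq[of x] unfolding wc_def zc_def prod_k by simp

text \<open>
  For \<open>m = 1\<close> the boundary is finite and need not be invariant. As the torus is trivial in this case,
  the whole of \<open>Y\<close> can be used.
\<close>

definition open_part :: "(nat \<Rightarrow> 'a) set" where "open_part = (if m \<ge> 2 then Y - D else Y)"

lemma open_part_Y: "x \<in> open_part \<Longrightarrow> x \<in> Y"
  by (simp add: open_part_def split: if_splits)

lemma G_open_part: "\<phi> \<in> G \<Longrightarrow> x \<in> open_part \<Longrightarrow> \<phi> x \<in> open_part"
  using G_off_D G_mem by (auto simp: open_part_def)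

definition act :: "(nat \<Rightarrow> 'a) \<Rightarrow> (nat \<Rightarrow> 'a) \<Rightarrow> nat \<Rightarrow> 'a"
  where "act lam x = pt (\<lambda>i. if i = Suc m then x i else lam i * x i)"

lemma act_apply:
  "i \<in> {1..m} \<Longrightarrow> act lam x i = lam i * x i" "act lam x (Suc m) = x (Suc m)"
  by (auto simp: act_def)

lemma act_cong: "(\<And>i. i \<in> {1..m} \<Longrightarrow> lam i = lam' i) \<Longrightarrow> act lam x = act lam' x"
  unfolding act_def pt_def by (rule restrict_ext) auto

lemma act_act: "act lam (act lam' x) = act (\<lambda>i. lam i * lam' i) x"
  unfolding act_def[of lam] act_def[of "\<lambda>i. lam i * lam' i"] pt_def
  by (rule restrict_ext) (auto simp: act_apply mult.assoc)

lemma act_one: "x \<in> Y \<Longrightarrow> (\<And>i. i \<in> {1..m} \<Longrightarrow> lam i = 1) \<Longrightarrow> act lam x = x"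
proof -
  assume x: "x \<in> Y" and l: "\<And>i. i \<in> {1..m} \<Longrightarrow> lam i = 1"
  have "act lam x = act (\<lambda>_. 1) x" by (rule act_cong[OF l])
  also have "(\<lambda>i. if i = Suc m then x i else 1 * x i) = x" by auto
  then have "act (\<lambda>_. 1) x = pt x" by (simp only: act_def)
  finally show ?thesis using Y_ext[OF x] by simp
qed

text \<open>
  The exponents \<open>\<kappa>\<^sub>i\<close> are coprime, so this group is connected. It fixes \<open>w\<close>, in contrast to the larger
  group given by the exponents \<open>k\<^sub>i\<close>, which multiplies \<open>w\<close> by \<open>g\<close>-th roots of unity.
\<close>

definition torus :: "(nat \<Rightarrow> 'a) set"
  where "torus = {lam. (\<forall>i\<in>{1..m}. lam i \<noteq> 0) \<and> (\<Prod>i\<in>{1..m}. lam i ^ \<kappa> i) = 1}"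

lemma act_mem_Y:
  assumes "(\<Prod>i\<in>{1..m}. lam i ^ k i) = 1" "x \<in> Y"
  shows "act lam x \<in> Y"
proof -
  have "(\<Prod>i\<in>{1..m}. act lam x i ^ k i) = (\<Prod>i\<in>{1..m}. lam i ^ k i * x i ^ k i)"
    by (rule prod.cong) (auto simp: act_apply power_mult_distrib)
  then have "F (act lam x) = F x"
    unfolding F_def act_apply(2) prod.distrib assms(1) by simp
  then show ?thesis using assms(2) unfolding act_def F_pt by (simp add: pt_mem_Y Y_F)
qed

lemma act_mem_open_part:
  assumes "\<And>i. i \<in> {1..m} \<Longrightarrow> lam i \<noteq> 0" "(\<Prod>i\<in>{1..m}. lam i ^ k i) = 1" "x \<in> open_part"
  shows "act lam x \<in> open_part"
  using assms act_mem_Y[OF assms(2), of x] by (auto simp: open_part_def D_def act_apply split: if_splits)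

lemma torus_prod_k: "lam \<in> torus \<Longrightarrow> (\<Prod>i\<in>{1..m}. lam i ^ k i) = 1"
  unfolding prod_k torus_def by simp

lemma torus_act_open_part: "lam \<in> torus \<Longrightarrow> x \<in> open_part \<Longrightarrow> act lam x \<in> open_part"
  by (rule act_mem_open_part[OF _ torus_prod_k]) (auto simp: torus_def)

lemma wc_act: "wc (act lam x) = (\<Prod>i\<in>{1..m}. lam i ^ \<kappa> i) * wc x"
proof -
  have "wc (act lam x) = (\<Prod>i\<in>{1..m}. lam i ^ \<kappa> i * x i ^ \<kappa> i)"
    unfolding wc_def by (rule prod.cong) (auto simp: act_apply power_mult_distrib)
  then show ?thesis by (simp add: prod.distrib wc_def)
qed

lemma zc_act: "zc (act lam x) = zc x"
  by (simp add: zc_def act_apply)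

lemma same_torus_orbit:
  assumes x: "x \<in> open_part" "x' \<in> open_part" and eq: "zc x = zc x'" "wc x = wc x'"
  shows "\<exists>lam\<in>torus. x' = act lam x"
proof (cases "m \<ge> 2")
  case True
  have nz: "x i \<noteq> 0" "x' i \<noteq> 0" if "i \<in> {1..m}" for i
    using x that True by (auto simp: open_part_def D_def)
  define lam where "lam i = x' i / x i" for i
  have "(\<Prod>i\<in>{1..m}. lam i ^ \<kappa> i) = wc x' / wc x"
    by (simp add: lam_def power_divide prod_dividef wc_def)
  moreover have "wc x \<noteq> 0" using nz by (auto simp: wc_def)
  ultimately have lam: "lam \<in> torus" using eq nz by (auto simp: torus_def lam_def)
  have "x' = act lam x"
    by (rule Y_eqI) (use x lam nz eq torus_act_open_part[OF lam x(1)] open_part_Y in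
        \<open>auto simp: act_apply lam_def zc_def\<close>)
  then show ?thesis using lam by blast
next
  case False
  then have m1: "m = 1" using m_pos by simp
  have I: "{1..m} = {1}" and "\<kappa> 1 = 1" using m1 \<kappa>_single False by auto
  then have wc1: "wc y = y 1" for y unfolding wc_def I by simp
  have "x = x'"
  proof (rule Y_eqI[OF open_part_Y[OF x(1)] open_part_Y[OF x(2)]])
    show "x i = x' i" if "i \<in> {1..m}" for i
      using that eq(2) unfolding I wc1 by simp
    show "x (Suc m) = x' (Suc m)" using eq(1) by (simp add: zc_def)
  qed
  moreover have "(\<lambda>_. 1) \<in> torus" by (simp add: torus_def)
  ultimately show ?thesis using act_one[OF open_part_Y[OF x(1)]] by metis
qed

lemma curve_point_lift:
  assumes "b ^ g = poly P a" "b \<noteq> 0"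
  shows "\<exists>x\<in>open_part. zc x = a \<and> wc x = b"
proof -
  have 1: "1 \<in> {1..m}" using m_pos by simp
  obtain \<beta> where \<beta>: "\<beta> ^ \<kappa> 1 = b" using nth_root_exists \<kappa>_pos[OF 1] by blast
  define y where "y i = (if i = Suc m then a else if i = 1 then \<beta> else 1)" for i
  have "(\<Prod>i\<in>{1..m}. y i ^ \<kappa> i) = (\<Prod>i\<in>{1..m}. if i = 1 then b else 1)"
    by (rule prod.cong) (auto simp: y_def \<beta>[unfolded One_nat_def])
  then have w: "(\<Prod>i\<in>{1..m}. y i ^ \<kappa> i) = b" using 1 by simp
  have "F y = 0" unfolding F_def prod_k w assms(1) by (simp add: y_def)
  then have Y: "pt y \<in> Y" by (simp add: pt_mem_Y)
  have "\<beta> \<noteq> 0" using \<beta> assms(2) \<kappa>_pos[OF 1] by (auto simp: zero_power)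
  then have "pt y \<in> open_part" using Y by (auto simp: open_part_def D_def y_def)
  moreover have "wc (pt y) = (\<Prod>i\<in>{1..m}. y i ^ \<kappa> i)" unfolding wc_def by (rule prod.cong) auto
  moreover have "zc (pt y) = a" using m_pos by (simp add: zc_def y_def)
  ultimately show ?thesis using w by metis
qed

lemma pair_weight_torus:
  assumes "p \<in> {1..m}" "q \<in> {1..m}" "t \<noteq> 0"
  shows "(\<lambda>i. t powi pair_weight \<kappa> p q i) \<in> torus"
proof -
  have "(\<Prod>i\<in>{1..m}. (t powi pair_weight \<kappa> p q i) ^ \<kappa> i) = t powi (\<Sum>i\<in>{1..m}. pair_weight \<kappa> p q i * int (\<kappa> i))"
    by (simp add: power_int_mult prod_power_int[OF assms(3), symmetric])
  also have "(\<Sum>i\<in>{1..m}. pair_weight \<kappa> p q i * int (\<kappa> i)) = 0"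
    unfolding sum_pair_weight[OF assms(1,2)] by (simp add: mult.commute)
  finally show ?thesis using assms(3) by (simp add: torus_def)
qed

lemma flow_pair_weight:
  assumes "p \<in> {1..m}" "q \<in> {1..m}"
  shows "flow a (pair_weight \<kappa> p q) t x = act (\<lambda>i. t powi pair_weight \<kappa> p q i) x"
  unfolding flow_def act_def pt_def by (rule restrict_ext) (auto simp: pair_weight_last[OF assms])

text \<open>
  The torus is generated by the one-parameter groups of the pair weights: \<open>b\<close> is a vector of Bezout
  coefficients of the \<open>\<kappa>\<^sub>i\<close>, and the pair \<open>(p, q)\<close> is used with the parameter \<open>\<lambda>\<^sub>p\<^bsup>b\<^sub>q\<^esup>\<close>.
\<close>

lemma torus_factorisation:
  assumes lam: "lam \<in> torus" and b: "(\<Sum>i\<in>{1..m}. b i * int (\<kappa> i)) = 1" and i: "i \<in> {1..m}"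
  shows "lam i = (\<Prod>(p, q)\<in>{1..m} \<times> {1..m}. (lam p powi b q) powi pair_weight \<kappa> p q i)"
proof -
  have nz: "lam p \<noteq> 0" if "p \<in> {1..m}" for p using lam that by (auto simp: torus_def)
  have split: "(lam p powi b q) powi pair_weight \<kappa> p q i =
      (if p = i then lam i powi (b q * int (\<kappa> q)) else 1) / (if q = i then lam p powi (b i * int (\<kappa> p)) else 1)"
    if "p \<in> {1..m}" for p q
    using nz[OF that] by (auto simp: pair_weight_def power_int_diff power_int_minus power_int_mult divide_inverse)
  have "(\<Prod>(p, q)\<in>{1..m} \<times> {1..m}. (lam p powi b q) powi pair_weight \<kappa> p q i)
      = (\<Prod>p\<in>{1..m}. \<Prod>q\<in>{1..m}. (lam p powi b q) powi pair_weight \<kappa> p q i)"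
    by (rule prod.cartesian_product[symmetric])
  also have "\<dots> = (\<Prod>p\<in>{1..m}. \<Prod>q\<in>{1..m}. (if p = i then lam i powi (b q * int (\<kappa> q)) else 1) /
      (if q = i then lam p powi (b i * int (\<kappa> p)) else 1))"
    by (intro prod.cong refl) (rule split)
  also have "\<dots> = (\<Prod>p\<in>{1..m}. (if p = i then \<Prod>q\<in>{1..m}. lam i powi (b q * int (\<kappa> q)) else 1)) /
      (\<Prod>p\<in>{1..m}. lam p powi (b i * int (\<kappa> p)))"
  proof -
    have "(\<Prod>q\<in>{1..m}. (if p = i then lam i powi (b q * int (\<kappa> q)) else 1) /
      (if q = i then lam p powi (b i * int (\<kappa> p)) else 1)) =
      (if p = i then \<Prod>q\<in>{1..m}. lam i powi (b q * int (\<kappa> q)) else 1) / lam p powi (b i * int (\<kappa> p))" for p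
      unfolding prod_dividef using i by simp
    then show ?thesis by (simp only: prod_dividef)
  qed
  also have "(\<Prod>p\<in>{1..m}. (if p = i then \<Prod>q\<in>{1..m}. lam i powi (b q * int (\<kappa> q)) else 1)) =
      lam i powi (\<Sum>q\<in>{1..m}. b q * int (\<kappa> q))"
    using i by (simp add: prod_power_int[OF nz[OF i]])
  also have "(\<Prod>p\<in>{1..m}. lam p powi (b i * int (\<kappa> p))) = (\<Prod>p\<in>{1..m}. lam p ^ \<kappa> p) powi b i"
    unfolding prod_power_int_distrib[symmetric]
    by (rule prod.cong) (simp_all add: mult.commute[of "b i"] power_int_mult)
  also have "(\<Prod>p\<in>{1..m}. lam p ^ \<kappa> p) = 1" using lam by (simp add: torus_def)
  finally show ?thesis using b by simp
qed

definition has_type :: "((nat \<Rightarrow> 'a) \<Rightarrow> (nat \<Rightarrow> 'a)) \<Rightarrow> (nat \<Rightarrow> nat) \<Rightarrow> bool"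
  where "has_type \<phi> \<tau> \<longleftrightarrow> \<tau> permutes {1..m} \<and> (\<forall>i\<in>{1..m}. k (\<tau> i) = k i) \<and>
    (\<forall>lam\<in>torus. \<forall>x\<in>open_part. \<phi> (act lam x) = act (lam \<circ> \<tau>) (\<phi> x))"

text \<open>
  The commutation rule holds for the one-parameter groups of the pair weights. The torus elements
  that satisfy it are closed under products.
\<close>

lemma has_type_exists:
  assumes \<phi>: "\<phi> \<in> G"
  shows "\<exists>\<tau>. has_type \<phi> \<tau>"
proof (cases "m \<ge> 2")
  case False
  then have m1: "m = 1" using m_pos by simp
  have "\<phi> (act lam x) = act (lam \<circ> id) (\<phi> x)" if "lam \<in> torus" "x \<in> open_part" for lam x
  proof -
    have I: "{1..m} = {1}" and "\<kappa> 1 = 1" using m1 \<kappa>_single False by auto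
    then have "lam i = 1" if "i \<in> {1..m}" for i
      using \<open>lam \<in> torus\<close> that unfolding torus_def I by simp
    then show ?thesis
      using act_one[of x lam] act_one[of "\<phi> x" lam] open_part_Y[OF that(2)] G_mem[OF \<phi>] by simp
  qed
  then have "has_type \<phi> id" by (simp add: has_type_def permutes_id)
  then show ?thesis by blast
next
  case m: True
  then have op: "open_part = Y - D" by (simp add: open_part_def)
  obtain \<tau> where \<tau>: "permutes_boundary \<phi> \<tau>" using permutes_boundary_exists[OF m \<phi>] by blast
  have perm: "\<tau> permutes {1..m}" using \<tau> by (simp add: permutes_boundary_def)
  define M where "M = {lam. \<forall>x\<in>open_part. act lam x \<in> open_part \<and> \<phi> (act lam x) = act (lam \<circ> \<tau>) (\<phi> x)}"
  have pw: "(\<lambda>i. t powi pair_weight \<kappa> p q i) \<in> M" if pq: "p \<in> {1..m}" "q \<in> {1..m}" and t: "t \<noteq> 0" for p q t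
  proof -
    let ?v = "pair_weight \<kappa> p q"
    have v0: "?v (Suc m) = 0" by (rule pair_weight_last[OF pq])
    have v1: "(\<Sum>i\<in>{1..m}. ?v i * int (k i)) = 0"
      unfolding sum_pair_weight[OF pq] by (simp add: k_eq[OF pq(1)] k_eq[OF pq(2)] mult_ac)
    have ok: "flow_ok base_root ?v" by (rule flow_ok_horizontal[of ?v, OF v0 v1])
    show ?thesis
      unfolding M_def
    proof (intro CollectI ballI conjI)
      fix x assume x: "x \<in> open_part"
      show xt: "act (\<lambda>i. t powi ?v i) x \<in> open_part" by (rule torus_act_open_part[OF pair_weight_torus[OF pq t] x])
      have x': "x \<in> Y - D" using x op by simp
      have fl: "act (\<lambda>i. t powi ?v i) x = flow base_root ?v t x" by (rule flow_pair_weight[OF pq, symmetric])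
      have lt: "(\<lambda>i. t powi ?v i) \<circ> \<tau> \<in> torus"
      proof -
        have "(\<Prod>i\<in>{1..m}. ((\<lambda>i. t powi ?v i) \<circ> \<tau>) i ^ \<kappa> i) = (\<Prod>i\<in>{1..m}. (t powi ?v (\<tau> i)) ^ \<kappa> (\<tau> i))"
          by (rule prod.cong) (simp_all add: \<kappa>_def permutation_preserves_exponents[OF m \<phi> \<tau>])
        also have "\<dots> = (\<Prod>i\<in>{1..m}. (t powi ?v i) ^ \<kappa> i)"
          using prod.permute[OF perm, of "\<lambda>i. (t powi ?v i) ^ \<kappa> i"] by (simp add: o_def)
        finally show ?thesis using pair_weight_torus[OF pq t] t by (simp add: torus_def)
      qed
      show "\<phi> (act (\<lambda>i. t powi ?v i) x) = act ((\<lambda>i. t powi ?v i) \<circ> \<tau>) (\<phi> x)"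
      proof (rule Y_eqI)
        show "\<phi> (act (\<lambda>i. t powi ?v i) x) \<in> Y" using G_open_part[OF \<phi> xt] open_part_Y by blast
        show "act ((\<lambda>i. t powi ?v i) \<circ> \<tau>) (\<phi> x) \<in> Y"
          using torus_act_open_part[OF lt G_open_part[OF \<phi> x]] open_part_Y by blast
        show "\<phi> (act (\<lambda>i. t powi ?v i) x) i = act ((\<lambda>i. t powi ?v i) \<circ> \<tau>) (\<phi> x) i" if i: "i \<in> {1..m}" for i
          using \<tau> ok x' t i unfolding permutes_boundary_def fl by (simp add: act_apply(1)[OF i])
        show "\<phi> (act (\<lambda>i. t powi ?v i) x) (Suc m) = act ((\<lambda>i. t powi ?v i) \<circ> \<tau>) (\<phi> x) (Suc m)"
          unfolding act_apply(2) fl by (rule last_coordinate_invariant[of \<phi> ?v, OF m \<phi> v0 v1 x' t])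
      qed
    qed
  qed
  have mult: "(\<lambda>i. lam i * lam' i) \<in> M" if "lam \<in> M" "lam' \<in> M" for lam lam'
    using that unfolding M_def by (auto simp: act_act[symmetric] o_def)
  have prodM: "(\<lambda>i. \<Prod>j\<in>J. f j i) \<in> M" if "finite J" "\<And>j. j \<in> J \<Longrightarrow> f j \<in> M" for J and f :: "nat \<times> nat \<Rightarrow> nat \<Rightarrow> 'a"
    using that
  proof (induction J)
    case empty
    show ?case unfolding M_def using act_one open_part_Y G_mem[OF \<phi>] by (auto simp: o_def)
  qed (simp add: mult)
  obtain b where b: "(\<Sum>i\<in>{1..m}. b i * int (\<kappa> i)) = 1" using bezout_\<kappa> by blast
  have "\<phi> (act lam x) = act (lam \<circ> \<tau>) (\<phi> x)" if lam: "lam \<in> torus" and x: "x \<in> open_part" for lam x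
  proof -
    define lam' where "lam' i = (\<Prod>j\<in>{1..m} \<times> {1..m}. (\<lambda>(p, q) i. (lam p powi b q) powi pair_weight \<kappa> p q i) j i)" for i
    have lam': "lam' \<in> M"
      unfolding lam'_def
    proof (rule prodM)
      fix j assume "j \<in> {1..m} \<times> {1..m}"
      then obtain p q where j: "j = (p, q)" "p \<in> {1..m}" "q \<in> {1..m}" by blast
      have "lam p powi b q \<noteq> 0" using lam j(2) by (auto simp: torus_def)
      then show "(\<lambda>(p, q) i. (lam p powi b q) powi pair_weight \<kappa> p q i) j \<in> M"
        using pw[OF j(2,3)] j(1) by simp
    qed simp
    have eq: "lam i = lam' i" if "i \<in> {1..m}" for i
      unfolding lam'_def using torus_factorisation[OF lam b that] by (simp add: case_prod_unfold)
    have "act lam x = act lam' x" by (rule act_cong[OF eq])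
    moreover have "act (lam \<circ> \<tau>) (\<phi> x) = act (lam' \<circ> \<tau>) (\<phi> x)"
      by (rule act_cong) (use eq permutes_in_image[OF perm] in auto)
    ultimately show ?thesis using lam' x by (simp add: M_def)
  qed
  then have "has_type \<phi> \<tau>"
    unfolding has_type_def using perm permutation_preserves_exponents[OF m \<phi> \<tau>] by blast
  then show ?thesis by blast
qed

text \<open>
  An invariant function is a combination of invariant monomials. A monomial with exponents \<open>B\<^sub>i\<close> is
  invariant under the pair weight \<open>(p, q)\<close> if \<open>\<kappa>\<^sub>q B\<^sub>p = \<kappa>\<^sub>p B\<^sub>q\<close>; as the \<open>\<kappa>\<^sub>i\<close> are coprime, the
  vector \<open>B\<close> is then an integral multiple of \<open>\<kappa>\<close>, and the monomial in the \<open>y\<^sub>i\<close> is a power of \<open>w\<close>.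
\<close>

lemma torus_invariant_function:
  assumes f: "f \<in> PF" and inv: "\<And>lam x. lam \<in> torus \<Longrightarrow> x \<in> open_part \<Longrightarrow> f (act lam x) = f x"
  shows "\<exists>B. \<forall>x\<in>open_part. f x = bev B (zc x) (wc x)"
proof -
  obtain L where L: "\<And>x. f x = (\<Sum>(c, B)\<leftarrow>L. c * mon 0 B x)" using monomial_expansion[OF f] by blast
  define Q where "Q ps B \<longleftrightarrow> (\<forall>(p, q)\<in>set ps. wt (pair_weight \<kappa> p q) B = 0)" for ps B
  have steps: "\<forall>x\<in>open_part. f x = (\<Sum>(c, B)\<leftarrow>filter (\<lambda>(c, B). Q ps B) L. c * mon 0 B x)"
    if "set ps \<subseteq> {1..m} \<times> {1..m}" for ps
    using that
  proof (induction ps)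
    case Nil
    show ?case using L by (simp add: Q_def case_prod_unfold)
  next
    case (Cons pq ps)
    obtain p q where pq: "pq = (p, q)" by fastforce
    have pq': "p \<in> {1..m}" "q \<in> {1..m}" using Cons.prems pq by auto
    let ?v = "pair_weight \<kappa> p q"
    let ?L = "filter (\<lambda>(c, B). Q ps B) L"
    show ?case
    proof
      fix x assume x: "x \<in> open_part"
      have xt: "flow 0 ?v t x \<in> open_part" "f (flow 0 ?v t x) = f x" if "t \<noteq> 0" for t
        unfolding flow_pair_weight[OF pq']
        using torus_act_open_part[OF pair_weight_torus[OF pq' that] x] inv[OF pair_weight_torus[OF pq' that] x]
        by blast+
      have "f x = (\<Sum>(c, B)\<leftarrow>filter (\<lambda>(c, B). wt ?v B = 0) ?L. c * mon 0 B x)"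
      proof (rule weight_component[of f 0 ?v x ?L])
        show "f (flow 0 ?v t x) = (\<Sum>(c, B)\<leftarrow>?L. c * mon 0 B (flow 0 ?v t x))" if "t \<noteq> 0" for t
          using Cons xt(1)[OF that] by auto
        show "f (flow 0 ?v t x) = t powi 0 * f x" if "t \<noteq> 0" for t using xt(2)[OF that] by simp
      qed
      also have "filter (\<lambda>(c, B). wt ?v B = 0) ?L = filter (\<lambda>(c, B). Q (pq # ps) B) L"
        by (auto simp: Q_def pq intro!: filter_cong)
      finally show "f x = (\<Sum>(c, B)\<leftarrow>filter (\<lambda>(c, B). Q (pq # ps) B) L. c * mon 0 B x)" .
    qed
  qed
  define ps where "ps = List.product [1..<Suc m] [1..<Suc m]"
  have set_ps: "set ps = {1..m} \<times> {1..m}" by (auto simp: ps_def simp del: upt_Suc)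
  then have f_eq: "\<forall>x\<in>open_part. f x = (\<Sum>(c, B)\<leftarrow>filter (\<lambda>(c, B). Q ps B) L. c * mon 0 B x)"
    by (intro steps) simp
  obtain b where b: "(\<Sum>i\<in>{1..m}. b i * int (\<kappa> i)) = 1" using bezout_\<kappa> by blast
  have mon_eq: "\<exists>n. \<forall>x. mon 0 B x = zc x ^ B (Suc m) * wc x ^ n" if Q: "Q ps B" for B
  proof -
    have cross: "int (\<kappa> q) * int (B p) = int (\<kappa> p) * int (B q)" if pq: "p \<in> {1..m}" "q \<in> {1..m}" for p q
    proof -
      have "wt (pair_weight \<kappa> p q) B = 0" using Q pq by (auto simp: Q_def set_ps)
      then have "(\<Sum>i\<in>{1..m}. pair_weight \<kappa> p q i * int (B i)) = 0"
        by (simp add: wt_def pair_weight_last[OF pq])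
      then show ?thesis unfolding sum_pair_weight[OF pq] by simp
    qed
    define n where "n = (\<Sum>q\<in>{1..m}. b q * int (B q))"
    have Bp: "int (B p) = int (\<kappa> p) * n" if "p \<in> {1..m}" for p
    proof -
      have "int (B p) = (\<Sum>q\<in>{1..m}. b q * int (\<kappa> q)) * int (B p)" using b by simp
      also have "\<dots> = (\<Sum>q\<in>{1..m}. b q * (int (\<kappa> q) * int (B p)))" by (simp add: sum_distrib_right mult.assoc)
      also have "\<dots> = (\<Sum>q\<in>{1..m}. b q * (int (\<kappa> p) * int (B q)))"
        by (rule sum.cong) (simp_all add: cross[OF that])
      also have "\<dots> = int (\<kappa> p) * n" by (simp add: n_def sum_distrib_left mult_ac)
      finally show ?thesis .
    qed
    have "n \<ge> 0"
    proof -
      have 1: "1 \<in> {1..m}" using m_pos by simp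
      have "0 \<le> int (\<kappa> 1) * n" using Bp[OF 1] by (metis of_nat_0_le_iff)
      then show ?thesis using \<kappa>_pos[OF 1] by (simp add: zero_le_mult_iff)
    qed
    have Bn: "B p = \<kappa> p * nat n" if "p \<in> {1..m}" for p
    proof -
      have "int (B p) = int (\<kappa> p * nat n)" using Bp[OF that] \<open>n \<ge> 0\<close> by simp
      then show ?thesis by (rule of_nat_eq_iff[THEN iffD1])
    qed
    have "mon 0 B x = zc x ^ B (Suc m) * wc x ^ nat n" for x
    proof -
      have "(\<Prod>i\<in>{1..m}. x i ^ B i) = (\<Prod>i\<in>{1..m}. (x i ^ \<kappa> i) ^ nat n)"
        by (rule prod.cong) (simp_all add: Bn power_mult)
      then show ?thesis by (simp add: mon_def zc_def wc_def prod_power_distrib mult.commute)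
    qed
    then show ?thesis by blast
  qed
  have "\<exists>A. \<forall>x. (\<Sum>(c, B)\<leftarrow>filter (\<lambda>(c, B). Q ps B) M. c * mon 0 B x) = bev A (zc x) (wc x)" for M
  proof (induction M)
    case Nil
    show ?case by (rule exI[of _ 0]) simp
  next
    case (Cons cB M)
    obtain c B where cB: "cB = (c, B)" by fastforce
    obtain A where A: "\<forall>x. (\<Sum>(c, B)\<leftarrow>filter (\<lambda>(c, B). Q ps B) M. c * mon 0 B x) = bev A (zc x) (wc x)"
      using Cons by blast
    show ?case
    proof (cases "Q ps B")
      case True
      obtain n where "\<forall>x. mon 0 B x = zc x ^ B (Suc m) * wc x ^ n" using mon_eq[OF True] by blast
      then show ?thesis using True A
        by (intro exI[of _ "monom (monom c (B (Suc m))) n + A"]) (simp add: cB poly_monom mult.assoc)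
    next
      case False
      then show ?thesis using A by (auto simp: cB)
    qed
  qed
  then show ?thesis using f_eq by metis
qed

end

section \<open>Laurent expansions at infinity\<close>

lemma map_poly_hom_mult:
  fixes h :: "'a::comm_ring_1 \<Rightarrow> 'b::comm_ring_1"
  assumes h0: "h 0 = 0" and add: "\<And>x y. h (x + y) = h x + h y" and mult: "\<And>x y. h (x * y) = h x * h y"
  shows "map_poly h (p * q) = map_poly h p * map_poly h q"
proof -
  have sum: "h (sum f I) = (\<Sum>i\<in>I. h (f i))" for f :: "nat \<Rightarrow> 'a" and I
    by (induction I rule: infinite_finite_induct) (simp_all add: h0 add)
  show ?thesis by (rule poly_eqI) (simp add: coeff_map_poly h0 coeff_mult sum mult)
qed

lemma map_poly_hom_add:
  fixes h :: "'a::comm_ring_1 \<Rightarrow> 'b::comm_ring_1"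
  assumes "h 0 = 0" and "\<And>x y. h (x + y) = h x + h y"
  shows "map_poly h (p + q) = map_poly h p + map_poly h q"
  by (rule poly_eqI) (simp add: coeff_map_poly assms)

text \<open>
  The value of a polynomial at a Laurent series. Below, \<open>lev\<close> is the analogue for polynomials in
  two variables, and \<open>psubst P B\<close> is the composition \<open>P \<circ> B\<close>.
\<close>

definition lpoly :: "'a::field fls \<Rightarrow> 'a poly \<Rightarrow> 'a fls"
  where "lpoly Z p = poly (map_poly fls_const p) Z"

lemma lpoly_add: "lpoly Z (p + q) = lpoly Z p + lpoly Z q"
  unfolding lpoly_def by (simp add: map_poly_hom_add fls_plus_const)

lemma lpoly_mult: "lpoly Z (p * q) = lpoly Z p * lpoly Z q"
  unfolding lpoly_def by (simp add: map_poly_hom_mult fls_plus_const)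

lemma lpoly_pCons [simp]: "lpoly Z (pCons c p) = fls_const c + Z * lpoly Z p"
  by (simp add: lpoly_def map_poly_pCons)

lemma lpoly_0 [simp]: "lpoly Z 0 = 0"
  by (simp add: lpoly_def)

lemma lpoly_1 [simp]: "lpoly Z 1 = 1"
  by (simp add: one_pCons)

definition lev :: "'a::field poly poly \<Rightarrow> 'a fls \<Rightarrow> 'a fls \<Rightarrow> 'a fls"
  where "lev B Z W = poly (map_poly (lpoly Z) B) W"

lemma lev_add: "lev (A + B) Z W = lev A Z W + lev B Z W"
  unfolding lev_def by (simp add: map_poly_hom_add lpoly_add)

lemma lev_mult: "lev (A * B) Z W = lev A Z W * lev B Z W"
  unfolding lev_def by (simp add: map_poly_hom_mult lpoly_add lpoly_mult)

lemma lev_pCons [simp]: "lev (pCons p B) Z W = lpoly Z p + W * lev B Z W"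
  by (simp add: lev_def map_poly_pCons)

lemma lev_0 [simp]: "lev 0 Z W = 0"
  by (simp add: lev_def)

lemma lev_1 [simp]: "lev 1 Z W = 1"
  by (simp add: one_pCons)

lemma lev_power: "lev (A ^ n) Z W = lev A Z W ^ n"
  by (induction n) (simp_all add: lev_mult)

lemma lev_diff: "lev (A - B) Z W = lev A Z W - lev B Z W"
  using lev_add[of "A - B" B Z W] by simp

lemma lev_monom: "lev (monom p n) Z W = lpoly Z p * W ^ n"
  by (induction n) (simp_all add: monom_0 monom_Suc)

lemma lev_sum: "lev (\<Sum>i\<in>I. f i) Z W = (\<Sum>i\<in>I. lev (f i) Z W)"
  by (induction I rule: infinite_finite_induct) (simp_all add: lev_add)

lemma lev_altdef:
  assumes "degree B < g"
  shows "lev B Z W = (\<Sum>j<g. lpoly Z (coeff B j) * W ^ j)"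
proof -
  have "B = (\<Sum>j<g. monom (coeff B j) j)"
  proof (rule poly_eqI)
    fix n show "coeff B n = coeff (\<Sum>j<g. monom (coeff B j) j) n"
      using assms by (simp add: coeff_sum coeff_eq_0)
  qed
  then have "lev B Z W = lev (\<Sum>j<g. monom (coeff B j) j) Z W" by simp
  then show ?thesis by (simp add: lev_sum lev_monom)
qed

definition psubst :: "'a::field poly \<Rightarrow> 'a poly poly \<Rightarrow> 'a poly poly"
  where "psubst a B = poly (map_poly (\<lambda>c. [:[:c:]:]) a) B"

lemma psubst_simps [simp]: "psubst 0 B = 0" "psubst (pCons c a) B = [:[:c:]:] + B * psubst a B"
  by (simp_all add: psubst_def map_poly_pCons)

lemma bev_psubst [simp]: "bev (psubst a B) z w = poly a (bev B z w)"
  by (induction a) simp_all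

lemma lev_psubst: "lev (psubst a B) Z W = lpoly (lev B Z W) a"
  by (induction a) (simp_all add: lev_add lev_mult)

text \<open>\<open>pole_le n f\<close> says that \<open>f\<close> has a pole of order at most \<open>n\<close>.\<close>

definition pole_le :: "int \<Rightarrow> 'a::field fls \<Rightarrow> bool"
  where "pole_le n f \<longleftrightarrow> f = 0 \<or> - n \<le> fls_subdegree f"

lemma pole_le_add: "pole_le n f \<Longrightarrow> pole_le n h \<Longrightarrow> pole_le n (f + h)"
  unfolding pole_le_def using fls_plus_subdegree[of f h]
  by (cases "f = 0"; cases "h = 0"; cases "f + h = 0") auto

lemma pole_le_0 [simp]: "pole_le n 0"
  by (simp add: pole_le_def)

lemma pole_le_sum: "(\<And>i. i \<in> I \<Longrightarrow> pole_le n (f i)) \<Longrightarrow> pole_le n (\<Sum>i\<in>I. f i)"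
  by (induction I rule: infinite_finite_induct) (simp_all add: pole_le_add)

lemma pole_le_mult: "pole_le n f \<Longrightarrow> pole_le n' h \<Longrightarrow> pole_le (n + n') (f * h)"
  unfolding pole_le_def by (cases "f = 0"; cases "h = 0") auto

lemma pole_le_const_mult: "pole_le n f \<Longrightarrow> pole_le n (fls_const c * f)"
  using pole_le_mult[of 0 "fls_const c" n f] by (simp add: pole_le_def)

lemma pole_le_const_mult_iff: "c \<noteq> 0 \<Longrightarrow> pole_le n (fls_const c * f) \<longleftrightarrow> pole_le n f"
  unfolding pole_le_def by (cases "f = 0") auto

lemma lpoly_subdegree:
  assumes p: "fls_subdegree Z = - int p" "p > 0" and a: "a \<noteq> 0"
  shows "lpoly Z a \<noteq> 0 \<and> fls_subdegree (lpoly Z a) = - int (p * degree a)"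
  using a
proof (induction a)
  case (pCons c a)
  have Z: "Z \<noteq> 0" using p by auto
  show ?case
  proof (cases "a = 0")
    case True
    then show ?thesis using pCons by simp
  next
    case False
    then have IH: "lpoly Z a \<noteq> 0" "fls_subdegree (lpoly Z a) = - int (p * degree a)" using pCons by auto
    have sub: "fls_subdegree (Z * lpoly Z a) = - int (p * degree (pCons c a))"
      using Z IH False p by (simp add: algebra_simps)
    have "0 < p * degree (pCons c a)" using p False by simp
    then have neg: "fls_subdegree (Z * lpoly Z a) < 0" unfolding sub by linarith
    have eq: "fls_subdegree (fls_const c + Z * lpoly Z a) = fls_subdegree (Z * lpoly Z a)"
    proof (cases "c = 0")
      case False
      then show ?thesis
        using fls_subdegree_add_eq2[of "Z * lpoly Z a" "fls_const c"] Z IH neg by simp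
    qed simp
    then have "fls_const c + Z * lpoly Z a \<noteq> 0" using neg by auto
    then show ?thesis using eq sub by simp
  qed
qed simp

lemma lpoly_regular: "0 \<le> fls_subdegree Z \<Longrightarrow> pole_le 0 (lpoly Z a)"
proof (induction a)
  case (pCons c a)
  have "pole_le 0 Z" using pCons.prems by (simp add: pole_le_def)
  then have "pole_le 0 (Z * lpoly Z a)" using pCons pole_le_mult[of 0 Z 0] by simp
  then show ?case by (simp add: pole_le_add pole_le_def[of 0 "fls_const c"])
qed (simp add: pole_le_def)

text \<open>
  Expansion at infinity: \<open>z = X\<^sup>-\<^sup>g\<close> and \<open>w\<close> is a \<open>g\<close>-th root of \<open>P(z)\<close>, which has a pole of order
  \<open>degree P\<close>.
\<close>

lemma branch_at_infinity:
  fixes P :: "'a::{alg_closed_field, field_char_0} poly"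
  assumes g: "g \<ge> 1" and P: "P \<noteq> 0"
  shows "\<exists>W. W ^ g = lpoly (fls_X_inv ^ g) P \<and> W \<noteq> 0 \<and> fls_subdegree W = - int (degree P)"
proof -
  define d where "d = degree P"
  define S where "S = (\<Sum>j\<le>d. fps_const (coeff P j) * fps_X ^ (g * (d - j)))"
  have S0: "S $ 0 = coeff P d"
  proof -
    have "S $ 0 = (\<Sum>j\<le>d. if j = d then coeff P d else 0)"
      unfolding S_def fps_sum_nth
      by (rule sum.cong) (use g in \<open>auto simp: fps_X_power_iff\<close>)
    then show ?thesis by simp
  qed
  then have S0nz: "S $ 0 \<noteq> 0" using P by (simp add: d_def)
  define rt where "rt = (\<lambda>(n::nat) (c::'a). SOME y. y ^ n = c)"
  obtain g' where g': "g = Suc g'" using g by (cases g) auto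
  have "rt g (S $ 0) ^ g = S $ 0"
    unfolding rt_def by (rule someI_ex[OF nth_root_exists]) (use g in simp)
  then have rad: "fps_radical rt g S ^ g = S" using power_radical[OF S0nz, of rt g'] g' by simp
  define r where "r = fps_radical rt g S"
  have "(r ^ n) $ 0 = (r $ 0) ^ n" for n by (induction n) auto
  then have r0: "r $ 0 \<noteq> 0" using rad S0nz g unfolding r_def
    by (metis zero_power g less_eq_Suc_le One_nat_def)
  define W where "W = fls_X_inv ^ d * fps_to_fls r"
  have "fps_to_fls r \<noteq> 0" "fls_subdegree (fps_to_fls r) = 0"
    using r0 by (auto simp: fls_subdegree_fls_to_fps subdegree_eq_0)
  then have W: "W \<noteq> 0" "fls_subdegree W = - int d"
    by (auto simp: W_def)
  have X: "fls_X_inv ^ (g * d) * fps_to_fls (fps_X ^ (g * (d - j)) :: 'a fps) = (fls_X_inv ^ g) ^ j" if "j \<le> d" for j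
  proof -
    have "fls_X_inv * (fls_X :: 'a fls) = 1" by (simp add: fls_X_inv_times_conv_shift)
    then have "fls_X_inv ^ n * (fls_X :: 'a fls) ^ n = 1" for n by (metis power_mult_distrib power_one)
    then have one: "fls_X_inv ^ (g * (d - j)) * (fls_X :: 'a fls) ^ (g * (d - j)) = 1" .
    have e: "g * d = g * j + g * (d - j)" using that by (simp add: diff_mult_distrib2)
    have "fls_X_inv ^ (g * d) * fps_to_fls (fps_X ^ (g * (d - j)) :: 'a fps) =
        fls_X_inv ^ (g * j) * (fls_X_inv ^ (g * (d - j)) * (fls_X :: 'a fls) ^ (g * (d - j)))"
      by (subst e) (simp only: power_add fps_to_fls_power fps_X_to_fls mult.assoc)
    then show ?thesis unfolding one mult_1_right power_mult[of fls_X_inv g j] .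
  qed
  have "W ^ g = fls_X_inv ^ (g * d) * fps_to_fls S"
    using rad by (simp add: W_def power_mult_distrib r_def fps_to_fls_power[symmetric] power_mult[symmetric] mult.commute)
  also have "\<dots> = (\<Sum>j\<le>d. fls_const (coeff P j) * (fls_X_inv ^ g) ^ j)"
  proof -
    have "fps_to_fls (sum f I) = (\<Sum>i\<in>I. fps_to_fls (f i))" for f :: "nat \<Rightarrow> 'a fps" and I
      by (induction I rule: infinite_finite_induct) (simp_all add: fps_to_fls_plus)
    then have "fls_X_inv ^ (g * d) * fps_to_fls S =
        (\<Sum>j\<le>d. fls_X_inv ^ (g * d) * (fls_const (coeff P j) * fps_to_fls (fps_X ^ (g * (d - j)))))"
      unfolding S_def by (simp add: sum_distrib_left fls_times_fps_to_fls)
    also have "\<dots> = (\<Sum>j\<le>d. fls_const (coeff P j) * (fls_X_inv ^ g) ^ j)"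
      by (rule sum.cong) (auto simp: X[symmetric] mult.left_commute)
    finally show ?thesis .
  qed
  also have "\<dots> = lpoly (fls_X_inv ^ g) P"
    unfolding lpoly_def poly_altdef d_def
    by (rule sum.cong) (simp_all add: coeff_map_poly degree_map_poly)
  finally show ?thesis using W by (auto simp: d_def)
qed

text \<open>
  More vectors than coordinates are dependent, over an integral domain as well: eliminate one
  coordinate after the other without division.
\<close>

lemma linear_dependence:
  fixes f :: "'i \<Rightarrow> 'j \<Rightarrow> 'r::idom"
  assumes "finite J" "finite I" "card J < card I"
  shows "\<exists>c. (\<exists>i\<in>I. c i \<noteq> 0) \<and> (\<forall>j\<in>J. (\<Sum>i\<in>I. c i * f i j) = 0)"
  using assms
proof (induction J arbitrary: I f)
  case empty
  then have "I \<noteq> {}" by auto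
  then show ?case by (intro exI[of _ "\<lambda>_. 1"]) auto
next
  case (insert b J)
  show ?case
  proof (cases "\<forall>i\<in>I. f i b = 0")
    case True
    obtain c where "\<exists>i\<in>I. c i \<noteq> 0" "\<forall>j\<in>J. (\<Sum>i\<in>I. c i * f i j) = 0"
      using insert.IH[of I f] insert.prems insert.hyps by (metis Suc_lessD card_insert_disjoint)
    then show ?thesis using True by (intro exI[of _ c]) auto
  next
    case False
    then obtain p where p: "p \<in> I" "f p b \<noteq> 0" by blast
    let ?I = "I - {p}"
    have "card J < card ?I" using insert.prems insert.hyps p(1) by simp
    then have "\<exists>c. (\<exists>i\<in>?I. c i \<noteq> 0) \<and> (\<forall>j\<in>J. (\<Sum>i\<in>?I. c i * (f p b * f i j - f i b * f p j)) = 0)"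
      using insert.prems(1) by (intro insert.IH) auto
    then obtain c where c: "\<exists>i\<in>?I. c i \<noteq> 0" "\<forall>j\<in>J. (\<Sum>i\<in>?I. c i * (f p b * f i j - f i b * f p j)) = 0"
      by (elim exE conjE)
    define c' where "c' i = (if i = p then - (\<Sum>i\<in>?I. c i * f i b) else f p b * c i)" for i
    have sum: "(\<Sum>i\<in>I. c' i * f i j) = (\<Sum>i\<in>?I. c i * (f p b * f i j - f i b * f p j))" for j
    proof -
      have "(\<Sum>i\<in>I. c' i * f i j) = c' p * f p j + (\<Sum>i\<in>?I. c' i * f i j)"
        using insert.prems p by (intro sum.remove) auto
      also have "(\<Sum>i\<in>?I. c' i * f i j) = (\<Sum>i\<in>?I. c i * (f p b * f i j))"
        by (rule sum.cong) (auto simp: c'_def)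
      also have "c' p * f p j = - (\<Sum>i\<in>?I. c i * (f i b * f p j))"
        by (simp add: c'_def sum_distrib_right mult.assoc)
      finally show ?thesis by (simp add: right_diff_distrib sum_subtractf)
    qed
    have "(\<Sum>i\<in>I. c' i * f i b) = 0" unfolding sum by (simp add: mult.commute)
    moreover have "\<exists>i\<in>I. c' i \<noteq> 0" using c(1) p(2) by (auto simp: c'_def)
    ultimately show ?thesis using c(2) sum by (intro exI[of _ c']) auto
  qed
qed

lemma sum_unique_lowest_nonzero:
  fixes f :: "'i \<Rightarrow> 'a::field fls"
  assumes "finite I" "i \<in> I" "f i \<noteq> 0"
    and "\<And>j. j \<in> I \<Longrightarrow> j \<noteq> i \<Longrightarrow> f j = 0 \<or> fls_subdegree (f i) < fls_subdegree (f j)"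
  shows "(\<Sum>j\<in>I. f j) \<noteq> 0"
proof -
  have "fls_nth (\<Sum>j\<in>I. f j) (fls_subdegree (f i)) = (\<Sum>j\<in>I. fls_nth (f j) (fls_subdegree (f i)))"
    using assms(1) by (induction I) auto
  also have "\<dots> = (\<Sum>j\<in>I. if j = i then fls_nth (f i) (fls_subdegree (f i)) else 0)"
    by (rule sum.cong) (use assms(4) in \<open>force intro: fls_eq0_below_subdegree\<close>)+
  also have "\<dots> \<noteq> 0" using assms(1-3) by simp
  finally show ?thesis by auto
qed

lemma lev_smult: "lev (smult p B) Z W = lpoly Z p * lev B Z W"
  using lev_mult[of "[:p:]" B Z W] by simp

section \<open>Pole orders of automorphisms of a curve w^g = P(z)\<close>

text \<open>
  A group of maps of a set \<open>X\<close> that lies over the curve \<open>w\<^bsup>g\<^esup> = P(z)\<close>, except possibly over its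
  points with \<open>w = 0\<close>, and descends to polynomial maps of this curve. It is assumed to contain lifts of
  the rotations \<open>w \<mapsto> \<zeta> w\<close>.
\<close>

locale curve_action =
  fixes P :: "'a::{alg_closed_field, field_char_0} poly" and g :: nat
    and X :: "'x set" and z w :: "'x \<Rightarrow> 'a" and H :: "('x \<Rightarrow> 'x) set"
  assumes g_ge_1: "g \<ge> 1" and deg_P_ge_2: "degree P \<ge> 2"
    and on_curve: "\<And>x. x \<in> X \<Longrightarrow> w x ^ g = poly P (z x)"
    and curve_lift: "\<And>a b. b ^ g = poly P a \<Longrightarrow> b \<noteq> 0 \<Longrightarrow> \<exists>x\<in>X. z x = a \<and> w x = b"
    and H_maps: "\<And>\<phi> x. \<phi> \<in> H \<Longrightarrow> x \<in> X \<Longrightarrow> \<phi> x \<in> X"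
    and H_comp: "\<And>\<phi> \<psi>. \<phi> \<in> H \<Longrightarrow> \<psi> \<in> H \<Longrightarrow> \<exists>\<chi>\<in>H. \<forall>x\<in>X. \<chi> x = \<phi> (\<psi> x)"
    and H_inv: "\<And>\<phi>. \<phi> \<in> H \<Longrightarrow> \<exists>\<psi>\<in>H. \<forall>x\<in>X. \<psi> (\<phi> x) = x \<and> \<phi> (\<psi> x) = x"
    and H_poly: "\<And>\<phi>. \<phi> \<in> H \<Longrightarrow> \<exists>B. \<forall>x\<in>X. z (\<phi> x) = bev B (z x) (w x)"
      "\<And>\<phi>. \<phi> \<in> H \<Longrightarrow> \<exists>B. \<forall>x\<in>X. w (\<phi> x) = bev B (z x) (w x)"
    and H_rot: "\<And>\<zeta>. \<zeta> ^ g = 1 \<Longrightarrow> \<exists>\<alpha>\<in>H. \<forall>x\<in>X. z (\<alpha> x) = z x \<and> w (\<alpha> x) = \<zeta> * w x"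
begin

lemma P_nz: "P \<noteq> 0" using deg_P_ge_2 by auto

abbreviation "d \<equiv> degree P"

definition Z0 :: "'a fls" where "Z0 = fls_X_inv ^ g"

text \<open>
  Together with \<open>Z0\<close> this is the expansion of \<open>(z, w)\<close> on one branch at infinity. The other branches
  arise by multiplying \<open>W0\<close> with the \<open>g\<close>-th roots of unity.
\<close>

definition W0 :: "'a fls"
  where "W0 = (SOME W. W ^ g = lpoly Z0 P \<and> W \<noteq> 0 \<and> fls_subdegree W = - int d)"

lemma W0: "W0 ^ g = lpoly Z0 P" "W0 \<noteq> 0" "fls_subdegree W0 = - int d"
  using someI_ex[OF branch_at_infinity[OF g_ge_1 P_nz, folded Z0_def]] unfolding W0_def by blast+

lemma Z0: "fls_subdegree Z0 = - int g" "Z0 \<noteq> 0"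
  by (simp_all add: Z0_def)

definition roots1 :: "'a set" where "roots1 = {\<zeta>. \<zeta> ^ g = 1}"

lemma card_roots1: "card roots1 = g"
  unfolding roots1_def by (rule card_nth_roots) (use g_ge_1 in auto)

lemma roots1_nz: "\<zeta> \<in> roots1 \<Longrightarrow> \<zeta> \<noteq> 0"
  using g_ge_1 by (auto simp: roots1_def zero_power)

text \<open>
  The expansion of the function \<open>B(z, w)\<close> on the branch \<open>\<zeta>\<close>. It depends on the function only and not
  on the polynomial \<open>B\<close>.
\<close>

definition E :: "'a \<Rightarrow> 'a poly poly \<Rightarrow> 'a fls" where "E \<zeta> B = lev B Z0 (fls_const \<zeta> * W0)"

lemma fls_const_power: "fls_const (c::'a) ^ n = fls_const (c ^ n)"
  by (induction n) (simp_all add: fls_const_mult_const)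

lemma E_vanish:
  assumes \<zeta>: "\<zeta> \<in> roots1" and B: "\<And>x. x \<in> X \<Longrightarrow> bev B (z x) (w x) = 0"
  shows "E \<zeta> B = 0"
proof -
  have "\<exists>q. B = curve_eqn g P * q"
  proof (rule curve_ideal[OF g_ge_1 P_nz])
    fix a b assume "b ^ g = poly P a" "b \<noteq> 0"
    then obtain x where "x \<in> X" "z x = a" "w x = b" using curve_lift by blast
    then show "bev B a b = 0" using B by blast
  qed
  then obtain q where q: "B = curve_eqn g P * q" by blast
  have "(fls_const \<zeta> * W0) ^ g = lpoly Z0 P"
    using \<zeta> by (simp add: power_mult_distrib fls_const_power W0 roots1_def)
  then have "lev (curve_eqn g P) Z0 (fls_const \<zeta> * W0) = 0"
    by (simp add: curve_eqn_def lev_diff lev_monom)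
  then show ?thesis by (simp add: E_def q lev_mult)
qed

lemma E_eq:
  assumes "\<zeta> \<in> roots1" "\<And>x. x \<in> X \<Longrightarrow> bev A (z x) (w x) = bev B (z x) (w x)"
  shows "E \<zeta> A = E \<zeta> B"
  using E_vanish[OF assms(1), of "A - B"] assms(2) by (simp add: E_def lev_diff)

lemma reduce:
  "\<exists>r. degree r < g \<and> (\<forall>x\<in>X. bev B (z x) (w x) = bev r (z x) (w x))"
proof -
  obtain q r where "B = curve_eqn g P * q + r" "degree r < g" using curve_division[OF g_ge_1] by blast
  then show ?thesis using on_curve by (intro exI[of _ r]) auto
qed

definition Bz :: "('x \<Rightarrow> 'x) \<Rightarrow> 'a poly poly"
  where "Bz \<phi> = (SOME B. degree B < g \<and> (\<forall>x\<in>X. z (\<phi> x) = bev B (z x) (w x)))"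

definition Bw :: "('x \<Rightarrow> 'x) \<Rightarrow> 'a poly poly"
  where "Bw \<phi> = (SOME B. degree B < g \<and> (\<forall>x\<in>X. w (\<phi> x) = bev B (z x) (w x)))"

lemma Bz:
  assumes "\<phi> \<in> H"
  shows "degree (Bz \<phi>) < g" "x \<in> X \<Longrightarrow> z (\<phi> x) = bev (Bz \<phi>) (z x) (w x)"
proof -
  have "\<exists>B. degree B < g \<and> (\<forall>x\<in>X. z (\<phi> x) = bev B (z x) (w x))"
    using H_poly(1)[OF assms] reduce by metis
  from someI_ex[OF this] show "degree (Bz \<phi>) < g" "x \<in> X \<Longrightarrow> z (\<phi> x) = bev (Bz \<phi>) (z x) (w x)"
    unfolding Bz_def by blast+
qed

lemma Bw:
  assumes "\<phi> \<in> H"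
  shows "degree (Bw \<phi>) < g" "x \<in> X \<Longrightarrow> w (\<phi> x) = bev (Bw \<phi>) (z x) (w x)"
proof -
  have "\<exists>B. degree B < g \<and> (\<forall>x\<in>X. w (\<phi> x) = bev B (z x) (w x))"
    using H_poly(2)[OF assms] reduce by metis
  from someI_ex[OF this] show "degree (Bw \<phi>) < g" "x \<in> X \<Longrightarrow> w (\<phi> x) = bev (Bw \<phi>) (z x) (w x)"
    unfolding Bw_def by blast+
qed

definition Zf :: "('x \<Rightarrow> 'x) \<Rightarrow> 'a \<Rightarrow> 'a fls" where "Zf \<phi> \<zeta> = E \<zeta> (Bz \<phi>)"
definition Wf :: "('x \<Rightarrow> 'x) \<Rightarrow> 'a \<Rightarrow> 'a fls" where "Wf \<phi> \<zeta> = E \<zeta> (Bw \<phi>)"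

lemma Wf_power:
  assumes "\<phi> \<in> H" "\<zeta> \<in> roots1"
  shows "Wf \<phi> \<zeta> ^ g = lpoly (Zf \<phi> \<zeta>) P"
proof -
  have "E \<zeta> (Bw \<phi> ^ g) = E \<zeta> (psubst P (Bz \<phi>))"
    by (rule E_eq[OF assms(2)])
      (simp add: Bz(2)[OF assms(1), symmetric] Bw(2)[OF assms(1), symmetric] on_curve H_maps[OF assms(1)])
  then show ?thesis by (simp add: E_def Wf_def Zf_def lev_power lev_psubst)
qed

text \<open>
  A zero of \<open>z \<circ> \<phi>\<close> counts as a pole of order zero. If there is a pole, then the equation of the
  curve determines the order of the pole of \<open>w \<circ> \<phi>\<close>.
\<close>

definition pole :: "('x \<Rightarrow> 'x) \<Rightarrow> 'a \<Rightarrow> nat" where "pole \<phi> \<zeta> = nat (- fls_subdegree (Zf \<phi> \<zeta>))"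

lemma pole_Zf: "pole_le (int n) (Zf \<phi> \<zeta>)" if "pole \<phi> \<zeta> \<le> n"
  using that by (auto simp: pole_def pole_le_def)

lemma Zf_subdegree: "pole \<phi> \<zeta> > 0 \<Longrightarrow> fls_subdegree (Zf \<phi> \<zeta>) = - int (pole \<phi> \<zeta>)"
  by (simp add: pole_def)

lemma Wf_subdegree:
  assumes "\<phi> \<in> H" "\<zeta> \<in> roots1" "pole \<phi> \<zeta> > 0"
  shows "Wf \<phi> \<zeta> \<noteq> 0" "int g * fls_subdegree (Wf \<phi> \<zeta>) = - int (pole \<phi> \<zeta> * d)"
proof -
  have l: "lpoly (Zf \<phi> \<zeta>) P \<noteq> 0" "fls_subdegree (lpoly (Zf \<phi> \<zeta>) P) = - int (pole \<phi> \<zeta> * d)"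
    using lpoly_subdegree[OF Zf_subdegree[OF assms(3)] assms(3) P_nz] by auto
  show "Wf \<phi> \<zeta> \<noteq> 0" using Wf_power[OF assms(1,2)] l(1) g_ge_1 by (auto simp: zero_power)
  show "int g * fls_subdegree (Wf \<phi> \<zeta>) = - int (pole \<phi> \<zeta> * d)"
    using l(2) unfolding Wf_power[OF assms(1,2), symmetric] by (simp add: fls_subdegree_pow)
qed

text \<open>
  The pole orders are bounded, uniformly in \<open>\<phi>\<close>: the functions \<open>1, u, \<dots>, u^g\<close> with
  \<open>u = z \<circ> \<phi>\<^sup>-\<^sup>1\<close> are linearly dependent over the polynomials in \<open>z\<close>. Applying \<open>\<phi>\<close> to a relation
  gives a relation between \<open>1, z, \<dots>, z^g\<close> with coefficients in the polynomials in \<open>z \<circ> \<phi>\<close>; if \<open>z \<circ> \<phi>\<close>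
  had a pole of order more than \<open>g\<^sup>2\<close>, all terms of this relation would have different pole orders.
\<close>

lemma pole_bounded:
  assumes \<phi>: "\<phi> \<in> H" and \<zeta>: "\<zeta> \<in> roots1"
  shows "pole \<phi> \<zeta> \<le> g * g"
proof (rule ccontr)
  assume "\<not> ?thesis"
  then have big: "pole \<phi> \<zeta> > g * g" by simp
  define p where "p = pole \<phi> \<zeta>"
  have p: "p > g * g" "p > 0" using big by (auto simp: p_def)
  obtain \<psi> where \<psi>: "\<psi> \<in> H" "\<And>x. x \<in> X \<Longrightarrow> \<psi> (\<phi> x) = x" using H_inv[OF \<phi>] by blast
  have "\<forall>i. \<exists>r. degree r < g \<and> (\<forall>x\<in>X. bev (Bz \<psi> ^ i) (z x) (w x) = bev r (z x) (w x))"
    using reduce by blast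
  then obtain r where r: "\<And>i. degree (r i) < g" "\<And>i x. x \<in> X \<Longrightarrow> bev (Bz \<psi> ^ i) (z x) (w x) = bev (r i) (z x) (w x)"
    by metis
  obtain c where c: "\<exists>i\<in>{..g}. c i \<noteq> 0" "\<forall>j\<in>{..<g}. (\<Sum>i\<le>g. c i * coeff (r i) j) = 0"
    using linear_dependence[of "{..<g}" "{..g}" "\<lambda>i j. coeff (r i) j"] by auto
  have "(\<Sum>i\<le>g. smult (c i) (r i)) = 0"
  proof (rule poly_eqI)
    fix j show "coeff (\<Sum>i\<le>g. smult (c i) (r i)) j = coeff 0 j"
    proof (cases "j < g")
      case True
      then show ?thesis using c(2) by (simp add: coeff_sum)
    next
      case False
      then have "coeff (r i) j = 0" for i using r(1)[of i] by (intro coeff_eq_0) simp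
      then show ?thesis by (simp add: coeff_sum)
    qed
  qed
  then have rel: "(\<Sum>i\<le>g. poly (c i) (z x) * z (\<psi> x) ^ i) = 0" if "x \<in> X" for x
  proof -
    have "(\<Sum>i\<le>g. poly (c i) (z x) * z (\<psi> x) ^ i) = (\<Sum>i\<le>g. bev (smult (c i) (r i)) (z x) (w x))"
      by (rule sum.cong) (simp_all add: r(2)[OF that, symmetric] Bz(2)[OF \<psi>(1) that])
    also have "\<dots> = bev (\<Sum>i\<le>g. smult (c i) (r i)) (z x) (w x)" by (simp add: bev_sum)
    finally show ?thesis using \<open>(\<Sum>i\<le>g. smult (c i) (r i)) = 0\<close> by simp
  qed
  define Q where "Q = (\<Sum>i\<le>g. psubst (c i) (Bz \<phi>) * [:[:0, 1:]:] ^ i)"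
  have "bev Q (z x) (w x) = 0" if "x \<in> X" for x
  proof -
    have "bev Q (z x) (w x) = (\<Sum>i\<le>g. poly (c i) (z (\<phi> x)) * z (\<psi> (\<phi> x)) ^ i)"
      unfolding Q_def bev_sum by (rule sum.cong) (simp_all add: Bz(2)[OF \<phi> that] \<psi>(2)[OF that])
    then show ?thesis using rel[OF H_maps[OF \<phi> that]] by simp
  qed
  then have "E \<zeta> Q = 0" by (rule E_vanish[OF \<zeta>])
  then have zero: "(\<Sum>i\<le>g. lpoly (Zf \<phi> \<zeta>) (c i) * Z0 ^ i) = 0"
    by (simp add: E_def Q_def lev_sum lev_mult lev_power lev_psubst Zf_def)
  define I where "I = {i. i \<le> g \<and> c i \<noteq> 0}"
  define \<delta> where "\<delta> = Max (degree ` c ` I)"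
  have I: "finite I" "I \<noteq> {}" using c(1) by (auto simp: I_def)
  have \<delta>: "degree (c i) \<le> \<delta>" if "i \<in> I" for i using that I by (auto simp: \<delta>_def)
  have "\<delta> \<in> degree ` c ` I" unfolding \<delta>_def using I by (intro Max_in) auto
  then have ne: "{i \<in> I. degree (c i) = \<delta>} \<noteq> {}" by auto
  \<comment> \<open>The dominant term: the largest degree in \<open>z \<circ> \<phi>\<close>, and among those the largest power
    of \<open>z\<close>.\<close>
  define s where "s = Max {i \<in> I. degree (c i) = \<delta>}"
  have s: "s \<in> I" "degree (c s) = \<delta>" "\<And>i. i \<in> I \<Longrightarrow> degree (c i) = \<delta> \<Longrightarrow> i \<le> s"
    using Max_in[OF _ ne] I by (auto simp: s_def)
  have sub: "lpoly (Zf \<phi> \<zeta>) (c i) * Z0 ^ i \<noteq> 0"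
    "fls_subdegree (lpoly (Zf \<phi> \<zeta>) (c i) * Z0 ^ i) = - int (p * degree (c i) + g * i)" if "i \<in> I" for i
  proof -
    have "c i \<noteq> 0" using that by (simp add: I_def)
    then have "lpoly (Zf \<phi> \<zeta>) (c i) \<noteq> 0" "fls_subdegree (lpoly (Zf \<phi> \<zeta>) (c i)) = - int (p * degree (c i))"
      using lpoly_subdegree[of "Zf \<phi> \<zeta>" p "c i"] Zf_subdegree[of \<phi> \<zeta>] p(2) by (auto simp: p_def)
    then show "lpoly (Zf \<phi> \<zeta>) (c i) * Z0 ^ i \<noteq> 0"
      "fls_subdegree (lpoly (Zf \<phi> \<zeta>) (c i) * Z0 ^ i) = - int (p * degree (c i) + g * i)"
      using Z0 by (simp_all add: fls_subdegree_pow algebra_simps)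
  qed
  have "(\<Sum>i\<le>g. lpoly (Zf \<phi> \<zeta>) (c i) * Z0 ^ i) \<noteq> 0"
  proof (rule sum_unique_lowest_nonzero[of _ s])
    show "s \<in> {..g}" using s(1) by (simp add: I_def)
    show "lpoly (Zf \<phi> \<zeta>) (c s) * Z0 ^ s \<noteq> 0" by (rule sub(1)[OF s(1)])
    fix i assume i: "i \<in> {..g}" "i \<noteq> s"
    show "lpoly (Zf \<phi> \<zeta>) (c i) * Z0 ^ i = 0 \<or>
      fls_subdegree (lpoly (Zf \<phi> \<zeta>) (c s) * Z0 ^ s) < fls_subdegree (lpoly (Zf \<phi> \<zeta>) (c i) * Z0 ^ i)"
    proof (cases "i \<in> I")
      case True
      have "p * degree (c i) + g * i < p * \<delta> + g * s"
      proof (cases "degree (c i) = \<delta>")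
        case eq: True
        then have "i < s" using s(3)[OF True] i(2) by simp
        then show ?thesis using eq g_ge_1 by simp
      next
        case False
        then have "Suc (degree (c i)) \<le> \<delta>" using \<delta>[OF True] by simp
        then have "p * Suc (degree (c i)) \<le> p * \<delta>" by (rule mult_le_mono2)
        moreover have "g * i \<le> g * g" using i(1) by (intro mult_le_mono2) simp
        ultimately show ?thesis using p(1) unfolding mult_Suc_right by linarith
      qed
      then show ?thesis unfolding sub(2)[OF True] sub(2)[OF s(1)] s(2)
        by (simp only: neg_less_iff_less of_nat_less_iff simp_thms)
    qed (use i in \<open>auto simp: I_def\<close>)
  qed simp
  then show False using zero by blast
qed

text \<open>Averaging over the rotations \<open>w \<mapsto> \<zeta> w\<close> isolates the terms of a polynomial in \<open>w\<close>.\<close>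

lemma sum_roots1_power:
  assumes "j < g" "l < g"
  shows "(\<Sum>\<zeta>\<in>roots1. \<zeta> ^ (g - j) * \<zeta> ^ l) = (if l = j then of_nat g else 0)"
proof (cases "l = j")
  case True
  have "(\<Sum>\<zeta>\<in>roots1. \<zeta> ^ (g - j) * \<zeta> ^ l) = (\<Sum>\<zeta>\<in>roots1. 1)"
    by (rule sum.cong) (use True assms in \<open>auto simp: roots1_def power_add[symmetric]\<close>)
  then show ?thesis using True card_roots1 by simp
next
  case False
  define n where "n = (if l < j then g - j + l else l - j)"
  have n: "0 < n" "n < g" using False assms by (auto simp: n_def)
  have "(\<Sum>\<zeta>\<in>roots1. \<zeta> ^ (g - j) * \<zeta> ^ l) = (\<Sum>\<zeta>\<in>roots1. \<zeta> ^ n)"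
  proof (rule sum.cong)
    fix \<zeta> assume \<zeta>: "\<zeta> \<in> roots1"
    show "\<zeta> ^ (g - j) * \<zeta> ^ l = \<zeta> ^ n"
    proof (cases "l < j")
      case False
      then have "g - j + l = g + (l - j)" using assms by simp
      then have "\<zeta> ^ (g - j) * \<zeta> ^ l = \<zeta> ^ g * \<zeta> ^ (l - j)" by (metis power_add)
      then show ?thesis using \<zeta> False by (simp add: roots1_def n_def)
    qed (simp add: n_def power_add)
  qed simp
  also have "\<dots> = 0" using sum_roots_of_unity_power[OF n, where 'a = 'a] by (simp add: roots1_def)
  finally show ?thesis using False by simp
qed

lemma average_terms:
  fixes a :: "nat \<Rightarrow> 'b::comm_ring_1" and \<iota> :: "'a \<Rightarrow> 'b"
  assumes j: "j < g"
    and hom: "\<And>c. \<iota> (\<Sum>\<zeta>\<in>roots1. c \<zeta>) = (\<Sum>\<zeta>\<in>roots1. \<iota> (c \<zeta>))" "\<And>c c'. \<iota> (c * c') = \<iota> c * \<iota> c'" "\<iota> 0 = 0"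
      "\<iota> 1 = 1"
  shows "(\<Sum>\<zeta>\<in>roots1. \<iota> (\<zeta> ^ (g - j)) * (\<Sum>l<g. a l * (\<iota> \<zeta> * b) ^ l)) = \<iota> (of_nat g) * (a j * b ^ j)"
proof -
  have pow: "\<iota> (\<zeta> ^ n) = \<iota> \<zeta> ^ n" for \<zeta> n by (induction n) (simp_all add: hom)
  have "(\<Sum>\<zeta>\<in>roots1. \<iota> (\<zeta> ^ (g - j)) * (\<Sum>l<g. a l * (\<iota> \<zeta> * b) ^ l))
      = (\<Sum>\<zeta>\<in>roots1. \<Sum>l<g. \<iota> (\<zeta> ^ (g - j) * \<zeta> ^ l) * (a l * b ^ l))"
    by (simp add: sum_distrib_left power_mult_distrib hom(2) pow mult_ac)
  also have "\<dots> = (\<Sum>l<g. \<iota> (\<Sum>\<zeta>\<in>roots1. \<zeta> ^ (g - j) * \<zeta> ^ l) * (a l * b ^ l))"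
    by (subst sum.swap) (simp add: hom(1) sum_distrib_right)
  also have "\<dots> = (\<Sum>l<g. if l = j then \<iota> (of_nat g) * (a j * b ^ j) else 0)"
    by (rule sum.cong) (use j in \<open>auto simp: sum_roots1_power hom(3)\<close>)
  finally show ?thesis using j by simp
qed

lemma fls_const_sum: "fls_const (\<Sum>i\<in>I. c i :: 'a) = (\<Sum>i\<in>I. fls_const (c i))"
  by (induction I rule: infinite_finite_induct) (simp_all flip: fls_plus_const)

lemma term_subdegree:
  assumes "a \<noteq> 0"
  shows "lpoly Z0 a * W0 ^ j \<noteq> 0" "fls_subdegree (lpoly Z0 a * W0 ^ j) = - int (g * degree a + d * j)"
  using lpoly_subdegree[OF Z0(1) _ assms] g_ge_1 W0 by (simp_all add: fls_subdegree_pow algebra_simps)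

lemma coefficient_bound:
  assumes B: "degree B < g" and n: "\<And>\<zeta>. \<zeta> \<in> roots1 \<Longrightarrow> pole_le (int n) (E \<zeta> B)"
    and j: "coeff B j \<noteq> 0"
  shows "g * degree (coeff B j) + d * j \<le> n"
proof -
  have jg: "j < g" using B j le_degree[OF j] by simp
  have "fls_const (of_nat g) * (lpoly Z0 (coeff B j) * W0 ^ j) =
      (\<Sum>\<zeta>\<in>roots1. fls_const (\<zeta> ^ (g - j)) * E \<zeta> B)"
    unfolding E_def lev_altdef[OF B]
    by (rule average_terms[OF jg, symmetric]) (simp_all add: fls_const_sum fls_const_mult_const)
  moreover have "pole_le (int n) (\<Sum>\<zeta>\<in>roots1. fls_const (\<zeta> ^ (g - j)) * E \<zeta> B)"
    by (intro pole_le_sum pole_le_const_mult n)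
  ultimately have "pole_le (int n) (fls_const (of_nat g) * (lpoly Z0 (coeff B j) * W0 ^ j))" by simp
  then have "pole_le (int n) (lpoly Z0 (coeff B j) * W0 ^ j)"
    using g_ge_1 by (simp add: pole_le_const_mult_iff)
  then have "- int n \<le> - int (g * degree (coeff B j) + d * j)"
    using term_subdegree(1)[OF j, of j] unfolding pole_le_def term_subdegree(2)[OF j] by blast
  then show ?thesis by linarith
qed

text \<open>
  Let \<open>M\<close> be the largest pole order of \<open>z \<circ> \<phi>\<close> for any \<open>\<phi>\<close>, attained by \<open>\<phi>\<^sub>0\<close>. Some term
  \<open>a(z) w^j\<close> of \<open>z \<circ> \<phi>\<^sub>0\<close> has a pole of order at least \<open>M\<close>, and composing it once more with
  \<open>\<phi>\<^sub>0\<close> multiplies this order by \<open>M / g\<close>. But the result is an average of the functions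
  \<open>z \<circ> \<phi>\<^sub>0 \<circ> \<alpha> \<circ> \<phi>\<^sub>0\<close> over the rotations \<open>\<alpha>\<close>, so its pole order is at most \<open>M\<close>. Hence \<open>M \<le> g\<close>.
\<close>

lemma pole_le_g:
  assumes \<phi>: "\<phi> \<in> H" and \<zeta>: "\<zeta> \<in> roots1"
  shows "pole \<phi> \<zeta> \<le> g"
proof -
  define S where "S = {pole \<phi> \<zeta> | \<phi> \<zeta>. \<phi> \<in> H \<and> \<zeta> \<in> roots1}"
  have "S \<subseteq> {..g * g}" using pole_bounded by (auto simp: S_def)
  then have fin: "finite S" by (rule finite_subset) simp
  have "pole \<phi> \<zeta> \<in> S" using \<phi> \<zeta> by (auto simp: S_def)
  define M where "M = Max S"
  have "M \<in> S" unfolding M_def using fin \<open>pole \<phi> \<zeta> \<in> S\<close> by (intro Max_in) auto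
  then obtain \<phi>0 \<zeta>0 where 0: "\<phi>0 \<in> H" "\<zeta>0 \<in> roots1" "pole \<phi>0 \<zeta>0 = M" by (auto simp: S_def)
  have max: "pole \<phi> \<zeta> \<le> M" if "\<phi> \<in> H" "\<zeta> \<in> roots1" for \<phi> \<zeta>
    unfolding M_def using fin that by (intro Max_ge) (auto simp: S_def)
  have "M \<le> g"
  proof (cases "M = 0")
    case False
    then have Mpos: "M > 0" by simp
    let ?B = "Bz \<phi>0"
    have "\<exists>j<g. \<not> pole_le (int (M - 1)) (lpoly Z0 (coeff ?B j) * (fls_const \<zeta>0 * W0) ^ j)"
    proof (rule ccontr)
      assume "\<not> ?thesis"
      then have "pole_le (int (M - 1)) (Zf \<phi>0 \<zeta>0)"
        unfolding Zf_def E_def lev_altdef[OF Bz(1)[OF 0(1)]] by (intro pole_le_sum) auto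
      then show False using Zf_subdegree[of \<phi>0 \<zeta>0] 0(3) Mpos by (auto simp: pole_le_def)
    qed
    then obtain j where j: "j < g" "\<not> pole_le (int (M - 1)) (lpoly Z0 (coeff ?B j) * (fls_const \<zeta>0 * W0) ^ j)"
      by blast
    define a where "a = coeff ?B j"
    have eq: "lpoly Z0 a * (fls_const \<zeta>0 * W0) ^ j = fls_const (\<zeta>0 ^ j) * (lpoly Z0 a * W0 ^ j)"
      by (simp add: power_mult_distrib fls_const_power mult_ac)
    have np: "\<not> pole_le (int (M - 1)) (lpoly Z0 a * W0 ^ j)"
      using j(2) roots1_nz[OF 0(2)] unfolding a_def[symmetric] eq by (simp add: pole_le_const_mult_iff)
    then have a: "a \<noteq> 0" by auto
    \<comment> \<open>The pole order of the chosen term \<open>a(z) w\<^bsup>j\<^esup>\<close> is its weight.\<close>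
    have big: "M \<le> g * degree a + d * j"
    proof -
      have "\<not> - int (M - 1) \<le> - int (g * degree a + d * j)"
        using np unfolding pole_le_def term_subdegree(2)[OF a] by blast
      then show ?thesis using Mpos by linarith
    qed

    have "\<forall>\<zeta>. \<exists>\<chi>. \<zeta> \<in> roots1 \<longrightarrow> \<chi> \<in> H \<and> (\<forall>x\<in>X. z (\<chi> x) = bev ?B (z (\<phi>0 x)) (\<zeta> * w (\<phi>0 x)))"
    proof (intro allI, goal_cases)
      case (1 \<zeta>)
      show ?case
      proof (cases "\<zeta> \<in> roots1")
        case True
        obtain \<alpha> where \<alpha>: "\<alpha> \<in> H" "\<And>x. x \<in> X \<Longrightarrow> z (\<alpha> x) = z x" "\<And>x. x \<in> X \<Longrightarrow> w (\<alpha> x) = \<zeta> * w x"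
          using H_rot[of \<zeta>] True by (auto simp: roots1_def)
        obtain \<chi>' where \<chi>': "\<chi>' \<in> H" "\<And>x. x \<in> X \<Longrightarrow> \<chi>' x = \<alpha> (\<phi>0 x)" using H_comp[OF \<alpha>(1) 0(1)] by blast
        obtain \<chi> where \<chi>: "\<chi> \<in> H" "\<And>x. x \<in> X \<Longrightarrow> \<chi> x = \<phi>0 (\<chi>' x)" using H_comp[OF 0(1) \<chi>'(1)] by blast
        have "z (\<chi> x) = bev ?B (z (\<phi>0 x)) (\<zeta> * w (\<phi>0 x))" if "x \<in> X" for x
          using that H_maps[OF 0(1) that] H_maps[OF \<alpha>(1) H_maps[OF 0(1) that]]
          by (simp add: \<chi>(2) \<chi>'(2) Bz(2)[OF 0(1)] \<alpha>(2,3))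
        then show ?thesis using \<chi>(1) by blast
      qed auto
    qed
    then obtain \<chi> where "\<forall>\<zeta>. \<zeta> \<in> roots1 \<longrightarrow> \<chi> \<zeta> \<in> H \<and> (\<forall>x\<in>X. z (\<chi> \<zeta> x) = bev ?B (z (\<phi>0 x)) (\<zeta> * w (\<phi>0 x)))"
      by (rule choice[THEN exE])
    then have \<chi>: "\<And>\<zeta>. \<zeta> \<in> roots1 \<Longrightarrow> \<chi> \<zeta> \<in> H"
      "\<And>\<zeta> x. \<zeta> \<in> roots1 \<Longrightarrow> x \<in> X \<Longrightarrow> z (\<chi> \<zeta> x) = bev ?B (z (\<phi>0 x)) (\<zeta> * w (\<phi>0 x))"
      by blast+
    \<comment> \<open>\<open>T\<close> is the term composed with \<open>\<phi>\<^sub>0\<close>, and \<open>A\<close> is \<open>g\<close> times this function, written as a sum over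
      the rotations.\<close>
    define T where "T = psubst a ?B * Bw \<phi>0 ^ j"
    define A where "A = (\<Sum>\<zeta>\<in>roots1. [:[:\<zeta> ^ (g - j):]:] * Bz (\<chi> \<zeta>))"
    have "E \<zeta>0 ([:[:of_nat g:]:] * T) = E \<zeta>0 A"
    proof (rule E_eq[OF 0(2)])
      fix x assume x: "x \<in> X"
      have "bev A (z x) (w x) = (\<Sum>\<zeta>\<in>roots1. \<zeta> ^ (g - j) * (\<Sum>l<g. poly (coeff ?B l) (z (\<phi>0 x)) * (\<zeta> * w (\<phi>0 x)) ^ l))"
        unfolding A_def bev_sum
        by (rule sum.cong) (simp_all add: Bz(2)[OF \<chi>(1) x, symmetric] \<chi>(2)[OF _ x] bev_altdef[OF Bz(1)[OF 0(1)]])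
      also have "\<dots> = of_nat g * (poly (coeff ?B j) (z (\<phi>0 x)) * w (\<phi>0 x) ^ j)"
        by (rule average_terms[OF j(1), of "\<lambda>c. c"]) simp_all
      finally show "bev ([:[:of_nat g:]:] * T) (z x) (w x) = bev A (z x) (w x)"
        using Bz(2)[OF 0(1) x] Bw(2)[OF 0(1) x] by (simp add: T_def a_def)
    qed
    moreover have "E \<zeta>0 A = (\<Sum>\<zeta>\<in>roots1. fls_const (\<zeta> ^ (g - j)) * Zf (\<chi> \<zeta>) \<zeta>0)"
      unfolding A_def E_def lev_sum Zf_def by (rule sum.cong) (simp_all add: lev_mult lev_smult)
    moreover have "pole_le (int M) (\<Sum>\<zeta>\<in>roots1. fls_const (\<zeta> ^ (g - j)) * Zf (\<chi> \<zeta>) \<zeta>0)"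
      by (intro pole_le_sum pole_le_const_mult pole_Zf max \<chi>(1) 0(2))
    moreover have "E \<zeta>0 ([:[:of_nat g:]:] * T) = fls_const (of_nat g) * (lpoly (Zf \<phi>0 \<zeta>0) a * Wf \<phi>0 \<zeta>0 ^ j)"
      by (simp add: T_def E_def lev_smult lev_mult lev_power lev_psubst Zf_def Wf_def)
    ultimately have pl: "pole_le (int M) (lpoly (Zf \<phi>0 \<zeta>0) a * Wf \<phi>0 \<zeta>0 ^ j)"
      using g_ge_1 by (simp add: pole_le_const_mult_iff)
    have l: "lpoly (Zf \<phi>0 \<zeta>0) a \<noteq> 0" "fls_subdegree (lpoly (Zf \<phi>0 \<zeta>0) a) = - int (M * degree a)"
      using lpoly_subdegree[OF Zf_subdegree _ a, of \<phi>0 \<zeta>0] 0(3) Mpos by auto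
    have Wf: "Wf \<phi>0 \<zeta>0 \<noteq> 0" "int g * fls_subdegree (Wf \<phi>0 \<zeta>0) = - int (M * d)"
      using Wf_subdegree[OF 0(1,2)] 0(3) Mpos by auto
    \<comment> \<open>On the branch \<open>\<zeta>\<^sub>0\<close> the function \<open>z \<circ> \<phi>\<^sub>0\<close> has pole order \<open>M\<close> and \<open>w \<circ> \<phi>\<^sub>0\<close> has pole
      order \<open>M d / g\<close>, so \<open>T\<close> has pole order \<open>M (g degree a + d j) / g\<close>.\<close>
    have "- int M \<le> - int (M * degree a) + int j * fls_subdegree (Wf \<phi>0 \<zeta>0)"
      using pl l Wf(1) by (simp add: pole_le_def fls_subdegree_pow)
    then have "int g * (- int M) \<le> int g * (- int (M * degree a) + int j * fls_subdegree (Wf \<phi>0 \<zeta>0))"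
      by (rule mult_left_mono) simp
    also have "\<dots> = - int g * int (M * degree a) + int j * (int g * fls_subdegree (Wf \<phi>0 \<zeta>0))"
      by (simp add: algebra_simps)
    also have "\<dots> = - int (M * (g * degree a + d * j))" unfolding Wf(2) by (simp add: algebra_simps)
    also have "\<dots> \<le> - int (M * M)"
      using mult_le_mono2[OF big, of M] by (simp only: neg_le_iff_le of_nat_le_iff)
    finally have "int (M * M) \<le> int (g * M)" by simp
    then have "M * M \<le> g * M" by (simp only: of_nat_le_iff)
    then show ?thesis using Mpos by simp
  qed simp
  then show ?thesis using max[OF \<phi> \<zeta>] by simp
qed

lemma pole_Wf:
  assumes \<phi>: "\<phi> \<in> H" and \<zeta>: "\<zeta> \<in> roots1"
  shows "pole_le (int d) (Wf \<phi> \<zeta>)"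
proof (cases "pole \<phi> \<zeta> > 0")
  case True
  have "int g * - int d \<le> int g * fls_subdegree (Wf \<phi> \<zeta>)"
  proof -
    have "pole \<phi> \<zeta> * d \<le> g * d" using pole_le_g[OF \<phi> \<zeta>] by (rule mult_le_mono1)
    then have "int (pole \<phi> \<zeta> * d) \<le> int (g * d)" by (simp only: of_nat_le_iff)
    then show ?thesis unfolding Wf_subdegree(2)[OF \<phi> \<zeta> True] by simp
  qed
  then have "- int d \<le> fls_subdegree (Wf \<phi> \<zeta>)"
    by (rule mult_left_le_imp_le) (use g_ge_1 in simp)
  then show ?thesis by (simp add: pole_le_def)
next
  case False
  then have "pole_le 0 (Wf \<phi> \<zeta> ^ g)"
    unfolding Wf_power[OF \<phi> \<zeta>] by (intro lpoly_regular) (simp add: pole_def)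
  then have "Wf \<phi> \<zeta> = 0 \<or> 0 \<le> fls_subdegree (Wf \<phi> \<zeta>)"
    using g_ge_1 by (auto simp: pole_le_def fls_subdegree_pow zero_le_mult_iff)
  then show ?thesis by (auto simp: pole_le_def)
qed

text \<open>
  With the weights \<open>g\<close> for \<open>z\<close> and \<open>d\<close> for \<open>w\<close>, the components of an automorphism have at most the weights
  of \<open>z\<close> and \<open>w\<close>.
\<close>

theorem degree_bounds:
  assumes \<phi>: "\<phi> \<in> H"
  shows "coeff (Bz \<phi>) j \<noteq> 0 \<Longrightarrow> g * degree (coeff (Bz \<phi>) j) + d * j \<le> g"
    and "coeff (Bw \<phi>) j \<noteq> 0 \<Longrightarrow> g * degree (coeff (Bw \<phi>) j) + d * j \<le> d"
  using coefficient_bound[OF Bz(1)[OF \<phi>], of g j] pole_Zf[OF pole_le_g[OF \<phi>]]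
    coefficient_bound[OF Bw(1)[OF \<phi>], of d j] pole_Wf[OF \<phi>]
  by (auto simp: Zf_def Wf_def)

end

section \<open>Groups of triangular and of affine transformations are solvable\<close>

locale bij_action =
  fixes Y X :: "'x set" and H :: "('x \<Rightarrow> 'x) set"
  assumes H_subgroup: "subgroup H (BijGroup Y)" and X_Y: "X \<subseteq> Y"
    and H_X: "\<And>\<phi> x. \<phi> \<in> H \<Longrightarrow> x \<in> X \<Longrightarrow> \<phi> x \<in> X"
begin

lemma H_Bij: "\<phi> \<in> H \<Longrightarrow> \<phi> \<in> Bij Y"
  using subgroup.subset[OF H_subgroup] by (auto simp: BijGroup_sel)

lemma H_inverse: "\<phi> \<in> H \<Longrightarrow> \<exists>\<psi>\<in>H. \<forall>x\<in>Y. \<psi> (\<phi> x) = x \<and> \<phi> (\<psi> x) = x"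
  using BijGroup_inv[OF H_Bij] subgroup.m_inv_closed[OF H_subgroup] by metis

lemma H_surj_X: "\<phi> \<in> H \<Longrightarrow> y \<in> X \<Longrightarrow> \<exists>x\<in>X. y = \<phi> x"
  using H_inverse[of \<phi>] H_X X_Y by (metis subsetD)

lemma subgroup_on_X:
  assumes one: "\<And>f. f \<in> H \<Longrightarrow> (\<And>x. x \<in> X \<Longrightarrow> f x = x) \<Longrightarrow> Q f"
    and comp: "\<And>f g h. f \<in> H \<Longrightarrow> g \<in> H \<Longrightarrow> h \<in> H \<Longrightarrow> Q f \<Longrightarrow> Q g \<Longrightarrow> (\<And>x. x \<in> X \<Longrightarrow> h x = f (g x)) \<Longrightarrow> Q h"
    and inv: "\<And>f h. f \<in> H \<Longrightarrow> h \<in> H \<Longrightarrow> Q f \<Longrightarrow> (\<And>x. x \<in> X \<Longrightarrow> f (h x) = x) \<Longrightarrow> Q h"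
  shows "subgroup {f \<in> H. Q f} (BijGroup Y)"
  by (rule subgroup_BijGroup_restrict[OF H_subgroup])
     (use X_Y in \<open>blast intro: one comp inv dest: subsetD\<close>)+

text \<open>
  A commutator is determined by \<open>g (f x) \<mapsto> f (g x)\<close>; it suffices to look at this map on \<open>X\<close>.
\<close>

lemma derives_into_on_X:
  assumes K: "subgroup {f \<in> H. Q f} (BijGroup Y)" and K': "subgroup {f \<in> H. Q' f} (BijGroup Y)"
    and comm: "\<And>f g c. f \<in> H \<Longrightarrow> g \<in> H \<Longrightarrow> c \<in> H \<Longrightarrow> Q f \<Longrightarrow> Q g \<Longrightarrow>
      (\<And>x. x \<in> X \<Longrightarrow> c (g (f x)) = f (g x)) \<Longrightarrow> (\<And>y. y \<in> X \<Longrightarrow> \<exists>x\<in>X. y = g (f x)) \<Longrightarrow> Q' c"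
  shows "derives_into (BijGroup Y) {f \<in> H. Q f} {f \<in> H. Q' f}"
proof (rule derives_into_BijGroup[OF K K'])
  fix f g c
  assume f: "f \<in> {f \<in> H. Q f}" and g: "g \<in> {f \<in> H. Q f}" and c: "c \<in> {f \<in> H. Q f}"
    and eq: "\<And>x. x \<in> Y \<Longrightarrow> c (g (f x)) = f (g x)"
  have "\<exists>x\<in>X. y = g (f x)" if "y \<in> X" for y
    using H_surj_X[of g y] H_surj_X[of f] f g that by blast
  moreover have "c (g (f x)) = f (g x)" if "x \<in> X" for x using eq X_Y that by blast
  ultimately have "Q' c" using comm[of f g c] f g c by blast
  then show "c \<in> {f \<in> H. Q' f}" using c by blast
qed

lemma derives_into_trans_BijGroup:
  "derives_into (BijGroup Y) A B \<Longrightarrow> derives_into (BijGroup Y) B C \<Longrightarrow> derives_into (BijGroup Y) A C"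
  by (rule group.derives_into_trans[OF group_BijGroup])

text \<open>
  Four commutator steps remove in turn the factor of \<open>p\<close>, the translation of \<open>p\<close>, the factor of \<open>q\<close>, and
  the shift of \<open>q\<close> by a function of \<open>p\<close>.
\<close>

lemma triangular_derives_into:
  fixes p q :: "'x \<Rightarrow> 'a::field"
  assumes tri: "\<And>\<phi>. \<phi> \<in> H \<Longrightarrow> \<exists>\<alpha> \<beta> \<gamma> Q. \<forall>x\<in>X. p (\<phi> x) = \<alpha> * p x + \<beta> \<and> q (\<phi> x) = \<gamma> * q x + Q (p x)"
  shows "derives_into (BijGroup Y) H {\<phi> \<in> H. \<forall>x\<in>X. p (\<phi> x) = p x \<and> q (\<phi> x) = q x}"
proof -
  define Q1 where "Q1 \<phi> \<longleftrightarrow> (\<exists>\<beta>. \<forall>x\<in>X. p (\<phi> x) = p x + \<beta>)" for \<phi>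
  define Q2 where "Q2 \<phi> \<longleftrightarrow> (\<forall>x\<in>X. p (\<phi> x) = p x)" for \<phi>
  define Q3 where "Q3 \<phi> \<longleftrightarrow> (\<forall>x\<in>X. p (\<phi> x) = p x) \<and> (\<exists>r. \<forall>x\<in>X. q (\<phi> x) = q x + r (p x))" for \<phi>
  define Q4 where "Q4 \<phi> \<longleftrightarrow> (\<forall>x\<in>X. p (\<phi> x) = p x \<and> q (\<phi> x) = q x)" for \<phi>
  have K0: "subgroup {\<phi> \<in> H. True} (BijGroup Y)" using H_subgroup by simp
  have K1: "subgroup {\<phi> \<in> H. Q1 \<phi>} (BijGroup Y)"
  proof (rule subgroup_on_X)
    fix f g h assume "g \<in> H" "Q1 f" "Q1 g" and h: "\<And>x. x \<in> X \<Longrightarrow> h x = f (g x)"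
    then obtain \<beta> \<beta>' where "\<forall>x\<in>X. p (f x) = p x + \<beta>" "\<forall>x\<in>X. p (g x) = p x + \<beta>'" by (auto simp: Q1_def)
    then show "Q1 h" unfolding Q1_def using h H_X[OF \<open>g \<in> H\<close>]
      by (intro exI[of _ "\<beta>' + \<beta>"]) (simp add: add.assoc)
  next
    fix f h assume "h \<in> H" "Q1 f" and h: "\<And>x. x \<in> X \<Longrightarrow> f (h x) = x"
    then obtain \<beta> where \<beta>: "\<forall>x\<in>X. p (f x) = p x + \<beta>" by (auto simp: Q1_def)
    have "p (h x) = p x + - \<beta>" if "x \<in> X" for x
      using \<beta> h[OF that] H_X[OF \<open>h \<in> H\<close> that] by (metis add_diff_cancel diff_conv_add_uminus)
    then show "Q1 h" unfolding Q1_def by blast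
  qed (auto simp: Q1_def intro!: exI[of _ 0])
  have K2: "subgroup {\<phi> \<in> H. Q2 \<phi>} (BijGroup Y)"
    by (rule subgroup_on_X) (auto simp: Q2_def H_X, metis H_X)
  have K3: "subgroup {\<phi> \<in> H. Q3 \<phi>} (BijGroup Y)"
  proof (rule subgroup_on_X)
    fix f g h assume "g \<in> H" "Q3 f" "Q3 g" and h: "\<And>x. x \<in> X \<Longrightarrow> h x = f (g x)"
    then obtain r r' where "\<forall>x\<in>X. q (f x) = q x + r (p x)" "\<forall>x\<in>X. q (g x) = q x + r' (p x)"
      "\<forall>x\<in>X. p (f x) = p x" "\<forall>x\<in>X. p (g x) = p x" by (auto simp: Q3_def)
    then show "Q3 h" unfolding Q3_def using h H_X[OF \<open>g \<in> H\<close>]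
      by (intro conjI exI[of _ "\<lambda>t. r' t + r t"]) (simp_all add: add.assoc)
  next
    fix f h assume "h \<in> H" "Q3 f" and h: "\<And>x. x \<in> X \<Longrightarrow> f (h x) = x"
    then obtain r where r: "\<forall>x\<in>X. q (f x) = q x + r (p x)" "\<forall>x\<in>X. p (f x) = p x" by (auto simp: Q3_def)
    have ph: "p (h x) = p x" if "x \<in> X" for x
      using r(2) h[OF that] H_X[OF \<open>h \<in> H\<close> that] by metis
    have "q (h x) = q x + - r (p x)" if "x \<in> X" for x
      using r(1) h[OF that] H_X[OF \<open>h \<in> H\<close> that] ph[OF that] by (metis add_diff_cancel diff_conv_add_uminus)
    then show "Q3 h" unfolding Q3_def using ph by (intro conjI exI[of _ "\<lambda>t. - r t"]) auto
  qed (auto simp: Q3_def intro!: exI[of _ "\<lambda>_. 0"])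
  have K4: "subgroup {\<phi> \<in> H. Q4 \<phi>} (BijGroup Y)"
    by (rule subgroup_on_X) (auto simp: Q4_def H_X, (metis H_X)+)
  have "derives_into (BijGroup Y) {\<phi> \<in> H. True} {\<phi> \<in> H. Q1 \<phi>}"
  proof (rule derives_into_on_X[OF K0 K1])
    fix f g c assume fg: "f \<in> H" "g \<in> H" and c: "\<And>x. x \<in> X \<Longrightarrow> c (g (f x)) = f (g x)"
      and s: "\<And>y. y \<in> X \<Longrightarrow> \<exists>x\<in>X. y = g (f x)"
    obtain \<alpha> \<beta> \<alpha>' \<beta>' where f: "\<forall>x\<in>X. p (f x) = \<alpha> * p x + \<beta>" and g: "\<forall>x\<in>X. p (g x) = \<alpha>' * p x + \<beta>'"
      using tri[OF fg(1)] tri[OF fg(2)] by meson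
    have "p (c y) = p y + (\<alpha> * \<beta>' + \<beta> - (\<alpha>' * \<beta> + \<beta>'))" if "y \<in> X" for y
    proof -
      obtain x where x: "x \<in> X" "y = g (f x)" using s \<open>y \<in> X\<close> by blast
      then show ?thesis using f g c H_X[OF fg(1)] H_X[OF fg(2)] by (simp add: algebra_simps)
    qed
    then show "Q1 c" unfolding Q1_def by blast
  qed
  moreover have "derives_into (BijGroup Y) {\<phi> \<in> H. Q1 \<phi>} {\<phi> \<in> H. Q2 \<phi>}"
  proof (rule derives_into_on_X[OF K1 K2])
    fix f g c assume fg: "f \<in> H" "g \<in> H" "Q1 f" "Q1 g" and c: "\<And>x. x \<in> X \<Longrightarrow> c (g (f x)) = f (g x)"
      and s: "\<And>y. y \<in> X \<Longrightarrow> \<exists>x\<in>X. y = g (f x)"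
    obtain \<beta> \<beta>' where f: "\<forall>x\<in>X. p (f x) = p x + \<beta>" and g: "\<forall>x\<in>X. p (g x) = p x + \<beta>'"
      using fg(3,4) by (auto simp: Q1_def)
    have "p (c y) = p y" if "y \<in> X" for y
    proof -
      obtain x where x: "x \<in> X" "y = g (f x)" using s \<open>y \<in> X\<close> by blast
      then show ?thesis using f g c H_X[OF fg(1)] H_X[OF fg(2)] by (simp add: algebra_simps)
    qed
    then show "Q2 c" unfolding Q2_def by blast
  qed
  moreover have "derives_into (BijGroup Y) {\<phi> \<in> H. Q2 \<phi>} {\<phi> \<in> H. Q3 \<phi>}"
  proof (rule derives_into_on_X[OF K2 K3])
    fix f g c assume fg: "f \<in> H" "g \<in> H" "Q2 f" "Q2 g" and c: "\<And>x. x \<in> X \<Longrightarrow> c (g (f x)) = f (g x)"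
      and s: "\<And>y. y \<in> X \<Longrightarrow> \<exists>x\<in>X. y = g (f x)"
    obtain \<gamma> r \<gamma>' r' where f: "\<forall>x\<in>X. q (f x) = \<gamma> * q x + r (p x)" and g: "\<forall>x\<in>X. q (g x) = \<gamma>' * q x + r' (p x)"
      using tri[OF fg(1)] tri[OF fg(2)] by meson
    have pp: "\<forall>x\<in>X. p (f x) = p x" "\<forall>x\<in>X. p (g x) = p x" using fg(3,4) by (simp_all add: Q2_def)
    have "p (c y) = p y \<and> q (c y) = q y + (\<gamma> * r' (p y) + r (p y) - (\<gamma>' * r (p y) + r' (p y)))" if "y \<in> X" for y
    proof -
      obtain x where x: "x \<in> X" "y = g (f x)" using s \<open>y \<in> X\<close> by blast
      then show ?thesis using f g c pp H_X[OF fg(1)] H_X[OF fg(2)] by (simp add: algebra_simps)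
    qed
    then show "Q3 c" unfolding Q3_def
      by (intro conjI exI[of _ "\<lambda>t. \<gamma> * r' t + r t - (\<gamma>' * r t + r' t)"]) auto
  qed
  moreover have "derives_into (BijGroup Y) {\<phi> \<in> H. Q3 \<phi>} {\<phi> \<in> H. Q4 \<phi>}"
  proof (rule derives_into_on_X[OF K3 K4])
    fix f g c assume fg: "f \<in> H" "g \<in> H" "Q3 f" "Q3 g" and c: "\<And>x. x \<in> X \<Longrightarrow> c (g (f x)) = f (g x)"
      and s: "\<And>y. y \<in> X \<Longrightarrow> \<exists>x\<in>X. y = g (f x)"
    obtain r r' where r: "\<forall>x\<in>X. q (f x) = q x + r (p x)" "\<forall>x\<in>X. q (g x) = q x + r' (p x)"
      "\<forall>x\<in>X. p (f x) = p x" "\<forall>x\<in>X. p (g x) = p x" using fg(3,4) by (auto simp: Q3_def)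
    have "p (c y) = p y \<and> q (c y) = q y" if "y \<in> X" for y
    proof -
      obtain x where x: "x \<in> X" "y = g (f x)" using s \<open>y \<in> X\<close> by blast
      then show ?thesis using r c H_X[OF fg(1)] H_X[OF fg(2)] by (simp add: algebra_simps)
    qed
    then show "Q4 c" unfolding Q4_def by blast
  qed
  ultimately have "derives_into (BijGroup Y) {\<phi> \<in> H. True} {\<phi> \<in> H. Q4 \<phi>}"
    by (blast intro: derives_into_trans_BijGroup)
  then show ?thesis by (simp add: Q4_def)
qed

text \<open>
  Three commutator steps remove in turn the exchange of the coordinates, the factors, and the
  translations.
\<close>

lemma monomial_affine_derives_into:
  fixes p q :: "'x \<Rightarrow> 'a::field"
  assumes aff: "\<And>\<phi>. \<phi> \<in> H \<Longrightarrow> \<exists>\<alpha> e \<delta> e'. \<alpha> \<noteq> 0 \<and> \<delta> \<noteq> 0 \<and>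
    ((\<forall>x\<in>X. p (\<phi> x) = \<alpha> * p x + e \<and> q (\<phi> x) = \<delta> * q x + e') \<or>
     (\<forall>x\<in>X. p (\<phi> x) = \<alpha> * q x + e \<and> q (\<phi> x) = \<delta> * p x + e'))"
  shows "derives_into (BijGroup Y) H {\<phi> \<in> H. \<forall>x\<in>X. p (\<phi> x) = p x \<and> q (\<phi> x) = q x}"
proof -
  define Q1 where "Q1 \<phi> \<longleftrightarrow> (\<exists>\<alpha> e \<delta> e'. \<alpha> \<noteq> 0 \<and> \<delta> \<noteq> 0 \<and> (\<forall>x\<in>X. p (\<phi> x) = \<alpha> * p x + e \<and> q (\<phi> x) = \<delta> * q x + e'))" for \<phi>
  define Q2 where "Q2 \<phi> \<longleftrightarrow> (\<exists>e e'. \<forall>x\<in>X. p (\<phi> x) = p x + e \<and> q (\<phi> x) = q x + e')" for \<phi>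
  define Q3 where "Q3 \<phi> \<longleftrightarrow> (\<forall>x\<in>X. p (\<phi> x) = p x \<and> q (\<phi> x) = q x)" for \<phi>
  have K0: "subgroup {\<phi> \<in> H. True} (BijGroup Y)" using H_subgroup by simp
  have inv_aff: "t = inverse \<alpha> * s + (- inverse \<alpha> * e)" if "s = \<alpha> * t + e" "\<alpha> \<noteq> 0" for s t \<alpha> e :: 'a
    using that by (simp add: field_simps)
  have K1: "subgroup {\<phi> \<in> H. Q1 \<phi>} (BijGroup Y)"
  proof (rule subgroup_on_X)
    show "Q1 f" if "\<And>x. x \<in> X \<Longrightarrow> f x = x" for f
      unfolding Q1_def using that by (intro exI[of _ 1] exI[of _ 0]) auto
    fix f g h assume "g \<in> H" and Q: "Q1 f" "Q1 g" and h: "\<And>x. x \<in> X \<Longrightarrow> h x = f (g x)"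
    obtain \<alpha> e \<delta> e' where nz1: "\<alpha> \<noteq> 0" "\<delta> \<noteq> 0"
      and f: "\<forall>x\<in>X. p (f x) = \<alpha> * p x + e \<and> q (f x) = \<delta> * q x + e'"
      using Q(1)[unfolded Q1_def] by (elim exE conjE) (rule that)
    obtain A E D E' where nz2: "A \<noteq> 0" "D \<noteq> 0"
      and g: "\<forall>x\<in>X. p (g x) = A * p x + E \<and> q (g x) = D * q x + E'"
      using Q(2)[unfolded Q1_def] by (elim exE conjE) (rule that)
    note fg = f g and nz = nz1 nz2
    have "\<forall>x\<in>X. p (h x) = (\<alpha> * A) * p x + (\<alpha> * E + e) \<and> q (h x) = (\<delta> * D) * q x + (\<delta> * E' + e')"
      using fg h H_X[OF \<open>g \<in> H\<close>] by (simp add: algebra_simps)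
    then show "Q1 h" unfolding Q1_def using nz by (metis mult_eq_0_iff)
  next
    fix f h assume "h \<in> H" "Q1 f" and h: "\<And>x. x \<in> X \<Longrightarrow> f (h x) = x"
    then obtain \<alpha> e \<delta> e' where nz: "\<alpha> \<noteq> 0" "\<delta> \<noteq> 0"
      and f: "\<forall>x\<in>X. p (f x) = \<alpha> * p x + e \<and> q (f x) = \<delta> * q x + e'" unfolding Q1_def
      by (elim exE conjE) (rule that)
    have "\<forall>x\<in>X. p (h x) = inverse \<alpha> * p x + (- inverse \<alpha> * e) \<and> q (h x) = inverse \<delta> * q x + (- inverse \<delta> * e')"
    proof
      fix x assume x: "x \<in> X"
      have "p x = \<alpha> * p (h x) + e" "q x = \<delta> * q (h x) + e'" using f h[OF x] H_X[OF \<open>h \<in> H\<close> x] by metis+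
      then show "p (h x) = inverse \<alpha> * p x + (- inverse \<alpha> * e) \<and> q (h x) = inverse \<delta> * q x + (- inverse \<delta> * e')"
        using inv_aff nz by blast
    qed
    then show "Q1 h" unfolding Q1_def using nz by (metis inverse_zero_imp_zero)
  qed
  have K2: "subgroup {\<phi> \<in> H. Q2 \<phi>} (BijGroup Y)"
  proof (rule subgroup_on_X)
    fix f g h assume "g \<in> H" "Q2 f" "Q2 g" and h: "\<And>x. x \<in> X \<Longrightarrow> h x = f (g x)"
    then obtain e e' E E' where "\<forall>x\<in>X. p (f x) = p x + e \<and> q (f x) = q x + e'"
        "\<forall>x\<in>X. p (g x) = p x + E \<and> q (g x) = q x + E'" unfolding Q2_def by (elim exE) (rule that)
    then show "Q2 h" unfolding Q2_def using h H_X[OF \<open>g \<in> H\<close>]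
      by (intro exI[of _ "E + e"] exI[of _ "E' + e'"]) (simp add: add.assoc)
  next
    fix f h assume "h \<in> H" "Q2 f" and h: "\<And>x. x \<in> X \<Longrightarrow> f (h x) = x"
    then obtain e e' where f: "\<forall>x\<in>X. p (f x) = p x + e \<and> q (f x) = q x + e'" unfolding Q2_def by auto
    have "p (h x) = p x + - e \<and> q (h x) = q x + - e'" if "x \<in> X" for x
      using f h[OF that] H_X[OF \<open>h \<in> H\<close> that] by (metis add_diff_cancel diff_conv_add_uminus)
    then show "Q2 h" unfolding Q2_def by blast
  qed (auto simp: Q2_def intro!: exI[of _ 0])
  have K3: "subgroup {\<phi> \<in> H. Q3 \<phi>} (BijGroup Y)"
    by (rule subgroup_on_X) (auto simp: Q3_def H_X, (metis H_X)+)
  have ratio: "s = (A / A') * t + (B - A * B' / A')" if "s = A * r + B" "t = A' * r + B'" "A' \<noteq> 0"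
    for s t r A A' B B' :: 'a
    using that by (simp add: field_simps)
  have "derives_into (BijGroup Y) {\<phi> \<in> H. True} {\<phi> \<in> H. Q1 \<phi>}"
  proof (rule derives_into_on_X[OF K0 K1])
    fix f g c assume fg: "f \<in> H" "g \<in> H" and c: "\<And>x. x \<in> X \<Longrightarrow> c (g (f x)) = f (g x)"
      and s: "\<And>y. y \<in> X \<Longrightarrow> \<exists>x\<in>X. y = g (f x)"
    have main: "\<exists>A A' B B' C C' E E'. A \<noteq> 0 \<and> A' \<noteq> 0 \<and> C \<noteq> 0 \<and> C' \<noteq> 0 \<and> (\<forall>x\<in>X. \<exists>r r'.
        p (f (g x)) = A * r + B \<and> p (g (f x)) = A' * r + B' \<and>
        q (f (g x)) = C * r' + E \<and> q (g (f x)) = C' * r' + E')"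
    proof -
      obtain a e d e' where nz: "a \<noteq> 0" "d \<noteq> 0" and
        f: "(\<forall>x\<in>X. p (f x) = a * p x + e \<and> q (f x) = d * q x + e') \<or>
            (\<forall>x\<in>X. p (f x) = a * q x + e \<and> q (f x) = d * p x + e')" using aff[OF fg(1)] by meson
      obtain a1 e1 d1 e1' where nz1: "a1 \<noteq> 0" "d1 \<noteq> 0" and
        g: "(\<forall>x\<in>X. p (g x) = a1 * p x + e1 \<and> q (g x) = d1 * q x + e1') \<or>
            (\<forall>x\<in>X. p (g x) = a1 * q x + e1 \<and> q (g x) = d1 * p x + e1')" using aff[OF fg(2)] by meson
      note hx = H_X[OF fg(1)] H_X[OF fg(2)]
      show ?thesis
      proof (cases "\<forall>x\<in>X. p (f x) = a * p x + e \<and> q (f x) = d * q x + e'")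
        case f1: True
        show ?thesis
        proof (cases "\<forall>x\<in>X. p (g x) = a1 * p x + e1 \<and> q (g x) = d1 * q x + e1'")
          case True
          have "\<forall>x\<in>X. p (f (g x)) = (a * a1) * p x + (a * e1 + e) \<and> p (g (f x)) = (a1 * a) * p x + (a1 * e + e1) \<and>
            q (f (g x)) = (d * d1) * q x + (d * e1' + e') \<and> q (g (f x)) = (d1 * d) * q x + (d1 * e' + e1')"
            using f1 True hx by (simp add: algebra_simps)
          then show ?thesis using nz nz1 by (metis mult_eq_0_iff)
        next
          case False
          then have g1: "\<forall>x\<in>X. p (g x) = a1 * q x + e1 \<and> q (g x) = d1 * p x + e1'" using g by blast
          have "\<forall>x\<in>X. p (f (g x)) = (a * a1) * q x + (a * e1 + e) \<and> p (g (f x)) = (a1 * d) * q x + (a1 * e' + e1) \<and>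
            q (f (g x)) = (d * d1) * p x + (d * e1' + e') \<and> q (g (f x)) = (d1 * a) * p x + (d1 * e + e1')"
            using f1 g1 hx by (simp add: algebra_simps)
          then show ?thesis using nz nz1 by (metis mult_eq_0_iff)
        qed
      next
        case False
        then have f1: "\<forall>x\<in>X. p (f x) = a * q x + e \<and> q (f x) = d * p x + e'" using f by blast
        show ?thesis
        proof (cases "\<forall>x\<in>X. p (g x) = a1 * p x + e1 \<and> q (g x) = d1 * q x + e1'")
          case True
          have "\<forall>x\<in>X. p (f (g x)) = (a * d1) * q x + (a * e1' + e) \<and> p (g (f x)) = (a1 * a) * q x + (a1 * e + e1) \<and>
            q (f (g x)) = (d * a1) * p x + (d * e1 + e') \<and> q (g (f x)) = (d1 * d) * p x + (d1 * e' + e1')"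
            using f1 True hx by (simp add: algebra_simps)
          then show ?thesis using nz nz1 by (metis mult_eq_0_iff)
        next
          case False
          then have g1: "\<forall>x\<in>X. p (g x) = a1 * q x + e1 \<and> q (g x) = d1 * p x + e1'" using g by blast
          have "\<forall>x\<in>X. p (f (g x)) = (a * d1) * p x + (a * e1' + e) \<and> p (g (f x)) = (a1 * d) * p x + (a1 * e' + e1) \<and>
            q (f (g x)) = (d * a1) * q x + (d * e1 + e') \<and> q (g (f x)) = (d1 * a) * q x + (d1 * e + e1')"
            using f1 g1 hx by (simp add: algebra_simps)
          then show ?thesis using nz nz1 by (metis mult_eq_0_iff)
        qed
      qed
    qed
    then obtain A A' B B' C C' E E' where nz: "A \<noteq> 0" "A' \<noteq> 0" "C \<noteq> 0" "C' \<noteq> 0"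
      and m: "\<forall>x\<in>X. \<exists>r r'. p (f (g x)) = A * r + B \<and> p (g (f x)) = A' * r + B' \<and>
        q (f (g x)) = C * r' + E \<and> q (g (f x)) = C' * r' + E'" by blast
    have "\<forall>y\<in>X. p (c y) = (A / A') * p y + (B - A * B' / A') \<and> q (c y) = (C / C') * q y + (E - C * E' / C')"
    proof
      fix y assume "y \<in> X"
      then obtain x where x: "x \<in> X" "y = g (f x)" using s by blast
      then obtain r r' where "p (c y) = A * r + B" "p y = A' * r + B'" "q (c y) = C * r' + E" "q y = C' * r' + E'"
        using m c by metis
      then show "p (c y) = (A / A') * p y + (B - A * B' / A') \<and> q (c y) = (C / C') * q y + (E - C * E' / C')"
        using ratio nz(2,4) by blast
    qed
    moreover have "A / A' \<noteq> 0" "C / C' \<noteq> 0" using nz by simp_all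
    ultimately show "Q1 c" unfolding Q1_def by blast
  qed
  moreover have "derives_into (BijGroup Y) {\<phi> \<in> H. Q1 \<phi>} {\<phi> \<in> H. Q2 \<phi>}"
  proof (rule derives_into_on_X[OF K1 K2])
    fix f g c assume fg: "f \<in> H" "g \<in> H" "Q1 f" "Q1 g" and c: "\<And>x. x \<in> X \<Longrightarrow> c (g (f x)) = f (g x)"
      and s: "\<And>y. y \<in> X \<Longrightarrow> \<exists>x\<in>X. y = g (f x)"
    obtain \<alpha> e \<delta> e' where f: "\<forall>x\<in>X. p (f x) = \<alpha> * p x + e \<and> q (f x) = \<delta> * q x + e'"
      using fg(3)[unfolded Q1_def] by (elim exE conjE) (rule that)
    obtain A E D E' where g: "\<forall>x\<in>X. p (g x) = A * p x + E \<and> q (g x) = D * q x + E'"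
      using fg(4)[unfolded Q1_def] by (elim exE conjE) (rule that)
    have "p (c y) = p y + (\<alpha> * E + e - (A * e + E)) \<and> q (c y) = q y + (\<delta> * E' + e' - (D * e' + E'))" if "y \<in> X" for y
    proof -
      obtain x where x: "x \<in> X" "y = g (f x)" using s \<open>y \<in> X\<close> by blast
      then show ?thesis using f g c H_X[OF fg(1)] H_X[OF fg(2)] by (simp add: algebra_simps)
    qed
    then show "Q2 c" unfolding Q2_def by blast
  qed
  moreover have "derives_into (BijGroup Y) {\<phi> \<in> H. Q2 \<phi>} {\<phi> \<in> H. Q3 \<phi>}"
  proof (rule derives_into_on_X[OF K2 K3])
    fix f g c assume fg: "f \<in> H" "g \<in> H" "Q2 f" "Q2 g" and c: "\<And>x. x \<in> X \<Longrightarrow> c (g (f x)) = f (g x)"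
      and s: "\<And>y. y \<in> X \<Longrightarrow> \<exists>x\<in>X. y = g (f x)"
    obtain e e' E E' where f: "\<forall>x\<in>X. p (f x) = p x + e \<and> q (f x) = q x + e'"
      and g: "\<forall>x\<in>X. p (g x) = p x + E \<and> q (g x) = q x + E'" using fg(3,4) unfolding Q2_def by (elim exE) (rule that)
    have "p (c y) = p y \<and> q (c y) = q y" if "y \<in> X" for y
    proof -
      obtain x where x: "x \<in> X" "y = g (f x)" using s \<open>y \<in> X\<close> by blast
      then show ?thesis using f g c H_X[OF fg(1)] H_X[OF fg(2)] by (simp add: algebra_simps)
    qed
    then show "Q3 c" unfolding Q3_def by blast
  qed
  ultimately have "derives_into (BijGroup Y) {\<phi> \<in> H. True} {\<phi> \<in> H. Q3 \<phi>}"
    by (blast intro: derives_into_trans_BijGroup)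
  then show ?thesis by (simp add: Q3_def)
qed

end

section \<open>The automorphism group of a curve w^g = P(z) is solvable\<close>

lemma top_coeff_mult:
  fixes f h :: "'a::field fls"
  assumes "pole_le n f" "pole_le n' h"
  shows "fls_nth (f * h) (- (n + n')) = fls_nth f (- n) * fls_nth h (- n')"
proof (cases "f = 0 \<or> h = 0")
  case False
  then have s: "- n \<le> fls_subdegree f" "- n' \<le> fls_subdegree h" using assms by (auto simp: pole_le_def)
  show ?thesis
  proof (cases "fls_subdegree f = - n \<and> fls_subdegree h = - n'")
    case True
    then show ?thesis using fls_times_base[of f h] by simp
  next
    case False
    then have "- (n + n') < fls_subdegree f + fls_subdegree h" "- n < fls_subdegree f \<or> - n' < fls_subdegree h"
      using s by auto
    then show ?thesis by (auto simp: fls_times_nth_eq0)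
  qed
qed auto

lemma pole_le_power: "pole_le n f \<Longrightarrow> pole_le (int e * n) (f ^ e)"
proof (induction e)
  case 0
  show ?case by (simp add: pole_le_def)
next
  case (Suc e)
  then show ?case using pole_le_mult[of n f "int e * n" "f ^ e"] by (simp add: algebra_simps)
qed

lemma top_coeff_power:
  assumes "pole_le n f"
  shows "fls_nth (f ^ e) (- (int e * n)) = fls_nth f (- n) ^ e"
proof (induction e)
  case (Suc e)
  have "fls_nth (f * f ^ e) (- (n + int e * n)) = fls_nth f (- n) * fls_nth (f ^ e) (- (int e * n))"
    by (rule top_coeff_mult[OF assms pole_le_power[OF assms]])
  then show ?case using Suc by (simp add: algebra_simps)
qed simp

lemma pole_le_mono: "pole_le n f \<Longrightarrow> n \<le> n' \<Longrightarrow> pole_le n' f"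
  by (auto simp: pole_le_def)

lemma lpoly_pole_le: "pole_le n Z \<Longrightarrow> n \<ge> 0 \<Longrightarrow> pole_le (int (degree a) * n) (lpoly Z a)"
proof (induction a)
  case (pCons c a)
  show ?case
  proof (cases "a = 0")
    case False
    then have "pole_le (n + int (degree a) * n) (Z * lpoly Z a)"
      using pCons by (intro pole_le_mult) auto
    moreover have "pole_le (n + int (degree a) * n) (fls_const c)"
      by (rule pole_le_mono[of 0]) (use pCons.prems in \<open>auto simp: pole_le_def\<close>)
    ultimately show ?thesis using False by (simp add: pole_le_add algebra_simps)
  qed (simp add: pole_le_def)
qed simp

lemma top_coeff_lpoly:
  assumes Z: "pole_le n Z" and n: "n > 0"
  shows "fls_nth (lpoly Z a) (- (int (degree a) * n)) = lead_coeff a * fls_nth Z (- n) ^ degree a"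
proof (induction a)
  case (pCons c a)
  show ?case
  proof (cases "a = 0")
    case False
    have "fls_nth (Z * lpoly Z a) (- (n + int (degree a) * n)) = fls_nth Z (- n) * fls_nth (lpoly Z a) (- (int (degree a) * n))"
      by (rule top_coeff_mult[OF Z lpoly_pole_le[OF Z]]) (use n in simp)
    moreover have "fls_nth (fls_const c) (- (n + int (degree a) * n)) = 0"
    proof -
      have "n + int (degree a) * n > 0" using n by (simp add: add_pos_nonneg)
      then show ?thesis by simp
    qed
    ultimately show ?thesis using False pCons by (simp add: algebra_simps)
  qed simp
qed simp

lemma coeff_binomial_poly: "coeff ([:a, b:] ^ n) i = of_nat (n choose i) * b ^ i * a ^ (n - i)"
  for a b :: "'a::field"
proof (cases "i \<le> n")
  case True
  then show ?thesis by (rule coeff_linear_poly_power)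
next
  case False
  have "degree ([:a, b:] ^ n) \<le> degree [:a, b:] * n" by (rule degree_power_le)
  also have "\<dots> \<le> 1 * n" by (rule mult_le_mono1) simp
  finally have "coeff ([:a, b:] ^ n) i = 0" using False by (intro coeff_eq_0) simp
  then show ?thesis using False by (simp add: binomial_eq_0)
qed

text \<open>
  A linear map that permutes the \<open>g \<ge> 3\<close> lines \<open>w^g = c z^g\<close> of the plane is diagonal or
  antidiagonal: comparing coefficients shows that otherwise it would be singular.
\<close>

lemma lines_permutation_monomial:
  fixes \<alpha> \<beta> \<gamma> \<delta> c :: "'a::{alg_closed_field, field_char_0}"
  assumes g: "g \<ge> 3" and c: "c \<noteq> 0" and det: "\<alpha> * \<delta> \<noteq> \<beta> * \<gamma>"
    and eq: "\<And>\<eta>. \<eta> ^ g = c \<Longrightarrow> (\<gamma> + \<delta> * \<eta>) ^ g = c * (\<alpha> + \<beta> * \<eta>) ^ g"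
  shows "(\<beta> = 0 \<and> \<gamma> = 0) \<or> (\<alpha> = 0 \<and> \<delta> = 0)"
proof -
  define \<kappa> where "\<kappa> = \<delta> ^ g - c * \<beta> ^ g"
  \<comment> \<open>The multiple of \<open>\<eta>\<^bsup>g\<^esup> - c\<close> is chosen such that it cancels the term of degree \<open>g\<close>; the difference
    then has more zeros than its degree.\<close>
  define p where "p = [:\<gamma>, \<delta>:] ^ g - smult c ([:\<alpha>, \<beta>:] ^ g) - smult \<kappa> (monom 1 g - [:c:])"
  have "coeff p j = 0" if "j \<ge> g" for j
    using that g by (cases "j = g") (auto simp: p_def coeff_binomial_poly \<kappa>_def coeff_pCons split: nat.splits)
  then have deg: "degree p < g" using g by (intro degree_lessI) auto
  have "poly p \<eta> = 0" if "\<eta> ^ g = c" for \<eta>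
    using eq[OF that] that by (simp add: p_def poly_power poly_monom mult.commute)
  then have "p = 0"
    using deg card_nth_roots[of g c] c g by (intro poly_eqI_degree[of "{\<eta>. \<eta> ^ g = c}"]) auto
  then have co: "\<delta> ^ j * \<gamma> ^ (g - j) = c * (\<beta> ^ j * \<alpha> ^ (g - j))" if "0 < j" "j < g" for j
  proof -
    have "coeff p j = of_nat (g choose j) * (\<delta> ^ j * \<gamma> ^ (g - j) - c * (\<beta> ^ j * \<alpha> ^ (g - j)))"
      using that by (auto simp: p_def coeff_binomial_poly coeff_pCons algebra_simps split: nat.splits)
    then show ?thesis using \<open>p = 0\<close> that by (simp add: of_nat_eq_0_iff)
  qed
  obtain n where n: "g = Suc (Suc (Suc n))" using g by (metis add_Suc_right le_Suc_ex numeral_3_eq_3 add.commute plus_nat.add_0 add_Suc)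
  have 1: "\<delta> * \<gamma> ^ Suc (Suc n) = c * (\<beta> * \<alpha> ^ Suc (Suc n))" using co[of 1] n by simp
  have 2: "\<delta> ^ 2 * \<gamma> ^ Suc n = c * (\<beta> ^ 2 * \<alpha> ^ Suc n)" using co[of 2] n by (simp add: numeral_2_eq_2)
  show ?thesis
  proof (cases "\<beta> = 0 \<or> \<alpha> = 0")
    case True
    then have "\<delta> * \<gamma> ^ Suc (Suc n) = 0" using 1 by auto
    then show ?thesis using True det by auto
  next
    case False
    then have nz: "\<delta> \<noteq> 0" "\<gamma> \<noteq> 0" using 1 c by auto
    have "(\<delta> * \<gamma> ^ Suc (Suc n)) * (c * (\<beta> ^ 2 * \<alpha> ^ Suc n)) = (\<delta> ^ 2 * \<gamma> ^ Suc n) * (c * (\<beta> * \<alpha> ^ Suc (Suc n)))"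
      using 1 2 by simp
    then have "(\<delta> * \<gamma> ^ Suc n * c * \<beta> * \<alpha> ^ Suc n) * (\<gamma> * \<beta>) = (\<delta> * \<gamma> ^ Suc n * c * \<beta> * \<alpha> ^ Suc n) * (\<delta> * \<alpha>)"
      by (simp add: power2_eq_square algebra_simps)
    then have "\<gamma> * \<beta> = \<delta> * \<alpha>" using nz False c by simp
    then show ?thesis using det by (simp add: mult.commute)
  qed
qed

locale curve_group = curve_action P g X z w H + bij_action Y X H
  for P :: "'a::{alg_closed_field, field_char_0} poly" and g X and z w :: "'x \<Rightarrow> 'a" and H Y
begin

abbreviation "curve_kernel \<equiv> {\<phi> \<in> H. \<forall>x\<in>X. z (\<phi> x) = z x \<and> w (\<phi> x) = w x}"

lemma bev_deg_le_1:
  assumes "\<And>j. j \<ge> 2 \<Longrightarrow> coeff B j = 0"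
  shows "bev B a b = poly (coeff B 0) a + poly (coeff B 1) a * b"
proof -
  have "degree B < 2" using assms by (intro degree_lessI) auto
  from bev_altdef[OF this, of a b] show ?thesis by (simp add: numeral_2_eq_2)
qed

lemma poly_deg_0: "degree a = 0 \<Longrightarrow> poly a s = coeff a 0"
  by (auto elim: degree_eq_zeroE)

lemma Bz_coeff_0: "\<phi> \<in> H \<Longrightarrow> degree (coeff (Bz \<phi>) 0) \<le> 1"
proof -
  assume \<phi>: "\<phi> \<in> H"
  have "g * degree (coeff (Bz \<phi>) 0) \<le> g * 1" if "coeff (Bz \<phi>) 0 \<noteq> 0"
    using degree_bounds(1)[OF \<phi> that] by simp
  then show ?thesis using g_ge_1 by (cases "coeff (Bz \<phi>) 0 = 0") auto
qed

lemma poly_deg_le_1: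
  assumes "degree a \<le> 1" shows "poly a s = coeff a 0 + coeff a 1 * s"
proof -
  obtain c0 a' where a: "a = pCons c0 a'" by (cases a)
  have "degree a' = 0" using assms by (cases "a' = 0") (auto simp: a)
  then show ?thesis using poly_deg_0[of a' s] by (simp add: a mult.commute)
qed

text \<open>
  If \<open>w\<close> is heavier than \<open>z\<close>, then \<open>z \<circ> \<phi>\<close> cannot involve \<open>w\<close>.
\<close>

lemma derives_into_kernel_less:
  assumes less: "g < d"
  shows "derives_into (BijGroup Y) H curve_kernel"
proof (rule triangular_derives_into)
  fix \<phi> assume \<phi>: "\<phi> \<in> H"
  have z0: "coeff (Bz \<phi>) j = 0" if "j \<ge> 1" for j
  proof (rule ccontr)
    assume "coeff (Bz \<phi>) j \<noteq> 0"
    then have "d * j \<le> g" using degree_bounds(1)[OF \<phi>, of j] by linarith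
    moreover have "d * 1 \<le> d * j" using that by (rule mult_le_mono2)
    ultimately show False using less by simp
  qed
  have w0: "coeff (Bw \<phi>) j = 0" if "j \<ge> 2" for j
  proof (rule ccontr)
    assume "coeff (Bw \<phi>) j \<noteq> 0"
    then have "d * j \<le> d" using degree_bounds(2)[OF \<phi>, of j] by linarith
    moreover have "d * 2 \<le> d * j" using that by (rule mult_le_mono2)
    ultimately show False using deg_P_ge_2 by simp
  qed
  have w1: "degree (coeff (Bw \<phi>) 1) = 0"
    using degree_bounds(2)[OF \<phi>, of 1] g_ge_1 by (cases "coeff (Bw \<phi>) 1 = 0") auto
  show "\<exists>\<alpha> \<beta> \<gamma> Q. \<forall>x\<in>X. z (\<phi> x) = \<alpha> * z x + \<beta> \<and> w (\<phi> x) = \<gamma> * w x + Q (z x)"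
    using bev_deg_le_1[of "Bz \<phi>"] bev_deg_le_1[of "Bw \<phi>", OF w0] z0
      poly_deg_le_1[OF Bz_coeff_0[OF \<phi>]] poly_deg_0[OF w1]
    by (intro exI[of _ "coeff (coeff (Bz \<phi>) 0) 1"] exI[of _ "coeff (coeff (Bz \<phi>) 0) 0"]
        exI[of _ "coeff (coeff (Bw \<phi>) 1) 0"] exI[of _ "poly (coeff (Bw \<phi>) 0)"])
       (simp add: Bz(2)[OF \<phi>] Bw(2)[OF \<phi>] add.commute)
qed

text \<open>
  If \<open>z\<close> is heavier than \<open>w\<close>, then \<open>w \<circ> \<phi>\<close> cannot involve \<open>z\<close>.
\<close>

lemma derives_into_kernel_greater:
  assumes greater: "d < g"
  shows "derives_into (BijGroup Y) H curve_kernel"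
proof -
  have "derives_into (BijGroup Y) H {\<phi> \<in> H. \<forall>x\<in>X. w (\<phi> x) = w x \<and> z (\<phi> x) = z x}"
  proof (rule triangular_derives_into)
    fix \<phi> assume \<phi>: "\<phi> \<in> H"
    have z0: "degree (coeff (Bz \<phi>) j) = 0" if "j \<ge> 1" for j
    proof (rule ccontr)
      assume "degree (coeff (Bz \<phi>) j) \<noteq> 0"
      then have "g * 1 \<le> g * degree (coeff (Bz \<phi>) j)" by (intro mult_le_mono2) simp
      moreover have "d * 1 \<le> d * j" using that by (rule mult_le_mono2)
      moreover have "g * degree (coeff (Bz \<phi>) j) + d * j \<le> g"
        using degree_bounds(1)[OF \<phi>, of j] \<open>degree (coeff (Bz \<phi>) j) \<noteq> 0\<close> by (metis degree_0)
      ultimately show False using deg_P_ge_2 by linarith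
    qed
    have w2: "degree (coeff (Bw \<phi>) j) = 0" for j
    proof (rule ccontr)
      assume "degree (coeff (Bw \<phi>) j) \<noteq> 0"
      then have "g * 1 \<le> g * degree (coeff (Bw \<phi>) j)" by (intro mult_le_mono2) simp
      moreover have "g * degree (coeff (Bw \<phi>) j) + d * j \<le> d"
        using degree_bounds(2)[OF \<phi>, of j] \<open>degree (coeff (Bw \<phi>) j) \<noteq> 0\<close> by (metis degree_0)
      ultimately show False using greater by linarith
    qed
    have w0: "coeff (Bw \<phi>) j = 0" if "j \<ge> 2" for j
    proof (rule ccontr)
      assume "coeff (Bw \<phi>) j \<noteq> 0"
      then have "d * j \<le> d" using degree_bounds(2)[OF \<phi>, of j] by linarith
      moreover have "d * 2 \<le> d * j" using that by (rule mult_le_mono2)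
      ultimately show False using deg_P_ge_2 by simp
    qed
    let ?Q = "\<lambda>t. (\<Sum>j\<in>{1..<g}. coeff (coeff (Bz \<phi>) j) 0 * t ^ j) + coeff (coeff (Bz \<phi>) 0) 0"
    have zx: "z (\<phi> x) = coeff (coeff (Bz \<phi>) 0) 1 * z x + ?Q (w x)" if "x \<in> X" for x
    proof -
      have "{..<g} = insert 0 {1..<g}" using g_ge_1 by auto
      then have "z (\<phi> x) = poly (coeff (Bz \<phi>) 0) (z x) + (\<Sum>j\<in>{1..<g}. poly (coeff (Bz \<phi>) j) (z x) * w x ^ j)"
        unfolding Bz(2)[OF \<phi> that] bev_altdef[OF Bz(1)[OF \<phi>]] by simp
      also have "(\<Sum>j\<in>{1..<g}. poly (coeff (Bz \<phi>) j) (z x) * w x ^ j) = (\<Sum>j\<in>{1..<g}. coeff (coeff (Bz \<phi>) j) 0 * w x ^ j)"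
        by (rule sum.cong) (simp_all add: poly_deg_0[OF z0])
      finally show ?thesis by (simp add: poly_deg_le_1[OF Bz_coeff_0[OF \<phi>]])
    qed
    have we: "bev (Bw \<phi>) s t = poly (coeff (Bw \<phi>) 0) s + poly (coeff (Bw \<phi>) 1) s * t" for s t
      by (rule bev_deg_le_1) (rule w0)
    have wx: "w (\<phi> x) = coeff (coeff (Bw \<phi>) 1) 0 * w x + coeff (coeff (Bw \<phi>) 0) 0" if "x \<in> X" for x
      unfolding Bw(2)[OF \<phi> that] we by (simp add: poly_deg_0[OF w2])
    show "\<exists>\<alpha> \<beta> \<gamma> Q. \<forall>x\<in>X. w (\<phi> x) = \<alpha> * w x + \<beta> \<and> z (\<phi> x) = \<gamma> * z x + Q (w x)"
      by (intro exI[of _ "coeff (coeff (Bw \<phi>) 1) 0"] exI[of _ "coeff (coeff (Bw \<phi>) 0) 0"]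
          exI[of _ "coeff (coeff (Bz \<phi>) 0) 1"] exI[of _ ?Q] ballI conjI wx zx)
  qed
  moreover have "{\<phi> \<in> H. \<forall>x\<in>X. w (\<phi> x) = w x \<and> z (\<phi> x) = z x} = curve_kernel" by auto
  ultimately show ?thesis by simp
qed

lemma not_in_line:
  assumes g2: "g \<ge> 2" and line: "\<And>x. x \<in> X \<Longrightarrow> a * z x + b * w x = e"
  shows "a = 0 \<and> b = 0"
proof -
  let ?r = "[:[:- e, a:], [:b:]:]"
  have "?r = 0"
  proof (rule curve_independent[OF g_ge_1 P_nz])
    show "degree ?r < g" using g2 by (auto intro: le_less_trans[OF degree_pCons_le])
    fix s t assume "t ^ g = poly P s" "t \<noteq> 0"
    then obtain x where "x \<in> X" "z x = s" "w x = t" using curve_lift by blast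
    then show "bev ?r s t = 0" using line[of x] by (simp add: algebra_simps)
  qed
  then show ?thesis by simp
qed

text \<open>
  If \<open>g\<close> and the degree of \<open>P\<close> agree, then \<open>H\<close> acts by affine maps of the plane, whose linear
  parts permute the \<open>g\<close> asymptotic directions of the curve.
\<close>

lemma affine_action:
  assumes eq: "d = g" and \<phi>: "\<phi> \<in> H"
  shows "\<exists>\<alpha> \<beta> e \<gamma> \<delta> e'. \<alpha> * \<delta> \<noteq> \<beta> * \<gamma> \<and>
    (\<forall>x\<in>X. z (\<phi> x) = \<alpha> * z x + \<beta> * w x + e \<and> w (\<phi> x) = \<gamma> * z x + \<delta> * w x + e') \<and>
    (\<forall>\<eta>. \<eta> ^ g = lead_coeff P \<longrightarrow> (\<gamma> + \<delta> * \<eta>) ^ g = lead_coeff P * (\<alpha> + \<beta> * \<eta>) ^ g)"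
proof -
  have g2: "g \<ge> 2" using eq deg_P_ge_2 by simp
  have co: "coeff B j = 0" if "\<And>j. coeff B j \<noteq> 0 \<Longrightarrow> g * degree (coeff B j) + d * j \<le> g" "j \<ge> 2" for B :: "'a poly poly" and j
  proof (rule ccontr)
    assume "coeff B j \<noteq> 0"
    then have "g * j \<le> g" using that(1)[of j] unfolding eq by linarith
    moreover have "g * 2 \<le> g * j" using that(2) by (rule mult_le_mono2)
    ultimately show False using g_ge_1 by simp
  qed
  have d1: "degree (coeff B 1) = 0" if "\<And>j. coeff B j \<noteq> 0 \<Longrightarrow> g * degree (coeff B j) + d * j \<le> g" for B :: "'a poly poly"
    using that[of 1] eq g_ge_1 by (cases "coeff B 1 = 0") auto
  have d0: "degree (coeff B 0) \<le> 1" if "\<And>j. coeff B j \<noteq> 0 \<Longrightarrow> g * degree (coeff B j) + d * j \<le> g" for B :: "'a poly poly"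
    using that[of 0] g_ge_1 by (cases "coeff B 0 = 0") auto
  have form: "bev B s t = coeff (coeff B 0) 1 * s + coeff (coeff B 1) 0 * t + coeff (coeff B 0) 0"
    if B: "\<And>j. coeff B j \<noteq> 0 \<Longrightarrow> g * degree (coeff B j) + d * j \<le> g" for B :: "'a poly poly" and s t
  proof -
    have "bev B s t = poly (coeff B 0) s + poly (coeff B 1) s * t"
      by (rule bev_deg_le_1) (use co B in blast)
    moreover have 1: "degree (coeff B 1) = 0" using d1 B by blast
    moreover have 0: "degree (coeff B 0) \<le> 1" using d0 B by blast
    ultimately show ?thesis by (simp only: poly_deg_le_1[OF 0] poly_deg_0[OF 1] add_ac)
  qed
  have bz: "g * degree (coeff (Bz \<phi>) j) + d * j \<le> g" if "coeff (Bz \<phi>) j \<noteq> 0" for j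
    by (rule degree_bounds(1)[OF \<phi> that])
  have bw: "g * degree (coeff (Bw \<phi>) j) + d * j \<le> g" if "coeff (Bw \<phi>) j \<noteq> 0" for j
    using degree_bounds(2)[OF \<phi> that] eq by simp
  obtain \<alpha> \<beta> e where z: "\<And>x. x \<in> X \<Longrightarrow> z (\<phi> x) = \<alpha> * z x + \<beta> * w x + e"
    using form[of "Bz \<phi>", OF bz] Bz(2)[OF \<phi>] by metis
  obtain \<gamma> \<delta> e' where w: "\<And>x. x \<in> X \<Longrightarrow> w (\<phi> x) = \<gamma> * z x + \<delta> * w x + e'"
    using form[of "Bw \<phi>", OF bw] Bw(2)[OF \<phi>] by metis
  \<comment> \<open>Otherwise the image of the curve, which is the whole curve, would be contained in a line.\<close>
  have det: "\<alpha> * \<delta> \<noteq> \<beta> * \<gamma>"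
  proof
    assume sing: "\<alpha> * \<delta> = \<beta> * \<gamma>"
    have rel: "a = 0 \<and> b = 0" if ab: "a * \<alpha> + b * \<gamma> = 0" "a * \<beta> + b * \<delta> = 0" for a b
    proof (rule not_in_line[OF g2])
      fix y assume "y \<in> X"
      then obtain x where x: "x \<in> X" "y = \<phi> x" using H_surj_X[OF \<phi>] by blast
      have "a * z y + b * w y = (a * \<alpha> + b * \<gamma>) * z x + (a * \<beta> + b * \<delta>) * w x + (a * e + b * e')"
        using x z w by (simp add: algebra_simps)
      then show "a * z y + b * w y = a * e + b * e'" unfolding ab by simp
    qed
    have "\<gamma> = 0 \<and> - \<alpha> = 0" by (rule rel) (use sing in \<open>simp_all add: algebra_simps\<close>)
    moreover have "\<delta> = 0 \<and> - \<beta> = 0" by (rule rel) (use sing in \<open>simp_all add: algebra_simps\<close>)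
    ultimately have "(1::'a) = 0 \<and> (0::'a) = 0" by (intro rel) simp_all
    then show False by simp
  qed
  have dirs: "(\<gamma> + \<delta> * \<eta>) ^ g = lead_coeff P * (\<alpha> + \<beta> * \<eta>) ^ g" if \<eta>: "\<eta> ^ g = lead_coeff P" for \<eta>
  proof -
    \<comment> \<open>The asymptotic direction of the branch given by \<open>W0\<close>. The directions of the other branches are
      its multiples by roots of unity; the leading coefficients of the equation of the curve are
      compared on the branch with direction \<open>\<eta>\<close>.\<close>
    define \<omega> where "\<omega> = fls_nth W0 (- int g)"
    have pW0: "pole_le (int g) W0" and pZ0: "pole_le (int g) Z0"
      using W0 Z0 eq by (simp_all add: pole_le_def)
    have tz: "fls_nth Z0 (- int g) = 1"
      using nth_fls_subdegree_nonzero[OF Z0(2)] Z0(1) by (simp add: Z0_def fls_X_inv_power_conv_shift_1)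
    have "\<omega> ^ g = fls_nth (W0 ^ g) (- (int g * int g))" unfolding \<omega>_def by (rule top_coeff_power[OF pW0, symmetric])
    also have "\<dots> = lead_coeff P"
      unfolding W0(1) using top_coeff_lpoly[OF pZ0, of P] g_ge_1 eq tz by simp
    finally have \<omega>: "\<omega> ^ g = lead_coeff P" .
    have lc: "lead_coeff P \<noteq> 0" using P_nz by simp
    then have \<omega>0: "\<omega> \<noteq> 0" using \<omega> g_ge_1 by (auto simp: zero_power)
    define \<zeta> where "\<zeta> = \<eta> / \<omega>"
    have \<zeta>: "\<zeta> \<in> roots1" using \<omega> \<eta> lc by (simp add: roots1_def \<zeta>_def power_divide)
    let ?lin = "\<lambda>a b c. [:[:c, a:], [:b:]:]"
    have E: "E \<zeta> (?lin a b c) = fls_const a * Z0 + fls_const b * (fls_const \<zeta> * W0) + fls_const c" for a b c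
      by (simp add: E_def algebra_simps)
    have pE: "pole_le (int g) (E \<zeta> (?lin a b c))" for a b c
      unfolding E by (intro pole_le_add pole_le_const_mult pZ0 pW0) (simp add: pole_le_def)
    have tE: "fls_nth (E \<zeta> (?lin a b c)) (- int g) = a + b * \<eta>" for a b c
      unfolding E using tz \<omega>0 g_ge_1 by (simp add: \<zeta>_def \<omega>_def[symmetric])
    have "E \<zeta> (?lin \<gamma> \<delta> e' ^ g) = E \<zeta> (psubst P (?lin \<alpha> \<beta> e))"
    proof (rule E_eq[OF \<zeta>])
      fix x assume x: "x \<in> X"
      have "w (\<phi> x) ^ g = poly P (z (\<phi> x))" by (rule on_curve[OF H_X[OF \<phi> x]])
      then show "bev (?lin \<gamma> \<delta> e' ^ g) (z x) (w x) = bev (psubst P (?lin \<alpha> \<beta> e)) (z x) (w x)"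
        unfolding z[OF x] w[OF x] by (simp add: algebra_simps)
    qed
    then have "E \<zeta> (?lin \<gamma> \<delta> e') ^ g = lpoly (E \<zeta> (?lin \<alpha> \<beta> e)) P"
      unfolding E_def lev_power lev_psubst .
    then have "fls_nth (E \<zeta> (?lin \<gamma> \<delta> e') ^ g) (- (int g * int g)) = fls_nth (lpoly (E \<zeta> (?lin \<alpha> \<beta> e)) P) (- (int d * int g))"
      using eq by simp
    then show ?thesis
      unfolding top_coeff_power[OF pE] using top_coeff_lpoly[OF pE, where a = P] g_ge_1 eq tE by simp
  qed
  show ?thesis using det z w dirs by blast
qed

lemma derives_into_kernel_equal:
  assumes eq: "d = g"
  shows "derives_into (BijGroup Y) H curve_kernel"
proof (cases "g \<ge> 3")
  case g3: True
  show ?thesis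
  proof (rule monomial_affine_derives_into)
    fix \<phi> assume \<phi>: "\<phi> \<in> H"
    obtain \<alpha> \<beta> e \<gamma> \<delta> e' where det: "\<alpha> * \<delta> \<noteq> \<beta> * \<gamma>"
      and f: "\<forall>x\<in>X. z (\<phi> x) = \<alpha> * z x + \<beta> * w x + e \<and> w (\<phi> x) = \<gamma> * z x + \<delta> * w x + e'"
      and dirs: "\<And>\<eta>. \<eta> ^ g = lead_coeff P \<Longrightarrow> (\<gamma> + \<delta> * \<eta>) ^ g = lead_coeff P * (\<alpha> + \<beta> * \<eta>) ^ g"
      using affine_action[OF eq \<phi>] by blast
    have "lead_coeff P \<noteq> 0" using P_nz by simp
    then consider "\<beta> = 0 \<and> \<gamma> = 0" | "\<alpha> = 0 \<and> \<delta> = 0"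
      using lines_permutation_monomial[OF g3 _ det dirs] by blast
    then show "\<exists>\<alpha> e \<delta> e'. \<alpha> \<noteq> 0 \<and> \<delta> \<noteq> 0 \<and>
      ((\<forall>x\<in>X. z (\<phi> x) = \<alpha> * z x + e \<and> w (\<phi> x) = \<delta> * w x + e') \<or>
       (\<forall>x\<in>X. z (\<phi> x) = \<alpha> * w x + e \<and> w (\<phi> x) = \<delta> * z x + e'))"
    proof cases
      case 1
      then show ?thesis using f det
        by (intro exI[of _ \<alpha>] exI[of _ e] exI[of _ \<delta>] exI[of _ e']) auto
    next
      case 2
      then show ?thesis using f det
        by (intro exI[of _ \<beta>] exI[of _ e] exI[of _ \<gamma>] exI[of _ e']) auto
    qed
  qed
next
  case False
  \<comment> \<open>Two asymptotic directions can be permuted by maps that are not diagonal or antidiagonal in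
  \<open>z\<close> and \<open>w\<close>; coordinates that vanish on these directions are needed.\<close>
  then have g2: "g = 2" using eq deg_P_ge_2 by simp
  obtain \<eta> where \<eta>: "\<eta> ^ 2 = lead_coeff P" using nth_root_exists[of 2 "lead_coeff P"] by auto
  have \<eta>0: "\<eta> \<noteq> 0" using \<eta> P_nz by auto
  define p q where "p x = w x - \<eta> * z x" and "q x = w x + \<eta> * z x" for x
  have zw: "z x = (q x - p x) / (2 * \<eta>)" "w x = (p x + q x) / 2" for x
    using \<eta>0 by (simp_all add: p_def q_def field_simps)
  have "derives_into (BijGroup Y) H {\<phi> \<in> H. \<forall>x\<in>X. p (\<phi> x) = p x \<and> q (\<phi> x) = q x}"
  proof (rule monomial_affine_derives_into)
    fix \<phi> assume \<phi>: "\<phi> \<in> H"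
    obtain \<alpha> \<beta> e \<gamma> \<delta> e' where det: "\<alpha> * \<delta> \<noteq> \<beta> * \<gamma>"
      and f: "\<forall>x\<in>X. z (\<phi> x) = \<alpha> * z x + \<beta> * w x + e \<and> w (\<phi> x) = \<gamma> * z x + \<delta> * w x + e'"
      and dirs: "\<And>\<eta>. \<eta> ^ g = lead_coeff P \<Longrightarrow> (\<gamma> + \<delta> * \<eta>) ^ g = lead_coeff P * (\<alpha> + \<beta> * \<eta>) ^ g"
      using affine_action[OF eq \<phi>] by blast
    define A where "A = - (\<gamma> - \<delta> * \<eta> - \<eta> * (\<alpha> - \<beta> * \<eta>)) / (2 * \<eta>)"
    define B where "B = (\<gamma> + \<delta> * \<eta> - \<eta> * (\<alpha> + \<beta> * \<eta>)) / (2 * \<eta>)"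
    define C where "C = - (\<gamma> - \<delta> * \<eta> + \<eta> * (\<alpha> - \<beta> * \<eta>)) / (2 * \<eta>)"
    define D where "D = (\<gamma> + \<delta> * \<eta> + \<eta> * (\<alpha> + \<beta> * \<eta>)) / (2 * \<eta>)"
    have diff: "(u - v) * (u + v) = 0" if "u ^ 2 = v ^ 2" for u v :: 'a
    proof -
      have "(u - v) * (u + v) = u ^ 2 - v ^ 2" by (simp add: power2_eq_square algebra_simps)
      then show ?thesis using that by simp
    qed
    have "(\<gamma> + \<delta> * \<eta>) ^ 2 = (\<eta> * (\<alpha> + \<beta> * \<eta>)) ^ 2"
      using dirs[of \<eta>] \<eta> g2 by (simp add: power_mult_distrib)
    from diff[OF this] have BD: "B * D = 0" by (auto simp: B_def D_def)
    have "(\<gamma> - \<delta> * \<eta>) ^ 2 = (\<eta> * (\<alpha> - \<beta> * \<eta>)) ^ 2"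
      using dirs[of "- \<eta>"] \<eta> g2 by (simp add: power_mult_distrib)
    from diff[OF this] have "\<gamma> - \<delta> * \<eta> - \<eta> * (\<alpha> - \<beta> * \<eta>) = 0 \<or> \<gamma> - \<delta> * \<eta> + \<eta> * (\<alpha> - \<beta> * \<eta>) = 0"
      by (simp only: mult_eq_0_iff)
    then have AC: "A * C = 0" unfolding A_def C_def
      by (elim disjE) (simp_all only: minus_zero div_0 mult_zero_left mult_zero_right)
    have dABCD: "A * D - B * C = \<alpha> * \<delta> - \<beta> * \<gamma>"
      using \<eta>0 by (simp add: A_def B_def C_def D_def field_simps)
    have pq: "p (\<phi> x) = A * p x + B * q x + (e' - \<eta> * e) \<and> q (\<phi> x) = C * p x + D * q x + (e' + \<eta> * e)"
      if "x \<in> X" for x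
      using bspec[OF f that] \<eta>0 by (simp add: A_def B_def C_def D_def p_def q_def field_simps)
    show "\<exists>\<alpha> e \<delta> e'. \<alpha> \<noteq> 0 \<and> \<delta> \<noteq> 0 \<and>
      ((\<forall>x\<in>X. p (\<phi> x) = \<alpha> * p x + e \<and> q (\<phi> x) = \<delta> * q x + e') \<or>
       (\<forall>x\<in>X. p (\<phi> x) = \<alpha> * q x + e \<and> q (\<phi> x) = \<delta> * p x + e'))"
    proof (cases "B = 0")
      case True
      then have "A \<noteq> 0" "D \<noteq> 0" using dABCD det by auto
      then show ?thesis using True AC pq
        by (intro exI[of _ A] exI[of _ "e' - \<eta> * e"] exI[of _ D] exI[of _ "e' + \<eta> * e"]) auto
    next
      case False
      then have "D = 0" using BD by simp
      then have "C \<noteq> 0" using dABCD det by auto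
      then show ?thesis using False AC pq \<open>D = 0\<close>
        by (intro exI[of _ B] exI[of _ "e' - \<eta> * e"] exI[of _ C] exI[of _ "e' + \<eta> * e"]) auto
    qed
  qed
  then show ?thesis
  proof (rule derives_into_trans_BijGroup)
    show "derives_into (BijGroup Y) {\<phi> \<in> H. \<forall>x\<in>X. p (\<phi> x) = p x \<and> q (\<phi> x) = q x} curve_kernel"
      by (rule derives_into_refl) (simp add: zw subset_iff)
  qed
qed

theorem curve_derives_into_kernel: "derives_into (BijGroup Y) H curve_kernel"
  by (cases g "degree P" rule: linorder_cases)
    (simp_all add: derives_into_kernel_less derives_into_kernel_equal derives_into_kernel_greater)

end

section \<open>The symmetric group on four points\<close>

text \<open>
  A permutation of \<open>{0, 1, 2, 3}\<close> is written as the list of its values. The groups are so small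
  that the derived series \<open>S\<^sub>4 > A\<^sub>4 > V\<^sub>4 > 1\<close> can be verified by evaluating all products.
\<close>

definition list_comp :: "nat list \<Rightarrow> nat list \<Rightarrow> nat list"
  where "list_comp xs ys = map (\<lambda>i. xs ! i) ys"

definition list_inv :: "nat list \<Rightarrow> nat list"
  where "list_inv xs = map (\<lambda>i. length (takeWhile (\<lambda>j. j \<noteq> i) xs)) [0, 1, 2, 3]"

definition list_commutator :: "nat list \<Rightarrow> nat list \<Rightarrow> nat list"
  where "list_commutator xs ys = list_comp (list_comp (list_comp (list_inv ys) (list_inv xs)) ys) xs"

definition S4 :: "nat list list"
  where "S4 =
    [[0, 1, 2, 3], [0, 1, 3, 2], [0, 2, 1, 3], [0, 2, 3, 1], [0, 3, 1, 2], [0, 3, 2, 1],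
     [1, 0, 2, 3], [1, 0, 3, 2], [1, 2, 0, 3], [1, 2, 3, 0], [1, 3, 0, 2], [1, 3, 2, 0],
     [2, 0, 1, 3], [2, 0, 3, 1], [2, 1, 0, 3], [2, 1, 3, 0], [2, 3, 0, 1], [2, 3, 1, 0],
     [3, 0, 1, 2], [3, 0, 2, 1], [3, 1, 0, 2], [3, 1, 2, 0], [3, 2, 0, 1], [3, 2, 1, 0]]"

definition A4 :: "nat list list"
  where "A4 =
    [[0, 1, 2, 3], [0, 2, 3, 1], [0, 3, 1, 2], [1, 0, 3, 2], [1, 2, 0, 3], [1, 3, 2, 0],
     [2, 0, 1, 3], [2, 1, 3, 0], [2, 3, 0, 1], [3, 0, 2, 1], [3, 1, 0, 2], [3, 2, 1, 0]]"

definition V4 :: "nat list list"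
  where "V4 = [[0, 1, 2, 3], [1, 0, 3, 2], [2, 3, 0, 1], [3, 2, 1, 0]]"

definition closed_list_group :: "nat list list \<Rightarrow> bool"
  where "closed_list_group S \<longleftrightarrow> list_all (\<lambda>xs. xs \<in> set S4) S \<and> [0, 1, 2, 3] \<in> set S \<and>
    list_all (\<lambda>xs. list_inv xs \<in> set S \<and> list_all (\<lambda>ys. list_comp xs ys \<in> set S) S) S"

definition commutators_in :: "nat list list \<Rightarrow> nat list list \<Rightarrow> bool"
  where "commutators_in S T \<longleftrightarrow> list_all (\<lambda>xs. list_all (\<lambda>ys. list_commutator xs ys \<in> set T) S) S"

lemma list_groups: "closed_list_group S4" "closed_list_group A4" "closed_list_group V4"
    "closed_list_group [[0, 1, 2, 3]]"
  by code_simp+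

lemma list_commutators: "commutators_in S4 A4" "commutators_in A4 V4" "commutators_in V4 [[0, 1, 2, 3]]"
  by code_simp+

lemma list_inv_comp: "xs \<in> set S4 \<Longrightarrow> list_comp (list_inv xs) xs = [0, 1, 2, 3]"
proof -
  have "list_all (\<lambda>xs. list_comp (list_inv xs) xs = [0, 1, 2, 3]) S4" by code_simp
  then show "xs \<in> set S4 \<Longrightarrow> list_comp (list_inv xs) xs = [0, 1, 2, 3]" by (simp add: list_all_iff)
qed

lemma S4_entries: "xs \<in> set S4 \<Longrightarrow> length xs = 4 \<and> set xs \<subseteq> {..<4}"
proof -
  have "list_all (\<lambda>xs. length xs = 4 \<and> list_all (\<lambda>i. i < 4) xs) S4" by code_simp
  then show "xs \<in> set S4 \<Longrightarrow> length xs = 4 \<and> set xs \<subseteq> {..<4}" by (auto simp: list_all_iff)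
qed

lemma S4_I:
  assumes "length xs = 4" "set xs \<subseteq> {..<4}" "distinct xs" 
  shows "xs \<in> set S4"
proof -
  have "finite (set S4)" by simp
  have "set S4 \<subseteq> {xs. length xs = 4 \<and> set xs \<subseteq> {..<4} \<and> distinct xs}" 
  proof -
    have "list_all (\<lambda>xs. length xs = 4 \<and> list_all (\<lambda>i. i < 4) xs \<and> distinct xs) S4" by code_simp
    then show ?thesis by (auto simp: list_all_iff)
  qed
  moreover have "card {xs :: nat list. length xs = 4 \<and> set xs \<subseteq> {..<4} \<and> distinct xs} = 24"
    using card_lists_distinct_length_eq[of "{..<4::nat}" 4] by (simp add: numeral_eq_Suc conj_commute conj_left_commute)
  moreover have "card (set S4) = 24"
  proof -
    have "distinct S4" "length S4 = 24" by code_simp+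
    then show ?thesis by (simp add: distinct_card)
  qed
  moreover have "finite {xs :: nat list. length xs = 4 \<and> set xs \<subseteq> {..<4} \<and> distinct xs}"
    by (rule finite_subset[OF _ finite_lists_length_eq[of "{..<4}" 4]]) auto
  ultimately have "set S4 = {xs. length xs = 4 \<and> set xs \<subseteq> {..<4} \<and> distinct xs}"
    by (intro card_subset_eq) simp_all
  then show ?thesis using assms by blast
qed

lemma list_comp_assoc:
  assumes "set zs \<subseteq> {..<length ys}"
  shows "list_comp xs (list_comp ys zs) = list_comp (list_comp xs ys) zs"
  using assms by (auto simp: list_comp_def subset_iff)

lemma less_4: "{..<4::nat} = {0, 1, 2, 3}" by auto

lemma list_comp_id: "set ys \<subseteq> {..<4} \<Longrightarrow> list_comp [0, 1, 2, 3] ys = ys"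
  unfolding list_comp_def less_4 by (rule map_idI) auto

lemma list_inv_unique:
  assumes "xs \<in> set S4" "ys \<in> set S4" "list_comp xs ys = [0, 1, 2, 3]"
  shows "ys = list_inv xs"
proof -
  have l: "length (list_inv xs) = 4" by (simp add: list_inv_def)
  have "list_inv xs \<in> set S4"
    using list_groups(1) assms(1) by (auto simp: closed_list_group_def list_all_iff)
  then have "list_comp (list_inv xs) [0, 1, 2, 3] = list_inv xs"
    by (auto simp: list_comp_def list_inv_def)
  moreover have "list_comp (list_inv xs) (list_comp xs ys) = ys"
    using S4_entries[OF assms(1)] S4_entries[OF assms(2)]
    by (simp add: list_comp_assoc list_inv_comp[OF assms(1)] list_comp_id[unfolded One_nat_def])
  ultimately show ?thesis using assms(3) by simp
qed

text \<open>
  The permutation that \<open>\<tau>\<close> induces on a class \<open>K\<close> of at most four indices, which \<open>h\<close> numbers. Numbers that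
  are not used are fixed.
\<close>

definition class_perm :: "(nat \<Rightarrow> nat) \<Rightarrow> nat set \<Rightarrow> (nat \<Rightarrow> nat) \<Rightarrow> nat list"
  where "class_perm h K \<tau> = map (\<lambda>u. if u \<in> h ` K then h (\<tau> (inv_into K h u)) else u) [0, 1, 2, 3]"

context
  fixes h :: "nat \<Rightarrow> nat" and K :: "nat set"
  assumes h_inj: "inj_on h K" and h_range: "h ` K \<subseteq> {..<4}"
begin

lemma class_perm_nth:
  assumes u: "u < 4"
  shows "class_perm h K \<tau> ! u = (if u \<in> h ` K then h (\<tau> (inv_into K h u)) else u)"
proof -
  have upt: "[0, 1, 2, 3] = [0..<4::nat]" by (simp add: upt_conv_Cons)
  show ?thesis unfolding class_perm_def upt using u by (subst nth_map) simp_all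
qed

lemma class_perm_entry: "i \<in> K \<Longrightarrow> class_perm h K \<tau> ! h i = h (\<tau> i)"
  using class_perm_nth[of "h i" \<tau>] h_range h_inj by (auto simp: inv_into_f_f)

lemma length_class_perm: "length (class_perm h K \<tau>) = 4"
  by (simp add: class_perm_def)

lemma class_perm_comp:
  assumes "\<tau> ` K \<subseteq> K"
  shows "class_perm h K (\<sigma> \<circ> \<tau>) = list_comp (class_perm h K \<sigma>) (class_perm h K \<tau>)"
proof (rule nth_equalityI)
  show "length (class_perm h K (\<sigma> \<circ> \<tau>)) = length (list_comp (class_perm h K \<sigma>) (class_perm h K \<tau>))"
    by (simp add: length_class_perm list_comp_def)
next
  fix u assume "u < length (class_perm h K (\<sigma> \<circ> \<tau>))"
  then have u: "u < 4" by (simp add: length_class_perm)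
  have *: "list_comp (class_perm h K \<sigma>) (class_perm h K \<tau>) ! u = class_perm h K \<sigma> ! (class_perm h K \<tau> ! u)"
    using u by (simp add: list_comp_def length_class_perm)
  show "class_perm h K (\<sigma> \<circ> \<tau>) ! u = list_comp (class_perm h K \<sigma>) (class_perm h K \<tau>) ! u"
  proof (cases "u \<in> h ` K")
    case True
    then obtain i where i: "i \<in> K" "u = h i" by blast
    then have "\<tau> i \<in> K" using assms by blast
    then show ?thesis unfolding * by (simp add: i class_perm_entry)
  next
    case False
    then show ?thesis unfolding * using u by (simp add: class_perm_nth)
  qed
qed

lemma class_perm_id: "class_perm h K id = [0, 1, 2, 3]"
proof -
  have "(if u \<in> h ` K then h (id (inv_into K h u)) else u) = u" for u
    by (simp add: f_inv_into_f)
  then show ?thesis unfolding class_perm_def by (simp only: list.map)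
qed

lemma class_perm_trivial:
  assumes "class_perm h K \<tau> = [0, 1, 2, 3]" "\<tau> ` K \<subseteq> K" "i \<in> K"
  shows "\<tau> i = i"
proof -
  have "h i < 4" using h_range assms(3) by blast
  then have "h (\<tau> i) = h i"
    using class_perm_entry[OF assms(3), of \<tau>] class_perm_nth[of "h i" id]
      class_perm_id assms(1,3) by (auto simp: f_inv_into_f split: if_splits)
  moreover have "\<tau> i \<in> K" using assms(2,3) by blast
  ultimately show ?thesis using h_inj assms(3) by (auto simp: inj_on_def)
qed

lemma class_perm_S4:
  assumes "\<tau> ` K \<subseteq> K" "inj_on \<tau> K"
  shows "class_perm h K \<tau> \<in> set S4"
proof (rule S4_I[OF length_class_perm])
  have val: "\<exists>v. class_perm h K \<tau> ! u = v \<and> v < 4 \<and> (v \<in> h ` K \<longleftrightarrow> u \<in> h ` K)" if "u < 4" for u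
  proof (cases "u \<in> h ` K")
    case True
    then obtain i where i: "i \<in> K" "u = h i" by blast
    then have "h (\<tau> i) \<in> h ` K" using assms(1) by blast
    then show ?thesis using i h_range by (auto simp: class_perm_entry)
  next
    case False
    then show ?thesis using that by (simp add: class_perm_nth)
  qed
  show "set (class_perm h K \<tau>) \<subseteq> {..<4}"
    using val by (auto simp: set_conv_nth length_class_perm)
  have "u = v" if "u < 4" "v < 4" and eq: "class_perm h K \<tau> ! u = class_perm h K \<tau> ! v" for u v
  proof (cases "u \<in> h ` K")
    case True
    then have "v \<in> h ` K" using val[OF that(1)] val[OF that(2)] eq by auto
    then obtain i j where ij: "i \<in> K" "u = h i" "j \<in> K" "v = h j" using True by blast
    then have "h (\<tau> i) = h (\<tau> j)" using eq by (simp add: class_perm_entry)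
    moreover have "\<tau> i \<in> K" "\<tau> j \<in> K" using assms(1) ij by blast+
    ultimately have "\<tau> i = \<tau> j" using h_inj by (auto simp: inj_on_def)
    then have "i = j" using assms(2) ij by (auto simp: inj_on_def)
    then show ?thesis using ij by simp
  next
    case False
    then have "v \<notin> h ` K" using val[OF that(1)] val[OF that(2)] eq by auto
    then show ?thesis using False eq that by (simp add: class_perm_nth)
  qed
  then show "distinct (class_perm h K \<tau>)"
    unfolding distinct_conv_nth length_class_perm by blast
qed

end

section \<open>Reduction to automorphisms that commute with the torus\<close>

lemma finite_set_embeds_in_4: "finite K \<Longrightarrow> card K \<le> 4 \<Longrightarrow> \<exists>h. inj_on h K \<and> h ` K \<subseteq> {..<4::nat}"
  using card_le_inj[of K "{..<4::nat}"] by auto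

context suspension_variety
begin

definition exponent_class :: "nat \<Rightarrow> nat set" where "exponent_class c = {i \<in> {1..m}. k i = c}"

lemma has_typeD:
  assumes "has_type \<phi> \<tau>"
  shows "\<tau> permutes {1..m}" "i \<in> {1..m} \<Longrightarrow> k (\<tau> i) = k i"
    "lam \<in> torus \<Longrightarrow> x \<in> open_part \<Longrightarrow> \<phi> (act lam x) = act (lam \<circ> \<tau>) (\<phi> x)"
  using assms by (auto simp: has_type_def)

lemma has_type_exponent_class:
  assumes "has_type \<phi> \<tau>"
  shows "\<tau> ` exponent_class c \<subseteq> exponent_class c" "inj_on \<tau> (exponent_class c)"
proof -
  show "\<tau> ` exponent_class c \<subseteq> exponent_class c"
    using permutes_in_image[OF has_typeD(1)[OF assms]] has_typeD(2)[OF assms]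
    by (auto simp: exponent_class_def simp del: atLeastAtMost_iff)
  show "inj_on \<tau> (exponent_class c)"
    by (rule permutes_inj_on[OF has_typeD(1)[OF assms]])
qed

lemma torus_permute:
  assumes "lam \<in> torus" and \<tau>: "\<tau> permutes {1..m}" and k: "\<And>i. i \<in> {1..m} \<Longrightarrow> k (\<tau> i) = k i"
  shows "lam \<circ> \<tau> \<in> torus"
proof -
  have "(\<Prod>i\<in>{1..m}. lam (\<tau> i) ^ \<kappa> i) = (\<Prod>i\<in>{1..m}. lam (\<tau> i) ^ \<kappa> (\<tau> i))"
    by (rule prod.cong) (simp_all add: \<kappa>_def k)
  also have "\<dots> = (\<Prod>i\<in>{1..m}. lam i ^ \<kappa> i)"
    by (rule prod.reindex_bij_betw[OF permutes_imp_bij[OF \<tau>]])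
  finally show ?thesis
    using assms(1) permutes_in_image[OF \<tau>] unfolding torus_def by (simp del: atLeastAtMost_iff)
qed

lemma has_type_comp:
  assumes \<phi>: "has_type \<phi> \<sigma>" and \<psi>: "has_type \<psi> \<tau>" and maps: "\<And>x. x \<in> open_part \<Longrightarrow> \<psi> x \<in> open_part"
    and h: "\<And>x. x \<in> open_part \<Longrightarrow> h x = \<phi> (\<psi> x)"
  shows "has_type h (\<tau> \<circ> \<sigma>)"
  unfolding has_type_def
proof (intro conjI ballI)
  show "\<tau> \<circ> \<sigma> permutes {1..m}" by (rule permutes_compose[OF has_typeD(1)[OF \<phi>] has_typeD(1)[OF \<psi>]])
  show "k ((\<tau> \<circ> \<sigma>) i) = k i" if "i \<in> {1..m}" for i
    using that permutes_in_image[OF has_typeD(1)[OF \<phi>], of i] has_typeD(2)[OF \<phi>, of i] has_typeD(2)[OF \<psi>, of "\<sigma> i"]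
    by (simp del: atLeastAtMost_iff)
  fix lam x assume l: "lam \<in> torus" and x: "x \<in> open_part"
  have "h (act lam x) = \<phi> (act (lam \<circ> \<tau>) (\<psi> x))"
    unfolding h[OF torus_act_open_part[OF l x]] has_typeD(3)[OF \<psi> l x] ..
  also have "\<dots> = act (lam \<circ> \<tau> \<circ> \<sigma>) (h x)"
    unfolding h[OF x]
    by (rule has_typeD(3)[OF \<phi> torus_permute[OF l has_typeD(1,2)[OF \<psi>]] maps[OF x]])
  finally show "h (act lam x) = act (lam \<circ> (\<tau> \<circ> \<sigma>)) (h x)" by (simp only: comp_assoc)
qed

lemma has_type_id: "(\<And>x. x \<in> open_part \<Longrightarrow> \<phi> x = x) \<Longrightarrow> has_type \<phi> id"
  by (simp add: has_type_def permutes_id torus_act_open_part)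

lemma has_type_inverse:
  assumes \<phi>: "has_type \<phi> \<sigma>" and maps: "\<And>x. x \<in> open_part \<Longrightarrow> \<psi> x \<in> open_part"
    and inv: "\<And>x. x \<in> open_part \<Longrightarrow> \<psi> (\<phi> x) = x" "\<And>x. x \<in> open_part \<Longrightarrow> \<phi> (\<psi> x) = x"
  shows "has_type \<psi> (inv_into UNIV \<sigma>)"
  unfolding has_type_def
proof (intro conjI ballI)
  let ?\<tau> = "inv_into UNIV \<sigma>"
  have \<sigma>: "\<sigma> permutes {1..m}" by (rule has_typeD(1)[OF \<phi>])
  show \<tau>: "?\<tau> permutes {1..m}" by (rule permutes_inv[OF \<sigma>])
  have k: "k (?\<tau> i) = k i" if "i \<in> {1..m}" for i
    using that has_typeD(2)[OF \<phi>, of "?\<tau> i"] permutes_in_image[OF \<tau>, of i] permutes_inverses(1)[OF \<sigma>]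
    by (simp del: atLeastAtMost_iff)
  then show "k (?\<tau> i) = k i" if "i \<in> {1..m}" for i using that .
  fix lam y assume l: "lam \<in> torus" and y: "y \<in> open_part"
  have l': "lam \<circ> ?\<tau> \<in> torus" by (rule torus_permute[OF l \<tau> k])
  have "\<phi> (act (lam \<circ> ?\<tau>) (\<psi> y)) = act lam y"
    unfolding has_typeD(3)[OF \<phi> l' maps[OF y]] inv(2)[OF y]
    by (simp only: comp_assoc permutes_inv_o(2)[OF \<sigma>] comp_id)
  then show "\<psi> (act lam y) = act (lam \<circ> ?\<tau>) (\<psi> y)"
    using inv(1)[OF torus_act_open_part[OF l' maps[OF y]]] by simp
qed

text \<open>
  Composition of automorphisms reverses the order of their types. So the derived series of
  \<open>S\<^sub>4\<close>, applied to every class of equal exponents, pulls back to the automorphism group although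
  a type need not be unique.
\<close>

context
  fixes h :: "nat \<Rightarrow> nat \<Rightarrow> nat"
  assumes h_inj: "\<And>c. inj_on (h c) (exponent_class c)"
    and h_range: "\<And>c. h c ` exponent_class c \<subseteq> {..<4}"
begin

definition type_list :: "nat \<Rightarrow> (nat \<Rightarrow> nat) \<Rightarrow> nat list"
  where "type_list c \<tau> = class_perm (h c) (exponent_class c) \<tau>"

definition typed_in :: "nat list list \<Rightarrow> ((nat \<Rightarrow> 'a) \<Rightarrow> nat \<Rightarrow> 'a) \<Rightarrow> bool"
  where "typed_in S \<phi> \<longleftrightarrow> (\<exists>\<tau>. has_type \<phi> \<tau> \<and> (\<forall>c. type_list c \<tau> \<in> set S))"

lemma type_list_comp:
  "has_type \<phi> \<tau> \<Longrightarrow> type_list c (\<sigma> \<circ> \<tau>) = list_comp (type_list c \<sigma>) (type_list c \<tau>)"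
  unfolding type_list_def by (rule class_perm_comp[OF h_inj h_range has_type_exponent_class(1)])

lemma type_list_S4: "has_type \<phi> \<tau> \<Longrightarrow> type_list c \<tau> \<in> set S4"
  unfolding type_list_def by (rule class_perm_S4[OF h_inj h_range has_type_exponent_class])

lemma type_list_inv:
  assumes "has_type \<phi> \<tau>" "has_type \<psi> (inv_into UNIV \<tau>)"
  shows "type_list c (inv_into UNIV \<tau>) = list_inv (type_list c \<tau>)"
proof (rule list_inv_unique[OF type_list_S4[OF assms(1)] type_list_S4[OF assms(2)]])
  show "list_comp (type_list c \<tau>) (type_list c (inv_into UNIV \<tau>)) = [0, 1, 2, 3]"
    unfolding type_list_comp[OF assms(2), symmetric] permutes_inv_o(1)[OF has_typeD(1)[OF assms(1)]]
    by (simp only: type_list_def class_perm_id[OF h_inj h_range])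
qed

lemma typed_subgroup:
  assumes S: "closed_list_group S"
  shows "subgroup {\<phi> \<in> G. typed_in S \<phi>} (BijGroup Y)"
proof (rule subgroup_BijGroup_restrict[OF G_subgroup])
  fix f assume "f \<in> G" "\<And>x. x \<in> Y \<Longrightarrow> f x = x"
  then have "has_type f id" by (intro has_type_id) (simp add: open_part_Y)
  moreover have "type_list c id \<in> set S" for c
    using S by (simp only: type_list_def class_perm_id[OF h_inj h_range] closed_list_group_def)
  ultimately show "typed_in S f" unfolding typed_in_def by blast
next
  fix f g h' assume f: "f \<in> G" and g: "g \<in> G" and Q: "typed_in S f" "typed_in S g"
    and h: "\<And>x. x \<in> Y \<Longrightarrow> h' x = f (g x)"
  obtain \<sigma> where \<sigma>: "has_type f \<sigma>" "\<And>c. type_list c \<sigma> \<in> set S" using Q(1) by (auto simp: typed_in_def)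
  obtain \<tau> where \<tau>: "has_type g \<tau>" "\<And>c. type_list c \<tau> \<in> set S" using Q(2) by (auto simp: typed_in_def)
  have "has_type h' (\<tau> \<circ> \<sigma>)"
    by (rule has_type_comp[OF \<sigma>(1) \<tau>(1) G_open_part[OF g]]) (simp_all add: h open_part_Y)
  moreover have "type_list c (\<tau> \<circ> \<sigma>) \<in> set S" for c
    using S \<sigma>(2) \<tau>(2) by (simp add: type_list_comp[OF \<sigma>(1)] closed_list_group_def list_all_iff)
  ultimately show "typed_in S h'" unfolding typed_in_def by blast
next
  fix f h' assume f: "f \<in> G" and h: "h' \<in> G" and Q: "typed_in S f"
    and i: "\<And>x. x \<in> Y \<Longrightarrow> h' (f x) = x" "\<And>x. x \<in> Y \<Longrightarrow> f (h' x) = x"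
  obtain \<sigma> where \<sigma>: "has_type f \<sigma>" "\<And>c. type_list c \<sigma> \<in> set S" using Q by (auto simp: typed_in_def)
  have t: "has_type h' (inv_into UNIV \<sigma>)"
    by (rule has_type_inverse[OF \<sigma>(1) G_open_part[OF h]]) (simp_all add: i open_part_Y)
  have "type_list c (inv_into UNIV \<sigma>) \<in> set S" for c
    using S \<sigma>(2) by (simp add: type_list_inv[OF \<sigma>(1) t] closed_list_group_def list_all_iff)
  then show "typed_in S h'" unfolding typed_in_def using t by blast
qed

lemma typed_derives_into:
  assumes S: "closed_list_group S" "closed_list_group T" "commutators_in S T"
  shows "derives_into (BijGroup Y) {\<phi> \<in> G. typed_in S \<phi>} {\<phi> \<in> G. typed_in T \<phi>}"
proof (rule derives_into_BijGroup[OF typed_subgroup[OF S(1)] typed_subgroup[OF S(2)]])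
  fix f g c assume f: "f \<in> {\<phi> \<in> G. typed_in S \<phi>}" and g: "g \<in> {\<phi> \<in> G. typed_in S \<phi>}"
    and c: "c \<in> {\<phi> \<in> G. typed_in S \<phi>}" and comm: "\<And>x. x \<in> Y \<Longrightarrow> c (g (f x)) = f (g x)"
  have fG: "f \<in> G" and gG: "g \<in> G" using f g by auto
  obtain \<sigma> where \<sigma>: "has_type f \<sigma>" "\<And>c. type_list c \<sigma> \<in> set S" using f by (auto simp: typed_in_def)
  obtain \<tau> where \<tau>: "has_type g \<tau>" "\<And>c. type_list c \<tau> \<in> set S" using g by (auto simp: typed_in_def)
  obtain f' where f': "f' \<in> G" "\<And>x. x \<in> Y \<Longrightarrow> f' (f x) = x" "\<And>x. x \<in> Y \<Longrightarrow> f (f' x) = x"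
    using G_inverse[OF fG] by auto
  obtain g' where g': "g' \<in> G" "\<And>x. x \<in> Y \<Longrightarrow> g' (g x) = x" "\<And>x. x \<in> Y \<Longrightarrow> g (g' x) = x"
    using G_inverse[OF gG] by auto
  have tf: "has_type f' (inv_into UNIV \<sigma>)"
    by (rule has_type_inverse[OF \<sigma>(1) G_open_part[OF f'(1)]]) (simp_all add: f' open_part_Y)
  have tg: "has_type g' (inv_into UNIV \<tau>)"
    by (rule has_type_inverse[OF \<tau>(1) G_open_part[OF g'(1)]]) (simp_all add: g' open_part_Y)
  let ?a = "inv_into UNIV \<tau> \<circ> inv_into UNIV \<sigma>"
  have 1: "has_type (\<lambda>x. f' (g' x)) ?a"
    by (rule has_type_comp[OF tf tg G_open_part[OF g'(1)]]) simp_all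
  have 2: "has_type (\<lambda>x. g (f' (g' x))) (?a \<circ> \<tau>)"
    by (rule has_type_comp[OF \<tau>(1) 1]) (simp_all add: G_open_part f'(1) g'(1))
  have 3: "has_type c (?a \<circ> \<tau> \<circ> \<sigma>)"
  proof (rule has_type_comp[OF \<sigma>(1) 2])
    fix x assume "x \<in> open_part"
    then have x: "x \<in> Y" by (rule open_part_Y)
    then have y: "g' x \<in> Y" "f' (g' x) \<in> Y" using G_mem f'(1) g'(1) by blast+
    show "c x = f (g (f' (g' x)))" using comm[OF y(2)] x y by (simp add: f' g')
  qed (simp add: G_open_part f'(1) g'(1) gG)
  have "type_list c (?a \<circ> \<tau> \<circ> \<sigma>) = list_commutator (type_list c \<sigma>) (type_list c \<tau>)" for c
    unfolding list_commutator_def type_list_comp[OF \<sigma>(1)] type_list_comp[OF \<tau>(1)] type_list_comp[OF tf]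
      type_list_inv[OF \<sigma>(1) tf] type_list_inv[OF \<tau>(1) tg] ..
  then have "type_list c (?a \<circ> \<tau> \<circ> \<sigma>) \<in> set T" for c
    using S(3) \<sigma>(2) \<tau>(2) by (simp add: commutators_in_def list_all_iff)
  then have "typed_in T c" unfolding typed_in_def using 3 by blast
  then show "c \<in> {\<phi> \<in> G. typed_in T \<phi>}" using c by simp
qed

lemma typed_trivial: "typed_in [[0, 1, 2, 3]] \<phi> \<Longrightarrow> has_type \<phi> id"
proof -
  assume "typed_in [[0, 1, 2, 3]] \<phi>"
  then obtain \<tau> where \<tau>: "has_type \<phi> \<tau>" "\<And>c. type_list c \<tau> = [0, 1, 2, 3]" by (auto simp: typed_in_def)
  have "\<tau> i = i" for i
  proof (cases "i \<in> {1..m}")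
    case True
    then have "i \<in> exponent_class (k i)" by (simp add: exponent_class_def)
    then show ?thesis
      by (rule class_perm_trivial[OF h_inj h_range \<tau>(2)[unfolded type_list_def] has_type_exponent_class(1)[OF \<tau>(1)]])
  next
    case False
    then show ?thesis using permutes_not_in[OF has_typeD(1)[OF \<tau>(1)]] by blast
  qed
  then have "\<tau> = id" by (intro ext) simp
  then show "has_type \<phi> id" using \<tau>(1) by simp
qed

lemma derives_into_typed_id: "derives_into (BijGroup Y) G {\<phi> \<in> G. has_type \<phi> id}"
proof -
  have "G \<subseteq> {\<phi> \<in> G. typed_in S4 \<phi>}"
    using has_type_exists type_list_S4 unfolding typed_in_def by blast
  note s = derives_into_refl[OF this]
  note d = typed_derives_into[OF list_groups(1,2) list_commutators(1)]
    typed_derives_into[OF list_groups(2,3) list_commutators(2)]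
    typed_derives_into[OF list_groups(3,4) list_commutators(3)]
  have "{\<phi> \<in> G. typed_in [[0, 1, 2, 3]] \<phi>} \<subseteq> {\<phi> \<in> G. has_type \<phi> id}"
    using typed_trivial by blast
  note e = derives_into_refl[OF this]
  note tr = group.derives_into_trans[OF group_BijGroup]
  show ?thesis by (rule tr[OF s tr[OF d(1) tr[OF d(2) tr[OF d(3) e]]]])
qed

end

theorem derives_into_torus_centraliser:
  assumes "\<And>c. card (exponent_class c) \<le> 4"
  shows "derives_into (BijGroup Y) G {\<phi> \<in> G. has_type \<phi> id}"
proof -
  have "\<forall>c. \<exists>h. inj_on h (exponent_class c) \<and> h ` exponent_class c \<subseteq> {..<4::nat}"
    using assms by (intro allI finite_set_embeds_in_4) (simp_all add: exponent_class_def)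
  then obtain h where "\<forall>c. inj_on (h c) (exponent_class c) \<and> h c ` exponent_class c \<subseteq> {..<4::nat}"
    by (rule choice[THEN exE])
  then show ?thesis using derives_into_typed_id[of h] by blast
qed

end

section \<open>Automorphisms that commute with the torus form a solvable group\<close>

lemma variety_auts_restrictI:
  assumes maps: "\<And>x. x \<in> X \<Longrightarrow> \<alpha> x \<in> X" "\<And>x. x \<in> X \<Longrightarrow> \<beta> x \<in> X"
    and inv: "\<And>x. x \<in> X \<Longrightarrow> \<beta> (\<alpha> x) = x" "\<And>x. x \<in> X \<Longrightarrow> \<alpha> (\<beta> x) = x"
    and pol: "\<And>j. j \<in> {1..n} \<Longrightarrow> \<exists>p\<in>polynomial_functions n. \<forall>x\<in>X. \<alpha> x j = p x"
      "\<And>j. j \<in> {1..n} \<Longrightarrow> \<exists>p\<in>polynomial_functions n. \<forall>x\<in>X. \<beta> x j = p x"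
  shows "restrict \<alpha> X \<in> variety_auts n X"
proof -
  have bij: "bij_betw \<alpha> X X"
    by (rule bij_betw_byWitness[of X \<beta>]) (use maps inv in auto)
  have i: "inv_into X (restrict \<alpha> X) x = \<beta> x" if "x \<in> X" for x
    using that maps inv bij by (intro inv_into_f_eq) (auto simp: bij_betw_def inj_on_restrict_eq)
  have "affine_morphism n X n X \<alpha>" "affine_morphism n X n X \<beta>"
    using maps pol by (auto simp: affine_morphism_def)
  then have "affine_morphism n X n X (restrict \<alpha> X)" "affine_morphism n X n X (inv_into X (restrict \<alpha> X))"
    by (auto elim: affine_morphism_cong simp: i)
  moreover have "restrict \<alpha> X \<in> Bij X"
    using bij by (simp add: Bij_def bij_betw_restrict_eq)
  ultimately show ?thesis by (simp add: variety_auts_def)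
qed

context suspension_variety
begin

lemma PF_coordinates_cases:
  assumes "\<And>j. j \<in> {1..m} \<Longrightarrow> Q j" "Q (Suc m)" "j \<in> {1..Suc m}"
  shows "Q j"
  using assms by (cases "j = Suc m") auto

lemma act_in_G:
  assumes nz: "\<And>i. i \<in> {1..m} \<Longrightarrow> lam i \<noteq> 0" and one: "(\<Prod>i\<in>{1..m}. lam i ^ k i) = 1"
  shows "restrict (act lam) Y \<in> G"
  unfolding G_def
proof (rule variety_auts_restrictI)
  let ?mu = "\<lambda>i. inverse (lam i)"
  have one': "(\<Prod>i\<in>{1..m}. ?mu i ^ k i) = 1"
    using one prod_inversef[of "\<lambda>i. lam i ^ k i" "{1..m}"] by (simp add: power_inverse comp_def)
  show "act lam x \<in> Y" if "x \<in> Y" for x by (rule act_mem_Y[OF one that])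
  show "act ?mu x \<in> Y" if "x \<in> Y" for x by (rule act_mem_Y[OF one' that])
  show "act ?mu (act lam x) = x" if "x \<in> Y" for x
    unfolding act_act by (rule act_one[OF that]) (use nz in auto)
  show "act lam (act ?mu x) = x" if "x \<in> Y" for x
    unfolding act_act by (rule act_one[OF that]) (use nz in auto)
  have "\<exists>p\<in>PF. \<forall>x\<in>Y. act mu x j = p x" if "j \<in> {1..Suc m}" for mu :: "nat \<Rightarrow> 'a" and j
  proof (rule PF_coordinates_cases[OF _ _ that])
    show "\<exists>p\<in>PF. \<forall>x\<in>Y. act mu x j = p x" if "j \<in> {1..m}" for j
      using that by (intro bexI[of _ "\<lambda>x. mu j * x j"])
        (auto simp: act_apply intro!: polynomial_functions.mult polynomial_functions.const coord_PF)
    show "\<exists>p\<in>PF. \<forall>x\<in>Y. act mu x (Suc m) = p x"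
      by (intro bexI[of _ "\<lambda>x. x (Suc m)"]) (auto simp: act_apply coord_PF)
  qed
  then show "\<exists>p\<in>PF. \<forall>x\<in>Y. act lam x j = p x" "\<exists>p\<in>PF. \<forall>x\<in>Y. act ?mu x j = p x"
    if "j \<in> {1..Suc m}" for j using that by blast+
qed

text \<open>The open part is dense, so an automorphism is determined by its restriction to it.\<close>

lemma identity_from_open_part:
  assumes \<phi>: "\<phi> \<in> G" and id: "\<And>x. x \<in> open_part \<Longrightarrow> \<phi> x = x" and x: "x \<in> Y"
  shows "\<phi> x = x"
proof -
  obtain \<Phi> where \<Phi>: "\<forall>i\<in>{1..Suc m}. (\<lambda>x. \<Phi> x i) \<in> PF \<and> (\<forall>x\<in>Y. \<phi> x i = \<Phi> x i)"
    using G_lift[OF \<phi>] by blast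
  have "\<phi> x i = x i" if i: "i \<in> {1..Suc m}" for i
  proof -
    have pf: "(\<lambda>x. \<Phi> x i - x i) \<in> PF"
      using \<Phi> i by (intro polynomial_functions_diff polynomial_functions.coord) blast+
    have zero: "\<Phi> x i - x i = 0" if "x \<in> Y" "\<And>i. i \<in> {1..m} \<Longrightarrow> x i \<noteq> 0" for x
    proof -
      have "x \<in> open_part" using that by (auto simp: open_part_def D_def)
      then have "\<phi> x i = x i" using id by simp
      then show ?thesis using \<Phi> i that(1) by simp
    qed
    obtain H where "\<forall>x. \<Phi> x i - x i = F x * H x" using vanishing_ideal[OF pf zero] by blast
    then have "\<Phi> x i - x i = 0" using Y_F[OF x] by simp
    then show ?thesis using \<Phi> i x by simp
  qed
  then show ?thesis by (intro Y_eqI[OF G_mem[OF \<phi> x] x]) simp_all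
qed

abbreviation "T0 \<equiv> {\<phi> \<in> G. has_type \<phi> id}"

lemma T0_act: "\<phi> \<in> T0 \<Longrightarrow> lam \<in> torus \<Longrightarrow> x \<in> open_part \<Longrightarrow> \<phi> (act lam x) = act lam (\<phi> x)"
  using has_typeD(3)[of \<phi> id lam x] by simp

lemma T0_subgroup: "subgroup T0 (BijGroup Y)"
proof (rule subgroup_BijGroup_restrict[OF G_subgroup])
  fix f assume "f \<in> G" "\<And>x. x \<in> Y \<Longrightarrow> f x = x"
  then show "has_type f id" by (intro has_type_id) (simp add: open_part_Y)
next
  fix f g h assume g: "g \<in> G" and f: "has_type f id" "has_type g id" and h: "\<And>x. x \<in> Y \<Longrightarrow> h x = f (g x)"
  then show "has_type h id"
    using has_type_comp[OF f G_open_part[OF g], of h] by (simp add: open_part_Y)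
next
  fix f h assume h: "h \<in> G" and f: "has_type f id"
    and i: "\<And>x. x \<in> Y \<Longrightarrow> h (f x) = x" "\<And>x. x \<in> Y \<Longrightarrow> f (h x) = x"
  show "has_type h id"
    using has_type_inverse[OF f G_open_part[OF h]] by (simp add: i open_part_Y inv_id)
qed

text \<open>
  For an automorphism \<open>\<phi>\<close> that commutes with the torus, \<open>z \<circ> \<phi>\<close> and \<open>w \<circ> \<phi>\<close> are invariant
  under the torus and hence polynomials in \<open>z\<close> and \<open>w\<close>. The rotations of the curve are
  obtained by scaling \<open>y\<^sub>1\<close>.
\<close>

sublocale centraliser: curve_group P g open_part zc wc T0 Y
proof (intro curve_group.intro curve_action.intro bij_action.intro)
  show "1 \<le> g" using g_pos by simp
  show "2 \<le> degree P" by (rule deg_P)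
  show "wc x ^ g = poly P (zc x)" if "x \<in> open_part" for x by (rule wc_power[OF open_part_Y[OF that]])
  show "\<exists>x\<in>open_part. zc x = a \<and> wc x = b" if "b ^ g = poly P a" "b \<noteq> 0" for a b
    by (rule curve_point_lift[OF that])
  show "\<phi> x \<in> open_part" if "\<phi> \<in> T0" "x \<in> open_part" for \<phi> x using that G_open_part by blast
  show "\<exists>\<chi>\<in>T0. \<forall>x\<in>open_part. \<chi> x = \<phi> (\<psi> x)" if fg: "\<phi> \<in> T0" "\<psi> \<in> T0" for \<phi> \<psi>
  proof (rule bexI)
    show "\<phi> \<otimes>\<^bsub>BijGroup Y\<^esub> \<psi> \<in> T0" by (rule subgroup.m_closed[OF T0_subgroup fg])
    show "\<forall>x\<in>open_part. (\<phi> \<otimes>\<^bsub>BijGroup Y\<^esub> \<psi>) x = \<phi> (\<psi> x)"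
      using fg by (simp add: BijGroup_sel G_Bij compose_def open_part_Y)
  qed
  show "\<exists>\<psi>\<in>T0. \<forall>x\<in>open_part. \<psi> (\<phi> x) = x \<and> \<phi> (\<psi> x) = x" if f: "\<phi> \<in> T0" for \<phi>
  proof (rule bexI)
    show "inv\<^bsub>BijGroup Y\<^esub> \<phi> \<in> T0" by (rule subgroup.m_inv_closed[OF T0_subgroup f])
    show "\<forall>x\<in>open_part. (inv\<^bsub>BijGroup Y\<^esub> \<phi>) (\<phi> x) = x \<and> \<phi> ((inv\<^bsub>BijGroup Y\<^esub> \<phi>) x) = x"
      using f BijGroup_inv[OF G_Bij] by (simp add: open_part_Y)
  qed
  show "\<exists>B. \<forall>x\<in>open_part. zc (\<phi> x) = bev B (zc x) (wc x)"
    and "\<exists>B. \<forall>x\<in>open_part. wc (\<phi> x) = bev B (zc x) (wc x)" if f: "\<phi> \<in> T0" for \<phi>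
  proof -
    obtain \<Phi> where \<Phi>: "\<forall>i\<in>{1..Suc m}. (\<lambda>x. \<Phi> x i) \<in> PF \<and> (\<forall>x\<in>Y. \<phi> x i = \<Phi> x i)"
      using G_lift f by blast
    have eq: "zc (\<Phi> x) = zc (\<phi> x)" "wc (\<Phi> x) = wc (\<phi> x)" if "x \<in> open_part" for x
    proof -
      have "\<phi> x i = \<Phi> x i" if "i \<in> {1..Suc m}" for i
        using \<Phi> that open_part_Y[OF \<open>x \<in> open_part\<close>] by blast
      then show "zc (\<Phi> x) = zc (\<phi> x)" "wc (\<Phi> x) = wc (\<phi> x)"
        unfolding zc_def wc_def by (auto intro: prod.cong)
    qed
    have pf: "(\<lambda>x. zc (\<Phi> x)) \<in> PF" "(\<lambda>x. wc (\<Phi> x)) \<in> PF"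
      unfolding zc_def wc_def using \<Phi>
      by (auto intro!: polynomial_functions_prod polynomial_functions_power)
    have inv: "zc (\<Phi> (act lam x)) = zc (\<Phi> x)" "wc (\<Phi> (act lam x)) = wc (\<Phi> x)"
      if l: "lam \<in> torus" and x: "x \<in> open_part" for lam x
    proof -
      have "(\<Prod>i\<in>{1..m}. lam i ^ \<kappa> i) = 1" using l by (simp add: torus_def)
      then show "zc (\<Phi> (act lam x)) = zc (\<Phi> x)" "wc (\<Phi> (act lam x)) = wc (\<Phi> x)"
        unfolding eq[OF torus_act_open_part[OF l x]] eq[OF x] T0_act[OF f l x] zc_act wc_act
        by simp_all
    qed
    show "\<exists>B. \<forall>x\<in>open_part. zc (\<phi> x) = bev B (zc x) (wc x)"
      using torus_invariant_function[OF pf(1) inv(1)] eq(1) by auto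
    show "\<exists>B. \<forall>x\<in>open_part. wc (\<phi> x) = bev B (zc x) (wc x)"
      using torus_invariant_function[OF pf(2) inv(2)] eq(2) by auto
  qed
  show "\<exists>\<alpha>\<in>T0. \<forall>x\<in>open_part. zc (\<alpha> x) = zc x \<and> wc (\<alpha> x) = \<zeta> * wc x" if \<zeta>: "\<zeta> ^ g = 1" for \<zeta>
  proof -
    have 1: "1 \<in> {1..m}" using m_pos by simp
    obtain \<nu> where \<nu>: "\<nu> ^ \<kappa> 1 = \<zeta>" using nth_root_exists \<kappa>_pos[OF 1] by blast
    define lam where "lam i = (if i = 1 then \<nu> else 1)" for i :: nat
    have "\<zeta> \<noteq> 0" using \<zeta> g_pos by (auto simp: power_0_left)
    then have "\<nu> \<noteq> 0" using \<nu> \<kappa>_pos[OF 1] by (auto simp: power_0_left)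
    then have nz: "lam i \<noteq> 0" for i by (simp add: lam_def)
    have "(\<Prod>i\<in>{1..m}. lam i ^ \<kappa> i) = (\<Prod>i\<in>{1..m}. if i = 1 then \<zeta> else 1)"
      using \<nu> by (intro prod.cong) (auto simp: lam_def)
    then have p: "(\<Prod>i\<in>{1..m}. lam i ^ \<kappa> i) = \<zeta>" using 1 by (simp add: prod.delta)
    have "restrict (act lam) Y \<in> G"
      by (rule act_in_G[OF nz]) (simp only: prod_k p \<zeta>)
    moreover have "has_type (restrict (act lam) Y) id"
      unfolding has_type_def
      by (simp add: permutes_id torus_act_open_part open_part_Y act_act mult.commute)
    moreover have "zc (restrict (act lam) Y x) = zc x \<and> wc (restrict (act lam) Y x) = \<zeta> * wc x"
      if "x \<in> open_part" for x
      unfolding restrict_apply'[OF open_part_Y[OF that]] zc_act wc_act p by simp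
    ultimately show ?thesis by blast
  qed
  show "subgroup T0 (BijGroup Y)" by (rule T0_subgroup)
  show "open_part \<subseteq> Y" using open_part_Y by blast
  show "\<phi> x \<in> open_part" if "\<phi> \<in> T0" "x \<in> open_part" for \<phi> x using that G_open_part by blast
qed

text \<open>
  An automorphism that fixes \<open>z\<close> and \<open>w\<close> moves every point within its torus orbit; since it also
  commutes with the torus, two such automorphisms commute.
\<close>

lemma curve_kernel_derives_into_one:
  "derives_into (BijGroup Y) centraliser.curve_kernel {\<one>\<^bsub>BijGroup Y\<^esub>}"
proof (rule derives_into_BijGroup)
  show "subgroup centraliser.curve_kernel (BijGroup Y)"
  proof (rule centraliser.subgroup_on_X)
    fix f h assume f: "f \<in> T0" and h: "h \<in> T0"
      and Q: "\<forall>x\<in>open_part. zc (f x) = zc x \<and> wc (f x) = wc x"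
      and i: "\<And>x. x \<in> open_part \<Longrightarrow> f (h x) = x"
    have "zc (f (h x)) = zc (h x) \<and> wc (f (h x)) = wc (h x)" if "x \<in> open_part" for x
      using Q G_open_part[of h x] h that by simp
    then show "\<forall>x\<in>open_part. zc (h x) = zc x \<and> wc (h x) = wc x" using i by simp
  next
    fix f g h assume g: "g \<in> T0" and Q: "\<forall>x\<in>open_part. zc (f x) = zc x \<and> wc (f x) = wc x"
      "\<forall>x\<in>open_part. zc (g x) = zc x \<and> wc (g x) = wc x" and h: "\<And>x. x \<in> open_part \<Longrightarrow> h x = f (g x)"
    then show "\<forall>x\<in>open_part. zc (h x) = zc x \<and> wc (h x) = wc x"
      using G_open_part[of g] by simp
  qed simp
  show "subgroup {\<one>\<^bsub>BijGroup Y\<^esub>} (BijGroup Y)" by (rule group.triv_subgroup[OF group_BijGroup])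
next
  fix f g c assume f: "f \<in> centraliser.curve_kernel" and g: "g \<in> centraliser.curve_kernel"
    and c: "c \<in> centraliser.curve_kernel" and comm: "\<And>x. x \<in> Y \<Longrightarrow> c (g (f x)) = f (g x)"
  have T: "f \<in> T0" "g \<in> T0" "c \<in> T0" using f g c by blast+
  then have TG: "f \<in> G" "g \<in> G" "c \<in> G" by blast+
  have orbit: "\<exists>lam\<in>torus. \<phi> x = act lam x" if "\<phi> \<in> centraliser.curve_kernel" "x \<in> open_part" for \<phi> x
    using that G_open_part[of \<phi> x] by (intro same_torus_orbit) simp_all
  have "c y = y" if y: "y \<in> open_part" for y
  proof -
    obtain y' where y': "y' \<in> open_part" "y = g y'" using centraliser.H_surj_X[OF T(2) y] by blast
    obtain x where x: "x \<in> open_part" "y' = f x" using centraliser.H_surj_X[OF T(1) y'(1)] by blast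
    obtain a where a: "a \<in> torus" "f x = act a x" using orbit[OF f x(1)] by blast
    obtain b where b: "b \<in> torus" "g x = act b x" using orbit[OF g x(1)] by blast
    have "g (f x) = act a (act b x)" unfolding a(2) T0_act[OF T(2) a(1) x(1)] b(2) ..
    moreover have "f (g x) = act b (act a x)" unfolding b(2) T0_act[OF T(1) b(1) x(1)] a(2) ..
    ultimately have "f (g x) = g (f x)" unfolding act_act by (simp add: mult.commute)
    then show ?thesis using comm[OF open_part_Y[OF x(1)]] x(2) y'(2) by simp
  qed
  then have "c x = x" if "x \<in> Y" for x by (rule identity_from_open_part[OF TG(3) _ that])
  then have "c = (\<lambda>x\<in>Y. x)" by (intro Bij_eqI[OF G_Bij[OF TG(3)] id_Bij]) simp
  then show "c \<in> {\<one>\<^bsub>BijGroup Y\<^esub>}" by (simp add: BijGroup_sel)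
qed

lemma Aut_eq: "Aut_variety (m + 1) (suspension m k P) = BijGroup Y\<lparr>carrier := G\<rparr>"
  by (simp add: Aut_variety_def G_def Y_def)

theorem Aut_solvable:
  assumes "\<And>c. card (exponent_class c) \<le> 4"
  shows "solvable (Aut_variety (m + 1) (suspension m k P))"
  unfolding Aut_eq
proof (rule group.solvable_if_derives_into_one[OF group_BijGroup G_subgroup])
  note tr = group.derives_into_trans[OF group_BijGroup]
  show "derives_into (BijGroup Y) G {\<one>\<^bsub>BijGroup Y\<^esub>}"
    by (rule tr[OF derives_into_torus_centraliser[OF assms]
        tr[OF centraliser.curve_derives_into_kernel curve_kernel_derives_into_one]])
qed

end

section \<open>Five equal exponents\<close>

context suspension_variety
begin

definition permute_coordinates :: "(nat \<Rightarrow> nat) \<Rightarrow> (nat \<Rightarrow> 'a) \<Rightarrow> nat \<Rightarrow> 'a"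
  where "permute_coordinates \<pi> x = pt (\<lambda>i. if i = Suc m then x i else x (\<pi> i))"

lemma permute_coordinates_apply:
  "i \<in> {1..m} \<Longrightarrow> permute_coordinates \<pi> x i = x (\<pi> i)" "permute_coordinates \<pi> x (Suc m) = x (Suc m)"
  by (auto simp: permute_coordinates_def)

lemma permute_coordinates_comp:
  assumes "\<pi> permutes {1..m}"
  shows "permute_coordinates \<pi> (permute_coordinates \<rho> x) = permute_coordinates (\<rho> \<circ> \<pi>) x"
  unfolding permute_coordinates_def[of \<pi>] permute_coordinates_def[of "\<rho> \<circ> \<pi>"] pt_def
proof (rule restrict_ext)
  fix i assume "i \<in> {1..Suc m}"
  then show "(if i = Suc m then permute_coordinates \<rho> x i else permute_coordinates \<rho> x (\<pi> i)) =
      (if i = Suc m then x i else x ((\<rho> \<circ> \<pi>) i))"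
    using permutes_in_image[OF assms, of i] by (auto simp: permute_coordinates_apply)
qed

lemma permute_coordinates_id:
  assumes "x \<in> Y"
  shows "permute_coordinates id x = x"
proof -
  have "(\<lambda>i. if i = Suc m then x i else x (id i)) = x" by auto
  then show ?thesis unfolding permute_coordinates_def using Y_ext[OF assms] by simp
qed

lemma permute_coordinates_Y:
  assumes \<pi>: "\<pi> permutes {1..m}" and k: "\<And>i. i \<in> {1..m} \<Longrightarrow> k (\<pi> i) = k i" and x: "x \<in> Y"
  shows "permute_coordinates \<pi> x \<in> Y"
proof -
  have "(\<Prod>i\<in>{1..m}. permute_coordinates \<pi> x i ^ k i) = (\<Prod>i\<in>{1..m}. x (\<pi> i) ^ k (\<pi> i))"
    by (rule prod.cong) (simp_all add: permute_coordinates_apply k)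
  also have "\<dots> = (\<Prod>i\<in>{1..m}. x i ^ k i)"
    by (rule prod.reindex_bij_betw[OF permutes_imp_bij[OF \<pi>]])
  finally have "F (permute_coordinates \<pi> x) = F x"
    unfolding F_def permute_coordinates_apply(2) by simp
  then show ?thesis using Y_F[OF x] unfolding permute_coordinates_def pt_mem_Y F_pt by simp
qed

lemma permute_coordinates_in_G:
  assumes \<pi>: "\<pi> permutes {1..m}" and k: "\<And>i. i \<in> {1..m} \<Longrightarrow> k (\<pi> i) = k i"
  shows "restrict (permute_coordinates \<pi>) Y \<in> G"
  unfolding G_def
proof (rule variety_auts_restrictI)
  let ?\<rho> = "inv_into UNIV \<pi>"
  have \<rho>: "?\<rho> permutes {1..m}" by (rule permutes_inv[OF \<pi>])
  have k': "k (?\<rho> i) = k i" if "i \<in> {1..m}" for i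
    using that k[of "?\<rho> i"] permutes_in_image[OF \<rho>, of i] permutes_inverses(1)[OF \<pi>]
    by (simp del: atLeastAtMost_iff)
  show "permute_coordinates \<pi> x \<in> Y" if "x \<in> Y" for x by (rule permute_coordinates_Y[OF \<pi> k that])
  show "permute_coordinates ?\<rho> x \<in> Y" if "x \<in> Y" for x by (rule permute_coordinates_Y[OF \<rho> k' that])
  show "permute_coordinates ?\<rho> (permute_coordinates \<pi> x) = x" if "x \<in> Y" for x
    unfolding permute_coordinates_comp[OF \<rho>] permutes_inv_o(1)[OF \<pi>] by (rule permute_coordinates_id[OF that])
  show "permute_coordinates \<pi> (permute_coordinates ?\<rho> x) = x" if "x \<in> Y" for x
    unfolding permute_coordinates_comp[OF \<pi>] permutes_inv_o(2)[OF \<pi>] by (rule permute_coordinates_id[OF that])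
  have "\<exists>p\<in>PF. \<forall>x\<in>Y. permute_coordinates \<tau> x j = p x" if \<tau>: "\<tau> permutes {1..m}" and j: "j \<in> {1..Suc m}" for \<tau> j
  proof (rule PF_coordinates_cases[OF _ _ j])
    show "\<exists>p\<in>PF. \<forall>x\<in>Y. permute_coordinates \<tau> x j = p x" if "j \<in> {1..m}" for j
      using that permutes_in_image[OF \<tau>, of j] coord_PF(1)[of "\<tau> j"]
      by (intro bexI[of _ "\<lambda>x. x (\<tau> j)"]) (simp_all add: permute_coordinates_apply del: atLeastAtMost_iff)
    show "\<exists>p\<in>PF. \<forall>x\<in>Y. permute_coordinates \<tau> x (Suc m) = p x"
      by (intro bexI[of _ "\<lambda>x. x (Suc m)"]) (auto simp: permute_coordinates_apply coord_PF)
  qed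
  then show "\<exists>p\<in>PF. \<forall>x\<in>Y. permute_coordinates \<pi> x j = p x" "\<exists>p\<in>PF. \<forall>x\<in>Y. permute_coordinates ?\<rho> x j = p x"
    if "j \<in> {1..Suc m}" for j using that \<pi> \<rho> by blast+
qed

text \<open>
  The point used here has pairwise distinct coordinates \<open>y\<^sub>i = i\<close>, so it detects every permutation of
  the coordinates.
\<close>

lemma permute_coordinates_inj:
  assumes \<pi>: "\<pi> permutes {1..m}" and \<rho>: "\<rho> permutes {1..m}"
    and eq: "\<And>x. x \<in> Y \<Longrightarrow> permute_coordinates \<pi> x = permute_coordinates \<rho> x"
  shows "\<pi> = \<rho>"
proof
  fix i
  show "\<pi> i = \<rho> i"
  proof (cases "i \<in> {1..m}")
    case True
    define c :: 'a where "c = (\<Prod>i\<in>{1..m}. of_nat i ^ k i)"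
    have "degree (P + [:- c:]) = degree P" by (rule degree_add_eq_left) (use deg_P in simp)
    then have "degree (P + [:- c:]) > 0" using deg_P by simp
    then obtain a where "poly (P + [:- c:]) a = 0" using alg_closed_imp_poly_has_root by blast
    then have a: "poly P a = c" by simp
    define y where "y = pt (\<lambda>i. if i = Suc m then a else of_nat i)"
    have app: "y i = of_nat i" if "i \<in> {1..m}" for i using that by (auto simp: y_def)
    have "F (\<lambda>i. if i = Suc m then a else of_nat i) = 0"
      unfolding F_def using a by (simp add: c_def)
    then have "y \<in> Y" unfolding y_def pt_mem_Y .
    then have "permute_coordinates \<pi> y i = permute_coordinates \<rho> y i" using eq by simp
    then have "y (\<pi> i) = y (\<rho> i)" using True by (simp only: permute_coordinates_apply)
    moreover have "\<pi> i \<in> {1..m}" "\<rho> i \<in> {1..m}"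
      using True permutes_in_image[OF \<pi>] permutes_in_image[OF \<rho>] by blast+
    ultimately show ?thesis by (simp only: app of_nat_eq_iff)
  next
    case False
    then show ?thesis using permutes_not_in[OF \<pi>] permutes_not_in[OF \<rho>] by simp
  qed
qed

text \<open>
  The symmetric group on five letters acts faithfully by permuting the coordinates with indices in \<open>J\<close>.
\<close>

theorem Aut_not_solvable:
  assumes J: "J \<subseteq> {1..m}" "card J = 5" and eq: "\<And>i j. i \<in> J \<Longrightarrow> j \<in> J \<Longrightarrow> k i = k j"
  shows "\<not> solvable (Aut_variety (m + 1) (suspension m k P))"
proof
  assume solv: "solvable (Aut_variety (m + 1) (suspension m k P))"
  have "finite J" using J(2) by (auto intro: card_ge_0_finite)
  then obtain b where b: "bij_betw b {1..5::nat} J"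
    using J(2) by (metis card_atLeastAtMost diff_Suc_1 finite_atLeastAtMost finite_same_card_bij)
  define \<pi> where "\<pi> p i = (if i \<in> J then b (p (inv_into {1..5} b i)) else i)" for p :: "nat \<Rightarrow> nat" and i
  have \<pi>_b: "\<pi> p (b u) = b (p u)" if "u \<in> {1..5}" for p u
    using that b by (auto simp: \<pi>_def bij_betw_def)
  have \<pi>_out: "\<pi> p i = i" if "i \<notin> J" for p i using that by (simp add: \<pi>_def)
  have b_J: "b u \<in> J" if "u \<in> {1..5}" for u using that b by (auto simp: bij_betw_def)
  have J_b: "\<exists>u\<in>{1..5}. i = b u" if "i \<in> J" for i using that b by (auto simp: bij_betw_def)
  have \<pi>_comp: "\<pi> (p \<circ> q) = \<pi> p \<circ> \<pi> q" if q: "q permutes {1..5}" for p q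
  proof
    fix i
    show "\<pi> (p \<circ> q) i = (\<pi> p \<circ> \<pi> q) i"
    proof (cases "i \<in> J")
      case True
      then obtain u where u: "u \<in> {1..5}" "i = b u" using J_b by blast
      have "q u \<in> {1..5}" using permutes_in_image[OF q] u(1) by blast
      then show ?thesis using u by (simp add: \<pi>_b)
    qed (simp add: \<pi>_out)
  qed
  have \<pi>_id: "\<pi> id = id"
  proof
    fix i show "\<pi> id i = id i" using J_b[of i] by (cases "i \<in> J") (auto simp: \<pi>_b \<pi>_out)
  qed
  have \<pi>_J: "\<pi> p i \<in> J" if p: "p permutes {1..5}" and i: "i \<in> J" for p i
  proof -
    obtain u where u: "u \<in> {1..5}" "i = b u" using J_b[OF i] by blast
    have "p u \<in> {1..5}" using permutes_in_image[OF p] u(1) by blast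
    then show ?thesis using u by (simp only: \<pi>_b b_J)
  qed
  have \<pi>_perm: "\<pi> p permutes {1..m}" if p: "p permutes {1..5}" for p
  proof -
    have p': "inv_into UNIV p permutes {1..5}" by (rule permutes_inv[OF p])
    have "\<pi> p \<circ> \<pi> (inv_into UNIV p) = id" "\<pi> (inv_into UNIV p) \<circ> \<pi> p = id"
      unfolding \<pi>_comp[OF p, symmetric] \<pi>_comp[OF p', symmetric] permutes_inv_o[OF p] \<pi>_id by simp_all
    then have "bij (\<pi> p)" by (rule o_bij[rotated])
    moreover have "\<pi> p i = i" if "i \<notin> {1..m}" for i using that J(1) \<pi>_out by blast
    ultimately show ?thesis unfolding permutes_def bij_iff by blast
  qed
  have \<pi>_k: "k (\<pi> p i) = k i" if "p permutes {1..5}" for p i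
    using eq[OF \<pi>_J[OF that], of i] \<pi>_out[of i p] by (cases "i \<in> J") auto
  \<comment> \<open>Permuting the coordinates reverses compositions, which is corrected by passing to inverses.\<close>
  define \<Psi> where "\<Psi> p = restrict (permute_coordinates (\<pi> (inv_into UNIV p))) Y" for p
  have \<Psi>_G: "\<Psi> p \<in> G" if p: "p permutes {1..5}" for p
    unfolding \<Psi>_def by (rule permute_coordinates_in_G[OF \<pi>_perm[OF permutes_inv[OF p]] \<pi>_k[OF permutes_inv[OF p]]])
  have \<Psi>_comp: "\<Psi> (p \<circ> q) = compose Y (\<Psi> p) (\<Psi> q)" if p: "p permutes {1..5}" and q: "q permutes {1..5}" for p q
    unfolding compose_def \<Psi>_def
  proof (rule restrict_ext)
    fix x assume x: "x \<in> Y"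
    have "inv_into UNIV (p \<circ> q) = inv_into UNIV q \<circ> inv_into UNIV p"
      by (rule o_inv_distrib[OF permutes_bij[OF p] permutes_bij[OF q]])
    moreover have "permute_coordinates (\<pi> (inv_into UNIV q)) x \<in> Y"
      by (rule permute_coordinates_Y[OF \<pi>_perm[OF permutes_inv[OF q]] \<pi>_k[OF permutes_inv[OF q]] x])
    ultimately show "permute_coordinates (\<pi> (inv_into UNIV (p \<circ> q))) x =
        restrict (permute_coordinates (\<pi> (inv_into UNIV p))) Y (restrict (permute_coordinates (\<pi> (inv_into UNIV q))) Y x)"
      using x by (simp add: permute_coordinates_comp[OF \<pi>_perm[OF permutes_inv[OF p]]] \<pi>_comp[OF permutes_inv[OF p]])
  qed
  have "group_hom (sym_group 5) (BijGroup Y\<lparr>carrier := G\<rparr>) \<Psi>"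
    unfolding group_hom_def group_hom_axioms_def
  proof (intro conjI)
    show "group (sym_group 5)" by (rule sym_group_is_group)
    show "group (BijGroup Y\<lparr>carrier := G\<rparr>)"
      by (rule subgroup.subgroup_is_group[OF G_subgroup group_BijGroup])
    show "\<Psi> \<in> hom (sym_group 5) (BijGroup Y\<lparr>carrier := G\<rparr>)"
      by (auto intro!: homI simp: sym_group_carrier sym_group_mult \<Psi>_G \<Psi>_comp BijGroup_sel G_Bij)
  qed
  moreover have "inj_on \<Psi> (carrier (sym_group 5))"
  proof (rule inj_onI, unfold sym_group_carrier)
    fix p q assume p: "p permutes {1..5}" and q: "q permutes {1..5}" and e: "\<Psi> p = \<Psi> q"
    have \<pi>_eq: "\<pi> (inv_into UNIV p) = \<pi> (inv_into UNIV q)"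
    proof (rule permute_coordinates_inj[OF \<pi>_perm[OF permutes_inv[OF p]] \<pi>_perm[OF permutes_inv[OF q]]])
      show "permute_coordinates (\<pi> (inv_into UNIV p)) x = permute_coordinates (\<pi> (inv_into UNIV q)) x" if "x \<in> Y" for x
        using fun_cong[OF e, of x] that by (simp add: \<Psi>_def)
    qed
    have "inv_into UNIV p u = inv_into UNIV q u" for u
    proof (cases "u \<in> {1..5}")
      case True
      then have "b (inv_into UNIV p u) = b (inv_into UNIV q u)" using fun_cong[OF \<pi>_eq, of "b u"] by (simp only: \<pi>_b)
      moreover have "inv_into UNIV p u \<in> {1..5}" "inv_into UNIV q u \<in> {1..5}"
        using True permutes_in_image[OF permutes_inv[OF p]] permutes_in_image[OF permutes_inv[OF q]] by blast+
      ultimately show ?thesis using b by (auto simp: bij_betw_def dest: inj_onD)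
    next
      case False
      then show ?thesis using permutes_not_in[OF permutes_inv[OF p]] permutes_not_in[OF permutes_inv[OF q]] by metis
    qed
    then have "inv_into UNIV p = inv_into UNIV q" by blast
    then show "p = q" using permutes_inv_inv[OF p] permutes_inv_inv[OF q] by metis
  qed
  ultimately have "solvable (sym_group 5)"
    using solv group_hom.inj_hom_imp_solvable unfolding Aut_eq by blast
  then show False using sym_group_is_unsolvable[of 5] by simp
qed

end

section \<open>The solvability criterion\<close>

lemma five_distinct_in_class:
  fixes k :: "nat \<Rightarrow> nat"
  shows "(\<exists>i1\<in>I. \<exists>i2\<in>I. \<exists>i3\<in>I. \<exists>i4\<in>I. \<exists>i5\<in>I. distinct [i1, i2, i3, i4, i5] \<and>
      k i1 = k i2 \<and> k i2 = k i3 \<and> k i3 = k i4 \<and> k i4 = k i5) \<longleftrightarrow>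
    (\<exists>J\<subseteq>I. card J = 5 \<and> (\<forall>i\<in>J. \<forall>j\<in>J. k i = k j))" (is "?L \<longleftrightarrow> ?R")
proof
  assume ?L
  then obtain a b c d e where l: "set [a, b, c, d, e] \<subseteq> I" "distinct [a, b, c, d, e]"
    and k: "k a = k b" "k b = k c" "k c = k d" "k d = k e" by auto
  have "card (set [a, b, c, d, e]) = 5" unfolding distinct_card[OF l(2)] by simp
  moreover have "\<forall>i\<in>set [a, b, c, d, e]. k i = k e" using k by simp
  ultimately show ?R using l(1) by metis
next
  assume ?R
  then obtain J where J: "J \<subseteq> I" "card J = 5" "\<forall>i\<in>J. \<forall>j\<in>J. k i = k j" by blast
  obtain xs where xs: "set xs = J" "distinct xs"
    using finite_distinct_list[of J] J(2) by (metis card.infinite zero_neq_numeral)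
  then have "length xs = 5" using J(2) distinct_card by metis
  then have "xs = map ((!) xs) [0..<5]" using map_nth[of xs] by simp
  also have "[0..<5] = [0, 1, 2, 3, 4::nat]" by (simp add: upt_conv_Cons)
  finally obtain a b c d e where abc: "xs = [a, b, c, d, e]" by (simp only: list.map)
  have "set [a, b, c, d, e] = J" "distinct [a, b, c, d, e]" using xs unfolding abc by blast+
  moreover from this have "a \<in> J" "b \<in> J" "c \<in> J" "d \<in> J" "e \<in> J" by auto
  moreover from this have "a \<in> I" "b \<in> I" "c \<in> I" "d \<in> I" "e \<in> I" using J(1) by blast+
  ultimately show ?L using J(3) by blast
qed

theorem corollary5p7:
  fixes P :: "'a::{alg_closed_field, field_char_0} poly"
    and m :: nat and k :: "nat \<Rightarrow> nat"
  assumes "m \<ge> 1"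
    and "degree P \<ge> 2"
    and "\<forall>i\<in>{1..m}. k i \<ge> 2"
  shows "\<not> solvable (Aut_variety (m + 1) (suspension m k P)) \<longleftrightarrow>
    (\<exists>i1\<in>{1..m}. \<exists>i2\<in>{1..m}. \<exists>i3\<in>{1..m}. \<exists>i4\<in>{1..m}. \<exists>i5\<in>{1..m}.
      distinct [i1, i2, i3, i4, i5] \<and>
      k i1 = k i2 \<and> k i2 = k i3 \<and> k i3 = k i4 \<and> k i4 = k i5)"
proof -
  interpret suspension_variety P m k using assms by unfold_locales auto
  show ?thesis unfolding five_distinct_in_class
  proof
    assume "\<exists>J\<subseteq>{1..m}. card J = 5 \<and> (\<forall>i\<in>J. \<forall>j\<in>J. k i = k j)"
    then show "\<not> solvable (Aut_variety (m + 1) (suspension m k P))"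
      using Aut_not_solvable by blast
  next
    assume ns: "\<not> solvable (Aut_variety (m + 1) (suspension m k P))"
    then obtain c where "card (exponent_class c) > 4" using Aut_solvable not_le by blast
    then have "5 \<le> card (exponent_class c)" by simp
    then obtain J where "J \<subseteq> exponent_class c" "card J = 5" by (rule obtain_subset_with_card_n)
    then show "\<exists>J\<subseteq>{1..m}. card J = 5 \<and> (\<forall>i\<in>J. \<forall>j\<in>J. k i = k j)"
      by (intro exI[of _ J]) (auto simp: exponent_class_def subset_iff)
  qed
qed

end
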